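(* The Lyndon insertion words form a generating set for the formal cell-zeta algebra $\mathcal{FC}$: $\mathcal{FC}$ is generated by the classes of the pairs $(\delta_n,w)$ with $n\ge5$ and $w\in\mathcal{W}_{\{1,\ldots,n-1\}}$. Furthermore, $\mathcal{FC}$ is defined by subjecting this generating set to only two sets of relations, the dihedral relations and the product map relations; that is, the kernel of the natural surjection onto $\mathcal{FC}$ from the free commutative $\mathbb{Q}$-algebra on the symbols $(\delta_n,w)$, $n\ge5$, $w\in\mathcal{W}_{\{1,\ldots,n-1\}}$, is the ideal generated by the dihedral relations and the product map relations, in which every pair is rewritten, modulo shuffles with respect to one element, as a linear combination of the $(\delta_n,w)$.
   Context: **Polygons and cell-forms.** For $n\ge 5$, $\ell=n-3$, let $Z_n=\{0,t_1,\ldots,t_\ell,1,\infty\}$ and let $\delta_n=(0,t_1,\ldots,t_\ell,1,\infty)$ be the standard cyclic order. For a finite set $T$ of $m$ elements, $\tilde{\mathcal P}_T$ is the $\mathbb{Q}$-vector space generated by cyclic orders on $T$ modulo $\gamma=(-1)^{m}\overleftarrow{\gamma}$, where $\overleftarrow\gamma$ is the opposite cyclic order; write $(\gamma,\eta)$ for $\gamma\otimes\eta\in\tilde{\mathcal P}_T\otimes\tilde{\mathcal P}_T$. The cell-form of $\eta=(y_1,\ldots,y_{n-1},\infty)$ is $\omega_\eta=\frac{dt_1\cdots dt_\ell}{(y_2-y_1)\cdots(y_{n-1}-y_{n-2})}$, extended linearly. A linear combination of cell-forms converges on the standard cell if it has no pole along any boundary divisor of $\overline{\mathfrak{M}}_{0,n}$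 corresponding to a partition of $Z_n$ into two subsets of cardinality $\ge2$ each consisting of consecutive elements for $\delta_n$. $\mathcal{A}_n$ is the space of elements $\sum_i a_i(\delta_n,\eta_i)$ with $\eta_i\in\tilde{\mathcal P}_{Z_n}$ such that $\sum_i a_i\omega_{\eta_i}$ converges on the standard cell. More generally, for an ordered set of labels $T$ with $|T|=m$, standard pairs on $T$ are identified with standard pairs on $Z_m$ by the order-preserving bijection. **Formal cell-zeta algebra.** $\mathcal{FC}$ is the commutative $\mathbb{Q}$-algebra generated by the vector space $\mathcal{A}=\bigoplus_{n\ge5}\mathcal{A}_n$ subject to: (1) *Product map relations.* Let $\{t_1,\ldots,t_\ell\}=S_1\sqcup S_2$ with $|S_i|\ge2$, $T_i=\{0,1,\infty\}\cup S_i$, with cyclic orders $\gamma_i$ on $T_i$; let $\delta^{(i)}$ be the standard order on $T_i$ and $\tau_i$ the permutation of $T_i$ with $\tau_i(\delta^{(i)})=\gamma_i$, $\tau_i(0)=0$. Then the product of standard pairs $(\delta^{(1)},\omega_1)\cdot(\delta^{(2)},\omega_2)$ equals $$(\gamma_1\text{ш}\gamma_2,\ \tau_1(\omega_1)\text{ш}\tau_2(\omega_2))=\sum_{\gamma\in\gamma_1\text{ш}\gamma_2}\bigl(\delta_n,\tau_\gamma^{-1}(\tau_1(\omega_1)\text{ш}\tau_2(\omega_2))\bigr),$$ extended linearly to convergent combinations, where $\tau_\gamma(\delta_n)=\gamma$, $\tau_\gamma(0)=0$. Here, for cyclic orders $\alpha_1,\alpha_2$ on $T_1,T_2$, $\alpha_1\text{ш}\alpha_2\in\tilde{\mathcal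 P}_{Z_n}$ is defined by first writing each $\alpha_i$ (using $\alpha_i=(-1)^{|T_i|}\overleftarrow{\alpha_i}$ if needed) with the orientation restricting to $(0,1,\infty)$ on $\{0,1,\infty\}$, and then taking the sum of all cyclic orders on $Z_n$ restricting to these on $T_1$ and $T_2$. (2) *Dihedral relations.* $(\delta_n,\omega)=(\sigma(\delta_n),\sigma(\omega))$ for $\sigma$ in the dihedral group of permutations of $Z_n$ preserving $\delta_n$ up to reversal. (3) *Shuffles with respect to one element.* $(\delta_n,(A\,\text{ш}\,B,e))=0$ for $e\in Z_n$ and nonempty words $A,B$ with distinct letters, disjoint, with union of letters $Z_n\setminus\{e\}$. **Pairs $(\delta_n,w)$.** With $S=\{1,\ldots,n-1\}$, rename $1,2,\ldots,n-2,n-1,d$ as $0,t_1,\ldots,t_\ell,1,\infty$. A linear combination $w$ of words using each letter of $S$ once defines an element of $\tilde{\mathcal P}_{Z_n}$ by sending a word $i_1\cdots i_{n-1}$ to the cyclic order $(i_1,\ldots,i_{n-1},d)$ with letters renamed; this gives the pair $(\delta_n,w)$. For $w\in\mathcal{W}_S$ this pair lies in $\mathcal{A}_n$, and every element of $\mathcal{A}_n$ is congruent, modulo the span of the elements in (3), to a unique linear combination of the $(\delta_n,w)$, $w\in\mathcal{W}_S$. **Words.** For $S=\{1,\ldots,m\}$, $V_S$ is the $\mathbb{Q}$-vector space with basis the words using each letter of $S$ exactly once; ш is the usual shuffle product. An *interval* of an ordered alphabet is a set of consecutive letters. A word with distinct letters in an ordered alphabet $T$ is *Lyndon* if its leftmost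 letter is its smallest, and *convergent* if it has no contiguous subword of length $\ge2$ whose set of letters is an interval of $T$. A *convergent Lyndon shuffle* on $T$ is $u_1\text{ш}\cdots\text{ш}u_s$, $s\ge2$, with $u_j$ nonempty convergent Lyndon words with disjoint letters, using each letter of $T$ once. **$\mathcal{L}_S$.** $\mathcal{L}_{\{1\}}=\emptyset$, $\mathcal{L}_{\{1,2\}}=\{1\text{ш}2\}$; for an ordered alphabet $D$ with $m$ letters $\mathcal{L}_D$ is the image of $\mathcal{L}_{\{1,\ldots,m\}}$ under the order-preserving bijection. For $m\ge3$, $\mathcal{L}_{\{1,\ldots,m\}}$ is the set of all elements obtained thus: choose $3\le k\le m$, $T=\{a_1<\cdots<a_k\}$, a convergent Lyndon shuffle $u_1\text{ш}\cdots\text{ш}u_s$ on $T$, integers $v_i\ge1$ with $\sum_{i=1}^k v_i=m$ and $v_i=1$ whenever $a_i$ is the leftmost letter of some $u_j$, and ordered alphabets $D_i$ with $|D_i|=v_i$; replace (multilinearly, by concatenation) each $a_i$ by the letter of $D_i$ if $v_i=1$ and by a chosen element of $\mathcal{L}_{D_i}$ if $v_i>1$; rename the letters of $D_1<\cdots<D_k$ as $1,\ldots,m$ in increasing order. **$\mathcal{W}_S$ (Lyndon insertion words), $S=\{1,\ldots,m\}$.** A *special convergent word* on an ordered alphabet $T$ with $k$ letters is a word using each letter of $T$ once with no contiguous subword of length between $2$ and $k-1$ whose set of letters is an interval of $T$. $\mathcal{W}_S$ consists of (i) the special convergent words on $S$ in which $1$ is immediately followed by $m$, and (ii) all elements obtained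 from some $k<m$, $T=\{a_1<\cdots<a_k\}$, a special convergent word on $T$ in which $a_1$ is immediately followed by $a_k$, and integers $v_i\ge1$ with $v_1=v_k=1$, $\sum v_i=m$, by replacing each $a_i$ by the letter of $D_i$ (an ordered alphabet with $v_i$ letters) if $v_i=1$ and by a chosen element of $\mathcal{L}_{D_i}$ if $v_i>1$, then renaming the letters of $D_1<\cdots<D_k$ as $1,\ldots,m$ in increasing order. *)

theory Defs
  imports
    "HOL-Library.Poly_Mapping"
    "HOL-Library.Sublist"
    "HOL-Combinatorics.Permutations"
    "HOL-Algebra.Generated_Rings"
    "HOL-Complex_Analysis.Complex_Analysis"
begin

section \<open>Rational vector spaces with a distinguished basis\<close>

text \<open>The vector space with basis \<open>'a\<close> is the type of finitely supported functions
  \<open>'a \<Rightarrow>\<^sub>0 rat\<close>; the basis vector of \<open>x\<close> is \<open>bvec x\<close>.\<close>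

abbreviation coef :: "('a \<Rightarrow>\<^sub>0 rat) \<Rightarrow> 'a \<Rightarrow> rat" where
  "coef \<equiv> Poly_Mapping.lookup"

abbreviation supp :: "('a \<Rightarrow>\<^sub>0 rat) \<Rightarrow> 'a set" where
  "supp \<equiv> Poly_Mapping.keys"

abbreviation bvec :: "'a \<Rightarrow> 'a \<Rightarrow>\<^sub>0 rat" where
  "bvec x \<equiv> Poly_Mapping.single x 1"

definition qscale :: "rat \<Rightarrow> ('a \<Rightarrow>\<^sub>0 rat) \<Rightarrow> ('a \<Rightarrow>\<^sub>0 rat)" where
  "qscale c p = Poly_Mapping.map ((*) c) p"

lemma coef_qscale [simp]: "coef (qscale c p) x = c * coef p x"
  by (simp add: qscale_def Poly_Mapping.map.rep_eq when_def)

global_interpretation qvec: vector_space qscale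
  by standard (auto intro!: poly_mapping_eqI simp: lookup_add algebra_simps)

definition lin_ext :: "('a \<Rightarrow> ('b \<Rightarrow>\<^sub>0 rat)) \<Rightarrow> ('a \<Rightarrow>\<^sub>0 rat) \<Rightarrow> ('b \<Rightarrow>\<^sub>0 rat)" where
  "lin_ext f p = (\<Sum>x\<in>supp p. qscale (coef p x) (f x))"

definition bilin_ext ::
  "('a \<Rightarrow> 'b \<Rightarrow> ('c \<Rightarrow>\<^sub>0 rat)) \<Rightarrow> ('a \<Rightarrow>\<^sub>0 rat) \<Rightarrow> ('b \<Rightarrow>\<^sub>0 rat) \<Rightarrow> ('c \<Rightarrow>\<^sub>0 rat)" where
  "bilin_ext f p q = lin_ext (\<lambda>x. lin_ext (f x) q) p"

definition tensor :: "('a \<Rightarrow>\<^sub>0 rat) \<Rightarrow> ('b \<Rightarrow>\<^sub>0 rat) \<Rightarrow> ('a \<times> 'b \<Rightarrow>\<^sub>0 rat)" where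
  "tensor = bilin_ext (\<lambda>x y. bvec (x, y))"

lemma lin_ext_superset:
  assumes "finite A" "supp p \<subseteq> A"
  shows "lin_ext f p = (\<Sum>x\<in>A. qscale (coef p x) (f x))"
  unfolding lin_ext_def using assms
  by (intro sum.mono_neutral_left) (auto simp: in_keys_iff)

lemma lin_ext_add: "lin_ext f (p + q) = lin_ext f p + lin_ext f q"
proof -
  let ?A = "supp p \<union> supp q"
  have "supp (p + q) \<subseteq> ?A" by (rule Poly_Mapping.keys_add)
  then show ?thesis
    by (simp add: lin_ext_superset[of ?A] lookup_add qvec.scale_left_distrib sum.distrib)
qed

lemma lin_ext_qscale: "lin_ext f (qscale c p) = qscale c (lin_ext f p)"
proof -
  have "supp (qscale c p) \<subseteq> supp p" by (auto simp: in_keys_iff)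
  then show ?thesis
    by (simp add: lin_ext_superset[of "supp p"] qvec.scale_sum_right)
qed

lemma lin_ext_bvec [simp]: "lin_ext f (bvec x) = f x"
  by (simp add: lin_ext_def)

lemma lin_ext_diff: "lin_ext f (p - q) = lin_ext f p - lin_ext f q"
proof -
  have "lin_ext f p = lin_ext f ((p - q) + q)" by simp
  also have "\<dots> = lin_ext f (p - q) + lin_ext f q" by (rule lin_ext_add)
  finally show ?thesis by simp
qed

lemma lin_ext_id: "lin_ext bvec p = p"
proof (rule poly_mapping_eqI)
  fix x
  show "coef (lin_ext bvec p) x = coef p x"
    by (cases "x \<in> supp p")
      (auto simp: lin_ext_def Poly_Mapping.lookup_sum lookup_single when_def in_keys_iff
         if_distrib[of "(*) _"] sum.delta cong: if_cong)
qed


section \<open>Polygons\<close>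

text \<open>A cyclic order is the set of all rotations of a list without repetitions.\<close>

type_synonym 'a cyclic_order = "'a list set"

definition cyc :: "'a list \<Rightarrow> 'a cyclic_order" where
  "cyc xs = {rotate k xs | k. True}"

definition cyclic_orders :: "'a set \<Rightarrow> 'a cyclic_order set" where
  "cyclic_orders T = {cyc xs | xs. distinct xs \<and> set xs = T}"

definition underlying :: "'a cyclic_order \<Rightarrow> 'a set" where
  "underlying \<gamma> = \<Union> (set ` \<gamma>)"

definition opposite :: "'a cyclic_order \<Rightarrow> 'a cyclic_order" where
  "opposite \<gamma> = rev ` \<gamma>"

definition restrict_cyc :: "'a set \<Rightarrow> 'a cyclic_order \<Rightarrow> 'a cyclic_order" where
  "restrict_cyc T \<gamma> = filter (\<lambda>x. x \<in> T) ` \<gamma>"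

definition permute_cyc :: "('a \<Rightarrow> 'b) \<Rightarrow> 'a cyclic_order \<Rightarrow> 'b cyclic_order" where
  "permute_cyc \<sigma> \<gamma> = map \<sigma> ` \<gamma>"

definition rev_sign :: "'a cyclic_order \<Rightarrow> rat" where
  "rev_sign \<gamma> = (-1) ^ card (underlying \<gamma>)"

text \<open>The quotient of the space spanned by cyclic orders by the relations
  \<open>\<gamma> = (-1)^m opposite \<gamma>\<close> is realised as the image of the projection
  \<open>\<gamma> \<mapsto> (\<gamma> + (-1)^m opposite \<gamma>) / 2\<close>, whose kernel is spanned by these relations
  (lemma \<open>polygon_eq_0_iff\<close>). Thus \<open>polygon \<gamma>\<close> is the class of \<open>\<gamma>\<close>, and the tensor square of
  the quotient is realised by tensors of such elements.\<close>

definition polygon :: "'a cyclic_order \<Rightarrow> 'a cyclic_order \<Rightarrow>\<^sub>0 rat" where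
  "polygon \<gamma> = qscale (1/2) (bvec \<gamma> + qscale (rev_sign \<gamma>) (bvec (opposite \<gamma>)))"

definition polygon_space :: "'a set \<Rightarrow> ('a cyclic_order \<Rightarrow>\<^sub>0 rat) set" where
  "polygon_space T = qvec.span (polygon ` cyclic_orders T)"

lemma opposite_opposite [simp]: "opposite (opposite \<gamma>) = \<gamma>"
  by (simp add: opposite_def image_image)

lemma rev_sign_opposite [simp]: "rev_sign (opposite \<gamma>) = rev_sign \<gamma>"
  by (simp add: rev_sign_def underlying_def opposite_def image_image)

lemma rev_sign_square: "rev_sign \<gamma> * rev_sign \<gamma> = 1"
  by (simp add: rev_sign_def flip: power_mult_distrib)

lemma polygon_opposite: "qscale (rev_sign \<gamma>) (polygon (opposite \<gamma>)) = polygon \<gamma>"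
  by (simp add: polygon_def qvec.scale_right_distrib rev_sign_square add.commute mult.commute
      del: qvec.scale_left_commute)

lemma polygon_eq_0_iff:
  assumes "supp p \<subseteq> cyclic_orders T"
  shows "lin_ext polygon p = 0 \<longleftrightarrow>
    p \<in> qvec.span {bvec \<gamma> - qscale ((-1) ^ card T) (bvec (opposite \<gamma>)) | \<gamma>. \<gamma> \<in> cyclic_orders T}"
    (is "_ \<longleftrightarrow> p \<in> qvec.span ?R")
proof -
  have und: "underlying \<gamma> = T" if g: "\<gamma> \<in> cyclic_orders T" for \<gamma>
  proof -
    obtain xs where xs: "\<gamma> = cyc xs" "distinct xs" "set xs = T"
      using g by (auto simp: cyclic_orders_def)
    have "set ` cyc xs = {T}"
      using xs by (force simp: cyc_def image_iff)
    then show ?thesis using xs by (simp add: underlying_def)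
  qed
  have rs: "rev_sign \<gamma> = (-1) ^ card T" if "\<gamma> \<in> cyclic_orders T" for \<gamma>
    using und[OF that] by (simp add: rev_sign_def)
  show ?thesis
  proof
    assume zero: "lin_ext polygon p = 0"
    have "p = lin_ext bvec p - lin_ext polygon p"
      using zero by (simp add: lin_ext_id)
    also have "\<dots> = (\<Sum>\<gamma>\<in>supp p. qscale (coef p \<gamma>) (bvec \<gamma> - polygon \<gamma>))"
      by (simp add: lin_ext_def qvec.scale_right_diff_distrib sum_subtractf)
    also have "\<dots> \<in> qvec.span ?R"
    proof (intro qvec.span_sum qvec.span_scale)
      fix \<gamma> assume "\<gamma> \<in> supp p"
      then have g: "\<gamma> \<in> cyclic_orders T" using assms by auto
      have "bvec \<gamma> - polygon \<gamma>
          = qscale (1/2) (bvec \<gamma> - qscale ((-1) ^ card T) (bvec (opposite \<gamma>)))"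
        by (rule poly_mapping_eqI)
          (simp add: polygon_def rs[OF g] lookup_minus lookup_add algebra_simps)
      then show "bvec \<gamma> - polygon \<gamma> \<in> qvec.span ?R"
        using g by (simp only:) (rule qvec.span_scale, rule qvec.span_base, blast)
    qed
    finally show "p \<in> qvec.span ?R" .
  next
    assume "p \<in> qvec.span ?R"
    then show "lin_ext polygon p = 0"
    proof (induction rule: qvec.span_induct_alt)
      case base
      then show ?case by (simp add: lin_ext_def)
    next
      case (step c x y)
      then obtain \<gamma> where g: "\<gamma> \<in> cyclic_orders T"
        and x: "x = bvec \<gamma> - qscale ((-1) ^ card T) (bvec (opposite \<gamma>))" by auto
      have "lin_ext polygon x = 0"
        using polygon_opposite[of \<gamma>] by (simp add: x lin_ext_diff lin_ext_qscale rs[OF g])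
      then show ?case using step by (simp add: lin_ext_add lin_ext_qscale)
    qed
  qed
qed


section \<open>Labels, standard cyclic orders, cell-forms and convergence\<close>

text \<open>\<open>Pt i\<close> is the marked point \<open>t\<^sub>i\<close>.\<close>

datatype label = P0 | Pt nat | P1 | Pinf

text \<open>Label sets \<open>{0,1,\<infinity>} \<union> {t\<^sub>i | i \<in> S}\<close> are indexed by the finite set \<open>S\<close> of indices.\<close>

definition labels :: "nat set \<Rightarrow> label set" where
  "labels S = {P0, P1, Pinf} \<union> Pt ` S"

definition std_order :: "nat set \<Rightarrow> label cyclic_order" where
  "std_order S = cyc (P0 # map Pt (sorted_list_of_set S) @ [P1, Pinf])"

abbreviation Z :: "nat \<Rightarrow> label set" where
  "Z n \<equiv> labels {1..n - 3}"

abbreviation delta :: "nat \<Rightarrow> label cyclic_order" where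
  "delta n \<equiv> std_order {1..n - 3}"

definition push :: "(label \<Rightarrow> label) \<Rightarrow> (label cyclic_order \<Rightarrow>\<^sub>0 rat) \<Rightarrow> (label cyclic_order \<Rightarrow>\<^sub>0 rat)" where
  "push \<sigma> = lin_ext (\<lambda>\<gamma>. bvec (permute_cyc \<sigma> \<gamma>))"

text \<open>The coefficient of \<open>dt\<^sub>1 \<dots> dt\<^sub>\<ell>\<close> in a cell-form, as a function of the positions \<open>x\<close>
  of the finite marked points. Replacing \<open>\<eta>\<close> by its opposite multiplies it by \<open>(-1)^n\<close>, so its
  linear extension takes the same value on \<open>\<eta>\<close> and on \<open>polygon \<eta>\<close>.\<close>

definition cell_coeff :: "label cyclic_order \<Rightarrow> (label \<Rightarrow> complex) \<Rightarrow> complex" where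
  "cell_coeff \<eta> x =
    (let ys = (THE ys. ys @ [Pinf] \<in> \<eta>)
     in \<Prod>i<length ys - 1. 1 / (x (ys ! Suc i) - x (ys ! i)))"

definition form_coeff :: "(label cyclic_order \<Rightarrow>\<^sub>0 rat) \<Rightarrow> (label \<Rightarrow> complex) \<Rightarrow> complex" where
  "form_coeff v x = (\<Sum>\<eta>\<in>supp v. of_rat (coef v \<eta>) * cell_coeff \<eta> x)"

definition consecutive :: "label cyclic_order \<Rightarrow> label set \<Rightarrow> bool" where
  "consecutive \<gamma> A \<longleftrightarrow> (\<exists>ys\<in>\<gamma>. \<exists>k. A = set (take k ys))"

text \<open>The boundary divisors adjacent to the standard cell, each partition of \<open>Z n\<close> being
  represented by its block not containing \<open>\<infinity>\<close>, i.e. by the set of points which collide.\<close>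

definition std_divisors :: "nat \<Rightarrow> label set set" where
  "std_divisors n = {A. A \<subseteq> Z n \<and> Pinf \<notin> A \<and> card A \<ge> 2 \<and> card (Z n - A) \<ge> 2 \<and>
     consecutive (delta n) A \<and> consecutive (delta n) (Z n - A)}"

text \<open>Local coordinates at a point of the open stratum of the divisor given by \<open>A\<close>: \<open>z\<close> gives
  the positions of the points after the points of \<open>A\<close> have collided, \<open>s\<close> the positions in the
  bubble, normalised so that some \<open>p \<in> A\<close> has \<open>s p = 0\<close> and some \<open>q \<in> A\<close> has \<open>s q = 1\<close> (with
  \<open>p\<close> the fixed point \<open>0\<close> or \<open>1\<close> if it lies in \<open>A\<close>), and \<open>\<epsilon>\<close> is the equation of the divisor:
  points of \<open>A\<close> sit at \<open>z a + \<epsilon> * s a\<close>. In these coordinates \<open>dt\<^sub>1 \<dots> dt\<^sub>\<ell>\<close> is, up to sign,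
  \<open>\<epsilon> ^ (card A - 2)\<close> times the standard volume form.\<close>

definition no_pole_along :: "nat \<Rightarrow> label set \<Rightarrow> ((label \<Rightarrow> complex) \<Rightarrow> complex) \<Rightarrow> bool" where
  "no_pole_along n A f \<longleftrightarrow>
    (\<forall>z s :: label \<Rightarrow> complex.
       z P0 = 0 \<and> z P1 = 1 \<and>
       (\<forall>a\<in>Z n - {Pinf}. \<forall>b\<in>Z n - {Pinf}. a \<noteq> b \<longrightarrow> (z a = z b \<longleftrightarrow> a \<in> A \<and> b \<in> A)) \<and>
       inj_on s A \<and> {0, 1} \<subseteq> s ` A \<and> (\<forall>a\<in>A \<inter> {P0, P1}. s a = 0)
       \<longrightarrow> \<not> is_pole (\<lambda>\<epsilon>. \<epsilon> ^ (card A - 2) * f (\<lambda>a. if a \<in> A then z a + \<epsilon> * s a else z a)) 0)"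

definition convergent_on_cell :: "nat \<Rightarrow> (label cyclic_order \<Rightarrow>\<^sub>0 rat) \<Rightarrow> bool" where
  "convergent_on_cell n v \<longleftrightarrow> (\<forall>A\<in>std_divisors n. no_pole_along n A (form_coeff v))"

type_synonym polygon_pair = "(label cyclic_order \<times> label cyclic_order) \<Rightarrow>\<^sub>0 rat"

definition std_pair :: "nat \<Rightarrow> (label cyclic_order \<Rightarrow>\<^sub>0 rat) \<Rightarrow> polygon_pair" where
  "std_pair n v = tensor (polygon (delta n)) v"

definition convergent_polygons :: "nat \<Rightarrow> (label cyclic_order \<Rightarrow>\<^sub>0 rat) set" where
  "convergent_polygons n = {v \<in> polygon_space (Z n). convergent_on_cell n v}"

definition cell_space :: "nat \<Rightarrow> polygon_pair set" where
  "cell_space n = std_pair n ` convergent_polygons n"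


section \<open>Relations between pairs of polygons\<close>

definition orientation_ok :: "label cyclic_order \<Rightarrow> bool" where
  "orientation_ok \<alpha> \<longleftrightarrow> restrict_cyc {P0, P1, Pinf} \<alpha> = cyc [P0, P1, Pinf]"

definition orient :: "label cyclic_order \<Rightarrow> label cyclic_order" where
  "orient \<alpha> = (if orientation_ok \<alpha> then \<alpha> else opposite \<alpha>)"

definition orient_sign :: "label cyclic_order \<Rightarrow> rat" where
  "orient_sign \<alpha> = (if orientation_ok \<alpha> then 1 else rev_sign \<alpha>)"

definition cyc_shuffles :: "label cyclic_order \<Rightarrow> label cyclic_order \<Rightarrow> label cyclic_order set" where
  "cyc_shuffles \<alpha>\<^sub>1 \<alpha>\<^sub>2 =
    {\<gamma> \<in> cyclic_orders (underlying \<alpha>\<^sub>1 \<union> underlying \<alpha>\<^sub>2).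
       restrict_cyc (underlying \<alpha>\<^sub>1) \<gamma> = orient \<alpha>\<^sub>1 \<and>
       restrict_cyc (underlying \<alpha>\<^sub>2) \<gamma> = orient \<alpha>\<^sub>2}"

definition polygon_shuffle ::
  "(label cyclic_order \<Rightarrow>\<^sub>0 rat) \<Rightarrow> (label cyclic_order \<Rightarrow>\<^sub>0 rat) \<Rightarrow> (label cyclic_order \<Rightarrow>\<^sub>0 rat)" where
  "polygon_shuffle = bilin_ext (\<lambda>\<alpha>\<^sub>1 \<alpha>\<^sub>2.
     qscale (orient_sign \<alpha>\<^sub>1 * orient_sign \<alpha>\<^sub>2) (\<Sum>\<gamma>\<in>cyc_shuffles \<alpha>\<^sub>1 \<alpha>\<^sub>2. polygon \<gamma>))"

definition std_perm :: "nat set \<Rightarrow> label cyclic_order \<Rightarrow> label \<Rightarrow> label" where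
  "std_perm S \<gamma> = (THE \<tau>. \<tau> permutes labels S \<and> permute_cyc \<tau> (std_order S) = \<gamma> \<and> \<tau> P0 = P0)"

text \<open>The order-preserving bijection from \<open>Z m\<close>, \<open>m = card S + 3\<close>, to \<open>labels S\<close>.\<close>

definition std_label :: "nat set \<Rightarrow> label \<Rightarrow> label" where
  "std_label S x = (case x of Pt j \<Rightarrow> Pt (sorted_list_of_set S ! (j - 1)) | _ \<Rightarrow> x)"

text \<open>The right-hand side of the product map relation for forms \<open>\<omega>\<^sub>i\<close> on \<open>labels S\<^sub>i\<close>.\<close>

definition product_pair ::
  "nat set \<Rightarrow> nat set \<Rightarrow> label cyclic_order \<Rightarrow> label cyclic_order \<Rightarrow>
   (label cyclic_order \<Rightarrow>\<^sub>0 rat) \<Rightarrow> (label cyclic_order \<Rightarrow>\<^sub>0 rat) \<Rightarrow> polygon_pair" where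
  "product_pair S\<^sub>1 S\<^sub>2 \<gamma>\<^sub>1 \<gamma>\<^sub>2 \<omega>\<^sub>1 \<omega>\<^sub>2 =
    (let n = card (S\<^sub>1 \<union> S\<^sub>2) + 3;
         \<omega> = polygon_shuffle (push (std_perm S\<^sub>1 \<gamma>\<^sub>1) \<omega>\<^sub>1) (push (std_perm S\<^sub>2 \<gamma>\<^sub>2) \<omega>\<^sub>2)
     in qscale (orient_sign \<gamma>\<^sub>1 * orient_sign \<gamma>\<^sub>2)
          (\<Sum>\<gamma>\<in>cyc_shuffles \<gamma>\<^sub>1 \<gamma>\<^sub>2.
             std_pair n (push (inv_into UNIV (std_perm (S\<^sub>1 \<union> S\<^sub>2) \<gamma>)) \<omega>)))"

text \<open>An element \<open>((m\<^sub>1, a\<^sub>1), (m\<^sub>2, a\<^sub>2), (n, a))\<close> stands for the relation \<open>a\<^sub>1 a\<^sub>2 = a\<close>.\<close>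

definition product_data ::
  "((nat \<times> polygon_pair) \<times> (nat \<times> polygon_pair) \<times> (nat \<times> polygon_pair)) set" where
  "product_data =
    {((card S\<^sub>1 + 3, std_pair (card S\<^sub>1 + 3) \<eta>\<^sub>1),
      (card S\<^sub>2 + 3, std_pair (card S\<^sub>2 + 3) \<eta>\<^sub>2),
      (n, product_pair S\<^sub>1 S\<^sub>2 \<gamma>\<^sub>1 \<gamma>\<^sub>2 (push (std_label S\<^sub>1) \<eta>\<^sub>1) (push (std_label S\<^sub>2) \<eta>\<^sub>2)))
     | n S\<^sub>1 S\<^sub>2 \<gamma>\<^sub>1 \<gamma>\<^sub>2 \<eta>\<^sub>1 \<eta>\<^sub>2.
       n \<ge> 5 \<and> S\<^sub>1 \<union> S\<^sub>2 = {1..n - 3} \<and> S\<^sub>1 \<inter> S\<^sub>2 = {} \<and> card S\<^sub>1 \<ge> 2 \<and> card S\<^sub>2 \<ge> 2 \<and>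
       \<gamma>\<^sub>1 \<in> cyclic_orders (labels S\<^sub>1) \<and> \<gamma>\<^sub>2 \<in> cyclic_orders (labels S\<^sub>2) \<and>
       \<eta>\<^sub>1 \<in> convergent_polygons (card S\<^sub>1 + 3) \<and> \<eta>\<^sub>2 \<in> convergent_polygons (card S\<^sub>2 + 3)}"

text \<open>An element \<open>(n, a, a')\<close> stands for the relation \<open>a = a'\<close>.\<close>

definition dihedral_data :: "(nat \<times> polygon_pair \<times> polygon_pair) set" where
  "dihedral_data =
    {(n, tensor (polygon (delta n)) v,
         tensor (polygon (permute_cyc \<sigma> (delta n))) (push \<sigma> v)) | n v \<sigma>.
       n \<ge> 5 \<and> v \<in> convergent_polygons n \<and> \<sigma> permutes Z n \<and>
       permute_cyc \<sigma> (delta n) \<in> {delta n, opposite (delta n)}}"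

definition shuffle_pairs :: "nat \<Rightarrow> polygon_pair set" where
  "shuffle_pairs n =
    {std_pair n (\<Sum>w\<in>shuffles A B. polygon (cyc (w @ [e]))) | A B e.
       e \<in> Z n \<and> A \<noteq> [] \<and> B \<noteq> [] \<and> distinct (A @ B) \<and> set (A @ B) = Z n - {e}}"


section \<open>Free commutative algebras and the formal cell-zeta algebra\<close>

text \<open>Polynomials with rational coefficients in variables from the type \<open>'v\<close>.\<close>

type_synonym 'v qpoly = "('v \<Rightarrow>\<^sub>0 nat) \<Rightarrow>\<^sub>0 rat"

definition free_alg :: "'v set \<Rightarrow> 'v qpoly ring" where
  "free_alg X =
    \<lparr>carrier = {p. \<forall>m\<in>supp p. Poly_Mapping.keys m \<subseteq> X},
     monoid.mult = (*), one = 1, zero = 0, add = (+)\<rparr>"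

definition cst :: "rat \<Rightarrow> 'v qpoly" where
  "cst c = Poly_Mapping.single 0 c"

definition var :: "'v \<Rightarrow> 'v qpoly" where
  "var x = Poly_Mapping.single (Poly_Mapping.single x 1) 1"

text \<open>Substitution of the polynomial \<open>f x\<close> for each variable \<open>x\<close>.\<close>

definition poly_subst :: "('v \<Rightarrow> 'u qpoly) \<Rightarrow> 'v qpoly \<Rightarrow> 'u qpoly" where
  "poly_subst f p =
    (\<Sum>m\<in>supp p. cst (coef p m) * (\<Prod>x\<in>Poly_Mapping.keys m. f x ^ Poly_Mapping.lookup m x))"

definition cell_gens :: "(nat \<times> polygon_pair) set" where
  "cell_gens = {(n, a). n \<ge> 5 \<and> a \<in> cell_space n}"

text \<open>Relations turning the variables \<open>(n, a)\<close> into elements of the direct sum of the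
  spaces \<open>cell_space n\<close>.\<close>

definition linear_rels :: "(nat \<times> polygon_pair) qpoly set" where
  "linear_rels =
     {var (n, a + b) - var (n, a) - var (n, b) | n a b.
        n \<ge> 5 \<and> a \<in> cell_space n \<and> b \<in> cell_space n} \<union>
     {var (n, qscale c a) - cst c * var (n, a) | n a c. n \<ge> 5 \<and> a \<in> cell_space n}"

definition product_rels :: "(nat \<times> polygon_pair) qpoly set" where
  "product_rels = {var x * var y - var z | x y z. (x, y, z) \<in> product_data}"

definition dihedral_rels :: "(nat \<times> polygon_pair) qpoly set" where
  "dihedral_rels = {var (n, a) - var (n, a') | n a a'. (n, a, a') \<in> dihedral_data}"

definition shuffle_rels :: "(nat \<times> polygon_pair) qpoly set" where
  "shuffle_rels = {var (n, a) | n a. n \<ge> 5 \<and> a \<in> shuffle_pairs n}"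

definition FC_ideal :: "(nat \<times> polygon_pair) qpoly set" where
  "FC_ideal =
    genideal (free_alg cell_gens) (linear_rels \<union> product_rels \<union> dihedral_rels \<union> shuffle_rels)"

definition FC :: "(nat \<times> polygon_pair) qpoly set ring" where
  "FC = free_alg cell_gens Quot FC_ideal"

definition FC_class :: "(nat \<times> polygon_pair) qpoly \<Rightarrow> (nat \<times> polygon_pair) qpoly set" where
  "FC_class p = FC_ideal +>\<^bsub>free_alg cell_gens\<^esub> p"


section \<open>Lyndon insertion words\<close>

text \<open>An ordered alphabet with \<open>m\<close> letters is always represented by \<open>{1..m}\<close>, and elements of
  \<open>V\<^sub>S\<close> by finitely supported functions on words.\<close>

type_synonym word_comb = "nat list \<Rightarrow>\<^sub>0 rat"

definition interval_of :: "nat set \<Rightarrow> nat set \<Rightarrow> bool" where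
  "interval_of T I \<longleftrightarrow> (\<exists>a b. I = T \<inter> {a..b})"

definition convergent_word :: "nat set \<Rightarrow> nat list \<Rightarrow> bool" where
  "convergent_word T w \<longleftrightarrow> \<not> (\<exists>u. sublist u w \<and> length u \<ge> 2 \<and> interval_of T (set u))"

definition special_convergent_word :: "nat \<Rightarrow> nat list \<Rightarrow> bool" where
  "special_convergent_word k w \<longleftrightarrow>
     distinct w \<and> set w = {1..k} \<and>
     \<not> (\<exists>u. sublist u w \<and> 2 \<le> length u \<and> length u \<le> k - 1 \<and> interval_of {1..k} (set u))"

definition lyndon_word :: "nat list \<Rightarrow> bool" where
  "lyndon_word w \<longleftrightarrow> w \<noteq> [] \<and> distinct w \<and> hd w = Min (set w)"

text \<open>The library's \<open>shuffles\<close> is a set of words; it is used here on words with disjoint sets of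
  letters only, where every shuffle arises exactly once.\<close>

definition word_shuffle :: "word_comb \<Rightarrow> word_comb \<Rightarrow> word_comb" where
  "word_shuffle = bilin_ext (\<lambda>u v. \<Sum>w\<in>shuffles u v. bvec w)"

definition word_concat :: "word_comb \<Rightarrow> word_comb \<Rightarrow> word_comb" where
  "word_concat = bilin_ext (\<lambda>u v. bvec (u @ v))"

text \<open>Insertion of \<open>c i\<close>, an element on the alphabet \<open>{1..v i}\<close>, for each letter \<open>i\<close> of a word.
  The letter \<open>j\<close> of \<open>c i\<close> becomes \<open>v 1 + \<dots> + v (i - 1) + j\<close>.\<close>

definition insert_word :: "(nat \<Rightarrow> nat) \<Rightarrow> (nat \<Rightarrow> word_comb) \<Rightarrow> nat list \<Rightarrow> word_comb" where
  "insert_word v c w =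
    foldr (\<lambda>i. word_concat (lin_ext (\<lambda>u. bvec (map (\<lambda>j. (\<Sum>h=1..<i. v h) + j) u)) (c i)))
      w (bvec [])"

text \<open>A convergent Lyndon shuffle is given by its list \<open>us\<close> of factors.\<close>

definition convergent_lyndon_factors :: "nat \<Rightarrow> nat list list \<Rightarrow> bool" where
  "convergent_lyndon_factors k us \<longleftrightarrow>
     length us \<ge> 2 \<and> distinct (concat us) \<and> set (concat us) = {1..k} \<and>
     (\<forall>u\<in>set us. lyndon_word u \<and> convergent_word {1..k} u)"

text \<open>\<open>lyndon_insertion_shuffle m x\<close> means that \<open>x\<close> belongs to the set \<open>\<L>\<close> for \<open>{1..m}\<close>.
  Letters are replaced inside the factors \<open>u\<^sub>j\<close>, whose shuffle product is then taken.\<close>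

inductive lyndon_insertion_shuffle :: "nat \<Rightarrow> word_comb \<Rightarrow> bool" where
  two: "lyndon_insertion_shuffle 2 (word_shuffle (bvec [1]) (bvec [2]))"
| insertion:
    "\<lbrakk>3 \<le> k; k \<le> m; convergent_lyndon_factors k us;
      \<forall>i\<in>{1..k}. v i \<ge> 1; (\<Sum>i=1..k. v i) = m; \<forall>u\<in>set us. v (hd u) = 1;
      \<forall>i\<in>{1..k}. (v i = 1 \<longrightarrow> c i = bvec [1]) \<and>
        (v i > 1 \<longrightarrow> lyndon_insertion_shuffle (v i) (c i))\<rbrakk>
     \<Longrightarrow> lyndon_insertion_shuffle m (foldr word_shuffle (map (insert_word v c) us) (bvec []))"

text \<open>The set \<open>\<W>\<close> for \<open>{1..m}\<close>.\<close>

definition lyndon_insertion_words :: "nat \<Rightarrow> word_comb set" where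
  "lyndon_insertion_words m =
     {bvec w | w. special_convergent_word m w \<and> sublist [1, m] w} \<union>
     {insert_word v c w | k v c w.
        k < m \<and> special_convergent_word k w \<and> sublist [1, k] w \<and>
        (\<forall>i\<in>{1..k}. v i \<ge> 1) \<and> v 1 = 1 \<and> v k = 1 \<and> (\<Sum>i=1..k. v i) = m \<and>
        (\<forall>i\<in>{1..k}. (v i = 1 \<longrightarrow> c i = bvec [1]) \<and>
           (v i > 1 \<longrightarrow> lyndon_insertion_shuffle (v i) (c i)))}"


section \<open>The presentation by Lyndon insertion words\<close>

definition letter_label :: "nat \<Rightarrow> nat \<Rightarrow> label" where
  "letter_label n i = (if i = 1 then P0 else if i = n - 1 then P1 else Pt (i - 1))"

text \<open>The pair \<open>(\<delta>\<^sub>n, w)\<close>; the additional letter \<open>d\<close> is \<open>\<infinity>\<close>.\<close>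

definition word_pair :: "nat \<Rightarrow> word_comb \<Rightarrow> polygon_pair" where
  "word_pair n w = std_pair n (lin_ext (\<lambda>u. polygon (cyc (map (letter_label n) u @ [Pinf]))) w)"

definition lyndon_gens :: "(nat \<times> word_comb) set" where
  "lyndon_gens = {(n, w). n \<ge> 5 \<and> w \<in> lyndon_insertion_words (n - 1)}"

definition lyndon_map :: "(nat \<times> word_comb) qpoly \<Rightarrow> (nat \<times> polygon_pair) qpoly set" where
  "lyndon_map p = FC_class (poly_subst (\<lambda>(n, w). var (n, word_pair n w)) p)"

definition lyndon_coeffs :: "nat \<Rightarrow> polygon_pair \<Rightarrow> (word_comb \<Rightarrow>\<^sub>0 rat)" where
  "lyndon_coeffs n a =
    (THE c. supp c \<subseteq> lyndon_insertion_words (n - 1) \<and>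
            a - lin_ext (word_pair n) c \<in> qvec.span (shuffle_pairs n))"

text \<open>A pair rewritten, modulo shuffles with respect to one element, in the free algebra.\<close>

definition rewrite_pair :: "nat \<times> polygon_pair \<Rightarrow> (nat \<times> word_comb) qpoly" where
  "rewrite_pair x = (case x of (n, a) \<Rightarrow>
    let c = lyndon_coeffs n a in \<Sum>w\<in>supp c. cst (coef c w) * var (n, w))"

definition lyndon_product_rels :: "(nat \<times> word_comb) qpoly set" where
  "lyndon_product_rels =
    {rewrite_pair x * rewrite_pair y - rewrite_pair z | x y z. (x, y, z) \<in> product_data}"

definition lyndon_dihedral_rels :: "(nat \<times> word_comb) qpoly set" where
  "lyndon_dihedral_rels =
    {rewrite_pair (n, a) - rewrite_pair (n, a') | n a a'. (n, a, a') \<in> dihedral_data}"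

end

(* Residues of cell-forms along the divisors of an interval of letters turn convergence of a linear
combination of cell-forms into a family of linear conditions on its coefficients: every slice obtained
by substituting the words on an interval for one letter has vanishing form. Shuffles of words are
products of forms, so that words and forests of Lyndon words yield two bases of the forms, and every
conditioned combination splits uniquely over skeletons without inner intervals into tensor products of
conditioned combinations on the parts. By induction the sets L_S are bases of the combinations in the
shuffle ideal all of whose slices vanish, and the sets W_S are bases of the convergent combinations
modulo shuffles with one letter. Rewriting pairs in this basis and including the basis into all pairs
are mutually inverse modulo the relations, which gives the presentation. *)
theory Submission imports Defs "HOL-Combinatorics.Multiset_Permutations" begin

text \<open>Convergence is a condition on words, while the insertion shuffles are products of words,
  and substituting a block for a letter does not commute with shuffling. So one residue is computed
  twice, in words behind a root 0 and in products of such words; since both families are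
  independent, the vanishing of all slices means the same in either basis. In the second basis the
  unknowns are lists of words, and each list has a unique skeleton, the coarsest admissible cutting
  of the alphabet into intervals that occur as blocks. The rule that certain letters are never
  replaced (the leftmost letter of a Lyndon factor, or 1 and m) is forced by convergence: a block
  containing such a letter has it at a fixed end, words sharing an end letter have independent
  forms, so a vanishing slice of this kind is zero. Forms are taken at arbitrary distinct complex
  positions, and 0, 1, infinity are fixed only in the comparison with the given notion of pole.
  Relabelling and passing to the complementary block then cost nothing, which is what the dihedral
  and product relations require.\<close>

abbreviation perms :: "'a set => 'a list set" where
 "perms \<equiv> permutations_of_set"

lemma perms_iff: "w \<in> perms S \<longleftrightarrow> distinct w & set w = S"
 by (auto simp: permutations_of_set_def)

section \<open>Cell-forms of words and their shuffle identities\<close>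

text \<open>For distinct letters this is the coefficient of the cell-form of the cyclic order (w,
  infinity).\<close>

fun chain :: "('a => complex) => 'a list => complex" where
 "chain x [] = 1"
| "chain x [a] = 1"
| "chain x (a # b # w) = chain x (b # w) / (x b - x a)"

lemma chain_append: "chain x (p @ a # q) = chain x (p @ [a]) * chain x (a # q)"
proof (induction p)
 case (Cons c p)
 thus ?case by (cases p) auto
qed simp

lemma chain_cong: "(!!a. a \<in> set w ==> x a = y a) ==> chain x w = chain y w"
 by (induction rule: induct_list012) auto

lemma chain_map: "chain x (map f w) = chain (%i. x (f i)) w"
 by (induction rule: induct_list012) auto

lemma chain_affine:
 assumes "c ~= 0"
 shows "chain (%i. c * x i + d) w = chain x w / c ^ (length w - 1)"
proof (induction w rule: induct_list012)
 case (3 a b w)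
 have "chain (%i. c * x i + d) (a # b # w) = chain (%i. c * x i + d) (b # w) / (c * (x b - x a))"
  by (simp add: right_diff_distrib)
 thus ?case using 3 by (simp add: mult.commute)
qed auto

lemma chain_rev: "chain x (rev w) = (-1) ^ (length w - 1) * chain x w"
proof (induction w rule: induct_list012)
 case (3 a b w)
 have "chain x (rev (a # b # w)) = chain x (rev (b # w)) * chain x [b, a]" using chain_append[of x "rev w" b "[a]"] by simp
 also have "chain x [b, a] = - 1 / (x b - x a)" by (simp add: minus_divide_right)
 finally show ?case using 3 by simp
qed auto

lemma sum_shuffles_Cons:
 assumes "a ~= b"
 shows "sum f (shuffles (a # A) (b # B)) =
  (\<Sum>w\<in>shuffles A (b # B). f (a # w)) + (\<Sum>w\<in>shuffles (a # A) B. f (b # w))"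
proof -
 have "sum f (shuffles (a # A) (b # B)) =
   sum f ((#) a ` shuffles A (b # B)) + sum f ((#) b ` shuffles (a # A) B)"
  using assms by (subst shuffles.simps, subst sum.union_disjoint) auto
 thus ?thesis by (simp add: sum.reindex)
qed

text \<open>Splitting by the first letter of the shuffle leaves two fractions that differ in the
  steps between \<open>r\<close>, \<open>a\<close> and \<open>b\<close>, and partial fractions
  combine them. Behind a common root, shuffling words is therefore multiplying functions.\<close>

lemma chain_shuffles_rooted:
 assumes "distinct (r # A @ B)" "inj_on x (set (r # A @ B))"
 shows "(\<Sum>w\<in>shuffles A B. chain x (r # w)) = chain x (r # A) * chain x (r # B)"
 using assms
proof (induction A B arbitrary: r rule: shuffles.induct)
 case (3 a A b B)
 have ne: "x a ~= x r" "x b ~= x r" "x a ~= x b" using 3(3,4) by auto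
 have "(\<Sum>w\<in>shuffles A (b # B). chain x (a # w)) = chain x (a # A) * chain x (a # b # B)" using 3 by  auto
 moreover have "(\<Sum>w\<in>shuffles (a # A) B. chain x (b # w)) = chain x (b # a # A) * chain x (b # B)" using 3 by  auto
 moreover have "a ~= b" using 3 by auto
 ultimately have "(\<Sum>w\<in>shuffles (a # A) (b # B). chain x (r # w)) =
   chain x (a # A) * chain x (b # B) / ((x b - x a) * (x a - x r)) +
   chain x (a # A) * chain x (b # B) / ((x a - x b) * (x b - x r))"
  by (simp add: sum_shuffles_Cons del: shuffles.simps flip: sum_divide_distrib)
 also have "... = chain x (a # A) * chain x (b # B) *
   (1 / ((x b - x a) * (x a - x r)) + 1 / ((x a - x b) * (x b - x r)))" by (simp add: algebra_simps)
 also have "1 / ((x b - x a) * (x a - x r)) + 1 / ((x a - x b) * (x b - x r)) =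
   1 / ((x a - x r) * (x b - x r))" using ne by (simp add: divide_simps) (simp add: algebra_simps)
 finally show ?case by simp
qed auto

text \<open>Once the first letter is chosen, each half is a rooted shuffle sum; the halves differ
  only by the sign of \<open>x b - x a\<close>. This is the shuffle relation for the element at
  infinity.\<close>

lemma chain_shuffles_eq_0:
 assumes "distinct (A @ B)" "inj_on x (set (A @ B))" "A ~= []" "B ~= []"
 shows "(\<Sum>w\<in>shuffles A B. chain x w) = 0"
proof -
 obtain a A' b B' where AB: "A = a # A'" "B = b # B'" using assms by (meson neq_Nil_conv)
 have ne: "x a ~= x b" "a ~= b" using assms by (auto simp: AB)
 have "(\<Sum>w\<in>shuffles A' (b # B'). chain x (a # w)) = chain x (a # A') * chain x (a # b # B')"
  using assms by (intro chain_shuffles_rooted) (auto simp: AB)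
 moreover have "(\<Sum>w\<in>shuffles (a # A') B'. chain x (b # w)) = chain x (b # a # A') * chain x (b # B')"
  using assms by (intro chain_shuffles_rooted) (auto simp: AB)
 ultimately have "(\<Sum>w\<in>shuffles A B. chain x w) = chain x (a # A') * chain x (b # B') * (1 / (x b - x a) + 1 / (x a - x b))"
  unfolding AB sum_shuffles_Cons[OF ne(2)] by (simp add: algebra_simps)
 also have "1 / (x b - x a) + 1 / (x a - x b) = 0" by (simp add: divide_simps)
 finally show ?thesis by simp
qed

text \<open>The partial fraction argument again, now with a fixed end point, whose distance from the
  root survives as a factor. It serves the product map, where 0, 1 and infinity cut a cyclic order
  into three such segments.\<close>

lemma chain_shuffles_two_roots:
 assumes "distinct (r # A @ B @ [e])" "inj_on x (set (r # A @ B @ [e]))"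
 shows "(\<Sum>w\<in>shuffles A B. chain x (r # w @ [e])) =
  (x e - x r) * chain x (r # A @ [e]) * chain x (r # B @ [e])" using assms
proof (induction A B arbitrary: r rule: shuffles.induct)
 case (1 B)
 thus ?case by (auto simp: inj_on_def)
next
 case (2 A)
 thus ?case by (auto simp: inj_on_def)
next
 case (3 a A b B)
 have ne: "x a ~= x r" "x b ~= x r" "x a ~= x b" "x e ~= x a" "x e ~= x b" "x e ~= x r"
  using 3(3,4) by (auto simp: inj_on_def)
 have "(\<Sum>w\<in>shuffles A (b # B). chain x (a # w @ [e])) =
   (x e - x a) * chain x (a # A @ [e]) * chain x (a # (b # B) @ [e])" using 3(3,4) by (intro 3(1)) (auto simp: inj_on_def)
 moreover have "(\<Sum>w\<in>shuffles (a # A) B. chain x (b # w @ [e])) =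
   (x e - x b) * chain x (b # (a # A) @ [e]) * chain x (b # B @ [e])" using 3(3,4) by (intro 3(2)) (auto simp: inj_on_def)
 moreover have "a ~= b" using 3(3) by auto
 ultimately have "(\<Sum>w\<in>shuffles (a # A) (b # B). chain x (r # w @ [e])) =
   (x e - x a) * chain x (a # A @ [e]) * chain x (b # B @ [e]) / ((x b - x a) * (x a - x r)) +
   (x e - x b) * chain x (a # A @ [e]) * chain x (b # B @ [e]) / ((x a - x b) * (x b - x r))"
  by (simp add: sum_shuffles_Cons del: shuffles.simps flip: sum_divide_distrib)
 also have "... = chain x (a # A @ [e]) * chain x (b # B @ [e]) *
   ((x e - x a) / ((x b - x a) * (x a - x r)) + (x e - x b) / ((x a - x b) * (x b - x r)))" by (simp add: algebra_simps)
 also have "(x e - x a) / ((x b - x a) * (x a - x r)) + (x e - x b) / ((x a - x b) * (x b - x r)) =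
   (x e - x r) / ((x a - x r) * (x b - x r))" using ne by (simp add: divide_simps) (simp add: algebra_simps)
 finally show ?case by simp
qed

section \<open>Residues along the collision of a set of points\<close>

text \<open>A path into the divisor of \<open>A\<close>: \<open>z\<close> gives the limit positions,
  \<open>s\<close> the positions in the bubble, and \<open>e\<close> is the equation of the
  divisor.\<close>

definition collide :: "'a set => ('a => complex) => ('a => complex) => complex => 'a => complex" where
 "collide A z s e = (%i. if i \<in> A then z i + e * s i else z i)"

text \<open>The pole order of \<open>chain\<close> at \<open>e = 0\<close> when the points of
  \<open>A\<close> collide.\<close>

fun inner_steps :: "'a set => 'a list => nat" where
 "inner_steps A (a # b # w) = (if a \<in> A & b \<in> A then 1 else 0) + inner_steps A (b # w)"
| "inner_steps A _ = 0"

text \<open>The leading coefficient at \<open>e = 0\<close>: steps inside \<open>A\<close> are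
  measured in the bubble, all others at the limit.\<close>

fun collided_chain :: "'a set => ('a => complex) => ('a => complex) => 'a list => complex" where
 "collided_chain A z s (a # b # w) = collided_chain A z s (b # w) / (if a \<in> A & b \<in> A then s b - s a else z b - z a)"
| "collided_chain A z s _ = 1"

text \<open>A point of the open stratum of the divisor: the limit identifies exactly the points of
  \<open>A\<close>, and the bubble separates them.\<close>

definition collidable :: "'a set => ('a => complex) => ('a => complex) => 'a set => bool" where
 "collidable A z s S \<longleftrightarrow> inj_on s A & (\<forall>i\<in>S. \<forall>j\<in>S. i ~= j --> (z i = z j \<longleftrightarrow> i \<in> A & j \<in> A))"

lemma collidable_eq:
 "collidable A z s S ==> i \<in> A ==> j \<in> A ==> i \<in> S ==> j \<in> S ==> z i = z j"
 unfolding collidable_def by metis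

lemma collidable_neq:
 "collidable A z s S ==> ~ (i \<in> A & j \<in> A) ==> i \<in> S ==> j \<in> S ==> i ~= j ==> z i ~= z j"
 unfolding collidable_def by metis

lemma collidable_inj: "collidable A z s S ==> inj_on s A"
 unfolding collidable_def by blast

lemma collidable_subset: "collidable A z s S ==> T \<subseteq> S ==> collidable A z s T"
 unfolding collidable_def by blast

text \<open>Each step inside \<open>A\<close> uses up one power of \<open>e\<close>. The extension
  \<open>H\<close> has to be a new function because the quotient takes a default value at 0; the
  factor \<open>0 ^ _\<close> in \<open>H 0\<close> is 1 if \<open>N\<close> is the exact pole order
  and 0 otherwise. Only neighbours must differ, since closed words repeat their first
  letter.\<close>

lemma chain_collide:
 assumes "collidable A z s (set w)" "distinct_adj w" "inner_steps A w <= N"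
 shows "EX H. H field_differentiable (at 0) & (ALL e. e ~= 0 --> H e = e ^ N * chain (collide A z s e) w) &
  H 0 = 0 ^ (N - inner_steps A w) * collided_chain A z s w" using assms
proof (induction w arbitrary: N rule: induct_list012)
 case (3 a b w)
 have col: "collidable A z s (set (b # w))" by (rule collidable_subset[OF 3(3)]) auto
 show ?case
 proof (cases "a \<in> A & b \<in> A")
  case True
  then obtain M where M: "N = Suc M" using 3 by (cases N) auto
  obtain H where H: "H field_differentiable (at 0)" "!!e. e ~= 0 ==> H e = e ^ M * chain (collide A z s e) (b # w)"
   "H 0 = 0 ^ (M - inner_steps A (b # w)) * collided_chain A z s (b # w)" using 3(2)[OF col] 3(4,5) True M by auto
  have "s b ~= s a" using True 3 collidable_inj[OF 3(3)] by (auto simp: inj_on_def)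
  moreover have "z a = z b" using collidable_eq[OF 3(3)] True by simp
  hence "collide A z s e b - collide A z s e a = e * (s b - s a)" for e
   using True by (simp add: collide_def right_diff_distrib)
  ultimately show ?thesis using True M H by (intro exI[of _ "%e. H e / (s b - s a)"]) (auto intro!: field_differentiable_divide)
 next
  case False
  obtain H where H: "H field_differentiable (at 0)" "!!e. e ~= 0 ==> H e = e ^ N * chain (collide A z s e) (b # w)"
   "H 0 = 0 ^ (N - inner_steps A (b # w)) * collided_chain A z s (b # w)" using 3(2)[OF col] 3(4,5) False by auto
  have nz: "collide A z s 0 b ~= collide A z s 0 a" using collidable_neq[OF 3(3) False] 3 by (auto simp: collide_def)
  have "(%e. collide A z s e i) field_differentiable (at 0)" for i
   by (cases "i \<in> A") (auto simp: collide_def intro!: derivative_intros)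
  hence "(%e. H e / (collide A z s e b - collide A z s e a)) field_differentiable (at 0)"
   using nz by (intro field_differentiable_divide field_differentiable_diff H) auto
  moreover have "collide A z s 0 = z" by (auto simp: collide_def)
  ultimately show ?thesis using False H
   by (intro exI[of _ "%e. H e / (collide A z s e b - collide A z s e a)"]) (simp add: if_not_P)
 qed
qed (auto intro!: exI[of _ "%e. e ^ N" for N] derivative_intros)

lemma inner_steps_notin: "set w Int A = {} ==> inner_steps A w = 0"
 by (induction rule: induct_list012) auto

lemma inner_steps_append_notin: "a \<notin> A ==> inner_steps A (p @ a # q) = inner_steps A p + inner_steps A q"
proof (induction p rule: induct_list012)
 case 1 thus ?case by (cases q) auto
next
 case (2 x) thus ?case by (cases q) auto
qed auto

lemma inner_steps_subset: "set w \<subseteq> A ==> inner_steps A w = length w - 1"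
 by (induction rule: induct_list012) auto

lemma inner_steps_bound:
 assumes "distinct (filter (%i. i \<in> A) w)" "set w Int A ~= {}"
 shows "inner_steps A w < card (set w Int A)"
 using assms
proof (induction w)
 case (Cons a w)
 show ?case
 proof (cases "set w Int A = {}")
  case True
  hence "inner_steps A (a # w) = 0" by (cases w) (auto simp: inner_steps_notin)
  with Cons True show ?thesis by (simp add: card_gt_0_iff)
 next
  case False
  with Cons have IH: "inner_steps A w < card (set w Int A)" by (auto split: if_splits)
  show ?thesis
  proof (cases "a \<in> A")
   case True
   hence "a \<notin> set w" using Cons(2) by auto
   hence "card (set (a # w) Int A) = Suc (card (set w Int A))" using True by (simp add: Int_insert_left)
   moreover have "inner_steps A (a # w) <= Suc (inner_steps A w)" by (cases w) auto
   ultimately show ?thesis using IH by simp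
  next
   case False
   thus ?thesis using IH by (cases w) auto
  qed
 qed
qed simp

text \<open>The extreme case of \<open>inner_steps_bound\<close>: the number of inner steps is
  maximal only if no letter outside \<open>A\<close> interrupts the letters of
  \<open>A\<close>.\<close>

lemma inner_steps_block:
 assumes "distinct (filter (%i. i \<in> A) w)" "set w Int A ~= {}"
  "card (set w Int A) <= Suc (inner_steps A w)"
 shows "EX p b q. w = p @ b @ q & set b = set w Int A & set p Int A = {} & set q Int A = {}"
 using assms
proof (induction w)
 case (Cons a w)
 show ?case
 proof (cases "a \<in> A")
  case False
  hence "inner_steps A (a # w) = inner_steps A w" by (cases w) auto
  with Cons.prems False have "EX p b q. w = p @ b @ q & set b = set w Int A & set p Int A = {} & set q Int A = {}"
   by (intro Cons.IH) simp_all
  then obtain p b q where "w = p @ b @ q" "set b = set w Int A" "set p Int A = {}" "set q Int A = {}" by auto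
  thus ?thesis using False by (intro exI[of _ "a # p"] exI[of _ b] exI[of _ q]) auto
 next
  case True
  hence aw: "a \<notin> set w" using Cons by auto
  show ?thesis
  proof (cases "set w Int A = {}")
   case True
   thus ?thesis using \<open>a \<in> A\<close> by (intro exI exI[of _ w]) auto
  next
   case False
   have c: "card (set (a # w) Int A) = Suc (card (set w Int A))" using True aw by simp
   obtain c w' where w: "w = c # w'" using False by (cases w) auto
   have "inner_steps A w < card (set w Int A)" using Cons False by (intro inner_steps_bound) (auto split: if_splits)
   hence cA: "c \<in> A" "card (set w Int A) <= Suc (inner_steps A w)" using Cons c by (auto simp: w split: if_splits)
   have "EX p b q. w = p @ b @ q & set b = set w Int A & set p Int A = {} & set q Int A = {}"
    using Cons.prems False True cA by (intro Cons.IH) simp_all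
   then obtain p b q where *: "w = p @ b @ q" "set b = set w Int A" "set p Int A = {}" "set q Int A = {}" by auto
   have "p = []" using * cA w by (cases p) auto
   thus ?thesis using * True by (intro exI exI[of _ q]) auto
  qed
 qed
qed simp

text \<open>At maximal pole order the leading coefficient is a product of a form in the bubble and a
  form on the base, where the letter \<open>a\<close> stands for the collapsed block.\<close>

lemma collided_chain_block:
 assumes "set b \<subseteq> A" "b ~= []" "set p Int A = {}" "set q Int A = {}" "!!i. i \<in> set b ==> z i = z a" "a \<in> A"
 shows "collided_chain A z s (p @ b @ q) = chain s b * chain z (p @ a # q)"
proof -
 have notin: "collided_chain A z s w = chain z w" if "set (butlast w) Int A = {}" for w
  using that by (induction rule: induct_list012) auto
 have bq: "collided_chain A z s (b @ q) = chain s b * chain z (a # q)" using assms(1,2,5)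
 proof (induction b rule: induct_list012)
  case (2 c)
   show ?case
  proof (cases q)
   case (Cons d q')
   hence "collided_chain A z s ([c] @ q) = chain z (d # q') / (z d - z c)"
    using assms(4) notin[of "d # q'"] in_set_butlastD[of _ "d # q'"] by force
   thus ?thesis using 2 Cons by simp
  qed simp
 qed auto
 obtain c b' where b: "b = c # b'" using assms by (cases b) auto
 show ?thesis using assms(3)
 proof (induction p)
  case Nil
   show ?case using bq by simp
 next
  case (Cons d p)
  thus ?case using assms by (cases p) (auto simp: b)
 qed
qed

definition subst1 :: "'a => 'a list => 'a list => 'a list" where
 "subst1 a u w = concat (map (%i. if i = a then u else [i]) w)"

lemma subst1_append [simp]: "subst1 a u (p @ q) = subst1 a u p @ subst1 a u q"
 by (simp add: subst1_def)

lemma subst1_notin [simp]: "a \<notin> set w ==> subst1 a u w = w"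
 by (induction w) (auto simp: subst1_def)

lemma subst1_Cons [simp]: "subst1 a u (a # w) = u @ subst1 a u w"
 by (simp add: subst1_def)

lemma perms_split:
 assumes "w \<in> perms (insert a S)" "a \<notin> S"
 obtains p q where "w = p @ a # q" "a \<notin> set p" "a \<notin> set q" "p @ q \<in> perms S"
proof -
 have "a \<in> set w" using assms by (auto simp: perms_iff)
 then obtain p q where w: "w = p @ a # q" "a \<notin> set p" by (meson split_list_first)
 moreover have "a \<notin> set q" "p @ q \<in> perms S" using assms w unfolding perms_iff by auto
 ultimately show ?thesis using that by blast
qed

lemma eq_append_blocks:
 assumes "p @ u @ q = p' @ u' @ q'" "set u = A" "set u' = A" "A ~= {}"
  "set p Int A = {}" "set p' Int A = {}" "set q Int A = {}" "set q' Int A = {}"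
 shows "p = p' & u = u' & q = q'"
proof -
 have tw: "takeWhile (%i. i \<notin> A) (p @ u @ q) = p"
  if h: "set u = A" "set p Int A = {}" for p u q :: "'a list"
 proof -
  obtain c u0 where u: "u = c # u0" using h assms by (cases u) auto
  hence "c \<in> A" using h by auto
  with h(2) u show ?thesis by (subst takeWhile_append2) auto
 qed
 have p: "p = p'" using tw[of u p q] tw assms by simp
 have fl: "filter (%i. i \<in> A) (u @ q) = u" if "set u = A" "set q Int A = {}" for u q :: "'a list"
  using that by (auto simp: disjoint_iff)
 have "u @ q = u' @ q'" using assms p by simp
 hence "u = u'" using fl[of u q] fl assms by simp
 thus ?thesis using p assms by simp
qed

text \<open>Cutting out the block and leaving \<open>a\<close> in its place is the inverse; since
  \<open>a\<close> belongs to \<open>A\<close>, no new letter has to be chosen.\<close>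

lemma blocks_bij:
 assumes "A \<subseteq> S" "a \<in> A"
 shows "bij_betw (%(w', u). subst1 a u w') (perms (insert a (S - A)) \<times> perms A)
  {w \<in> perms S. EX p b q. w = p @ b @ q & set b = A}"
proof (rule bij_betwI')
 fix x y
 assume x: "x \<in> perms (insert a (S - A)) \<times> perms A" and y: "y \<in> perms (insert a (S - A)) \<times> perms A"
 obtain w1 u1 w2 u2 where xy: "x = (w1, u1)" "y = (w2, u2)" by force
 obtain p1 q1 where 1: "w1 = p1 @ a # q1" "a \<notin> set p1" "a \<notin> set q1" "p1 @ q1 \<in> perms (S - A)"
  using perms_split[of w1 a] x assms xy by auto
 obtain p2 q2 where 2: "w2 = p2 @ a # q2" "a \<notin> set p2" "a \<notin> set q2" "p2 @ q2 \<in> perms (S - A)"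
  using perms_split[of w2 a] y assms xy by auto
 show "((case x of (w', u) => subst1 a u w') = (case y of (w', u) => subst1 a u w')) = (x = y)"
 proof
  assume "(case x of (w', u) => subst1 a u w') = (case y of (w', u) => subst1 a u w')"
  hence "p1 @ u1 @ q1 = p2 @ u2 @ q2" by (simp add: xy 1 2)
  hence "p1 = p2 & u1 = u2 & q1 = q2" using x y 1 2 assms by (intro eq_append_blocks[where A=A]) (auto simp: xy perms_iff)
  thus "x = y" by (simp add: xy 1 2)
 qed simp
next
 fix x assume x: "x \<in> perms (insert a (S - A)) \<times> perms A"
 obtain w u where xw: "x = (w, u)" by force
 obtain p q where 1: "w = p @ a # q" "a \<notin> set p" "a \<notin> set q" "p @ q \<in> perms (S - A)"
  using perms_split[of w a] x assms xw by auto
 have "set p Un set q = S - A" "distinct p" "distinct q" "set p Int set q = {}" "distinct u" "set u = A"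
  using 1 x by (auto simp: perms_iff xw)
 hence "p @ u @ q \<in> perms S" using assms by (auto simp: perms_iff)
 thus "(case x of (w', u) => subst1 a u w') \<in> {w \<in> perms S. EX p b q. w = p @ b @ q & set b = A}"
  using \<open>set u = A\<close> by (auto simp: xw 1)
next
 fix w assume "w \<in> {w \<in> perms S. EX p b q. w = p @ b @ q & set b = A}"
 then obtain p b q where w: "w = p @ b @ q" "set b = A" "w \<in> perms S" by auto

  have "p @ a # q \<in> perms (insert a (S - A))" "a \<notin> set p" "a \<notin> set q" "b \<in> perms A"
  using assms w by (auto simp: perms_iff)
 thus "\<exists>x\<in>perms (insert a (S - A)) \<times> perms A. w = (case x of (w', u) => subst1 a u w')"
  by (intro bexI) (auto simp: w)
qed

lemma subst1_perms:
 assumes "w \<in> perms (insert p (S - A))" "u \<in> perms A" "p \<in> A" "A \<subseteq> S"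
 shows "subst1 p u w \<in> perms S"
proof -
 obtain x y where "w = x @ p # y" "p \<notin> set x" "p \<notin> set y" "x @ y \<in> perms (S - A)"
  using perms_split[OF assms(1)] assms by auto
 thus ?thesis using assms by (auto simp: perms_iff)
qed

lemma distinct_imp_adj: "distinct w ==> distinct_adj w"
 by (induction rule: induct_list012) auto

text \<open>Each of the finitely many pairs of points stays apart for small nonzero
  \<open>e\<close>, by injectivity of \<open>s\<close> inside \<open>A\<close> and by continuity
  otherwise.\<close>

lemma collide_inj:
 assumes "finite T" "collidable A z s T"
 shows "eventually (%e. inj_on (collide A z s e) T) (at 0)"
proof -
 have "eventually (%e. i ~= j --> collide A z s e i ~= collide A z s e j) (at 0)"
  if "i \<in> T" "j \<in> T" for i j
 proof (cases "i = j | i \<in> A & j \<in> A")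
  case True
  have "collide A z s e i ~= collide A z s e j" if "i ~= j" "e ~= 0" for e
  proof -
   have ij: "i \<in> A" "j \<in> A" using True that by auto
   have "s i ~= s j" using collidable_inj[OF assms(2)] ij that(1) by (auto simp: inj_on_def)
   moreover have "z i = z j" using collidable_eq[OF assms(2) ij \<open>i \<in> T\<close> \<open>j \<in> T\<close>] .
   ultimately show ?thesis using ij that(2) by (simp add: collide_def)
  qed
  moreover have "eventually (%e::complex. e ~= 0) (at 0)" by (simp add: eventually_at_filter)
  ultimately show ?thesis by (auto elim: eventually_mono)
 next
  case False
  hence "z i ~= z j" using collidable_neq[OF assms(2)] that by blast
  moreover have "((%e. collide A z s e i - collide A z s e j) \<longlongrightarrow> z i - z j) (at 0)"
   unfolding collide_def by (cases "i \<in> A"; cases "j \<in> A") (auto intro!: tendsto_eq_intros)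
  ultimately have "eventually (%e. collide A z s e i - collide A z s e j ~= 0) (at 0)"
   by (intro tendsto_imp_eventually_ne) auto
  thus ?thesis by (rule eventually_mono) auto
 qed
 hence "eventually (%e. \<forall>i\<in>T. \<forall>j\<in>T. i ~= j --> collide A z s e i ~= collide A z s e j) (at 0)"
  using assms(1) by (intro eventually_ball_finite ballI) auto
 thus ?thesis by (rule eventually_mono) (auto simp: inj_on_def)
qed

text \<open>Pole orders are at most \<open>card A - 1\<close>, and only words containing
  \<open>A\<close> as a block attain this. The frame \<open>pre\<close>, \<open>post\<close> covers
  three uses: no frame for forms with a point at infinity, \<open>[0]\<close> in front for rooted
  words, and \<open>[e]\<close> at both ends for cyclic orders.\<close>

lemma residue_sum:
 fixes c :: "'a list => complex"
 assumes S: "finite S" "A \<subseteq> S" "a \<in> A"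
  and col: "collidable A z s (set pre Un S Un set post)"
  and fr: "(set pre Un set post) Int S = {}" "length pre <= 1" "length post <= 1"
 shows "EX H. H field_differentiable (at 0) &
  H 0 = (\<Sum>w\<in>perms (insert a (S - A)). \<Sum>u\<in>perms A. c (subst1 a u w) * chain s u * chain z (pre @ w @ post)) &
  (ALL t. t ~= 0 --> H t = t ^ (card A - 1) *
    (\<Sum>w\<in>perms S. c w * chain (collide A z s t) (pre @ w @ post)))"
proof -
 let ?F = "%w. pre @ w @ post"
 \<comment> \<open>The defect from the maximal pole order; through the factor
   \<open>0 ^ d w\<close>, only words of defect 0 contribute to \<open>H 0\<close>.\<close>
 define d where "d w = card A - 1 - inner_steps A (?F w)" for w
 have prepost: "distinct_adj pre" "distinct_adj post" using fr by (cases pre; force) (cases post; use fr in force)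
 have facts: "set (?F w) = set pre Un S Un set post" "distinct_adj (?F w)"
  "filter (%i. i \<in> A) (?F w) = filter (%i. i \<in> A) w" "set (?F w) Int A = A" "distinct w"
  if w: "w \<in> perms S" for w
 proof -
  have ww: "distinct w" "set w = S" "w ~= []" using w S by (auto simp: perms_iff)
  have "last pre ~= hd w" if "pre ~= []" using ww fr that last_in_set[of pre] by force
  moreover have "last w ~= hd post" if "post ~= []" using ww fr that last_in_set[of w] by force
  ultimately show "distinct_adj (?F w)" using prepost ww distinct_imp_adj by (auto simp: distinct_adj_append_iff)
  have "filter (%i. i \<in> A) pre = []" "filter (%i. i \<in> A) post = []" using fr S by (auto simp: filter_empty_conv)
  thus "filter (%i. i \<in> A) (?F w) = filter (%i. i \<in> A) w" by simp
  show "set (?F w) = set pre Un S Un set post" "set (?F w) Int A = A" "distinct w" using ww S by auto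
 qed
 have "inner_steps A (?F w) <= card A - 1" if "w \<in> perms S" for w
 proof -
  have "distinct (filter (%i. i \<in> A) (?F w))" using facts[OF that] by simp
  hence "inner_steps A (?F w) < card A" using inner_steps_bound[of A "?F w"] S unfolding facts(4)[OF that] by blast
  thus ?thesis by simp
 qed
 hence "\<forall>w\<in>perms S. EX H. H field_differentiable (at 0) & (ALL t. t ~= 0 --> H t = t ^ (card A - 1) * chain (collide A z s t) (?F w)) &
   H 0 = 0 ^ d w * collided_chain A z s (?F w)" unfolding d_def using col facts by (intro ballI chain_collide) auto
 from bchoice[OF this] obtain G where G: "!!w. w \<in> perms S ==> G w field_differentiable (at 0)"
  "!!w t. w \<in> perms S ==> t ~= 0 ==> G w t = t ^ (card A - 1) * chain (collide A z s t) (?F w)"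
  "!!w. w \<in> perms S ==> G w 0 = 0 ^ d w * collided_chain A z s (?F w)" by blast
 define H where "H t = (\<Sum>w\<in>perms S. c w * G w t)" for t
 have "H field_differentiable (at 0)" unfolding H_def using G by (intro field_differentiable_sum field_differentiable_mult) auto
 moreover have "H t = t ^ (card A - 1) * (\<Sum>w\<in>perms S. c w * chain (collide A z s t) (?F w))" if "t ~= 0" for t
  using G(2)[OF _ that] by (simp add: H_def sum_distrib_left mult.left_commute)
 moreover have "H 0 = (\<Sum>w\<in>perms (insert a (S - A)). \<Sum>u\<in>perms A.
   c (subst1 a u w) * chain s u * chain z (pre @ w @ post))"
 proof -
  let ?B = "{w \<in> perms S. EX p b q. w = p @ b @ q & set b = A}"
  have "c w * (0 ^ d w * collided_chain A z s (?F w)) = 0" if w: "w \<in> perms S - ?B" for w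
  proof -
   have "d w ~= 0"
   proof
    assume "d w = 0"
     have "card (set w Int A) <= Suc (inner_steps A w)"
    proof -
     have "inner_steps A (?F w) = inner_steps A w"
     proof -
      have nA: "a \<notin> A" if "a \<in> set pre Un set post" for a using fr that S by auto
      have pw: "inner_steps A (pre @ v) = inner_steps A v" for v
      proof (cases pre)
       case (Cons e pre')
       hence "pre = [e]" "e \<notin> A" using fr nA by auto
       thus ?thesis by (cases v) auto
      qed simp
      have "inner_steps A (w @ post) = inner_steps A w"
      proof (cases post)
       case (Cons e post')
       hence "post = [e]" "e \<notin> A" using fr nA by auto
       thus ?thesis using inner_steps_append_notin[of e] by simp
      qed simp
      thus ?thesis by (simp add: pw)
     qed
     moreover have "set w Int A = A" using w S by (auto simp: perms_iff)
     ultimately show ?thesis using \<open>d w = 0\<close> by (simp add: d_def)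
    qed
    hence "EX p b q. w = p @ b @ q & set b = set w Int A & set p Int A = {} & set q Int A = {}"
     using w S by (intro inner_steps_block) (auto simp: perms_iff)
    moreover have "set w Int A = A" using w S by (auto simp: perms_iff)
    ultimately show False using w by auto
   qed
   thus ?thesis by simp
  qed
  moreover have "H 0 = (\<Sum>w\<in>perms S. c w * (0 ^ d w * collided_chain A z s (?F w)))" unfolding H_def by (simp_all add: G)
  ultimately have "H 0 = (\<Sum>w\<in>?B. c w * (0 ^ d w * collided_chain A z s (?F w)))" by simp (intro sum.mono_neutral_right; auto)
  also have "... = (\<Sum>(w, u)\<in>perms (insert a (S - A)) \<times> perms A.
    c (subst1 a u w) * (0 ^ d (subst1 a u w) * collided_chain A z s (?F (subst1 a u w))))"
   using sum.reindex_bij_betw[OF blocks_bij[OF S(2,3)], symmetric,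
     of] by (simp add: case_prod_unfold)
  also have "... = (\<Sum>(w, u)\<in>perms (insert a (S - A)) \<times> perms A. c (subst1 a u w) * chain s u * chain z (?F w))"
  proof (rule sum.cong[OF refl], clarify)
   fix w u assume w: "w \<in> perms (insert a (S - A))" and u: "u \<in> perms A"
   obtain p q where 1: "w = p @ a # q" "a \<notin> set p" "a \<notin> set q" "p @ q \<in> perms (S - A)"
    using perms_split[of w a] w S by auto
   have uu: "set u = A" "distinct u" "length u = card A" using u by (auto simp: perms_iff distinct_card)
   have pq: "set p Int A = {}" "set q Int A = {}" using 1 by (auto simp: perms_iff)
   have pp: "set (pre @ p) Int A = {}" "set (q @ post) Int A = {}" using pq fr S by auto
   have "collided_chain A z s ((pre @ p) @ u @ (q @ post)) = chain s u * chain z ((pre @ p) @ a # (q @ post))"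
   proof (rule collided_chain_block[OF _ _ pp])
    show "z i = z a" if "i \<in> set u" for i using collidable_eq[OF col] that uu S by auto
   qed (use uu S in auto)
   moreover have "inner_steps A ((pre @ p) @ u @ (q @ post)) = card A - 1"
   proof -
    have "inner_steps A (v @ u') = inner_steps A u'" if "set v Int A = {}" for v u' using that
    proof (induction v)
     case (Cons b v)
     thus ?case by (cases "v @ u'") auto
    qed simp
    moreover have "inner_steps A (u @ v) = inner_steps A u" if "set v Int A = {}" for v

    proof (cases v)
     case (Cons b v')
     thus ?thesis using that inner_steps_append_notin[of b] inner_steps_notin by auto
    qed simp
    ultimately have "inner_steps A ((pre @ p) @ u @ (q @ post)) = inner_steps A u" using pp by metis
    thus ?thesis using inner_steps_subset[of u] uu by simp
   qed
   ultimately show "c (subst1 a u w) * (0 ^ d (subst1 a u w) * collided_chain A z s (?F (subst1 a u w)))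
     = c (subst1 a u w) * chain s u * chain z (?F w)" using 1 by (simp add: d_def)
  qed
  also have "... = (\<Sum>w\<in>perms (insert a (S - A)). \<Sum>u\<in>perms A. c (subst1 a u w) * chain s u * chain z (?F w))"
   by (simp add: sum.cartesian_product)
  finally show ?thesis .
 qed
 ultimately show ?thesis by blast
qed

lemma residue_eq_0:
 fixes c :: "'a list => complex"
 assumes S: "finite S" "A \<subseteq> S" "a \<in> A"
  and col: "collidable A z s (set pre Un S Un set post)"
  and fr: "(set pre Un set post) Int S = {}" "length pre <= 1" "length post <= 1"
  and zero: "!!x. inj_on x (set pre Un S Un set post) ==> (\<Sum>w\<in>perms S. c w * chain x (pre @ w @ post)) = 0"
 shows "(\<Sum>w\<in>perms (insert a (S - A)). \<Sum>u\<in>perms A. c (subst1 a u w) * chain s u * chain z (pre @ w @ post)) = 0"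
proof -
 obtain H where H: "H field_differentiable (at 0)"
  "H 0 = (\<Sum>w\<in>perms (insert a (S - A)). \<Sum>u\<in>perms A. c (subst1 a u w) * chain s u * chain z (pre @ w @ post))"
  "!!e. e ~= 0 ==> H e = e ^ (card A - 1) *
    (\<Sum>w\<in>perms S. c w * chain (collide A z s e) (pre @ w @ post))" using residue_sum[OF S col fr] by blast
 have "eventually (%e. H e = 0) (at 0)"
 proof -
  have "eventually (%e::complex. e ~= 0) (at 0)" by (simp add: eventually_at_filter)
  moreover have "eventually (%e. inj_on (collide A z s e) (set pre Un S Un set post)) (at 0)"
   using collide_inj[OF _ col] S by simp
  ultimately show ?thesis by eventually_elim (simp add: H zero)
 qed
 hence "(H \<longlongrightarrow> 0) (at 0)" by (simp add: tendsto_eventually)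
 moreover have "(H \<longlongrightarrow> H 0) (at 0)" using field_differentiable_imp_continuous_at[OF H(1)] by (simp add: continuous_at)
 ultimately show ?thesis using H(2) tendsto_unique by force
qed

text \<open>Only words in which \<open>b\<close> and \<open>t\<close> are neighbours survive the
  collision of these two points. With bubble positions 0 for \<open>b\<close> and 1 for
  \<open>t\<close>, the two orders of the pair contribute 1 and -1.\<close>

lemma residue_pair_eq_0:
 fixes c :: "'a list => complex"
 assumes S: "finite S" "b \<in> S" "t \<in> S" "b ~= t"
  and zero: "!!x. inj_on x S ==> (\<Sum>w\<in>perms S. c w * chain x w) = 0"
  and x: "inj_on x (S - {t})"
 shows "(\<Sum>w\<in>perms (S - {t}). (c (subst1 b [b, t] w) - c (subst1 b [t, b] w)) * chain x w) = 0"
proof -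
 define z where "z = x(t := x b)"
 define s :: "'a => complex" where "s = (%i. if i = t then 1 else 0)"
 have "collidable {b, t} z s (set [] Un S Un set [])" using x S unfolding collidable_def z_def s_def inj_on_def by auto
 hence "(\<Sum>w\<in>perms (insert b (S - {b, t})). \<Sum>u\<in>perms {b, t}.
   c (subst1 b u w) * chain s u * chain z ([] @ w @ [])) = 0" using S zero by (intro residue_eq_0) auto
 moreover have "insert b (S - {b, t}) = S - {t}" using S by auto
 moreover have "perms {b, t} = {[b, t], [t, b]}" using S by (intro permutations_of_set_doubleton)
 moreover have "chain z w = chain x w" if "w \<in> perms (S - {t})" for w using that by (intro chain_cong) (auto simp: z_def perms_iff)
 ultimately show ?thesis using S by (simp add: s_def algebra_simps)
qed

lemma perms_remove:
 assumes "w \<in> perms S" "w = p @ t # q"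
 shows "p @ q \<in> perms (S - {t})"
 using assms by (auto simp: perms_iff)

text \<open>Let \<open>t\<close> collide with the root. As \<open>r\<close> always stands first,
  only the words starting with \<open>t\<close> survive, and contracting the pair leaves rooted
  words on \<open>S - {t}\<close>, to which the induction applies.\<close>

lemma rooted_chain_independent:
 fixes c :: "'a list => complex"
 assumes "finite S" "r \<notin> S"
  and "!!x. inj_on x (insert r S) ==> (\<Sum>w\<in>perms S. c w * chain x (r # w)) = 0"
  and "w \<in> perms S"
 shows "c w = 0"
 using assms
proof (induction "card S" arbitrary: S c w)
 case 0
 have "inj_on (%_. 0) (insert r S)" using 0 by auto
 from 0(4)[OF this] 0 show ?case by auto
next
 case (Suc n)
 have "w ~= []" using Suc.hyps(2) Suc.prems(4) by (auto simp: perms_iff)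
 then obtain t v where w: "w = t # v" by (cases w) auto
 have t: "t \<in> S" "t ~= r" "v \<in> perms (S - {t})" using Suc.prems w perms_remove[of w S "[]" t v] by (auto simp: perms_iff)
 \<comment> \<open>Extends \<open>c\<close> by zero to words that do not begin with the root, so
   that the residue can be taken over all words on \<open>insert r S\<close>.\<close>
 define d where "d u = (if u ~= [] & hd u = r then c (tl u) else 0)" for u
 have inj: "inj_on ((#) r) A" for A by (simp add: inj_on_def)
 have sub: "(\<Sum>u\<in>perms (insert r T). g u) = (\<Sum>u\<in>perms T. g (r # u))"
  if h: "r \<notin> T" "!!u. g u ~= 0 ==> u ~= [] & hd u = r" for T and g :: "'a list => complex"
 proof -
  have "sum g (perms (insert r T)) = sum g ((#) r ` perms T)"
  proof (intro sum.mono_neutral_right)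
   show "(#) r ` perms T \<subseteq> perms (insert r T)" using h(1) by (auto simp: perms_iff)
   show "\<forall>i\<in>perms (insert r T) - (#) r ` perms T. g i = 0"
   proof
    fix u assume u: "u \<in> perms (insert r T) - (#) r ` perms T"
    show "g u = 0"
    proof (rule ccontr)
     assume "g u ~= 0"
     hence "u ~= [] & hd u = r" using h(2) by blast
     then obtain u' where "u = r # u'" by (cases u) auto
     thus False using u h(1) perms_remove[of u "insert r T" "[]" r u'] by auto
    qed
   qed
  qed auto
  thus ?thesis by (simp add: sum.reindex[OF inj])
 qed
 have "c (t # v) = 0" if "v \<in> perms (S - {t})" for v
 proof (rule Suc.hyps(1)[where S="S - {t}" and c="%v. c (t # v)" and w=v])
  show "n = card (S - {t})" using Suc t by simp
  fix x :: "'a => complex" assume x: "inj_on x (insert r (S - {t}))"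
  have "(\<Sum>w\<in>perms (insert r S - {t}). (d (subst1 r [r, t] w) - d (subst1 r [t, r] w)) * chain x w) = 0"
  proof (rule residue_pair_eq_0)
   show "inj_on x (insert r S - {t})" using x t by (simp add: insert_Diff_if)
   show "(\<Sum>w\<in>perms (insert r S). d w * chain x w) = 0" if "inj_on x (insert r S)" for x
   proof -
    have "(\<Sum>w\<in>perms (insert r S). d w * chain x w) = (\<Sum>w\<in>perms S. d (r # w) * chain x (r # w))"
     using Suc.prems(2) by (intro sub) (auto simp: d_def split: if_splits)
    also have "... = (\<Sum>w\<in>perms S. c w * chain x (r # w))" by (simp add: d_def)
    also have "... = 0" by (rule Suc.prems(3)[OF that])
    finally show ?thesis .
   qed
  qed (use Suc t in auto)
  also have "insert r S - {t} = insert r (S - {t})" using t by auto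
  also have "(\<Sum>w\<in>perms (insert r (S - {t})). (d (subst1 r [r, t] w) - d (subst1 r [t, r] w)) * chain x w) =
    (\<Sum>w\<in>perms (insert r (S - {t})). d (subst1 r [r, t] w) * chain x w)"
  proof (rule sum.cong[OF refl])
   fix w assume "w \<in> perms (insert r (S - {t}))"
   hence "w ~= []" by (auto simp: perms_iff)
   hence "hd (subst1 r [t, r] w) ~= r" using t by (cases w) (auto simp: subst1_def)
   thus "(d (subst1 r [r, t] w) - d (subst1 r [t, r] w)) * chain x w = d (subst1 r [r, t] w) * chain x w" by (simp add: d_def)
  qed
  also have "... = (\<Sum>w\<in>perms (S - {t}). d (subst1 r [r, t] (r # w)) * chain x (r # w))"
  proof (rule sub)
   show "u ~= [] & hd u = r" if "d (subst1 r [r, t] u) * chain x u ~= 0" for u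
    using that by (cases u) (auto simp: d_def subst1_def split: if_splits)
  qed (use Suc.prems in auto)
  also have "... = (\<Sum>w\<in>perms (S - {t}). c (t # w) * chain x (r # w))"
   using Suc.prems(2) by (intro sum.cong refl) (auto simp: d_def perms_iff)
  finally show "(\<Sum>w\<in>perms (S - {t}). c (t # w) * chain x (r # w)) = 0" .
 qed (use Suc.prems that in auto)
 thus ?case using t w by simp
qed

lemma sublist_pair_iff: "sublist [a, b] w \<longleftrightarrow> (EX p q. w = p @ a # b # q)"
 by (auto simp: sublist_def)

section \<open>Linear and bilinear extensions\<close>

lemma lin_ext_0 [simp]: "lin_ext f 0 = 0"
 by (simp add: lin_ext_def)

lemma lin_ext_sum: "lin_ext f (sum g A) = (\<Sum>i\<in>A. lin_ext f (g i))"
 by (induction rule: infinite_finite_induct) (auto simp: lin_ext_add)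

lemma poly_mapping_expand:
 assumes "finite A" "supp p \<subseteq> A"
 shows "p = (\<Sum>x\<in>A. qscale (coef p x) (bvec x))"
 using lin_ext_superset[OF assms, of bvec] by (simp add: lin_ext_id)

lemma lin_ext_comp: "lin_ext f (lin_ext g p) = lin_ext (%x. lin_ext f (g x)) p"
 by (simp add: lin_ext_def[of g] lin_ext_def[of "%x. lin_ext f (g x)"] lin_ext_sum lin_ext_qscale)

lemma lin_ext_const_add: "lin_ext (%x. f x + g x) p = lin_ext f p + lin_ext g p"
 by (simp add: lin_ext_def qvec.scale_right_distrib sum.distrib)

lemma lin_ext_const_scale: "lin_ext (%x. qscale c (f x)) p = qscale c (lin_ext f p)"
 by (simp add: lin_ext_def qvec.scale_sum_right mult.commute)

lemma lin_ext_cong: "(!!x. x \<in> supp p ==> f x = g x) ==> lin_ext f p = lin_ext g p"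
 by (simp add: lin_ext_def)

lemma lin_ext_in_span: "(!!x. x \<in> supp p ==> f x \<in> qvec.span S) ==> lin_ext f p \<in> qvec.span S"
 by (auto simp: lin_ext_def intro!: qvec.span_sum qvec.span_scale)

lemma bilin_ext_bvec [simp]: "bilin_ext f (bvec x) (bvec y) = f x y"
 by (simp add: bilin_ext_def)

lemma bilin_ext_sum_left: "bilin_ext f (sum g A) q = (\<Sum>i\<in>A. bilin_ext f (g i) q)"
 by (simp add: bilin_ext_def lin_ext_sum)

lemma bilin_ext_scale_left: "bilin_ext f (qscale c p) q = qscale c (bilin_ext f p q)"
 by (simp add: bilin_ext_def lin_ext_qscale)

lemma bilin_ext_scale_right: "bilin_ext f p (qscale c q) = qscale c (bilin_ext f p q)"
 by (simp add: bilin_ext_def lin_ext_qscale lin_ext_const_scale)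

lemma bilin_ext_add_right: "bilin_ext f p (q + r) = bilin_ext f p q + bilin_ext f p r"
 by (simp add: bilin_ext_def lin_ext_add lin_ext_const_add)

lemma bilin_ext_zero_right [simp]: "bilin_ext f p 0 = 0"
 by (simp add: bilin_ext_def) (simp add: lin_ext_def)

lemma bilin_ext_sum_right: "bilin_ext f p (sum g A) = (\<Sum>i\<in>A. bilin_ext f p (g i))"
 by (induction rule: infinite_finite_induct) (auto simp: bilin_ext_add_right)

lemma coef_sum: "coef (sum g A) x = (\<Sum>i\<in>A. coef (g i) x)"
 by (simp add: Poly_Mapping.lookup_sum)

lemma supp_qscale: "supp (qscale c p) \<subseteq> supp p"
 by (auto simp: in_keys_iff)

lemma supp_sum: "supp (sum g A) \<subseteq> (\<Union>i\<in>A. supp (g i))"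
 by (rule Poly_Mapping.keys_sum)

lemma supp_lin_ext: "supp (lin_ext f p) \<subseteq> (\<Union>x\<in>supp p. supp (f x))"
proof -
 have "supp (lin_ext f p) \<subseteq> (\<Union>x\<in>supp p. supp (qscale (coef p x) (f x)))" unfolding lin_ext_def by (rule supp_sum)
 also have "... \<subseteq> (\<Union>x\<in>supp p. supp (f x))" by (intro UN_mono order_refl supp_qscale)
 finally show ?thesis .
qed

lemma span_image_lin_ext:
 assumes "x \<in> qvec.span (h ` W)"
 shows "EX f. supp f \<subseteq> W & x = lin_ext h f"
 using assms
proof (induction rule: qvec.span_induct_alt)
 case base
  show ?case by (intro exI[of _ 0]) simp
next
 case (step c x y)
 then obtain f w where f: "supp f \<subseteq> W" "y = lin_ext h f" and w: "w \<in> W" "x = h w" by blast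
 have "supp (qscale c (bvec w) + f) \<subseteq> W"
  using Poly_Mapping.keys_add[of "qscale c (bvec w)"] supp_qscale[of c "bvec w"] f w by auto
 thus ?case using f w by (intro exI[of _ "qscale c (bvec w) + f"]) (simp add: lin_ext_add lin_ext_qscale)
qed

lemma supp_span:
 assumes "v \<in> qvec.span S" "!!s. s \<in> S ==> supp s \<subseteq> T"
 shows "supp v \<subseteq> T"
 using assms(1)
proof (induction rule: qvec.span_induct_alt)
 case (step c x y)
 have "supp (qscale c x + y) \<subseteq> supp x Un supp y" using Poly_Mapping.keys_add[of "qscale c x"] supp_qscale[of c x] by blast
 thus ?case using step assms by blast
qed simp

section \<open>Pure tensors\<close>

lemma sum_PiE_insert:
 assumes "i \<notin> I"
 shows "(\<Sum>b\<in>PiE (insert i I) B. g b) = (\<Sum>x\<in>B i. \<Sum>b\<in>PiE I B. g (b(i := x)))"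
proof -
 have "(\<Sum>b\<in>PiE (insert i I) B. g b) = (\<Sum>(x, b)\<in>B i \<times> PiE I B. g (b(i := x)))"
  unfolding PiE_insert_eq using inj_combinator[OF assms, of B] by (simp add: sum.reindex case_prod_unfold)
 thus ?thesis by (simp add: sum.cartesian_product)
qed

lemma sum_PiE_Un:
 assumes "finite I" "I Int J = {}"
 shows "(\<Sum>b\<in>PiE (I Un J) B. g b) = (\<Sum>b\<in>PiE I B. \<Sum>b'\<in>PiE J B. g (%i. if i \<in> I then b i else b' i))"
 using assms
proof (induction I arbitrary: g)
 case (insert i I)
 have "(\<Sum>b\<in>PiE (insert i I Un J) B. g b) = (\<Sum>x\<in>B i. \<Sum>b\<in>PiE (I Un J) B. g (b(i := x)))"
  using insert by (simp add: sum_PiE_insert)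
 also have "... = (\<Sum>x\<in>B i. \<Sum>b\<in>PiE I B. \<Sum>b'\<in>PiE J B. g ((%j. if j \<in> I then b j else b' j)(i := x)))"
  using insert by simp
 also have "... = (\<Sum>x\<in>B i. \<Sum>b\<in>PiE I B. \<Sum>b'\<in>PiE J B. g (%j. if j \<in> insert i I then (b(i := x)) j else b' j))"
  by (intro sum.cong arg_cong[of _ _ g]) auto
 also have "... = (\<Sum>b\<in>PiE (insert i I) B. \<Sum>b'\<in>PiE J B. g (%j. if j \<in> insert i I then b j else b' j))"
  using insert by (simp add: sum_PiE_insert)
 finally show ?case .
qed simp

text \<open>Extend the map sending each element of \<open>G i\<close> to a basis vector of its own
  to a linear map \<open>l\<close>. The weights are the matrix entries of \<open>l\<close>, so that
  weighted sums of coefficients read off coordinates with respect to \<open>G i\<close>.\<close>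

lemma dual_weights:
 fixes G :: "'i => ('b \<Rightarrow>\<^sub>0 rat) set"
 assumes ind: "!!i. i \<in> J ==> qvec.independent (G i)"
 shows "EX w. \<forall>i\<in>J. \<forall>v\<in>qvec.span (G i). ALL h B. finite B & supp v \<subseteq> B -->
  (\<Sum>y\<in>B. coef v y * w i h y) = qvec.representation (G i) v h"
proof (rule bchoice, rule ballI)
 fix i assume "i \<in> J"
 hence ind: "qvec.independent (G i)" by (rule ind)
 interpret vector_space_pair "qscale :: rat => ('b \<Rightarrow>\<^sub>0 rat) => _" "qscale :: rat => (('b \<Rightarrow>\<^sub>0 rat) \<Rightarrow>\<^sub>0 rat) => _" ..
 obtain l where l: "Vector_Spaces.linear qscale qscale l" "\<forall>g\<in>G i. l g = bvec g"
  using linear_independent_extend[OF ind, of bvec] by blast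
 interpret l: Vector_Spaces.linear qscale qscale l by (rule l)
 show "EX w. \<forall>v\<in>qvec.span (G i). ALL h B. finite B & supp v \<subseteq> B --> (\<Sum>y\<in>B. coef v y * w h y) = qvec.representation (G i) v h"
 proof (intro exI[of _ "%h y. coef (l (bvec y)) h"] ballI allI impI, elim conjE)
  fix v h and B :: "'b set" assume v: "v \<in> qvec.span (G i)" and B: "finite B" "supp v \<subseteq> B"
  let ?r = "qvec.representation (G i) v"
  have "l v = (\<Sum>y\<in>B. qscale (coef v y) (l (bvec y)))"
   using arg_cong[OF poly_mapping_expand[OF B], of l] by (simp add: l.sum l.scale)
  moreover have "l v = (\<Sum>g | ?r g ~= 0. qscale (?r g) (bvec g))"
   using arg_cong[OF qvec.sum_nonzero_representation_eq[OF ind v], of l] l by (simp add: l.sum l.scale qvec.representation_ne_zero)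
  hence "coef (l v) h = (\<Sum>g | ?r g ~= 0. if g = h then ?r g else 0)"
   by (simp add: coef_sum lookup_single when_def if_distrib cong: if_cong)
  ultimately show "(\<Sum>y\<in>B. coef v y * coef (l (bvec y)) h) = ?r h" by (simp add: coef_sum qvec.finite_representation)
 qed
qed

text \<open>Summing against the weights dual to \<open>h i\<close> in every direction
  \<open>i\<close> kills all tensors except the one of \<open>h\<close> and so isolates
  \<open>a h\<close>.\<close>

lemma pure_tensors_independent:
 fixes G :: "'i => ('b \<Rightarrow>\<^sub>0 rat) set"
 assumes J: "finite J" and ind: "!!i. i \<in> J ==> qvec.independent (G i)" and A: "finite A" "A \<subseteq> PiE J G"
  and zero: "!!b. (\<Sum>g\<in>A. a g * (\<Prod>i\<in>J. coef (g i) (b i))) = (0::rat)" and h: "h \<in> A"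
 shows "a h = 0"
proof -
 from dual_weights[OF ind] obtain w where w: "\<forall>i\<in>J. \<forall>v\<in>qvec.span (G i). ALL h B. finite B & supp v \<subseteq> B -->
  (\<Sum>y\<in>B. coef v y * w i h y) = qvec.representation (G i) v h" ..
 let ?S = "%i. \<Union>g\<in>A. supp (g i)"
 have "(\<Prod>i\<in>J. \<Sum>y\<in>?S i. coef (g i) y * w i (h i) y) = (if g = h then 1 else 0)" if g: "g \<in> A" for g
 proof -
  have "(\<Sum>y\<in>?S i. coef (g i) y * w i (h i) y) = (if g i = h i then 1 else 0)" if i: "i \<in> J" for i
  proof -
   have "g i \<in> G i" "finite (?S i)" "supp (g i) \<subseteq> ?S i" using g i A by auto
   thus ?thesis using w i qvec.representation_basis[OF ind] by (simp add: qvec.span_base)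
  qed
  moreover have "\<exists>i\<in>J. g i ~= h i" if "g ~= h" using that PiE_ext[of g] g h A by blast
  ultimately show ?thesis using J by auto
 qed
 hence "a h = (\<Sum>g\<in>A. a g * (\<Prod>i\<in>J. \<Sum>y\<in>?S i. coef (g i) y * w i (h i) y))"
  using A h by (simp add: if_distrib[of "(*) _"] cong: if_cong)
 also have "... = (\<Sum>g\<in>A. \<Sum>b\<in>PiE J ?S. a g * (\<Prod>i\<in>J. coef (g i) (b i)) * (\<Prod>i\<in>J. w i (h i) (b i)))"
  using J A by (simp add: prod_sum_PiE sum_distrib_left prod.distrib mult.assoc)
 also have "... = (\<Sum>b\<in>PiE J ?S. (\<Sum>g\<in>A. a g * (\<Prod>i\<in>J. coef (g i) (b i))) * (\<Prod>i\<in>J. w i (h i) (b i)))"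
  by (subst sum.swap) (simp add: sum_distrib_right)
 finally show ?thesis by (simp add: zero)
qed

text \<open>Weights dual to \<open>G i\<close> expand each slice in direction \<open>i\<close>; this is done in one direction
 after the other.\<close>

lemma pure_tensors_span:
 fixes G :: "'i => ('b \<Rightarrow>\<^sub>0 rat) set" and c :: "('i => 'b) => rat"
 assumes J: "finite J" and B: "!!i. i \<in> J ==> finite (B i)" and ind: "!!i. i \<in> J ==> qvec.independent (G i)"
  and slices: "!!i b. i \<in> J ==> b \<in> PiE J B ==> (\<Sum>y\<in>B i. qscale (c (b(i := y))) (bvec y)) \<in> qvec.span (G i)"
 shows "EX A a. finite A & A \<subseteq> PiE J G &
  (\<forall>b\<in>PiE J B. c b = (\<Sum>g\<in>A. a g * (\<Prod>i\<in>J. coef (g i) (b i))))"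
proof -
 from dual_weights[OF ind] obtain w where w: "\<forall>i\<in>J. \<forall>v\<in>qvec.span (G i). ALL h B. finite B & supp v \<subseteq> B -->
  (\<Sum>y\<in>B. coef v y * w i h y) = qvec.representation (G i) v h" ..
 define F where "F i b = (\<Sum>y\<in>B i. qscale (c (b(i := y))) (bvec y))" for i b
 let ?R = "%i b. qvec.representation (G i) (F i b)"
 define H where "H i = (\<Union>b\<in>PiE J B. {h. ?R i b h ~= 0})" for i
 have H: "finite (H i)" "H i \<subseteq> G i" if "i \<in> J" for i
  using finite_PiE[OF J B] by (auto simp: H_def qvec.finite_representation qvec.representation_ne_zero)
 have slice: "c b = (\<Sum>h\<in>H i. (\<Sum>y\<in>B i. c (b(i := y)) * w i h y) * coef h (b i))" if i: "i \<in> J" and b: "b \<in> PiE J B" for i b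
 proof -
  note S = slices[OF i b, folded F_def]
  have cF: "coef (F i b) y = (if y \<in> B i then c (b(i := y)) else 0)" for y using B[OF i] unfolding F_def coef_sum
   by (simp add: lookup_single when_def if_distrib cong: if_cong)
  have "F i b = (\<Sum>h | ?R i b h ~= 0. qscale (?R i b h) h)" by (rule qvec.sum_nonzero_representation_eq[OF ind[OF i] S, symmetric])
  also have "... = (\<Sum>h\<in>H i. qscale (?R i b h) h)" using b H[OF i] by (intro sum.mono_neutral_left) (auto simp: H_def)
  finally have "coef (F i b) (b i) = coef (\<Sum>h\<in>H i. qscale (?R i b h) h) (b i)" by simp
  moreover have "?R i b h = (\<Sum>y\<in>B i. c (b(i := y)) * w i h y)" for h
   using w[rule_format, OF i S, of "B i"] B[OF i] by (simp add: cF subset_iff in_keys_iff)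
  moreover have "b i \<in> B i" using i b by auto
  ultimately show ?thesis by (simp add: cF coef_sum)
 qed
 let ?o = "%J' x b i. if i \<in> J' then x i else b i"
 have "c b = (\<Sum>g\<in>PiE J' H. \<Sum>x\<in>PiE J' B. c (?o J' x b) * (\<Prod>i\<in>J'. w i (g i) (x i) * coef (g i) (b i)))"
  if "finite J'" "J' \<subseteq> J" and b: "b \<in> PiE J B" for J' b using that(1,2)
 proof (induction J')
  case (insert i J')
  let ?P = "%g x. \<Prod>i\<in>J'. w i (g i) (x i) * coef (g i) (b i)"
  let ?T = "%h g y x. c (?o (insert i J') (x(i := y)) b) * w i h y * coef h (b i) * ?P g x"
  have e: "c (?o J' x b) * ?P g x = (\<Sum>h\<in>H i. \<Sum>y\<in>B i. ?T h g y x)" if x: "x \<in> PiE J' B" for x g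
  proof -
   have "(?o J' x b)(i := y) = ?o (insert i J') (x(i := y)) b" for y by auto
   moreover have "?o J' x b \<in> PiE J B" using x b insert.prems by auto
   ultimately show ?thesis using slice[of i] insert by (simp add: sum_distrib_right)
  qed
  have P: "(\<Prod>j\<in>insert i J'. w j ((g(i := h)) j) ((x(i := y)) j) * coef ((g(i := h)) j) (b j)) = w i h y * coef h (b i) * ?P g x" for g h x y
  proof -
   have "(\<Prod>j\<in>J'. w j ((g(i := h)) j) ((x(i := y)) j) * coef ((g(i := h)) j) (b j)) = ?P g x"
    using insert.hyps by (intro prod.cong) auto
   thus ?thesis using insert.hyps by simp
  qed
  have "c b = (\<Sum>g\<in>PiE J' H. \<Sum>x\<in>PiE J' B. \<Sum>h\<in>H i. \<Sum>y\<in>B i. ?T h g y x)" using insert by (simp add: e)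
  also have "... = (\<Sum>g\<in>PiE J' H. \<Sum>h\<in>H i. \<Sum>y\<in>B i. \<Sum>x\<in>PiE J' B. ?T h g y x)"
   by (subst sum.swap, subst  sum.swap) rule
  also have "... = (\<Sum>h\<in>H i. \<Sum>g\<in>PiE J' H. \<Sum>y\<in>B i. \<Sum>x\<in>PiE J' B. ?T h g y x)" by (rule sum.swap)
  finally show ?case unfolding sum_PiE_insert[OF insert.hyps(2)] P by (simp only: mult.assoc)
 qed simp
 from this[OF J order_refl]
 have "c b = (\<Sum>g\<in>PiE J H. (\<Sum>x\<in>PiE J B. c x * (\<Prod>i\<in>J. w i (g i) (x i))) * (\<Prod>i\<in>J. coef (g i) (b i)))" if b: "b \<in> PiE J B" for b
 proof -
  have "?o J x b = x" if "x \<in> PiE J B" for x using that b by (auto simp: PiE_def extensional_def)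
  thus ?thesis using \<open>!!b. _ ==> c b = _\<close>[OF b] by (simp add: prod.distrib sum_distrib_right mult.assoc)
 qed
 moreover have "finite (PiE J H)" "PiE J H \<subseteq> PiE J G" using H by (auto intro!: finite_PiE[OF J])
 ultimately show ?thesis by (intro exI exI[of _ "%g. \<Sum>x\<in>PiE J B. c x * (\<Prod>i\<in>J. w i (g i) (x i))"]) blast
qed

section \<open>Insertion of words for letters\<close>

definition off :: "(nat => nat) => nat => nat" where
 "off v i = (\<Sum>h=1..<i. v h)"

definition expand :: "(nat => nat) => (nat => nat list) => nat list => nat list" where
 "expand v b w = concat (map (%i. map ((+) (off v i)) (b i)) w)"

definition shuffle_all :: "nat list list => word_comb" where
 "shuffle_all us = foldr word_shuffle (map bvec us) (bvec [])"

text \<open>Insertions are recorded as combinations of lists of words, with the factors still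
  separate. Taking the shuffle product, or the single word of the list, is a linear map applied
  afterwards, so both kinds of insertion share one theory.\<close>

definition tensor_array :: "(nat => nat) => (nat => word_comb) => nat list list => (nat list list \<Rightarrow>\<^sub>0 rat)" where
 "tensor_array v c us =
  (\<Sum>b\<in>PiE (set (concat us)) (%i. supp (c i)).
    qscale (\<Prod>i\<in>set (concat us). coef (c i) (b i)) (bvec (map (expand v b) us)))"

lemma expand_Nil [simp]: "expand v b [] = []"
 by (simp add: expand_def)

lemma expand_Cons: "expand v b (i # w) = map ((+) (off v i)) (b i) @ expand v b w"
 by (simp add: expand_def)

lemma expand_append: "expand v b (w @ w') = expand v b w @ expand v b w'"
 by (simp add: expand_def)

lemma expand_cong: "(!!i. i \<in> set w ==> b i = b' i) ==> expand v b w = expand v b' w"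
 by (auto simp: expand_def intro!: arg_cong[of _ _ concat])

lemma insert_word_expand:
 assumes "distinct w"
 shows "insert_word v c w = (\<Sum>b\<in>PiE (set w) (%i. supp (c i)).
  qscale (\<Prod>i\<in>set w. coef (c i) (b i)) (bvec (expand v b w)))" using assms
proof (induction w)
 case Nil
  show ?case by (simp add: insert_word_def)
next
 case (Cons i w)
 let ?f = "%u. bvec (map ((+) (off v i)) u)"
 have iw: "insert_word v c (i # w) = word_concat (lin_ext ?f (c i)) (insert_word v c w)" by (simp add: insert_word_def off_def)
 have "insert_word v c (i # w) = (\<Sum>y\<in>supp (c i). \<Sum>b\<in>PiE (set w) (%i. supp (c i)).
   qscale (coef (c i) y * (\<Prod>i\<in>set w. coef (c i) (b i))) (bvec (map ((+) (off v i)) y @ expand v b w)))" using Cons unfolding iw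
  by (simp add: lin_ext_def word_concat_def bilin_ext_sum_left bilin_ext_scale_left bilin_ext_sum_right
    bilin_ext_scale_right qvec.scale_sum_right) (subst sum.swap, simp add: mult.commute)
 also have "... = (\<Sum>y\<in>supp (c i). \<Sum>b\<in>PiE (set w) (%i. supp (c i)).
   qscale (\<Prod>j\<in>set (i # w). coef (c j) ((b(i := y)) j)) (bvec (expand v (b(i := y)) (i # w))))"
 proof (intro sum.cong refl)
  fix y b
  have "(\<Prod>j\<in>set w. coef (c j) ((b(i := y)) j)) = (\<Prod>j\<in>set w. coef (c j) (b j))"
   using Cons.prems by (intro prod.cong) auto
  moreover have "expand v (b(i := y)) w = expand v b w" using Cons.prems by (intro expand_cong) auto
  ultimately show "qscale (coef (c i) y * (\<Prod>i\<in>set w. coef (c i) (b i))) (bvec (map ((+) (off v i)) y @ expand v b w)) =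
   qscale (\<Prod>j\<in>set (i # w). coef (c j) ((b(i := y)) j)) (bvec (expand v (b(i := y)) (i # w)))"
   using Cons.prems by (simp add: expand_Cons)
 qed
 also have "... = (\<Sum>b\<in>PiE (set (i # w)) (%i. supp (c i)).
  qscale (\<Prod>i\<in>set (i # w). coef (c i) (b i)) (bvec (expand v b (i # w))))"
  unfolding list.set by (subst sum_PiE_insert) (use Cons.prems in simp_all)
 finally show ?case .
qed

lemma insert_word_tensor_array:
 assumes "distinct w"
 shows "insert_word v c w = lin_ext (%us. bvec (hd us)) (tensor_array v c [w])"
 by (simp add: tensor_array_def insert_word_expand[OF assms] lin_ext_sum lin_ext_qscale)

text \<open>Both sides are multilinear in the inserted elements. As the factors have disjoint
  letters, choices of words in different factors are independent and combine to one choice for all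
  letters.\<close>

lemma shuffle_insert_words:
 assumes "distinct (concat us)"
 shows "foldr word_shuffle (map (insert_word v c) us) (bvec []) = lin_ext shuffle_all (tensor_array v c us)"
 using assms
proof (induction us)
 case Nil
  show ?case by (simp add: tensor_array_def shuffle_all_def)
next
 case (Cons u us)
 let ?P = "%I b. \<Prod>i\<in>I. coef (c i) (b i)"
 have disj: "set u Int set (concat us) = {}" "distinct u" "distinct (concat us)" using Cons.prems by auto
 have "foldr word_shuffle (map (insert_word v c) (u # us)) (bvec []) =
   word_shuffle (insert_word v c u) (lin_ext shuffle_all (tensor_array v c us))" using Cons by simp
 also have "... = (\<Sum>b\<in>PiE (set u) (%i. supp (c i)). \<Sum>b'\<in>PiE (set (concat us)) (%i. supp (c i)).
   qscale (?P (set u) b * ?P (set (concat us)) b')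
    (word_shuffle (bvec (expand v b u)) (shuffle_all (map (expand v b') us))))"
  by (simp add: insert_word_expand[OF disj(2)] tensor_array_def lin_ext_sum lin_ext_qscale word_shuffle_def
    bilin_ext_sum_left bilin_ext_scale_left bilin_ext_sum_right bilin_ext_scale_right qvec.scale_sum_right)
   (subst sum.swap, simp add: mult.commute)
 also have "... = (\<Sum>b\<in>PiE (set u) (%i. supp (c i)). \<Sum>b'\<in>PiE (set (concat us)) (%i. supp (c i)).
   (%b. qscale (?P (set u Un set (concat us)) b) (shuffle_all (map (expand v b) (u # us))))
    (%i. if i \<in> set u then b i else b' i))"
 proof (intro sum.cong refl)
  fix b b' :: "nat => nat list"
  let ?b = "%i. if i \<in> set u then b i else b' i"
  have "?P (set u Un set (concat us)) ?b = ?P (set u) ?b * ?P (set (concat us)) ?b" using disj by (intro prod.union_disjoint) auto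
  also have "?P (set u) ?b = ?P (set u) b" by simp
  also have "?P (set (concat us)) ?b = ?P (set (concat us)) b'" using disj by (intro prod.cong) auto
  finally have 1: "?P (set u Un set (concat us)) ?b = ?P (set u) b * ?P (set (concat us)) b'" .
  have 2: "expand v ?b u = expand v b u" by (intro expand_cong) auto
  have 3: "map (expand v ?b) us = map (expand v b') us" using disj by (intro map_cong expand_cong) auto
  have 4: "shuffle_all (map (expand v ?b) (u # us)) = word_shuffle (bvec (expand v b u)) (shuffle_all (map (expand v b') us))"
   by (simp add: shuffle_all_def 2 3)
  show "qscale (?P (set u) b * ?P (set (concat us)) b') (word_shuffle (bvec (expand v b u)) (shuffle_all (map (expand v b') us))) =
   (%b. qscale (?P (set u Un set (concat us)) b) (shuffle_all (map (expand v b) (u # us)))) ?b" unfolding 1 4 ..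
 qed
 also have "... = lin_ext shuffle_all (tensor_array v c (u # us))"
  by (simp only: tensor_array_def lin_ext_sum lin_ext_qscale lin_ext_bvec concat.simps set_append
    sum_PiE_Un[OF finite_set disj(1)])
 finally show ?case .
qed

section \<open>Compositions of m and the segments of the alphabet\<close>

definition composition :: "nat => (nat => nat) => nat => bool" where
 "composition k v m \<longleftrightarrow> (\<forall>i\<in>{1..k}. v i \<ge> 1) & (\<Sum>i=1..k. v i) = m"

definition seg :: "(nat => nat) => nat => nat set" where
 "seg v i = {off v i + 1..off v i + v i}"

lemma off_Suc: "i \<ge> 1 ==> off v (Suc i) = off v i + v i"
 by (simp add: off_def)

lemma off_1 [simp]: "off v (Suc 0) = 0"
 by (simp add: off_def)

lemma off_mono: "i <= j ==> off v i <= off v j"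
 unfolding off_def by (intro sum_mono2) auto

lemma off_less: "1 <= i ==> i < j ==> off v i + v i <= off v j"
 using off_mono[of "Suc i"] by (simp add: off_Suc)

lemma composition_off: "composition k v m ==> off v (Suc k) = m"
 by (simp add: composition_def off_def atLeastLessThanSuc_atLeastAtMost)

lemma part_subset: "composition k v m ==> i \<in> {1..k} ==> seg v i \<subseteq> {1..m}"
 using off_less composition_off[of k v m] by (auto simp: seg_def)

lemma part_less: "1 <= i ==> i < j ==> x \<in> seg v i ==> y \<in> seg v j ==> x < y"
 using off_less[of i j v] by (auto simp: seg_def)

lemma part_unique: "i \<ge> 1 ==> j \<ge> 1 ==> x \<in> seg v i ==> x \<in> seg v j ==> i = j"
 using part_less[of i] part_less[of j i x v x] by (cases rule: linorder_cases) auto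

lemma part_nonempty: "composition k v m ==> i \<in> {1..k} ==> off v i + 1 \<in> seg v i"
 by (auto simp: seg_def composition_def)

lemma part_cover:
 assumes "composition k v m" "x \<in> {1..m}"
 obtains i where "i \<in> {1..k}" "x \<in> seg v i"
proof -
 have "\<exists>i\<in>{1..k}. x \<in> seg v i" if "x <= off v (Suc k)" for k using that
 proof (induction k)
  case 0
  thus ?case using assms(2) by simp
 next
  case (Suc k)
  show ?case
  proof (cases "x <= off v (Suc k)")
   case True
   thus ?thesis using Suc.IH by force
  next
   case False
   hence "x \<in> seg v (Suc k)" using Suc.prems by (auto simp: seg_def off_Suc)
   thus ?thesis by force
  qed
 qed
 from this[of k] obtain i where "i \<in> {1..k}" "x \<in> seg v i" using assms(2) composition_off[OF assms(1)] by auto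
 thus ?thesis using that by blast
qed

definition valid_parts :: "(nat => nat) => (nat => nat list) => nat set => bool" where
 "valid_parts v b I \<longleftrightarrow> (\<forall>i\<in>I. b i \<in> perms {1..v i})"

lemma valid_part:
 assumes "valid_parts v b I" "i \<in> I"
 shows "distinct (map ((+) (off v i)) (b i))" "set (map ((+) (off v i)) (b i)) = seg v i" "length (b i) = v i"
proof -
 have *: "distinct (b i)" "set (b i) = {1..v i}" using assms by (auto simp: valid_parts_def perms_iff)
 thus "distinct (map ((+) (off v i)) (b i))" by (simp add: distinct_map)

  show "set (map ((+) (off v i)) (b i)) = seg v i" using * by (simp add: seg_def)
 show "length (b i) = v i" using * distinct_card[of "b i"] by simp
qed

lemma set_expand: "valid_parts v b (set w) ==> set (expand v b w) = (\<Union>i\<in>set w. seg v i)"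
 using valid_part by (auto simp: expand_def)

lemma distinct_expand:
 assumes "valid_parts v b (set w)" "distinct w" "0 \<notin> set w"
 shows "distinct (expand v b w)"
 using assms
proof (induction w)
 case (Cons i w)
 have "valid_parts v b (set w)" using Cons.prems by (auto simp: valid_parts_def)
 moreover have "seg v i Int seg v j = {}" if "j \<in> set w" for j
  using that Cons.prems part_unique by (metis disjoint_iff distinct.simps less_one linorder_not_less list.set_intros)
 moreover have "distinct (map ((+) (off v i)) (b i))" "set (map ((+) (off v i)) (b i)) = seg v i" using valid_part[OF Cons.prems(1)] by auto
 ultimately show ?case using Cons.IH Cons.prems unfolding expand_Cons distinct_append by (simp only: set_expand) auto
qed simp

lemma concat_expand: "concat (map (expand v b) us) = expand v b (concat us)"
 by (induction us) (auto simp: expand_append)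

lemma composition_union: "composition k v m ==> (\<Union>i\<in>{1..k}. seg v i) = {1..m}"
proof (rule antisym)
 assume c: "composition k v m"
 show "(\<Union>i\<in>{1..k}. seg v i) \<subseteq> {1..m}" by (rule UN_least) (rule part_subset[OF c])
 show "{1..m} \<subseteq> (\<Union>i\<in>{1..k}. seg v i)" using part_cover c by force
qed

lemma expand_perms:
 assumes "composition k v m" "w \<in> perms {1..k}" "valid_parts v b {1..k}"
 shows "expand v b w \<in> perms {1..m}"
 using assms distinct_expand set_expand composition_union by (auto simp: perms_iff)

text \<open>Segments are disjoint, so the first letter of an expanded word reveals the letter that
  was replaced, and the length of its segment tells where the inserted word ends.\<close>

lemma expand_eqD:
 assumes "expand v b w = expand v b' w'" "valid_parts v b (set w)" "valid_parts v b' (set w')"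
  "0 \<notin> set w" "0 \<notin> set w'" "!!i. i \<in> set w Un set w' ==> v i \<ge> 1"
 shows "w = w' & (\<forall>i\<in>set w. b i = b' i)"
 using assms
proof (induction w arbitrary: w')
 case Nil
 show ?case
 proof (cases w')
  case (Cons i w0)
  hence "length (b' i) = v i" "v i \<ge> 1" using valid_part Nil by auto
  thus ?thesis using Nil Cons by (auto simp: expand_Cons)
 qed simp
next
 case (Cons i w)
 have vi: "length (b i) = v i" "v i \<ge> 1" "set (map ((+) (off v i)) (b i)) = seg v i" using valid_part Cons.prems by auto
 hence "b i ~= []" by auto
 hence "w' ~= []" using Cons.prems by (auto simp: expand_Cons)
 then obtain i' w0 where w': "w' = i' # w0" by (cases w') auto
 have vi': "length (b' i') = v i'" "v i' \<ge> 1" "set (map ((+) (off v i')) (b' i')) = seg v i'" using valid_part Cons.prems w' by auto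
 hence "b' i' ~= []" by auto
 have eq: "map ((+) (off v i)) (b i) @ expand v b w = map ((+) (off v i')) (b' i') @ expand v b' w0"
  using Cons.prems by (simp add: w' expand_Cons)
 have hd: "hd (map ((+) (off v i)) (b i)) = hd (map ((+) (off v i')) (b' i'))"
  using arg_cong[OF eq, of hd] \<open>b i ~= []\<close> \<open>b' i' ~= []\<close> by simp
 have "hd (map ((+) (off v i)) (b i)) \<in> seg v i"
  unfolding vi(3)[symmetric] by (rule hd_in_set) (use \<open>b i ~= []\<close> in simp)
 moreover have "hd (map ((+) (off v i')) (b' i')) \<in> seg v i'"
  unfolding vi'(3)[symmetric] by (rule hd_in_set) (use \<open>b' i' ~= []\<close> in simp)
 moreover have "i \<ge> 1" "i' \<ge> 1" using Cons.prems w' by auto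
 ultimately have ii: "i = i'" using hd part_unique by metis
 hence "map ((+) (off v i)) (b i) = map ((+) (off v i)) (b' i) & expand v b w = expand v b' w0" using eq vi vi' by auto
 hence "b i = b' i" "expand v b w = expand v b' w0" by auto
 moreover have "w = w0 & (\<forall>i\<in>set w. b i = b' i)"
  using Cons.prems w' calculation(2) by (intro Cons.IH) (auto simp: valid_parts_def)
 ultimately show ?case using ii w' by simp
qed

lemma map_expand_eqD:
 assumes "map (expand v b) us = map (expand v b') us'" "valid_parts v b (set (concat us))" "valid_parts v b' (set (concat us'))"
  "0 \<notin> set (concat us)" "0 \<notin> set (concat us')" "!!i. i \<in> set (concat us) Un set (concat us') ==> v i \<ge> 1"
 shows "us = us' & (\<forall>i\<in>set (concat us). b i = b' i)"
 using assms
proof (induction us arbitrary: us')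
 case (Cons u us)
 obtain u' us0 where us': "us' = u' # us0" "expand v b u = expand v b' u'" "map (expand v b) us = map (expand v b') us0"
  using Cons.prems by  auto
 have "u = u' & (\<forall>i\<in>set u. b i = b' i)" using Cons.prems us' by (intro expand_eqD[of v]) (auto simp: valid_parts_def)
 moreover have "us = us0 & (\<forall>i\<in>set (concat us). b i = b' i)"
 proof (rule Cons.IH[OF us'(3)])
  show "v i \<ge> 1" if "i \<in> set (concat us) Un set (concat us0)" for i by (rule Cons.prems) (use that us' in auto)
 qed (use Cons.prems us' in "auto simp: valid_parts_def")
 ultimately show ?case using us' by auto
qed simp

lemma prefix_concat:
 assumes "concat (map g w) = B @ Q" "distinct (concat (map g w))" "!!i. i \<in> set w ==> g i ~= []"
 shows "EX bb. prefix bb w & set bb = {i\<in>set w. set (g i) Int set B ~= {}}"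
 using assms
proof (induction w arbitrary: B)
 case (Cons i w)
 have dis: "set (g i) Int set (concat (map g w)) = {}" "distinct (concat (map g w))" using Cons.prems(2) by auto
 show ?case
 proof (cases "B = []")
  case False
  have pre: "prefix B (g i) | (EX B'. B = g i @ B' & concat (map g w) = B' @ Q)"
   using Cons.prems by (auto simp: append_eq_append_conv2)
  show ?thesis
  proof (cases "prefix B (g i)")
   case True
   hence "set B \<subseteq> set (g i)" by (rule set_mono_prefix)
   hence "{j\<in>set w. set (g j) Int set B ~= {}} = {}" using dis by fastforce
   moreover have "set (g i) Int set B ~= {}" using False \<open>set B \<subseteq> set (g i)\<close> by (cases B) auto
   ultimately show ?thesis by (intro exI[of _ "[i]"]) auto
  next
   case False
   then obtain B' where B': "B = g i @ B'" "concat (map g w) = B' @ Q" using pre by blast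
   obtain bb where bb: "prefix bb w" "set bb = {j\<in>set w. set (g j) Int set B' ~= {}}"
    using Cons.IH[OF B'(2) dis(2)] Cons.prems by auto
   have "set (g j) Int set (g i) = {}" if "j \<in> set w" for j using dis that by auto
   moreover have "set (g i) ~= {}" using Cons.prems by auto
   ultimately show ?thesis using bb B' by (intro exI[of _ "i # bb"]) auto
  qed
 qed auto
qed simp

text \<open>Pieces are skipped until \<open>B\<close> starts. If it starts inside a piece, cutting
  off what precedes \<open>B\<close> reduces the claim to the prefix case.\<close>

lemma sublist_concat:
 assumes "concat (map g w) = P @ B @ Q" "distinct (concat (map g w))" "!!i. i \<in> set w ==> g i ~= []"
 shows "EX bb. sublist bb w & set bb = {i\<in>set w. set (g i) Int set B ~= {}}"
 using assms
proof (induction w arbitrary: P)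
 case (Cons i w)
 have dis: "set (g i) Int set (concat (map g w)) = {}" "distinct (concat (map g w))" using Cons.prems(2) by auto
 have "(EX P'. P = g i @ P' & concat (map g w) = P' @ B @ Q) | (EX R. g i = P @ R & R @ concat (map g w) = B @ Q)"
  using Cons.prems by (auto simp: append_eq_append_conv2)
 thus ?case
 proof (elim disjE exE conjE)
  fix P' assume P': "P = g i @ P'" "concat (map g w) = P' @ B @ Q"
  obtain bb where bb: "sublist bb w" "set bb = {j\<in>set w. set (g j) Int set B ~= {}}"
   using Cons.IH[OF P'(2) dis(2)] Cons.prems by auto
  have "set (g i) Int set B = {}" using dis P' by auto
  thus ?thesis using bb by (auto intro: sublist_Cons_right[THEN iffD2])
 next
  fix R assume R: "g i = P @ R" "R @ concat (map g w) = B @ Q"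
  show ?thesis
  proof (cases "R = []")
   case True
   then obtain bb where bb: "prefix bb w" "set bb = {j\<in>set w. set (g j) Int set B ~= {}}"
    using prefix_concat[of g w B] R Cons.prems by auto
   have "set B \<subseteq> set (concat (map g w))" using R True by simp
   hence "set (g i) Int set B = {}" using dis by blast
   thus ?thesis using bb by (auto intro: sublist_Cons_right[THEN iffD2])
  next
   case False
   \<comment> \<open>Only the tail \<open>R\<close> of the piece in which \<open>B\<close> starts is
     kept, which makes \<open>B\<close> a prefix of the concatenation.\<close>
   let ?g = "%j. if j = i then R else g j"
   have iw: "i \<notin> set w"
   proof
    assume "i \<in> set w"
    hence "set (g i) \<subseteq> set (concat (map g w))" by auto
    moreover have "set (g i) ~= {}" using Cons.prems by simp
    ultimately show False using dis by (metis Int_absorb2)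
   qed
   have gw: "map ?g w = map g w" using iw by  auto
   have "distinct (concat (map ?g (i # w)))" using Cons.prems R by (simp add: gw)
   moreover have "concat (map ?g (i # w)) = B @ Q" using R by (simp add: gw)
   moreover have "!!j. j \<in> set (i # w) ==> ?g j ~= []" using False Cons.prems by auto
   ultimately obtain bb where bb: "prefix bb (i # w)" "set bb = {j\<in>set (i # w). set (?g j) Int set B ~= {}}"
    using prefix_concat by blast
   have "set P Int set B = {}" using Cons.prems by (metis append.assoc distinct_append)
   hence "set bb = {j\<in>set (i # w). set (g j) Int set B ~= {}}" using bb R by auto
   thus ?thesis using bb by blast
  qed
 qed
qed simp

section \<open>Words without inner intervals, and contraction of intervals\<close>

text \<open>A block using the whole alphabet is tolerated. For a word on all letters this is special
  convergence, and for a Lyndon factor, which is shorter than \<open>k\<close>, it is plain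
  convergence; one notion serves both.\<close>

definition simple_word :: "nat => nat list => bool" where
 "simple_word k u \<longleftrightarrow> ~ (EX b. sublist b u & 2 <= length b & length b < k & interval_of {1..k} (set b))"

lemma interval_cases:
 assumes "interval_of {1..k} I" "I ~= {}"
 obtains p q where "1 <= p" "p <= q" "q <= k" "I = {p..q}"
proof -
 obtain a b where I: "I = {1..k} Int {a..b}" using assms by (auto simp: interval_of_def)
 hence "I = {max 1 a..min k b}" by auto
 moreover from this have "max 1 a <= min k b" using assms by auto
 ultimately show ?thesis using that[of "max 1 a" "min k b"] by auto
qed

lemma interval_ofI: "1 <= p ==> q <= k ==> interval_of {1..k} {p..q}"
 unfolding interval_of_def by (intro exI[of _ p] exI[of _ q]) auto

lemma interval_parts:
 assumes "composition k v m" "1 <= p" "p <= q" "q <= m"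
 shows "EX i j. 1 <= i & i <= j & j <= k & p \<in> seg v i & q \<in> seg v j &
  {h\<in>{1..k}. seg v h Int {p..q} ~= {}} = {i..j}"
proof -
 obtain i where i: "i \<in> {1..k}" "p \<in> seg v i" using part_cover[OF assms(1), of p] assms by auto
 obtain j where j: "j \<in> {1..k}" "q \<in> seg v j" using part_cover[OF assms(1), of q] assms by auto
 have ij: "i <= j" using part_less[of j i q v p] i j assms(3) by (cases "i <= j") auto
 have "seg v h Int {p..q} ~= {} \<longleftrightarrow> i <= h & h <= j" if h: "h \<in> {1..k}" for h
 proof
  assume "seg v h Int {p..q} ~= {}"
  then obtain x where x: "x \<in> seg v h" "p <= x" "x <= q" by auto
  show "i <= h & h <= j"
   using part_less[of h i x v p] part_less[of j h q v x] x i j h by (cases "i <= h"; cases "h <= j") auto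
 next
  assume ihj: "i <= h & h <= j"
  consider "h = i" | "h = j" | "i < h" "h < j" using ihj by linarith
  thus "seg v h Int {p..q} ~= {}"
  proof cases
   case 3
   have "off v h + 1 \<in> seg v h" using part_nonempty[OF assms(1) h] .
   moreover have "p < off v h + 1" "off v h + 1 < q"
    using part_less[of i h p v "off v h + 1"] part_less[of h j "off v h + 1" v q] i j 3 h calculation by auto
   ultimately show ?thesis by (auto simp: disjoint_iff)
  qed (use i j assms(3) in auto)
 qed
 hence "{h\<in>{1..k}. seg v h Int {p..q} ~= {}} = {h\<in>{1..k}. i <= h & h <= j}" by blast
 also have "... = {i..j}" using i(1) j(1) by auto
 finally have "{h\<in>{1..k}. seg v h Int {p..q} ~= {}} = {i..j}" .
 thus ?thesis using i j ij unfolding atLeastAtMost_iff by blast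
qed

text \<open>The letters of \<open>u\<close> whose segments meet \<open>B\<close> form a block of
  \<open>u\<close>, because \<open>B\<close> is a block, and an interval, because \<open>B\<close>
  spans one. Simplicity leaves a single letter or all of them.\<close>

lemma block_in_part:
 assumes comp: "composition k v m" and val: "valid_parts v b {1..k}"
  and u: "distinct u" "set u \<subseteq> {1..k}" "simple_word k u"
  and B: "sublist B (expand v b u)" "set B = {p..q}" "1 <= p" "p <= q" "q <= m"
 shows "(\<exists>i\<in>{1..k}. {p..q} \<subseteq> seg v i) |
  {1..k} \<subseteq> set u & (\<forall>i\<in>{1..k}. seg v i Int {p..q} ~= {})"
proof -
 have v1: "v i \<ge> 1" if "i \<in> {1..k}" for i using comp that by (auto simp: composition_def)
 have valu: "valid_parts v b (set u)" using val u by (auto simp: valid_parts_def)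
 obtain P Q where PQ: "expand v b u = P @ B @ Q" using B by (auto simp: sublist_def)
 have "EX bb. sublist bb u & set bb = {i\<in>set u. set (map ((+) (off v i)) (b i)) Int set B ~= {}}"
 proof (rule sublist_concat)
  show "concat (map (%i. map ((+) (off v i)) (b i)) u) = P @ B @ Q" using PQ by (simp add: expand_def)
  show "distinct (concat (map (%i. map ((+) (off v i)) (b i)) u))" using u distinct_expand valu by (force simp: expand_def)
  show "map ((+) (off v i)) (b i) ~= []" if "i \<in> set u" for i using valid_part(3)[OF valu] v1 that u by fastforce
 qed
 then obtain bb where bb: "sublist bb u" "set bb = {i\<in>set u. set (map ((+) (off v i)) (b i)) Int set B ~= {}}" by blast
 have "set bb = {i\<in>set u. seg v i Int {p..q} ~= {}}" unfolding bb B using valid_part(2)[OF valu] by auto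
 also have "... = {i\<in>{1..k}. seg v i Int {p..q} ~= {}}"
 proof -
  have "i \<in> set u" if i: "i \<in> {1..k}" "seg v i Int {p..q} ~= {}" for i
  proof -
   obtain x where x: "x \<in> seg v i" "x \<in> set B" using i unfolding B by blast
   have "x \<in> set (expand v b u)" using x B set_mono_sublist by blast
   then obtain j where "j \<in> set u" "x \<in> seg v j" using set_expand[OF valu] by auto
   moreover have "i = j" using part_unique[of j] x calculation i u by force
   ultimately show ?thesis by simp
  qed
  thus ?thesis using u by auto
 qed
 finally have bbset: "set bb = {i\<in>{1..k}. seg v i Int {p..q} ~= {}}" .
 obtain i j where ij: "1 <= i" "i <= j" "j <= k" "p \<in> seg v i" "q \<in> seg v j" "set bb = {i..j}"
  using interval_parts[OF comp B(3-)] bbset by auto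
 show ?thesis
 proof (cases "i = j")
  case True
  hence "{p..q} \<subseteq> seg v i" using ij by (auto simp: seg_def)
  thus ?thesis using ij by auto
 next
  case False
  have "distinct bb" using bb u by (auto simp: sublist_def)
  hence len: "length bb = Suc j - i" using distinct_card[of bb] ij by simp
  hence "length bb \<ge> 2" using False ij by simp
  moreover have "interval_of {1..k} (set bb)" unfolding ij by (rule interval_ofI[OF ij(1,3)])
  ultimately have "~ length bb < k" using u bb unfolding simple_word_def by blast
  hence "i = 1" "j = k" using len ij by auto
  hence "set bb = {1..k}" using ij by simp
  thus ?thesis using bb bbset by blast
 qed
qed

lemma contiguous_append:
 assumes "b @ q = p' @ b' @ q'" "set b Int set b' = {}" "b' ~= []"
 shows "EX p''. q = p'' @ b' @ q'"
proof -
 have "(EX us. b @ us = p' & q = us @ b' @ q') | (EX us. b = p' @ us & us @ q = b' @ q')"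
  using assms by (auto simp: append_eq_append_conv2)
 thus ?thesis
 proof (elim disjE exE conjE)
  fix us assume us: "b = p' @ us" "us @ q = b' @ q'"
  have "us = []" using us assms hd_append2 UnCI disjoint_iff hd_in_set set_append by metis
  thus ?thesis using us by  auto
 qed blast
qed

text \<open>The first letter lies in some segment, and as this segment is a block it must be an
  initial one; it is split off and the remainder treated recursively.\<close>

lemma contract_word:
 assumes comp: "composition k v m" and val: "valid_parts v b {1..k}" and u: "distinct u" "set u \<subseteq> {1..m}"
  and cont: "!!i. i \<in> {1..k} ==> seg v i Int set u ~= {} ==> EX p q. u = p @ map ((+) (off v i)) (b i) @ q"
 shows "EX u0. set u0 \<subseteq> {1..k} & u = expand v b u0"
 using u cont
proof (induction "length u" arbitrary: u rule: less_induct)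
 case less
 show ?case
 proof (cases u)
  case (Cons x u')
  let ?B = "%i. map ((+) (off v i)) (b i)"
  note B = valid_part(2)[OF val]
  obtain i where i: "i \<in> {1..k}" "x \<in> seg v i" using part_cover[OF comp] less.prems Cons by auto
  then obtain p q where pq: "u = p @ ?B i @ q" using less.prems(3)[of i] Cons by auto
  have p: "p = []" using less.prems i B by (cases p) (use Cons pq in auto)
  have "EX u0. set u0 \<subseteq> {1..k} & q = expand v b u0"
  proof (rule less.hyps)
   fix j assume j: "j \<in> {1..k}" "seg v j Int set q ~= {}"
   then obtain p' q' where e: "?B i @ q = p' @ ?B j @ q'" using less.prems(3)[of j] pq p by auto
   have "i ~= j" using j B less.prems unfolding pq by auto
   hence "seg v i Int seg v j = {}" using part_unique i j by auto
   thus "EX p q'. q = p @ ?B j @ q'" using contiguous_append[OF e] B[OF i(1)] B[OF j(1)] by force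
  qed (use less.prems i B[OF i(1)] in "auto simp: pq p")
  then obtain u0 where "set u0 \<subseteq> {1..k}" "q = expand v b u0" by blast
  thus ?thesis using i by (intro exI[of _ "i # u0"]) (simp add: pq p expand_Cons)
 qed (auto intro: exI[of _ "[]"])
qed

text \<open>The converse of expansion. The word to be inserted for letter \<open>i\<close> is found
  by filtering the letters of its segment out of the concatenation and shifting them back to
  1.\<close>

lemma contract_words:
 assumes comp: "composition k v m" and us: "concat us \<in> perms {1..m}" "[] \<notin> set us"
  and cont: "!!i. i \<in> {1..k} ==> \<exists>u\<in>set us. EX p b q. u = p @ b @ q & set b = seg v i"
 shows "EX us0 b. valid_parts v b {1..k} & us = map (expand v b) us0 & concat us0 \<in> perms {1..k} & [] \<notin> set us0"
proof -
 define b where "b i = map (%x. x - off v i) (filter (%x. x \<in> seg v i) (concat us))" for i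
 let ?B = "%i. map ((+) (off v i)) (b i)"
 have shift: "?B i = filter (%x. x \<in> seg v i) (concat us)" for i by (auto simp: b_def seg_def intro!: map_idI)
 have d: "distinct (concat us)" "set (concat us) = {1..m}" using us by (simp_all add: perms_iff)
 have val: "valid_parts v b {1..k}" unfolding valid_parts_def
 proof
  fix i assume i: "i \<in> {1..k}"
  have "distinct (?B i)" "set (?B i) = seg v i" unfolding shift using d part_subset[OF comp i] by auto
  moreover have "seg v i = (+) (off v i) ` {1..v i}" "inj ((+) (off v i))" by (auto simp: seg_def)
  ultimately show "b i \<in> perms {1..v i}" unfolding perms_iff by (metis distinct_map inj_image_eq_iff list.set_map)
 qed
 have block: "EX U1 p q U2. us = U1 @ (p @ ?B i @ q) # U2" if i: "i \<in> {1..k}" for i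
 proof -
  obtain U1 p c q U2 where U: "us = U1 @ (p @ c @ q) # U2" "set c = seg v i" using cont[OF i] by (metis split_list)
  have "set (concat U1 @ p) Int seg v i = {}" "set (q @ concat U2) Int seg v i = {}" using d(1) U(2) by (auto simp: U)
  hence "filter (%x. x \<in> seg v i) (concat U1 @ p) = []" "filter (%x. x \<in> seg v i) (q @ concat U2) = []"
   unfolding filter_empty_conv by blast+
  hence "?B i = c" by (simp add: shift U)
  thus ?thesis using U by blast
 qed
 have "EX u0. set u0 \<subseteq> {1..k} & u = expand v b u0" if u: "u \<in> set us" for u
 proof (rule contract_word[OF comp val])
  fix i assume i: "i \<in> {1..k}" "seg v i Int set u ~= {}"
  obtain U1 p q U2 where U: "us = U1 @ (p @ ?B i @ q) # U2" using block[OF i(1)] by blast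
  have "set (?B i) = seg v i" using valid_part(2)[OF val i(1)] .
  hence "u \<notin> set U1" "u \<notin> set U2" using i d(1) unfolding U by auto
  thus "EX p q. u = p @ ?B i @ q" using u U by auto
 qed (use d u in "auto simp: distinct_concat_iff")
 then obtain g where g: "\<forall>u\<in>set us. set (g u) \<subseteq> {1..k} & u = expand v b (g u)" by metis
 hence e: "us = map (expand v b) (map g us)" by (simp add: map_idI)
 let ?w = "concat (map g us)"
 have w: "expand v b ?w = concat us" "set ?w \<subseteq> {1..k}" using g arg_cong[OF e, of concat] by (auto simp only: concat_expand set_concat list.set_map)
 have "i \<in> set ?w" if i: "i \<in> {1..k}" for i
 proof -
  have "off v i + 1 \<in> set (expand v b ?w)" using part_nonempty[OF comp i] part_subset[OF comp i] unfolding w d by blast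
  then obtain j where "j \<in> set ?w" "off v i + 1 \<in> seg v j" using set_expand[of v b ?w] val w by (auto simp: valid_parts_def)
  thus ?thesis using part_unique part_nonempty[OF comp] i w by (metis atLeastAtMost_iff subsetD)
 qed
 moreover have "distinct xs" if "distinct (expand v b xs)" "set xs \<subseteq> {1..k}" for xs using that
 proof (induction xs)
  case (Cons x xs)
  have "off v x + 1 \<in> set (?B x)" using part_nonempty[OF comp] valid_part[OF val] Cons.prems by simp
  thus ?case using Cons unfolding expand_def by auto
 qed simp
 ultimately have "?w \<in> perms {1..k}" using w d(1) by (auto simp: perms_iff)
 moreover have "[] \<notin> set (map g us)" using us g by (metis (no_types, lifting) expand_Nil image_iff list.set_map)
 ultimately show ?thesis using val e by blast
qed

text \<open>The parts from \<open>i\<close> to \<open>j\<close> become one part and later parts move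
  down by \<open>j - i\<close>, which leaves all other segments as they were.\<close>

lemma merge_composition:
 assumes comp: "composition k v m" and ij: "1 <= i" "i < j" "j <= k"
 shows "EX v'. composition (k - (j - i)) v' m &
  (\<forall>h\<in>{1..k - (j - i)}. (\<exists>h'\<in>{1..k}. h' \<notin> {i..j} & seg v' h = seg v h') |
    seg v' h = {off v i + 1..off v j + v j})"
proof -
 let ?d = "j - i"
 define v' where "v' h = (if h < i then v h else if h = i then off v j + v j - off v i else v (h + ?d))" for h
 have 1: "off v' h = off v h" if "h <= i" for h unfolding off_def using that by (auto simp: v'_def)
 have ioj: "off v i <= off v j" using off_mono ij by simp
 have 2: "off v' h = off v (h + ?d)" if "i < h" for h using that
 proof (induction h)
  case (Suc h)
  show ?case
  proof (cases "h = i")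
   case True
   hence "off v' (Suc h) = off v' i + v' i" using ij by (simp add: off_Suc)
   also have "... = off v j + v j" using ioj by (simp add: 1 v'_def)
   also have "... = off v (Suc h + ?d)" using True ij off_Suc by simp
   finally show ?thesis .
  next
   case False
   hence "off v' (Suc h) = off v' h + v' h" using Suc by (simp add: off_Suc)
   also have "off v' h = off v (h + ?d)" using Suc False by simp
   also have "v' h = v (h + ?d)" using Suc False by (simp add: v'_def)
   finally show ?thesis using Suc False off_Suc by simp
  qed
 qed simp
 have vpos: "v h \<ge> 1" if "h \<in> {1..k}" for h using comp that by (auto simp: composition_def)
 have "composition (k - ?d) v' m" unfolding composition_def
 proof
  show "\<forall>h\<in>{1..k - ?d}. v' h \<ge> 1"
  proof
   fix h assume "h \<in> {1..k - ?d}"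
   hence "1 <= h" "h + ?d <= k" by auto
   thus "v' h \<ge> 1" using vpos[of h] vpos[of "h + ?d"] ij ioj unfolding v'_def by auto
  qed
  have "(\<Sum>h=1..k - ?d. v' h) = off v' (Suc (k - ?d))" by (simp add: off_def atLeastLessThanSuc_atLeastAtMost)
  also have "... = off v (Suc k)" using 2 ij by simp
  also have "... = m" by (rule composition_off[OF comp])
  finally show "(\<Sum>h=1..k - ?d. v' h) = m" .
 qed
 moreover have "(\<exists>h'\<in>{1..k}. h' \<notin> {i..j} & seg v' h = seg v h') | seg v' h = {off v i + 1..off v j + v j}"
  if h: "h \<in> {1..k - ?d}" for h
 proof (cases h i rule: linorder_cases)
  case less
  hence "seg v' h = seg v h" by (simp add: seg_def 1 v'_def)
  thus ?thesis using less h by (intro disjI1 bexI[of _ h]) auto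
 next
  case equal
  thus ?thesis using ioj by (simp add: seg_def 1 v'_def)
 next
  case greater
  hence "seg v' h = seg v (h + ?d)" by (simp add: seg_def 2 v'_def)
  thus ?thesis using greater h by (intro disjI1 bexI) auto
 qed
 ultimately show ?thesis by blast
qed

section \<open>Combinations with vanishing form and vanishing slices\<close>

text \<open>The cell-form of the combination vanishes identically. Positions are complex so that
  residues can be formed as limits.\<close>

definition null_on :: "nat set => (nat list => rat) => bool" where
 "null_on I g \<longleftrightarrow> (ALL x. inj_on x I --> (\<Sum>u\<in>perms I. of_rat (g u) * chain x u) = 0)"

lemma null_on_cong: "(!!u. u \<in> perms I ==> g u = h u) ==> null_on I g \<longleftrightarrow> null_on I h"
 by (simp add: null_on_def)

lemma null_on_0: "null_on I (%_. 0)"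
 by (simp add: null_on_def)

lemma null_on_add: "null_on I g ==> null_on I h ==> null_on I (%u. g u + h u)"
 by (simp add: null_on_def of_rat_add distrib_right sum.distrib)

lemma null_on_scale: "null_on I g ==> null_on I (%u. a * g u)"
 by (simp add: null_on_def of_rat_mult mult.assoc flip: sum_distrib_left)

lemma perms_shift: "perms {d + p..d + q} = map ((+) d) ` perms {p..q::nat}"
proof -
 have "(+) d ` {p..q} = {d + p..d + q}" by simp
 thus ?thesis using permutations_of_set_image_inj[of "(+) d" "{p..q}"] by (simp only:) simp
qed

lemma null_on_shift: "null_on {d + p..d + q} g \<longleftrightarrow> null_on {p..q} (%u. g (map ((+) d) u))"
proof -
 have inj: "inj_on (map ((+) d)) A" for A by rule auto
 have eq: "(\<Sum>u\<in>perms {d + p..d + q}. of_rat (g u) * chain x u) =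
   (\<Sum>u\<in>perms {p..q}. of_rat (g (map ((+) d) u)) * chain (%i. x (d + i)) u)" for x
  unfolding perms_shift by (simp add: sum.reindex[OF inj] chain_map)
 show ?thesis
 proof
  assume L: "null_on {d + p..d + q} g"
  show "null_on {p..q} (%u. g (map ((+) d) u))" unfolding null_on_def
  proof (intro allI impI)
   fix x :: "nat => complex" assume x: "inj_on x {p..q}"
   have "inj_on (%i. x (i - d)) {d + p..d + q}"
   proof (rule inj_onI)
    fix a b assume ab: "a \<in> {d + p..d + q}" "b \<in> {d + p..d + q}" and eq: "x (a - d) = x (b - d)"
    have "a - d \<in> {p..q}" "b - d \<in> {p..q}" using ab by auto
    hence "a - d = b - d" using inj_onD[OF x eq] by blast
    thus "a = b" using ab by auto
   qed
   hence "(\<Sum>u\<in>perms {d + p..d + q}. of_rat (g u) * chain (%i. x (i - d)) u) = 0" using L by (auto simp: null_on_def)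
   thus "(\<Sum>u\<in>perms {p..q}. of_rat (g (map ((+) d) u)) * chain x u) = 0" by (simp add: eq)
  qed
 next
  assume R: "null_on {p..q} (%u. g (map ((+) d) u))"
  show "null_on {d + p..d + q} g" unfolding null_on_def
  proof (intro allI impI)
   fix x :: "nat => complex" assume x: "inj_on x {d + p..d + q}"
   have "inj_on (%i. x (d + i)) {p..q}"
   proof (rule inj_onI)
    fix a b assume ab: "a \<in> {p..q}" "b \<in> {p..q}" and eq: "x (d + a) = x (d + b)"

    thus "a = b" using inj_onD[OF x eq] by simp
   qed
   thus "(\<Sum>u\<in>perms {d + p..d + q}. of_rat (g u) * chain x u) = 0" using R by (auto simp: eq null_on_def)
  qed
 qed
qed

text \<open>The case \<open>p = 1\<close>, \<open>q = j\<close> is included: it says that the form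
  of \<open>f\<close> itself vanishes, as it does for combinations of shuffles.\<close>

definition null_slices :: "nat => word_comb set" where
 "null_slices j = {f. supp f \<subseteq> perms {1..j} &
   (ALL p q w. 1 <= p & p < q & q <= j & w \<in> perms (insert p ({1..j} - {p..q})) -->
    null_on {p..q} (%u. coef f (subst1 p u w)))}"

text \<open>The full interval is left out. For Lyndon factors its condition is replaced by the
  presence of two factors, and for insertion words the full interval is not a boundary
  divisor.\<close>

definition array_null_slices :: "nat => (nat list list \<Rightarrow>\<^sub>0 rat) => bool" where
 "array_null_slices m c \<longleftrightarrow>
   (ALL p q us. 1 <= p & p < q & q <= m & ~ (p = 1 & q = m) &
     concat us \<in> perms (insert p ({1..m} - {p..q})) -->
    null_on {p..q} (%u. coef c (map (subst1 p u) us)))"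

lemma array_null_slices_add:
 "array_null_slices m c ==> array_null_slices m d ==> array_null_slices m (c + d)"
 by (simp add: array_null_slices_def lookup_add null_on_add)

lemma array_null_slices_scale: "array_null_slices m c ==> array_null_slices m (qscale a c)"
 by (simp add: array_null_slices_def null_on_scale)

lemma array_null_slices_0: "array_null_slices m 0"
 by (simp add: array_null_slices_def null_on_0)

lemma array_null_slices_span:
 assumes "c \<in> qvec.span S" "!!s. s \<in> S ==> array_null_slices m s"
 shows "array_null_slices m c"
 using assms by (induction rule: qvec.span_induct_alt)
  (auto intro: array_null_slices_0 array_null_slices_add array_null_slices_scale)

lemma subspace_null_slices: "qvec.subspace (null_slices j)"
proof -
 have "supp (x + y) \<subseteq> perms {1..j}" if "supp x \<subseteq> perms {1..j}" "supp y \<subseteq> perms {1..j}" for x y :: word_comb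
  using Poly_Mapping.keys_add[of x] that by blast
 moreover have "supp (qscale a x) \<subseteq> perms {1..j}" if "supp x \<subseteq> perms {1..j}" for x :: word_comb and a
  using supp_qscale[of a x] that by blast
 ultimately show ?thesis unfolding qvec.subspace_def null_slices_def by (auto simp: lookup_add null_on_0 null_on_add null_on_scale)
qed

text \<open>By \<open>map_expand_eqD\<close> a list arises from only one choice of inserted words,
  so no two terms of the tensor can meet.\<close>

lemma coef_tensor_array:
 assumes comp: "composition k v m" and us: "concat us \<in> perms {1..k}"
  and c: "!!i. i \<in> {1..k} ==> supp (c i) \<subseteq> perms {1..v i}"
 shows "valid_parts v b {1..k} ==>
   coef (tensor_array v c us) (map (expand v b) us) = (\<Prod>i\<in>{1..k}. coef (c i) (b i))" (is "_ ==> ?A")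
  and "us' \<in> supp (tensor_array v c us) ==> EX b. valid_parts v b {1..k} & us' = map (expand v b) us" (is "_ ==> ?B")
proof -
 let ?P = "PiE {1..k} (%i. supp (c i))"
 have setus: "set (concat us) = {1..k}" using us by (simp add: perms_iff)
 have ta: "tensor_array v c us = (\<Sum>b\<in>?P. qscale (\<Prod>i\<in>{1..k}. coef (c i) (b i)) (bvec (map (expand v b) us)))"
  unfolding tensor_array_def setus ..
 have valP: "valid_parts v b {1..k}" if "b \<in> ?P" for b using that c unfolding valid_parts_def by blast
 have finP: "finite ?P" by (intro finite_PiE) auto
 show ?A if val: "valid_parts v b {1..k}"
 proof -
  have un: "b' = restrict b {1..k}" if "b' \<in> ?P" "map (expand v b') us = map (expand v b) us" for b'
  proof -
   have "us = us & (\<forall>i\<in>set (concat us). b' i = b i)" by (rule map_expand_eqD[OF that(2)])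
     (use valP[OF that(1)] val setus comp in "auto simp: composition_def")
   thus ?thesis using that unfolding setus by (auto simp: PiE_def extensional_def)
  qed
  have same: "map (expand v (restrict b {1..k})) us = map (expand v b) us"
  proof (rule map_cong[OF refl])
   fix u assume "u \<in> set us"
   hence "set u \<subseteq> {1..k}" using setus by auto
   thus "expand v (restrict b {1..k}) u = expand v b u" by (intro expand_cong) auto
  qed
  have "coef (tensor_array v c us) (map (expand v b) us) =
    (\<Sum>b'\<in>?P. if b' = restrict b {1..k} then \<Prod>i\<in>{1..k}. coef (c i) (b' i) else 0)" unfolding ta coef_sum
  proof (intro sum.cong refl)
   fix b' assume "b' \<in> ?P"
   thus "coef (qscale (\<Prod>i\<in>{1..k}. coef (c i) (b' i)) (bvec (map (expand v b') us))) (map (expand v b) us) =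
    (if b' = restrict b {1..k} then \<Prod>i\<in>{1..k}. coef (c i) (b' i) else 0)"
    using un[of b'] same by (cases "b' = restrict b {1..k}") (simp_all add: lookup_single when_def, metis)
  qed
  also have "... = (if restrict b {1..k} \<in> ?P then \<Prod>i\<in>{1..k}. coef (c i) (b i) else 0)" using finP by simp
  also have "... = (\<Prod>i\<in>{1..k}. coef (c i) (b i))" by (simp add: PiE_iff in_keys_iff)
  finally show ?thesis .
 qed
 show ?B if "us' \<in> supp (tensor_array v c us)"
 proof -
  have "us' \<in> (\<Union>b\<in>?P. supp (qscale (\<Prod>i\<in>{1..k}. coef (c i) (b i)) (bvec (map (expand v b) us))))"
   using that unfolding ta by (rule subsetD[OF supp_sum])
  then obtain b where "b \<in> ?P" "us' \<in> supp (qscale (\<Prod>i\<in>{1..k}. coef (c i) (b i)) (bvec (map (expand v b) us)))" by auto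
  hence "us' = map (expand v b) us" by (fastforce simp: in_keys_iff lookup_single)
  thus ?thesis using valP[OF \<open>b \<in> ?P\<close>] by blast
 qed
qed

section \<open>Skeletons and insertions for a general pattern\<close>

text \<open>\<open>X m us\<close> prescribes the shape of a list of words, and \<open>M m us\<close>
  holds the marked letters, which must not be replaced: the heads of the factors for Lyndon
  shuffles, 1 and m for insertion words. \<open>X_whole\<close> covers a factor that uses every
  letter: if the end letters are marked, a block meeting all segments has to be the whole
  alphabet.\<close>

locale pattern_family =
 fixes X :: "nat => nat list list => bool" and M :: "nat => nat list list => nat set"
 assumes X_perms: "X m us ==> concat us \<in> perms {1..m}"
  and X_nonempty: "X m us ==> [] \<notin> set us"
  and X_ge2: "X m us ==> 2 <= m"
  and X_whole: "X m us ==> u \<in> set us ==> {1..m} \<subseteq> set u ==> 1 \<in> M m us & m \<in> M m us"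
  and X_contract: "composition k v m ==> valid_parts v b {1..k} ==> concat us \<in> perms {1..k} ==>
   [] \<notin> set us ==> X m (map (expand v b) us) ==>
   (!!i. i \<in> {1..k} ==> v i > 1 ==> seg v i Int M m (map (expand v b) us) = {}) ==>
   X k us & (\<forall>i\<in>M k us. v i = 1)"
  and X_expand: "composition k v m ==> valid_parts v b {1..k} ==> X k us ==> (\<forall>i\<in>M k us. v i = 1) ==>
   X m (map (expand v b) us)"
begin

text \<open>The outer word of an insertion with the sizes of the inserted parts, but without the
  parts themselves.\<close>

definition skeleton :: "nat => nat => (nat => nat) => nat list list => bool" where
 "skeleton m k v us \<longleftrightarrow> composition k v m & X k us & (\<forall>i\<in>M k us. v i = 1) & (\<forall>u\<in>set us. simple_word k u)"

definition filling :: "(nat => word_comb set) => nat => (nat => nat) => (nat => word_comb) => bool" where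
 "filling L k v c \<longleftrightarrow> (\<forall>i\<in>{1..k}. (v i = 1 --> c i = bvec [1]) & (v i > 1 --> c i \<in> L (v i)))"

definition insertions :: "(nat => word_comb set) => nat => (nat list list \<Rightarrow>\<^sub>0 rat) set" where
 "insertions L m = {tensor_array v c us | k v c us. skeleton m k v us & filling L k v c}"

lemma X_word:
 assumes "X k us" "u \<in> set us"
 shows "distinct u" "set u \<subseteq> {1..k}" "u ~= []"
 using X_perms[OF assms(1)] X_nonempty[OF assms(1)] assms(2) by (auto simp: perms_iff distinct_concat_iff)

text \<open>Otherwise, by \<open>block_in_part\<close>, the interval meets every segment. Then the
  first and the last letter are marked, their segments are single letters, and the interval contains
  both 1 and \<open>m\<close>, which was excluded.\<close>

lemma skeleton_block:
 assumes sk: "skeleton m k v us" and val: "valid_parts v b {1..k}" and u: "u \<in> set us"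
  and B: "sublist B (expand v b u)" "set B = {p..q}" "1 <= p" "p <= q" "q <= m" "~ (p = 1 & q = m)"
 shows "\<exists>i\<in>{1..k}. {p..q} \<subseteq> seg v i"
proof (rule ccontr)
 assume no: "~ ?thesis"
 have comp: "composition k v m" and X: "X k us" and simple: "simple_word k u" using sk u by (auto simp: skeleton_def)
 have *: "{1..k} \<subseteq> set u" "\<forall>i\<in>{1..k}. seg v i Int {p..q} ~= {}"
  using block_in_part[OF comp val X_word(1,2)[OF X u] simple B(1-5)] no by auto
 have M: "1 \<in> M k us" "k \<in> M k us" using X_whole[OF X u *(1)] by auto
 hence v1: "v 1 = 1" "v k = 1" using sk by (auto simp: skeleton_def)
 have k: "1 <= k" using X_ge2[OF X] by simp
 have "seg v 1 = {1}" using v1 by (simp add: seg_def)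
 moreover have "seg v k = {m}" using composition_off[OF comp] off_Suc[OF k] v1 by (auto simp: seg_def)
 moreover have "seg v 1 Int {p..q} ~= {}" "seg v k Int {p..q} ~= {}" using * k by simp_all
 ultimately have "1 \<in> {p..q}" "m \<in> {p..q}" by auto
 thus False using B by auto
qed

lemma skeleton_parts_proper:
 assumes "skeleton m k v us" "i \<in> {1..k}"
 shows "~ (off v i + 1 = 1 & off v i + v i = m)"
proof
 assume h: "off v i + 1 = 1 & off v i + v i = m"
 have comp: "composition k v m" and k: "2 <= k" using assms X_ge2 by (auto simp: skeleton_def)
 define j where "j = (if i = 1 then 2 else 1 :: nat)"
 have j: "j \<in> {1..k}" "j ~= i" using k by (auto simp: j_def)
 have "off v j + 1 \<in> seg v j" by (rule part_nonempty[OF comp j(1)])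
 moreover have "seg v j \<subseteq> seg v i" using part_subset[OF comp j(1)] h by (auto simp: seg_def)
 ultimately show False using part_unique assms j by auto
qed

text \<open>A segment of the first decomposition is an interval occurring as a block of the same
  list, so \<open>skeleton_block\<close> for the second decomposition places it inside one of its
  segments.\<close>

lemma skeleton_refines:
 assumes "skeleton m k v us" "valid_parts v b {1..k}" "skeleton m k' v' us'" "valid_parts v' b' {1..k'}"
  and eq: "map (expand v b) us = map (expand v' b') us'" and i: "i \<in> {1..k}"
 shows "\<exists>j\<in>{1..k'}. seg v i \<subseteq> seg v' j"
proof -
 have comp: "composition k v m" and X: "X k us" using assms by (auto simp: skeleton_def)
 have "set (concat us) = {1..k}" using X_perms[OF X] unfolding perms_iff by simp
 hence "i \<in> set (concat us)" using i by simp
 then obtain u where u: "u \<in> set us" "i \<in> set u" by auto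
 hence "expand v b u \<in> set (map (expand v' b') us')" unfolding eq[symmetric] by simp
 then obtain u' where u': "u' \<in> set us'" "expand v b u = expand v' b' u'" by auto
 obtain p q where pq: "u = p @ i # q" using split_list[OF u(2)] by blast
 have "sublist (map ((+) (off v i)) (b i)) (expand v' b' u')" unfolding u'(2)[symmetric] pq by (simp add: expand_append expand_Cons)
 moreover have "set (map ((+) (off v i)) (b i)) = {off v i + 1..off v i + v i}" using valid_part[OF assms(2) i] by (simp add: seg_def)
 moreover have "v i \<ge> 1" "off v i + v i <= m" using comp i part_subset[OF comp] by (auto simp: composition_def seg_def)
 ultimately show ?thesis using skeleton_block[OF assms(3,4) u'(1), of "map ((+) (off v i)) (b i)" "off v i + 1"]
   skeleton_parts_proper[OF assms(1) i] by (simp add: seg_def)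
qed

text \<open>Going from left to right, the next segments of both decompositions start at the same
  letter, and each contains the other by mutual refinement.\<close>

lemma skeleton_same_parts:
 assumes sk: "skeleton m k v us" "valid_parts v b {1..k}" "skeleton m k' v' us'" "valid_parts v' b' {1..k'}"
  and eq: "map (expand v b) us = map (expand v' b') us'" and i: "i \<in> {1..k}"
 shows "i <= k' & off v i = off v' i & v i = v' i"
 using i
proof (induction i)
 case (Suc i)
 have comp: "composition k v m" "composition k' v' m" using sk by (auto simp: skeleton_def)

 have off: "off v (Suc i) = off v' (Suc i)" using Suc by (cases "i = 0") (auto simp: off_Suc)
 have lt: "off v (Suc i) + 1 \<in> seg v (Suc i)" by (rule part_nonempty[OF comp(1) Suc.prems])
 have "Suc i <= k'"
 proof (rule ccontr)
  assume "~ Suc i <= k'"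
  hence "i = k'" using Suc by cases auto
  hence "off v (Suc i) = m" using off composition_off[OF comp(2)] by simp
  thus False using lt part_subset[OF comp(1) Suc.prems] by auto
 qed
 hence iS: "Suc i \<in> {1..k'}" by simp
 have lt': "off v' (Suc i) + 1 \<in> seg v' (Suc i)" by (rule part_nonempty[OF comp(2) iS])
 obtain j where j: "j \<in> {1..k'}" "seg v (Suc i) \<subseteq> seg v' j" using skeleton_refines[OF sk eq Suc.prems] by blast
 have "j = Suc i" using part_unique j lt lt' off by auto
 hence "off v (Suc i) + v (Suc i) \<in> seg v' (Suc i)" using j lt by (auto simp: seg_def)
 hence 1: "v (Suc i) <= v' (Suc i)" using off by (simp add: seg_def)
 obtain j where j: "j \<in> {1..k}" "seg v' (Suc i) \<subseteq> seg v j" using skeleton_refines[OF sk(3,4,1,2) eq[symmetric] iS] by blast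
 have "j = Suc i" using part_unique j lt lt' off by auto
 hence "off v' (Suc i) + v' (Suc i) \<in> seg v (Suc i)" using j lt' by (auto simp: seg_def)
 hence 2: "v' (Suc i) <= v (Suc i)" using off by (simp add: seg_def)
 show ?case using 1 2 off \<open>Suc i <= k'\<close> by simp
qed simp

lemma expand_cong_v:
 assumes "!!i. i \<in> {1..k} ==> off v i = off v' i" "set u \<subseteq> {1..k}"
 shows "expand v b u = expand v' b u"
 using assms unfolding expand_def by (intro arg_cong[of _ _ concat] map_cong) auto

text \<open>Once the segments agree, words and insertions are recovered by
  \<open>map_expand_eqD\<close>. Consequently insertions with different skeletons have disjoint
  supports.\<close>

lemma skeleton_unique:
 assumes sk: "skeleton m k v us" "valid_parts v b {1..k}" "skeleton m k' v' us'" "valid_parts v' b' {1..k'}"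
  and eq: "map (expand v b) us = map (expand v' b') us'"
 shows "k = k' & us = us' & (\<forall>i\<in>{1..k}. v i = v' i & off v i = off v' i & b i = b' i)"
proof -
 have k2: "k \<ge> 2" "k' \<ge> 2" using sk X_ge2 by (auto simp: skeleton_def)
 have s1: "!!i. i \<in> {1..k} ==> i <= k' & off v i = off v' i & v i = v' i"
  by (rule skeleton_same_parts[OF sk eq])
 have s2: "!!i. i \<in> {1..k'} ==> i <= k & off v' i = off v i & v' i = v i"
  by (rule skeleton_same_parts[OF sk(3,4,1,2) eq[symmetric]])
 have kk: "k = k'" using s1[of k] s2[of k'] k2 by simp
 have X: "X k us" "X k us'" "composition k v m" using sk kk by (auto simp: skeleton_def)
 have "map (expand v' b') us' = map (expand v b') us'" using s1 X_word[OF X(2)] by (intro map_cong expand_cong_v[of k]) auto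
 hence eq': "map (expand v b) us = map (expand v b') us'" using eq by simp
 have val': "valid_parts v b' {1..k}" using s1 sk by (simp add: valid_parts_def)
 have sets: "set (concat us) = {1..k}" "set (concat us') = {1..k}" using X_perms[OF X(1)] X_perms[OF X(2)] by (simp_all add: perms_iff)
 have "us = us' & (\<forall>i\<in>set (concat us). b i = b' i)"
 proof (rule map_expand_eqD[OF eq'])
  show "v i \<ge> 1" if "i \<in> set (concat us) Un set (concat us')" for i
   using that X unfolding sets by (auto simp: composition_def)
 qed (use sets sk(2) val' in auto)
 thus ?thesis using kk s1 unfolding sets by blast
qed

text \<open>Take the least number of parts for which the list is an expansion whose nontrivial parts
  avoid the marks. A forbidden interval block in the contracted list could be merged into one part,
  contradicting minimality.\<close>

lemma skeleton_exists:
 assumes X: "X m us"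
  and unmarked: "!!u B. u \<in> set us ==> sublist B u ==> 2 <= length B ==> length B < m ==>
   interval_of {1..m} (set B) ==> set B Int M m us = {}"
 shows "EX k v us0 b. skeleton m k v us0 & valid_parts v b {1..k} & us = map (expand v b) us0"
proof -
 define P where "P k \<longleftrightarrow> (EX v us0 b. composition k v m & concat us0 \<in> perms {1..k} & [] \<notin> set us0 &
  valid_parts v b {1..k} & us = map (expand v b) us0 &
  (\<forall>i\<in>{1..k}. v i > 1 --> seg v i Int M m us = {}))" for k
 \<comment> \<open>The trivial composition into single letters starts the search for the
   minimum.\<close>
 have "P m"
 proof -
  have e: "expand (%_. 1) (%_. [1]) u = u" if "u \<in> set us" for u
  proof -
   have "0 \<notin> set u" using X_word[OF X that] by auto
   thus ?thesis by (induction u) (auto simp: expand_Cons off_def)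
  qed
  show ?thesis unfolding P_def by (rule , rule , rule exI[of _ "%_. [1]"])
    (use X_perms[OF X] X_nonempty[OF X] e in "auto simp: composition_def valid_parts_def perms_iff map_idI")
 qed
 define k where "k = (LEAST k. P k)"
 have Pk: "P k" unfolding k_def by (rule LeastI[of P, OF \<open>P m\<close>])
 have least: "k <= k'" if "P k'" for k' unfolding k_def by (rule Least_le[of P, OF that])
 obtain v us0 b where comp: "composition k v m" and us0: "concat us0 \<in> perms {1..k}" "[] \<notin> set us0"
  and val: "valid_parts v b {1..k}" and us: "us = map (expand v b) us0"
  and seg: "!!i. i \<in> {1..k} ==> v i > 1 ==> seg v i Int M m us = {}"
  using Pk unfolding P_def by auto
 have Xk: "X k us0 & (\<forall>i\<in>M k us0. v i = 1)" by (rule X_contract[OF comp val us0]) (use X us seg in auto)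
 have "simple_word k u0" if u0: "u0 \<in> set us0" for u0 unfolding simple_word_def
 proof (rule notI, elim exE conjE)
  fix bb assume bb: "sublist bb u0" "2 <= length bb" "length bb < k" "interval_of {1..k} (set bb)"
  have Xk1: "X k us0" using Xk by simp
  note w0 = X_word[OF Xk1 u0]
  have dbb: "distinct bb" "set bb \<subseteq> {1..k}" using bb w0(1,2) by (auto simp: sublist_def)
  obtain i j where ij: "1 <= i" "i <= j" "j <= k" "set bb = {i..j}"
   using interval_cases bb by (metis list.size not_numeral_le_zero set_empty2)
  have len: "length bb = Suc j - i" using distinct_card[OF dbb(1)] ij by simp
  hence ij': "i < j" using bb by simp
  have valbb: "valid_parts v b (set bb)" using val dbb by (auto simp: valid_parts_def)
  let ?B = "expand v b bb"
  have segij: "(\<Union>h\<in>{i..j}. seg v h) = {off v i + 1..off v j + v j}"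
  proof
   show "(\<Union>h\<in>{i..j}. seg v h) \<subseteq> {off v i + 1..off v j + v j}"
   proof (rule UN_least)
    fix h assume h: "h \<in> {i..j}"
    have "off v i <= off v h" using h by (intro off_mono) auto
    moreover have "off v h + v h <= off v j + v j" using off_less[of h j v] h ij by (cases "h = j") auto
    ultimately show "seg v h \<subseteq> {off v i + 1..off v j + v j}" by (auto simp: seg_def)
   qed
   show "{off v i + 1..off v j + v j} \<subseteq> (\<Union>h\<in>{i..j}. seg v h)"
   proof
    fix x assume x: "x \<in> {off v i + 1..off v j + v j}"
    moreover have "off v j + v j <= m" using off_less[of j "Suc k" v] composition_off[OF comp] ij by simp
    ultimately obtain h where h: "h \<in> {1..k}" "x \<in> seg v h" using part_cover[OF comp, of x] by auto
    have pi: "off v i + 1 \<in> seg v i" "off v j + v j \<in> seg v j" using part_nonempty[OF comp] ij by (auto simp: seg_def)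
    have "~ h < i" using part_less[of h i x v "off v i + 1"] h pi x by auto
    moreover have "~ j < h" using part_less[of j h "off v j + v j" v x] h pi x ij by auto
    ultimately show "x \<in> (\<Union>h\<in>{i..j}. seg v h)" using h by auto
   qed
  qed
  have setB: "set ?B = {off v i + 1..off v j + v j}" using set_expand[OF valbb] segij ij by simp
  have dB: "distinct ?B" using distinct_expand valbb dbb by force
  have vpos: "v h \<ge> 1" if "h \<in> {1..k}" for h using comp that by (auto simp: composition_def)
  have oj: "off v i + v i <= off v j" using off_less ij ij' by simp
  have Bm: "off v j + v j <= m" using off_less[of j "Suc k" v] composition_off[OF comp] ij by simp
  have "length ?B = off v j + v j - off v i" using distinct_card[OF dB] setB by simp
  hence lB: "2 <= length ?B" using oj vpos[of i] vpos[of j] ij by simp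
  have "set ?B ~= {1..m}"
  proof
   assume full: "set ?B = {1..m}"
   have "{1..k} - {i..j} ~= {}"
   proof
    assume "{1..k} - {i..j} = {}"
    hence "i = 1" "j = k" using ij by auto
    thus False using len bb by simp
   qed
   then obtain h where h: "h \<in> {1..k}" "h \<notin> {i..j}" by auto
   have "off v h + 1 \<in> {1..m}" using part_nonempty[OF comp h(1)] part_subset[OF comp h(1)] by blast
   hence "off v h + 1 \<in> (\<Union>h\<in>{i..j}. seg v h)" unfolding segij setB[symmetric] full .
   then obtain h' where "h' \<in> {i..j}" "off v h + 1 \<in> seg v h'" by blast
   thus False using part_unique[of h'] part_nonempty[OF comp] h ij by auto
  qed
  moreover have "set ?B \<subseteq> {1..m}" using setB Bm by auto
  ultimately have "card (set ?B) < card {1..m}" by (intro psubset_card_mono) auto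
  hence lB': "length ?B < m" using distinct_card[OF dB] by simp
  have subB: "sublist ?B (expand v b u0)" using bb by (auto simp: sublist_def expand_append) blast
  have intB: "interval_of {1..m} (set ?B)" unfolding setB using Bm by (intro interval_ofI) auto
  \<comment> \<open>The block of the expanded word is itself an interval of the original alphabet,
    so the hypothesis on marks allows it to become one part.\<close>
  have noM: "set ?B Int M m us = {}" using unmarked[OF _ subB lB lB' intB] u0 us by auto
  obtain v' where v': "composition (k - (j - i)) v' m"
   "!!h. h \<in> {1..k - (j - i)} ==> (\<exists>h'\<in>{1..k}. h' \<notin> {i..j} & seg v' h = seg v h') |
     seg v' h = {off v i + 1..off v j + v j}" using merge_composition[OF comp ij(1) ij' ij(3)] by blast
  have cont: "\<exists>u\<in>set us. EX p b q. u = p @ b @ q & set b = seg v' h" if h: "h \<in> {1..k - (j - i)}" for h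
   using v'(2)[OF h]
  proof (elim disjE bexE conjE)
   fix h' assume h': "h' \<in> {1..k}" "seg v' h = seg v h'"
   have "set (concat us0) = {1..k}" using us0 by (simp add: perms_iff)
   hence "h' \<in> set (concat us0)" using h' by simp
   then obtain u where u: "u \<in> set us0" "h' \<in> set u" by auto
   obtain p q where pq: "u = p @ h' # q" using split_list[OF u(2)] by blast
   have "expand v b u = expand v b p @ map ((+) (off v h')) (b h') @ expand v b q" by (simp add: pq expand_append expand_Cons)
   moreover have "expand v b u \<in> set us" using u us by auto
   moreover have "set (map ((+) (off v h')) (b h')) = seg v h'" by (rule valid_part[OF val h'(1)])
   ultimately show ?thesis using h' by blast
  next
   assume s: "seg v' h = {off v i + 1..off v j + v j}"
   obtain p q where "expand v b u0 = p @ ?B @ q" using subB by (auto simp: sublist_def)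
   moreover have "expand v b u0 \<in> set us" using u0 us by auto
   ultimately show ?thesis using setB s by metis
  qed
  obtain us1 b1 where us1: "valid_parts v' b1 {1..k - (j - i)}" "us = map (expand v' b1) us1"
   "concat us1 \<in> perms {1..k - (j - i)}" "[] \<notin> set us1"
   using contract_words[OF v'(1) X_perms[OF X] X_nonempty[OF X] cont] by blast
  have "seg v' h Int M m us = {}" if h: "h \<in> {1..k - (j - i)}" "v' h > 1" for h using v'(2)[OF h(1)]
  proof (elim disjE bexE conjE)
   fix h' assume h': "h' \<in> {1..k}" "seg v' h = seg v h'"
   have "v' h = v h'" using arg_cong[OF h'(2), of card] by (simp add: seg_def)
   thus ?thesis using seg h h' by simp
  next
   assume "seg v' h = {off v i + 1..off v j + v j}"
   thus ?thesis using noM setB by simp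
  qed
  hence "P (k - (j - i))" unfolding P_def using v' us1 by blast
  thus False using least[of "k - (j - i)"] ij ij' by simp
 qed
 hence "skeleton m k v us0" using comp Xk by (simp add: skeleton_def)
 thus ?thesis using val us by blast
qed

lemma skeleton_supp:
 assumes sk: "skeleton m k v us" and fill: "filling L k v c"
  and L: "!!j f. 2 <= j ==> j < m ==> f \<in> L j ==> f \<in> null_slices j"
  and i: "i \<in> {1..k}"
 shows "c i \<in> null_slices (v i)" "v i < m"
proof -
 have comp: "composition k v m" and X: "X k us" using sk by (auto simp: skeleton_def)
 have "off v i + v i <= m" using part_subset comp i by (auto simp: seg_def composition_def)
 thus vm: "v i < m" using skeleton_parts_proper[OF sk i] by linarith
 show "c i \<in> null_slices (v i)"
 proof (cases "v i = 1")
  case True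
  hence "c i = bvec [1]" using fill i by (auto simp: filling_def)
  thus ?thesis using True by (auto simp: null_slices_def)
 next
  case False
  moreover have "v i \<ge> 1" using comp i by (auto simp: composition_def)
  ultimately have "v i > 1" by simp
  thus ?thesis using fill i vm L by (auto simp: filling_def)
 qed
qed

lemma insertions_X:
 assumes L: "!!j f. 2 <= j ==> j < m ==> f \<in> L j ==> f \<in> null_slices j"
  and g: "g \<in> insertions L m" "us \<in> supp g"
 shows "X m us"
proof -
 obtain k v c us0 where *: "g = tensor_array v c us0" "skeleton m k v us0" "filling L k v c" using g by (auto simp: insertions_def)
 have comp: "composition k v m" and X: "X k us0" "\<forall>i\<in>M k us0. v i = 1" using * by (auto simp: skeleton_def)
 have "EX b. valid_parts v b {1..k} & us = map (expand v b) us0" by (rule coef_tensor_array[OF comp X_perms[OF X(1)]])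
   (use skeleton_supp[OF *(2,3) L] g * in "auto simp: null_slices_def")
 thus ?thesis using X_expand[OF comp _ X] by blast
qed

lemma remdups_disjoint_append: "set xs Int set ys = {} ==> remdups (xs @ ys) = remdups xs @ remdups ys"
 by (induction xs) auto

lemma remdups_map_shift: "remdups (map ((+) (d::nat)) u) = map ((+) d) (remdups u)"
 by (induction u) auto

text \<open>Followed by \<open>remdups\<close>, this undoes the substitution of a word on {p..q} for
  the letter \<open>p\<close>.\<close>

definition merge_to :: "nat => nat => nat => nat" where
 "merge_to p q j = (if j \<in> {p..q} then p else j)"

lemma collapse_subst1:
 assumes "p <= q" "u \<in> perms {p..q}" "w \<in> perms (insert p (S - {p..q}))"
 shows "remdups (map (merge_to p q) (subst1 p u w)) = w"
proof -
 obtain x y where w: "w = x @ p # y" "p \<notin> set x" "p \<notin> set y" "x @ y \<in> perms (S - {p..q})"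
  using perms_split[OF assms(3)] assms by auto
 have xy: "set x Int {p..q} = {}" "set y Int {p..q} = {}" "distinct x" "distinct y" "set x Int set y = {}"
  using w unfolding perms_iff by auto
 have mx: "map (merge_to p q) x = x" "map (merge_to p q) y = y" using xy unfolding disjoint_iff by (auto intro!: map_idI simp: merge_to_def)
 have "map (merge_to p q) u = replicate (length u) p" using assms by (intro replicate_eqI) (auto simp: perms_iff merge_to_def)
 moreover have "u ~= []" using assms by (auto simp: perms_iff)
 moreover have "remdups (replicate n p) = [p]" if "n ~= 0" for n using that by (induction n) auto
 ultimately have mu: "remdups (map (merge_to p q) u) = [p]" "set (map (merge_to p q) u) = {p}" by auto
 have "remdups (map (merge_to p q) (subst1 p u w)) = remdups (x @ map (merge_to p q) u @ y)" using w by (simp add: mx)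
 also have "... = remdups x @ remdups (map (merge_to p q) u) @ remdups y"
 proof -
  have d: "set (map (merge_to p q) u) Int set y = {}" using w mu by simp
  have "set x Int set (map (merge_to p q) u @ y) = {}" unfolding set_append mu using w xy by auto
  thus ?thesis by (simp only: remdups_disjoint_append[OF d] remdups_disjoint_append)
 qed
 finally show ?thesis using xy w mu by simp
qed

text \<open>An interval inside segment \<open>i\<close> does not touch the other segments, so
  collapsing it commutes with expansion and only changes the inserted word
  \<open>b i\<close>.\<close>

lemma collapse_expand:
 assumes comp: "composition k v m" and val: "valid_parts v b {1..k}" and i: "i \<in> {1..k}"
  and pq: "1 <= p" "p < q" "q <= v i"
  and u: "distinct u" "set u \<subseteq> {1..k}"
 shows "remdups (map (merge_to (off v i + p) (off v i + q)) (expand v b u)) =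
  expand v (b(i := remdups (map (merge_to p q) (b i)))) u" using u
proof (induction u)
 case (Cons h u)
 let ?f = "merge_to (off v i + p) (off v i + q)"
 let ?g = "merge_to p q"
 let ?b = "b(i := remdups (map ?g (b i)))"
 have fseg: "?f j \<in> seg v l" if "j \<in> seg v l" "l \<in> {1..k}" for j l
 proof (cases "j \<in> {off v i + p..off v i + q}")
  case True
  hence "j \<in> seg v i" using pq by (auto simp: seg_def)
  hence "l = i" using part_unique that i by auto
  thus ?thesis using True pq by (auto simp: seg_def merge_to_def)
 qed (use that in "auto simp: merge_to_def")
 have sh: "set (map ((+) (off v h)) (b h)) = seg v h" by (rule valid_part[OF val]) (use Cons.prems in auto)
 have valu: "valid_parts v b (set u)" using val Cons.prems by (auto simp: valid_parts_def)
 have disj: "set (map ?f (map ((+) (off v h)) (b h))) Int set (map ?f (expand v b u)) = {}"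
 proof (rule ccontr)
  assume "~ ?thesis"
  then obtain x y where xy: "x \<in> seg v h" "y \<in> set (expand v b u)" "?f x = ?f y" unfolding set_map[of ?f] sh by blast
  obtain l where l: "l \<in> set u" "y \<in> seg v l" using xy set_expand[OF valu] by auto
  have "?f x \<in> seg v h" "?f x \<in> seg v l" using fseg[OF xy(1)] fseg Cons.prems l unfolding xy by auto
  hence "h = l" using part_unique Cons.prems l by auto
  thus False using l Cons.prems by simp
 qed
 have "remdups (map ?f (map ((+) (off v h)) (b h))) = map ((+) (off v h)) (?b h)"
 proof (cases "h = i")
  case True
  have "map ?f (map ((+) (off v h)) (b h)) = map ((+) (off v h)) (map ?g (b h))" using True by (auto simp: merge_to_def)
  thus ?thesis using True by (simp add: remdups_map_shift del: map_map)
 next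
  case False
  have "?f j = j" if "j \<in> seg v h" for j
  proof -
   have "j \<notin> seg v i" using part_unique that False Cons.prems i by auto
   hence "j \<notin> {off v i + p..off v i + q}" using pq by (auto simp: seg_def)
   thus ?thesis by (auto simp: merge_to_def)
  qed
  hence "map ?f (map ((+) (off v h)) (b h)) = map ((+) (off v h)) (b h)" using sh by  auto
  moreover have "distinct (map ((+) (off v h)) (b h))" by (rule valid_part[OF val]) (use Cons.prems in auto)
  ultimately show ?thesis using False by (simp del: map_map)
 qed
 moreover have "remdups (map ?f (expand v b u)) = expand v ?b u" by (rule Cons.IH) (use Cons.prems in auto)
 ultimately show ?case unfolding expand_Cons map_append remdups_disjoint_append[OF disj] by simp
qed simp

lemma expand_subst1:
 assumes val: "valid_parts v b {1..k}" and i: "i \<in> {1..k}" and p: "1 <= p" "p <= v i"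
  and w: "set w \<subseteq> {1..v i}" and u: "set u \<subseteq> {1..k}"
 shows "subst1 (off v i + p) (map ((+) (off v i)) z) (expand v (b(i := w)) u) = expand v (b(i := subst1 p z w)) u"
 using u
proof (induction u)
 case (Cons h u)
 have "subst1 (off v i + p) (map ((+) (off v i)) z) (map ((+) (off v h)) ((b(i := w)) h)) =
   map ((+) (off v h)) ((b(i := subst1 p z w)) h)"
 proof (cases "h = i")
  case True
  have "subst1 (d + p) (map ((+) d) z) (map ((+) d) w) = map ((+) d) (subst1 p z w)" for d by (induction w) (auto simp: subst1_def)
  thus ?thesis using True by simp
 next
  case False
  have "off v i + p \<in> seg v i" using p by (simp add: seg_def)
  hence "off v i + p \<notin> seg v h" using part_unique False Cons.prems i by auto
  hence "off v i + p \<notin> set (map ((+) (off v h)) (b h))" using valid_part[OF val] Cons.prems by simp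
  thus ?thesis using False by simp
 qed
 thus ?case using Cons by (simp add: expand_Cons)
qed simp

lemma valid_parts_upd: "valid_parts v b I ==> w \<in> perms {1..v i} ==> valid_parts v (b(i := w)) I"
 by (simp add: valid_parts_def)

lemma collapse_perms:
 assumes "w \<in> perms {1..n::nat}" "1 <= p" "p < q" "q <= n"
 shows "remdups (map (merge_to p q) w) \<in> perms (insert p ({1..n} - {p..q}))" using assms by (auto simp: merge_to_def image_iff perms_iff)

text \<open>If the slice is not identically zero, the interval occurs as a block and lies in one
  segment by \<open>skeleton_block\<close>. The slice of the tensor is then a scalar multiple of a
  slice of the part \<open>c i\<close>, which vanishes by assumption.\<close>

lemma insertions_null_slices:
 assumes L: "!!j f. 2 <= j ==> j < m ==> f \<in> L j ==> f \<in> null_slices j"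
  and g: "g \<in> insertions L m"
 shows "array_null_slices m g"
 unfolding array_null_slices_def
proof (intro allI impI, elim conjE)
 fix p q us assume pq: "1 <= p" "p < q" "q <= m" "~ (p = 1 & q = m)"
  and us: "concat us \<in> perms (insert p ({1..m} - {p..q}))"
 obtain k v c us0 where *: "g = tensor_array v c us0" "skeleton m k v us0" "filling L k v c" using g by (auto simp: insertions_def)
 have comp: "composition k v m" and X: "X k us0" using * by (auto simp: skeleton_def)
 have cs: "supp (c i) \<subseteq> perms {1..v i}" if "i \<in> {1..k}" for i
  using skeleton_supp[OF *(2,3) L that] by (auto simp: null_slices_def)
 note coefg = coef_tensor_array[OF comp X_perms[OF X] cs, folded *(1)]
 show "null_on {p..q} (%u. coef g (map (subst1 p u) us))"
 proof (cases "\<exists>u\<in>perms {p..q}. coef g (map (subst1 p u) us) ~= 0")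
  case False
  hence "null_on {p..q} (%u. coef g (map (subst1 p u) us)) \<longleftrightarrow> null_on {p..q} (%_. 0)"
   by (intro null_on_cong) auto
  thus ?thesis using null_on_0 by simp
 next
  case True
  then obtain u where u: "u \<in> perms {p..q}" "map (subst1 p u) us \<in> supp g" by (auto simp: in_keys_iff)
  obtain b where b: "valid_parts v b {1..k}" "map (subst1 p u) us = map (expand v b) us0" using coefg(2)[OF _ u(2)] by blast
  have "set (concat us) = insert p ({1..m} - {p..q})" using us by (simp add: perms_iff)
  then obtain w where w: "w \<in> set us" "p \<in> set w" by auto
  obtain x y where xy: "w = x @ p # y" "p \<notin> set x" by (metis split_list_first w)
  have "subst1 p u w \<in> set (map (expand v b) us0)" using w unfolding b(2)[symmetric] by simp
  then obtain w0 where w0: "w0 \<in> set us0" "subst1 p u w = expand v b w0" by auto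
  have "sublist u (expand v b w0)" unfolding w0(2)[symmetric] using xy by simp
  then obtain i where i: "i \<in> {1..k}" "{p..q} \<subseteq> seg v i"
   using skeleton_block[OF *(2) b(1) w0(1), of u p] u(1) pq by (auto simp: perms_iff)
  define d where "d = off v i"
  define p' where "p' = p - d"
  define q' where "q' = q - d"
  have "p \<in> seg v i" "q \<in> seg v i" using i pq by auto
  hence pq': "p = d + p'" "q = d + q'" "1 <= p'" "p' < q'" "q' <= v i" using pq by (auto simp: seg_def d_def p'_def q'_def)
  let ?f = "merge_to p q"
  let ?w = "remdups (map (merge_to p' q') (b i))"
  have bi: "b i \<in> perms {1..v i}" using b i by (auto simp: valid_parts_def)
  have wp: "?w \<in> perms (insert p' ({1..v i} - {p'..q'}))" by (rule collapse_perms[OF bi pq'(3-)])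
  \<comment> \<open>The contracted list is recovered by collapsing one of its expansions; hence it
    is itself an expansion of \<open>us0\<close>, with only the word in segment \<open>i\<close>
    collapsed.\<close>
  have "us = map (%w. remdups (map ?f w)) (map (subst1 p u) us)"
  proof -
   have "remdups (map ?f (subst1 p u w)) = w" if w: "w \<in> set us" for w
   proof (cases "p \<in> set w")
    case True
    have dw: "distinct w" "set w \<subseteq> insert p ({1..m} - {p..q})" using us w by (auto simp: perms_iff distinct_concat_iff)
    hence "w \<in> perms (insert p (set w - {p..q}))" using True by auto
    thus ?thesis using u pq by (intro collapse_subst1) auto
   next
    case False
    have dw: "distinct w" "set w \<subseteq> insert p ({1..m} - {p..q})" using us w by (auto simp: perms_iff distinct_concat_iff)
    hence "map ?f w = w" by (intro map_idI) (auto simp: merge_to_def)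
    thus ?thesis using False dw by simp
   qed
   thus ?thesis by (simp add: map_idI)
  qed
  also have "... = map (%w. remdups (map ?f w)) (map (expand v b) us0)" using b by simp
  also have "... = map (expand v (b(i := ?w))) us0"
  proof -
   have "remdups (map ?f (expand v b u)) = expand v (b(i := ?w)) u" if "u \<in> set us0" for u
    using collapse_expand[OF comp b(1) i(1) pq'(3-) X_word(1,2)[OF X that]] unfolding pq' d_def .
   thus ?thesis by simp
  qed
  finally have us': "us = map (expand v (b(i := ?w))) us0" .
  have cf: "coef g (map (subst1 p (map ((+) d) z)) us) =
    (\<Prod>h\<in>{1..k} - {i}. coef (c h) (b h)) * coef (c i) (subst1 p' z ?w)"
   if z: "z \<in> perms {p'..q'}" for z
  proof -
   have "map (subst1 p (map ((+) d) z)) us = map (expand v (b(i := subst1 p' z ?w))) us0"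
   proof -
    have "subst1 (off v i + p') (map ((+) (off v i)) z) (expand v (b(i := ?w)) u) = expand v (b(i := subst1 p' z ?w)) u"
     if "u \<in> set us0" for u
    proof (rule expand_subst1[OF b(1) i(1) pq'(3)])
     show "p' <= v i" using pq' by simp
     show "set ?w \<subseteq> {1..v i}" using wp pq' by (auto simp: perms_iff)
     show "set u \<subseteq> {1..k}" using X_word(2)[OF X that] .
    qed
    thus ?thesis by (subst us') (simp add: pq' d_def)
   qed
   moreover have "subst1 p' z ?w \<in> perms {1..v i}" using pq' wp z by (intro subst1_perms) auto
   ultimately have "coef g (map (subst1 p (map ((+) d) z)) us) =
     (\<Prod>h\<in>{1..k}. coef (c h) ((b(i := subst1 p' z ?w)) h))" using coefg(1)[OF _ valid_parts_upd[OF b(1)]] by simp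
   also have "... = coef (c i) (subst1 p' z ?w) * (\<Prod>h\<in>{1..k} - {i}. coef (c h) ((b(i := subst1 p' z ?w)) h))"
    using i by (subst prod.remove[of _ i]) auto
   also have "(\<Prod>h\<in>{1..k} - {i}. coef (c h) ((b(i := subst1 p' z ?w)) h)) = (\<Prod>h\<in>{1..k} - {i}. coef (c h) (b h))" by simp
   finally show ?thesis by simp
  qed
  have "null_on {p'..q'} (%z. coef (c i) (subst1 p' z ?w))"
   using skeleton_supp[OF *(2,3) L i(1)] pq'(3-) wp by (auto simp: null_slices_def)
  hence "null_on {p'..q'} (%z. (\<Prod>h\<in>{1..k} - {i}. coef (c h) (b h)) * coef (c i) (subst1 p' z ?w))" by (rule null_on_scale)
  hence "null_on {p'..q'} (%z. coef g (map (subst1 p (map ((+) d) z)) us))" using null_on_cong[OF cf] by simp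
  thus ?thesis using null_on_shift by (simp add: pq')
 qed
qed

lemma tensor_array_cong:
 assumes "set (concat us) \<subseteq> {1..k}" "!!i. i \<in> {1..k} ==> off v i = off v' i" "!!i. i \<in> {1..k} ==> c i = c' i"
 shows "tensor_array v c us = tensor_array v' c' us"
proof -
 have "expand v b u = expand v' b u" if "u \<in> set us" for b u using that assms by (intro expand_cong_v assms) auto
 hence "map (expand v b) us = map (expand v' b) us" for b by simp
 moreover have "PiE (set (concat us)) (%i. supp (c i)) = PiE (set (concat us)) (%i. supp (c' i))"
  using assms by (intro PiE_cong) (metis subsetD)
 moreover have "(\<Prod>i\<in>set (concat us). coef (c i) (b i)) = (\<Prod>i\<in>set (concat us). coef (c' i) (b i))" for b
  using assms by (intro prod.cong refl) (metis subsetD)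
 ultimately show ?thesis unfolding tensor_array_def by (simp only:)
qed

text \<open>A part of size one has the single generator \<open>bvec [1]\<close>, which lets trivial
  and proper insertions be tensored uniformly.\<close>

definition part_generators :: "(nat => word_comb set) => (nat => nat) => nat => word_comb set" where
 "part_generators L v i = (if v i = 1 then {bvec [1]} else L (v i))"

lemma filling_iff:
 assumes "composition k v m"
 shows "filling L k v c \<longleftrightarrow> (\<forall>i\<in>{1..k}. c i \<in> part_generators L v i)" using assms by (auto simp: composition_def filling_def part_generators_def)

lemma part_generators_independent:
 assumes "v i \<ge> 1" "v i > 1 ==> qvec.independent (L (v i))"
 shows "qvec.independent (part_generators L v i)"
proof -
 have "bvec [1::nat] ~= 0" by (metis lookup_single_eq lookup_zero zero_neq_one)
 thus ?thesis using assms by (cases "v i = 1") (simp_all add: part_generators_def)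
qed

text \<open>Spell the interval out in some order, here increasingly, to obtain a genuine expansion,
  and collapse that one.\<close>

lemma collapsed_concat:
 assumes comp: "composition k v m" and us: "concat us \<in> perms {1..k}" and b: "valid_parts v b {1..k}"
  and i: "i \<in> {1..k}" and pq: "1 <= p" "p < q" "q <= v i"
  and w: "w \<in> perms (insert p ({1..v i} - {p..q}))"
 shows "concat (map (expand v (b(i := w))) us) \<in> perms (insert (off v i + p) ({1..m} - {off v i + p..off v i + q}))"
proof -
 let ?u = "[p..<Suc q]"
 have u: "?u \<in> perms {p..q}" by force
 let ?b = "b(i := subst1 p ?u w)"
 have "subst1 p ?u w \<in> perms {1..v i}" using pq w u by (intro subst1_perms) auto
 hence val: "valid_parts v ?b {1..k}" by (rule valid_parts_upd[OF b])
 have dis: "distinct (concat us)" "set (concat us) \<subseteq> {1..k}" using us by (simp_all add: perms_iff)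
 have "remdups (map (merge_to (off v i + p) (off v i + q)) (expand v ?b (concat us))) =
   expand v (?b(i := remdups (map (merge_to p q) (?b i)))) (concat us)" by (rule collapse_expand[OF comp val i pq dis])
 also have "remdups (map (merge_to p q) (?b i)) = w" using collapse_subst1[OF _ u w] pq by simp
 also have "?b(i := w) = b(i := w)" by simp
 finally have "concat (map (expand v (b(i := w))) us) =
   remdups (map (merge_to (off v i + p) (off v i + q)) (expand v ?b (concat us)))" unfolding concat_expand by rule
 moreover have "expand v ?b (concat us) \<in> perms {1..m}" by (rule expand_perms[OF comp us val])
 moreover have "off v i + q <= m" using part_subset[OF comp i] pq by (auto simp: seg_def)
 ultimately show ?thesis using collapse_perms pq by simp
qed

text \<open>Pick a list in the support and its skeleton. On all expansions of this skeleton the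
  coefficients form a tensor whose slices in each direction are null, so they agree with a
  combination of pure tensors of generators. Subtracting it removes the picked list from the support
  and adds none.\<close>

lemma insertions_span:
 assumes L: "!!j. 2 <= j ==> j < m ==> qvec.span (L j) = null_slices j"
   "!!j. 2 <= j ==> j < m ==> qvec.independent (L j)"
  and c: "!!us. us \<in> supp c ==> X m us" "array_null_slices m c"
  and unmarked: "!!us u B. us \<in> supp c ==> u \<in> set us ==> sublist B u ==> 2 <= length B ==> length B < m ==>
   interval_of {1..m} (set B) ==> set B Int M m us = {}"
 shows "c \<in> qvec.span (insertions L m)"
 using c unmarked
proof (induction "card (supp c)" arbitrary: c rule: less_induct)
 case less
 have Ls: "f \<in> null_slices j" if "2 <= j" "j < m" "f \<in> L j" for j f using L[OF that(1,2)] qvec.span_base[OF that(3)] by simp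
 show ?case
 proof (cases "supp c = {}")
  case True
  thus ?thesis by (simp add: qvec.span_zero)
 next
  case False
  then obtain us where us: "us \<in> supp c" by blast
  obtain k v us0 b0 where sk: "skeleton m k v us0" and b0: "valid_parts v b0 {1..k}" "us = map (expand v b0) us0" using skeleton_exists less.prems us by blast
  have comp: "composition k v m" and X: "X k us0" using sk by (auto simp: skeleton_def)
  have us0: "concat us0 \<in> perms {1..k}" by (rule X_perms[OF X])
  let ?J = "{1..k}"
  let ?B = "%i. perms {1..v i}"
  let ?G = "part_generators L v"
  let ?C = "%b. coef c (map (expand v b) us0)"
  have vm: "v i < m" "v i \<ge> 1" "off v i + v i <= m" if i: "i \<in> ?J" for i
  proof -
   show "v i \<ge> 1" using comp i by (auto simp: composition_def)
   thus "off v i + v i <= m" using part_subset[OF comp i] by (auto simp: seg_def)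
   thus "v i < m" using skeleton_parts_proper[OF sk i] by linarith
  qed
  have spanG: "qvec.span (?G i) = null_slices (v i)" if i: "i \<in> ?J" "v i ~= 1" for i
   using L vm[OF i(1)] i by (simp add: part_generators_def)
  have indG: "qvec.independent (?G i)" if "i \<in> ?J" for i using vm[OF that] L(2) by (intro part_generators_independent) auto
  \<comment> \<open>The slice conditions on \<open>c\<close> for intervals inside segment
    \<open>i\<close> are, after a shift, those defining \<open>null_slices (v i)\<close>; as the
    segment is proper, even its full interval is covered.\<close>
  have slices: "(\<Sum>y\<in>?B i. qscale (?C (b(i := y))) (bvec y)) \<in> qvec.span (?G i)"
   if i: "i \<in> ?J" and b: "b \<in> PiE ?J ?B" for i b
  proof (cases "v i = 1")
   case True
   thus ?thesis by (simp add: part_generators_def qvec.span_scale qvec.span_base)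
  next
   case False
   let ?f = "\<Sum>y\<in>?B i. qscale (?C (b(i := y))) (bvec y)"
   have val: "valid_parts v b {1..k}" using b by (auto simp: valid_parts_def)
   have cf: "coef ?f y = ?C (b(i := y))" if "y \<in> ?B i" for y using that unfolding coef_sum
    by (simp add: lookup_single when_def if_distrib cong: if_cong)
   have sf: "supp ?f \<subseteq> ?B i"
   proof -
    have "supp ?f \<subseteq> (\<Union>y\<in>?B i. supp (qscale (?C (b(i := y))) (bvec y)))" by (rule supp_sum)
    also have "... \<subseteq> ?B i" by (fastforce simp: in_keys_iff lookup_single)
    finally show ?thesis .
   qed
   have "null_on {p..q} (%u. coef ?f (subst1 p u w))"
    if pq: "1 <= p" "p < q" "q <= v i" and w: "w \<in> perms (insert p ({1..v i} - {p..q}))" for p q w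
   proof -
    let ?us = "map (expand v (b(i := w))) us0"
    have cat: "concat ?us \<in> perms (insert (off v i + p) ({1..m} - {off v i + p..off v i + q}))"
     by (rule collapsed_concat[OF comp us0 val i pq w])
    have "~ (off v i + p = 1 & off v i + q = m)" using vm[OF i] pq by auto
    moreover have "1 <= off v i + p" "off v i + p < off v i + q" "off v i + q <= m" using pq vm[OF i] by auto
    ultimately have "null_on {off v i + p..off v i + q} (%u. coef c (map (subst1 (off v i + p) u) ?us))"
     using less.prems cat unfolding array_null_slices_def by blast
    hence "null_on {p..q} (%u. coef c (map (subst1 (off v i + p) (map ((+) (off v i)) u)) ?us))" unfolding null_on_shift .
    moreover have "coef c (map (subst1 (off v i + p) (map ((+) (off v i)) u)) ?us) = coef ?f (subst1 p u w)"
     if u: "u \<in> perms {p..q}" for u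
    proof -
     have "subst1 p u w \<in> perms {1..v i}" using pq w u by (intro subst1_perms) auto
     moreover have "map (subst1 (off v i + p) (map ((+) (off v i)) u)) ?us = map (expand v (b(i := subst1 p u w))) us0" using expand_subst1 val i pq w X_word X by (force simp: perms_iff)
     ultimately show ?thesis by (simp only: cf)
    qed
    ultimately show ?thesis using null_on_cong by (metis (no_types, lifting))
   qed
   hence "?f \<in> null_slices (v i)" using sf by (simp add: null_slices_def)
   thus ?thesis using spanG[OF i False] by simp
  qed
  obtain A a where A: "finite A" "A \<subseteq> PiE ?J ?G"
   "!!b. b \<in> PiE ?J ?B ==> ?C b = (\<Sum>g\<in>A. a g * (\<Prod>i\<in>?J. coef (g i) (b i)))"
   using pure_tensors_span[of ?J ?B ?G ?C, OF _ _ indG slices] by auto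
  define c' where "c' = (\<Sum>g\<in>A. qscale (a g) (tensor_array v g us0))"
  have fill: "filling L k v g" if "g \<in> A" for g unfolding filling_iff[OF comp] using that A by auto
  have c'span: "c' \<in> qvec.span (insertions L m)" unfolding c'_def
  proof (intro qvec.span_sum qvec.span_scale qvec.span_base)
   fix g assume "g \<in> A"
   thus "tensor_array v g us0 \<in> insertions L m" unfolding insertions_def using sk fill by blast
  qed
  have gs: "supp (g i) \<subseteq> perms {1..v i}" if "g \<in> A" "i \<in> ?J" for g i
   using skeleton_supp[OF sk fill[OF that(1)] Ls that(2)] by (auto simp: null_slices_def)
  have cc': "coef c' (map (expand v b) us0) = ?C b" if b: "valid_parts v b {1..k}" for b
  proof -
   let ?b = "restrict b {1..k}"
   have bP: "?b \<in> PiE ?J ?B" using b by (auto simp: valid_parts_def)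
   have same: "map (expand v ?b) us0 = map (expand v b) us0"
   proof (intro map_cong refl expand_cong)
    fix u i assume "u \<in> set us0" "i \<in> set u"
    hence "i \<in> {1..k}" using X_word[OF X] by blast
    thus "?b i = b i" by simp
   qed
   have "coef c' (map (expand v b) us0) = (\<Sum>g\<in>A. a g * (\<Prod>i\<in>?J. coef (g i) (b i)))" unfolding c'_def coef_sum coef_qscale
    by (intro sum.cong arg_cong2[of _ _ _ _ "(*)"] coef_tensor_array(1)[OF comp us0 gs b]) auto
   also have "... = (\<Sum>g\<in>A. a g * (\<Prod>i\<in>?J. coef (g i) (?b i)))" by simp
   also have "... = ?C ?b" using A(3)[OF bP] by simp
   finally show ?thesis unfolding same .
  qed
  have sc': "EX b. valid_parts v b {1..k} & us' = map (expand v b) us0" if us': "us' \<in> supp c'" for us'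
  proof -
   have "us' \<in> (\<Union>g\<in>A. supp (qscale (a g) (tensor_array v g us0)))" using us' unfolding c'_def by (rule subsetD[OF supp_sum])
   then obtain g where g: "g \<in> A" "us' \<in> supp (qscale (a g) (tensor_array v g us0))" by auto
   hence g: "g \<in> A" "us' \<in> supp (tensor_array v g us0)" using subsetD[OF supp_qscale] by simp_all
   show ?thesis by (rule coef_tensor_array(2)[OF comp us0 gs[OF g(1)] g(2)])
  qed
  let ?d = "c - c'"
  \<comment> \<open>\<open>c'\<close> lives on expansions of this one skeleton and agrees with
    \<open>c\<close> there.\<close>
  have dsub: "supp ?d \<subseteq> supp c - {us}"
  proof
   fix us' assume d: "us' \<in> supp ?d"
   hence neq: "coef c us' ~= coef c' us'" by (simp add: in_keys_iff lookup_minus)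
   have "us' ~= us" using cc' b0 neq by auto
   moreover have "us' \<in> supp c" using neq in_keys_iff sc' cc' by metis
   ultimately show "us' \<in> supp c - {us}" by simp
  qed
  have "?d \<in> qvec.span (insertions L m)"
  proof (rule less.hyps)
   show "card (supp ?d) < card (supp c)" using dsub us by (intro psubset_card_mono) auto
   have "array_null_slices m c'" by (rule array_null_slices_span[OF c'span insertions_null_slices[OF Ls]])
   hence "array_null_slices m (c + qscale (-1) c')" using less.prems by (intro array_null_slices_add array_null_slices_scale)
   thus "array_null_slices m ?d" by simp
   show "!!us. us \<in> supp ?d ==> X m us" using less.prems dsub by blast
   show "set B Int M m us = {}" if "us \<in> supp ?d" "u \<in> set us" "sublist B u" "2 <= length B" "length B < m"
    "interval_of {1..m} (set B)" for us u B using less.prems that dsub by blast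
  qed
  hence "?d + c' \<in> qvec.span (insertions L m)" using c'span by (rule qvec.span_add)
  thus ?thesis by simp
 qed
qed

text \<open>Evaluate a relation on the expansions of the skeleton of \<open>g0\<close>. By
  \<open>skeleton_unique\<close> only insertions with that skeleton contribute, and these are pure
  tensors of independent generators.\<close>

lemma insertions_independent:
 assumes L: "!!j. 2 <= j ==> j < m ==> qvec.span (L j) = null_slices j"
   "!!j. 2 <= j ==> j < m ==> qvec.independent (L j)"
 shows "qvec.independent (insertions L m)"
 unfolding qvec.independent_explicit_finite_subsets
proof (intro allI impI ballI)
 fix F a g0
 assume F: "F \<subseteq> insertions L m" "finite F" and zero: "(\<Sum>g\<in>F. qscale (a g) g) = 0" and g0: "g0 \<in> F"
 have Ls: "f \<in> null_slices j" if "2 <= j" "j < m" "f \<in> L j" for j f using L[OF that(1,2)] qvec.span_base[OF that(3)] by simp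
 obtain k v c0 us0 where g0': "g0 = tensor_array v c0 us0" "skeleton m k v us0" "filling L k v c0" using F g0 by (auto simp: insertions_def)
 note sk = g0'(2)
 have comp: "composition k v m" and X: "X k us0" using sk by (auto simp: skeleton_def)
 have us0: "concat us0 \<in> perms {1..k}" "set (concat us0) \<subseteq> {1..k}" using X_perms[OF X] by (simp_all add: perms_iff)
 let ?J = "{1..k}"
 let ?G = "part_generators L v"
 \<comment> \<open>The members of the relation sharing the skeleton of \<open>g0\<close>; all others
   vanish on its expansions.\<close>
 define F0 where "F0 = {g\<in>F. EX c. g = tensor_array v c us0 & filling L k v c}"
 have vanish: "coef g (map (expand v b) us0) = 0" if g: "g \<in> F - F0" and b: "valid_parts v b {1..k}" for g b
 proof (rule ccontr)
  assume nz: "coef g (map (expand v b) us0) ~= 0"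
  obtain k1 v1 c1 us1 where g1: "g = tensor_array v1 c1 us1" "skeleton m k1 v1 us1" "filling L k1 v1 c1"
   using F g by (auto simp: insertions_def)
  have comp1: "composition k1 v1 m" and X1: "X k1 us1" using g1 by (auto simp: skeleton_def)
  have c1: "supp (c1 i) \<subseteq> perms {1..v1 i}" if "i \<in> {1..k1}" for i
   using skeleton_supp[OF g1(2,3) Ls that] by (auto simp: null_slices_def)
  have "map (expand v b) us0 \<in> supp (tensor_array v1 c1 us1)" using nz g1 by (simp add: in_keys_iff)
  from coef_tensor_array(2)[OF comp1 X_perms[OF X1] c1 this]
  obtain b1 where b1: "valid_parts v1 b1 {1..k1}" "map (expand v b) us0 = map (expand v1 b1) us1" by blast
  have un: "k = k1 & us0 = us1 & (\<forall>i\<in>{1..k}. v i = v1 i & off v i = off v1 i & b i = b1 i)"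
   by (rule skeleton_unique[OF sk b g1(2) b1])
  have "g = tensor_array v c1 us0" using tensor_array_cong us0 un g1 by fastforce
  moreover have "filling L k v c1" using g1 un unfolding filling_def by simp
  ultimately show False using g by (auto simp: F0_def)
 qed
 have "EX c. c \<in> PiE ?J ?G & g = tensor_array v c us0" if "g \<in> F0" for g
 proof -
  have "EX c. g = tensor_array v c us0 & filling L k v c" using that unfolding F0_def by simp
  then obtain c where c: "g = tensor_array v c us0" "filling L k v c" by auto
  have "g = tensor_array v (restrict c ?J) us0" unfolding c by (rule tensor_array_cong[OF us0(2)]) auto
  moreover have "restrict c ?J \<in> PiE ?J ?G" using c unfolding filling_iff[OF comp] by auto
  ultimately show ?thesis by blast
 qed
 then obtain t where t: "!!g. g \<in> F0 ==> t g \<in> PiE ?J ?G" "!!g. g \<in> F0 ==> g = tensor_array v (t g) us0" by metis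
 have inj: "inj_on t F0" using t by (metis inj_onI)
 have fillt: "filling L k v (t g)" if "g \<in> F0" for g unfolding filling_iff[OF comp] using t[OF that] by auto
 have gs: "supp (t g i) \<subseteq> perms {1..v i}" if "g \<in> F0" "i \<in> ?J" for g i
  using skeleton_supp[OF sk fillt[OF that(1)] Ls that(2)] by (auto simp: null_slices_def)
 have fin0: "finite F0" using F by (simp add: F0_def)
 have g00: "g0 \<in> F0" using g0 g0' by (auto simp: F0_def)
 have "(%h. a (inv_into F0 t h)) (t g0) = 0"
 proof (rule pure_tensors_independent[where J="?J" and G="?G" and A="t ` F0"])
  show "qvec.independent (?G i)" if i: "i \<in> ?J" for i
   using comp i skeleton_supp(2)[OF sk g0'(3) Ls i] L(2) by (intro part_generators_independent) (auto simp: composition_def)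
  show "(\<Sum>g\<in>t ` F0. a (inv_into F0 t g) * (\<Prod>i\<in>?J. coef (g i) (b i))) = 0" for b
  proof -
   have "(\<Sum>g\<in>t ` F0. a (inv_into F0 t g) * (\<Prod>i\<in>?J. coef (g i) (b i))) =
     (\<Sum>g\<in>F0. a g * (\<Prod>i\<in>?J. coef (t g i) (b i)))" using inj by (simp add: sum.reindex)
   also have "... = 0"
   proof (cases "valid_parts v b ?J")
    case True
    have "0 = coef (\<Sum>g\<in>F. qscale (a g) g) (map (expand v b) us0)" using zero by simp
    also have "... = (\<Sum>g\<in>F. a g * coef g (map (expand v b) us0))" by (simp add: coef_sum)
    also have "... = (\<Sum>g\<in>F0. a g * coef g (map (expand v b) us0))"
     using F vanish[OF _ True] by (intro sum.mono_neutral_right) (auto simp: F0_def)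
    also have "... = (\<Sum>g\<in>F0. a g * (\<Prod>i\<in>?J. coef (t g i) (b i)))"
    proof (rule sum.cong[OF refl])
     fix g assume g: "g \<in> F0"
     have "coef (tensor_array v (t g) us0) (map (expand v b) us0) = (\<Prod>i\<in>?J. coef (t g i) (b i))"
      by (rule coef_tensor_array(1)[OF comp us0(1) gs[OF g] True])
     thus "a g * coef g (map (expand v b) us0) = a g * (\<Prod>i\<in>?J. coef (t g i) (b i))" using t[OF g] by simp
    qed
    finally show ?thesis by simp
   next
    case False
    then obtain i where i: "i \<in> ?J" "b i \<notin> perms {1..v i}" by (auto simp: valid_parts_def)
    have "(\<Prod>i\<in>?J. coef (t g i) (b i)) = 0" if "g \<in> F0" for g
    proof -
     have "coef (t g i) (b i) = 0" using i gs[OF that i(1)] by (auto simp: in_keys_iff)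
     thus ?thesis using i(1) by  auto
    qed
    thus ?thesis by (intro sum.neutral) simp
   qed
   finally show ?thesis .
  qed
  show "t ` F0 \<subseteq> PiE ?J ?G" using t by blast
 qed (use fin0 g00 in auto)
 thus "a g0 = 0" using inj g00 by simp
qed

end

section \<open>Evaluation of forms; shuffles as products of rooted forms\<close>

definition lin_eval :: "('a => complex) => ('a \<Rightarrow>\<^sub>0 rat) => complex" where
 "lin_eval \<phi> f = (\<Sum>u\<in>supp f. of_rat (coef f u) * \<phi> u)"

lemma lin_eval_superset: "finite A ==> supp f \<subseteq> A ==> lin_eval \<phi> f = (\<Sum>u\<in>A. of_rat (coef f u) * \<phi> u)"
 unfolding lin_eval_def by (intro sum.mono_neutral_left) (auto simp: in_keys_iff)

lemma lin_eval_add: "lin_eval \<phi> (f + g) = lin_eval \<phi> f + lin_eval \<phi> g"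
proof -
 let ?A = "supp f Un supp g"
 have "supp (f + g) \<subseteq> ?A" by (rule Poly_Mapping.keys_add)
 thus ?thesis by (simp add: lin_eval_superset[of ?A] lookup_add of_rat_add distrib_right sum.distrib)
qed

lemma lin_eval_scale: "lin_eval \<phi> (qscale a f) = of_rat a * lin_eval \<phi> f"
 using lin_eval_superset[OF _ supp_qscale] by (simp add: lin_eval_def of_rat_mult sum_distrib_left mult.assoc)

lemma lin_eval_0 [simp]: "lin_eval \<phi> 0 = 0"
 by (simp add: lin_eval_def)

lemma lin_eval_bvec [simp]: "lin_eval \<phi> (bvec u) = \<phi> u"
 by (simp add: lin_eval_def)

lemma lin_eval_sum: "lin_eval \<phi> (sum g A) = (\<Sum>i\<in>A. lin_eval \<phi> (g i))"
 by (induction rule: infinite_finite_induct) (auto simp: lin_eval_add)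

lemma lin_eval_lin_ext: "lin_eval \<phi> (lin_ext f p) = lin_eval (%y. lin_eval \<phi> (f y)) p"
 by (simp add: lin_ext_def lin_eval_sum lin_eval_scale lin_eval_def[of "%y. lin_eval \<phi> (f y)"])

lemma lin_eval_diff: "lin_eval \<phi> (f - g) = lin_eval \<phi> f - lin_eval \<phi> g"
 using lin_eval_add[of \<phi> "f - g" g] by simp

lemma lin_eval_cong: "(!!u. u \<in> supp f ==> \<phi> u = \<psi> u) ==> lin_eval \<phi> f = lin_eval \<psi> f"
 by (simp add: lin_eval_def)

abbreviation rooted :: "(nat => complex) => word_comb => complex" where
 "rooted x \<equiv> lin_eval (%u. chain x (0 # u))"

text \<open>The form of a forest in which every factor is attached to the root 0, a letter outside
  the alphabet.\<close>

definition tree :: "(nat => complex) => nat list list => complex" where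
 "tree x us = prod_list (map (%u. chain x (0 # u)) us)"

lemma shuffles_perms:
 assumes "u \<in> perms A" "v \<in> perms B" "A Int B = {}" "w \<in> shuffles u v"
 shows "w \<in> perms (A Un B)"
 using assms set_shuffles[OF assms(4)] distinct_disjoint_shuffles[of u v w] by (simp add: perms_iff)

lemma supp_word_shuffle:
 assumes "supp f \<subseteq> perms A" "supp g \<subseteq> perms B" "A Int B = {}"
 shows "supp (word_shuffle f g) \<subseteq> perms (A Un B)"
proof
 fix w assume "w \<in> supp (word_shuffle f g)"
 hence "w \<in> (\<Union>u\<in>supp f. supp (lin_ext (%v. \<Sum>w\<in>shuffles u v. bvec w) g))"
  unfolding word_shuffle_def bilin_ext_def by (rule subsetD[OF supp_lin_ext])
 then obtain u where u: "u \<in> supp f" "w \<in> supp (lin_ext (%v. \<Sum>w\<in>shuffles u v. bvec w) g)" by auto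
 from subsetD[OF supp_lin_ext u(2)] obtain v where v: "v \<in> supp g" "w \<in> supp (\<Sum>w\<in>shuffles u v. bvec w :: word_comb)" by auto
 from subsetD[OF supp_sum v(2)] have "w \<in> shuffles u v" by auto
 thus "w \<in> perms (A Un B)" using shuffles_perms u v assms by blast
qed

text \<open>The bilinear extension of \<open>chain_shuffles_rooted\<close>.\<close>

lemma rooted_word_shuffle:
 assumes "supp f \<subseteq> perms A" "supp g \<subseteq> perms B" "A Int B = {}" "0 \<notin> A Un B" "inj_on x (insert 0 (A Un B))"
 shows "rooted x (word_shuffle f g) = rooted x f * rooted x g"
proof -
 have "rooted x (word_shuffle f g) = lin_eval (%u. lin_eval (%v. \<Sum>w\<in>shuffles u v. chain x (0 # w)) g) f"
  by (simp add: word_shuffle_def bilin_ext_def lin_eval_lin_ext lin_eval_sum)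
 also have "... = lin_eval (%u. lin_eval (%v. chain x (0 # u) * chain x (0 # v)) g) f"
 proof (intro lin_eval_cong chain_shuffles_rooted)
  fix u v assume "u \<in> supp f" "v \<in> supp g"
  hence "distinct u" "set u = A" "distinct v" "set v = B" using assms(1,2) by (auto simp: perms_iff)
  thus "distinct (0 # u @ v)" "inj_on x (set (0 # u @ v))" using assms by auto
 qed
 also have "... = rooted x f * rooted x g" unfolding lin_eval_def sum_product by (simp add: sum_distrib_left mult_ac)
 finally show ?thesis .
qed

lemma supp_shuffle_all: "distinct (concat us) ==> supp (shuffle_all us) \<subseteq> perms (set (concat us))"
proof (induction us)
 case (Cons u us)
 have "supp (word_shuffle (bvec u) (shuffle_all us)) \<subseteq> perms (set u Un set (concat us))"
  using Cons by (intro supp_word_shuffle) auto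
 thus ?case by (simp add: shuffle_all_def)
qed (simp add: shuffle_all_def)

lemma rooted_shuffle_all:
 assumes "distinct (concat us)" "0 \<notin> set (concat us)" "inj_on x (insert 0 (set (concat us)))"
 shows "rooted x (shuffle_all us) = tree x us"
 using assms
proof (induction us)
 case (Cons u us)
 have i: "inj_on x (insert 0 (set u Un set (concat us)))" "inj_on x (insert 0 (set (concat us)))"
  using Cons.prems by (auto intro: inj_on_subset)
 have "rooted x (word_shuffle (bvec u) (shuffle_all us)) = rooted x (bvec u) * rooted x (shuffle_all us)"
  using Cons.prems supp_shuffle_all by (intro rooted_word_shuffle) auto
 moreover have "rooted x (shuffle_all us) = tree x us" by (rule Cons.IH) (use Cons.prems i in auto)
 moreover have "shuffle_all (u # us) = word_shuffle (bvec u) (shuffle_all us)" by (simp add: shuffle_all_def)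
 ultimately show ?case by (simp add: tree_def)
qed (simp add: shuffle_all_def tree_def)

lemma rooted_eq_0D:
 assumes "finite S" "0 \<notin> S" "supp f \<subseteq> perms S" "!!x. inj_on x (insert 0 S) ==> rooted x f = 0"
 shows "f = 0"
proof (rule poly_mapping_eqI)
 fix w
 show "coef f w = coef 0 w"
 proof (cases "w \<in> perms S")
  case True
  have "(of_rat (coef f w) :: complex) = 0"
  proof (rule rooted_chain_independent[OF assms(1,2) _ True])
   show "(\<Sum>w\<in>perms S. of_rat (coef f w) * chain x (0 # w)) = 0" if "inj_on x (insert 0 S)" for x
    using assms(4)[OF that] lin_eval_superset[OF _ assms(3)] by simp
  qed
  thus ?thesis by simp
 next
  case False
  hence "w \<notin> supp f" using assms by blast
  thus ?thesis by (simp add: in_keys_iff)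
 qed
qed

section \<open>Forests of Lyndon words\<close>

text \<open>For distinct letters, being Lyndon means starting with the smallest letter, so the
  shuffle products of these lists are Radford's basis. Sorting by first letters picks one list for
  every multiset of factors.\<close>

definition forests :: "nat set => nat list list set" where
 "forests S = {us. concat us \<in> perms S & sorted_wrt (<) (map hd us) & (\<forall>u\<in>set us. u ~= [] & (\<forall>i\<in>set u. hd u <= i))}"

lemma forests_perms: "us \<in> forests S ==> concat us \<in> perms S"
 by (simp add: forests_def)

lemma supp_lin_ext_shuffle_all:
 assumes "supp c \<subseteq> forests S"
 shows "supp (lin_ext shuffle_all c) \<subseteq> perms S"
proof -
 have "supp (shuffle_all us) \<subseteq> perms S" if "us \<in> supp c" for us
  using supp_shuffle_all forests_perms[of us] that assms by (auto simp: perms_iff)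
 thus ?thesis by (intro order_trans[OF supp_lin_ext] UN_least)
qed

lemma finite_forests: "finite S ==> finite (forests S)"
proof -
 assume S: "finite S"
 have "forests S \<subseteq> {us. set us \<subseteq> (\<Union>A\<in>Pow S. perms A) & length us <= card S}"
 proof
  fix us assume us: "us \<in> forests S"
  have ne: "[] \<notin> set us" using us by (auto simp: forests_def)
  have "length us <= length (concat us)" using ne by (induction us) (auto simp: Suc_le_eq, case_tac a, auto)
  moreover have "length (concat us) = card S" using us distinct_card[of "concat us"] by (simp add: forests_def perms_iff)
  moreover have "u \<in> (\<Union>A\<in>Pow S. perms A)" if "u \<in> set us" for u
  proof -
   have "distinct u" "set u \<subseteq> S" using us that by (auto simp: forests_def perms_iff distinct_concat_iff)
   thus ?thesis by (auto simp: perms_iff)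
  qed
  ultimately show "us \<in> {us. set us \<subseteq> (\<Union>A\<in>Pow S. perms A) & length us <= card S}" by auto
 qed
 moreover have "finite {us. set us \<subseteq> (\<Union>A\<in>Pow S. perms A) & length us <= card S}"
  using S by (intro finite_lists_length_le) auto
 ultimately show ?thesis by (rule finite_subset)
qed

text \<open>Each factor is preceded by the separator \<open>r\<close>, and a block avoiding
  \<open>r\<close> cannot reach across a separator. This lets a forest be treated as a single word
  when inner steps are counted.\<close>

lemma block_in_word:
 assumes "concat (map ((#) r) us) = P @ b @ Q" "r \<notin> set b" "b ~= []"
 shows "EX us1 p q us2. us = us1 @ (p @ b @ q) # us2"
 using assms
proof (induction us arbitrary: P)
 case (Cons u us)
 have "P ~= []"
 proof
  assume "P = []"
  hence "hd b = r" using Cons.prems by (cases b) auto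
  thus False using Cons.prems hd_in_set[of b] by simp
 qed
 then obtain P' where P: "P = r # P'" "u @ concat (map ((#) r) us) = P' @ b @ Q" using Cons.prems by (cases P) auto
 have "(EX x. P' = u @ x & concat (map ((#) r) us) = x @ b @ Q) | (EX x. u = P' @ x & x @ concat (map ((#) r) us) = b @ Q)"
  using P by (auto simp: append_eq_append_conv2)
 thus ?case
 proof (elim disjE exE conjE)
  fix x assume "concat (map ((#) r) us) = x @ b @ Q"
  from Cons.IH[OF this Cons.prems(2,3)] obtain us1 p q us2 where "us = us1 @ (p @ b @ q) # us2" by blast
  hence "u # us = (u # us1) @ (p @ b @ q) # us2" by simp
  thus ?thesis by blast
 next
  fix x assume x: "u = P' @ x" "x @ concat (map ((#) r) us) = b @ Q"
  hence "(EX y. x = b @ y) | (EX y. b = x @ y & y @ Q = concat (map ((#) r) us))"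
   by (auto simp: append_eq_append_conv2)
  hence "EX y. x = b @ y"
  proof (elim disjE exE conjE)
   fix y assume y: "b = x @ y" "y @ Q = concat (map ((#) r) us)"
   have "y = []"
   proof (rule ccontr)
    assume "y ~= []"
    hence "us ~= []" using y by auto
    hence "hd y = r" using arg_cong[OF y(2), of hd] \<open>y ~= []\<close> by (cases us) auto
    thus False using Cons.prems y \<open>y ~= []\<close> by auto
   qed
   thus ?thesis using y by  simp
  qed auto
  then obtain y where "x = b @ y" ..
  hence "u # us = [] @ (P' @ b @ y) # us" using x by simp
  thus ?thesis by blast
 qed
qed simp

lemma collided_chain_notin: "set w Int A = {} ==> collided_chain A z s w = chain z w"
 by (induction rule: induct_list012) auto

lemma inner_steps_separated: "r \<notin> A ==> inner_steps A (w @ concat (map ((#) r) us)) = inner_steps A w + inner_steps A (concat (map ((#) r) us))"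
proof (cases us)
 case (Cons u us')
 assume "r \<notin> A"
 from inner_steps_append_notin[OF this] inner_steps_append_notin[OF this, of "[]"] Cons show ?thesis by simp
qed simp

text \<open>Pole orders and leading coefficients of a product add and multiply over the factors. The
  separator 0 is outside \<open>A\<close>, so joining the factors to one word creates no inner
  steps.\<close>

lemma tree_collide:
 assumes "distinct (concat us)" "0 \<notin> set (concat us)" "0 \<notin> A" "collidable A z s (insert 0 (set (concat us)))" "inner_steps A (concat (map ((#) 0) us)) <= N"
 shows "((%t. t ^ N * tree (collide A z s t) us) \<longlongrightarrow>
  0 ^ (N - inner_steps A (concat (map ((#) 0) us))) * prod_list (map (%u. collided_chain A z s (0 # u)) us)) (at 0)" using assms
proof (induction us arbitrary: N)
 case Nil
 have "((%t::complex. t ^ N) \<longlongrightarrow> 0 ^ N) (at 0)" by (intro tendsto_intros)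
 thus ?case by (simp add: tree_def)
next
 case (Cons u us)
 let ?m = "inner_steps A (0 # u)" and ?n = "inner_steps A (concat (map ((#) 0) us))"
 have n: "inner_steps A (concat (map ((#) 0) (u # us))) = ?m + ?n" using inner_steps_separated[OF Cons.prems(3), of "0 # u"] by simp
 hence e: "N = ?m + (N - ?m)" "?n <= N - ?m" using Cons.prems by simp_all
 have col: "collidable A z s (set (0 # u))" "collidable A z s (insert 0 (set (concat us)))"
  by (rule collidable_subset[OF Cons.prems(4)]; auto)+
 have "distinct_adj (0 # u)" by (rule distinct_imp_adj) (use Cons.prems in auto)
 from chain_collide[OF col(1) this order_refl] obtain H where H: "H field_differentiable (at 0)"
  "!!t. t ~= 0 ==> H t = t ^ ?m * chain (collide A z s t) (0 # u)" "H 0 = collided_chain A z s (0 # u)" by auto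
 have "(H \<longlongrightarrow> H 0) (at 0)" using field_differentiable_imp_continuous_at[OF H(1)] by (simp add: continuous_at)
 hence "((%t. H t * (t ^ (N - ?m) * tree (collide A z s t) us)) \<longlongrightarrow>
   H 0 * (0 ^ (N - ?m - ?n) * prod_list (map (%u. collided_chain A z s (0 # u)) us))) (at 0)"
  using Cons.prems col e(2) by (intro tendsto_mult Cons.IH) auto
 moreover have "t ^ N = t ^ ?m * t ^ (N - ?m)" for t :: complex using e by (metis power_add)
 hence "eventually (%t. H t * (t ^ (N - ?m) * tree (collide A z s t) us) = t ^ N * tree (collide A z s t) (u # us)) (at 0)"
  unfolding eventually_at_filter by (simp add: H tree_def)
 ultimately show ?case unfolding n H by (rule Lim_transform_eventually[THEN tendsto_eq_rhs]) simp
qed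

text \<open>The case distinction of \<open>residue_sum\<close> for a single forest: the maximal pole
  order is reached only if one factor contains \<open>A\<close> as a block, and then the limit is a
  bubble form times the tree of the contracted forest.\<close>

lemma tree_residue:
 assumes us: "concat us \<in> perms S" and S: "finite S" "0 \<notin> S" "A \<subseteq> S" "a \<in> A"
  and col: "collidable A z s (insert 0 S)"
 shows "((%e. e ^ (card A - 1) * tree (collide A z s e) us) \<longlongrightarrow> l) (at 0) ==>
   (!!us1 p b q us2. us = us1 @ (p @ b @ q) # us2 ==> set b ~= A) ==> l = 0"
  and "EX l. ((%e. e ^ (card A - 1) * tree (collide A z s e) us) \<longlongrightarrow> l) (at 0)"
  and "us = us1 @ (p @ b @ q) # us2 ==> set b = A ==>
   ((%e. e ^ (card A - 1) * tree (collide A z s e) us) \<longlongrightarrow> chain s b * tree z (us1 @ (p @ a # q) # us2)) (at 0)"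
proof -
 let ?f = "%e. e ^ (card A - 1) * tree (collide A z s e) us"
 let ?F = "concat (map ((#) 0) us)"
 have d: "distinct (concat us)" "set (concat us) = S" using us by (simp_all add: perms_iff)
 have A0: "0 \<notin> A" using S by auto
 define d where "d = card A - 1 - inner_steps A ?F"
 let ?R = "0 ^ d * prod_list (map (%u. collided_chain A z s (0 # u)) us)"
 have filt: "filter (%i. i \<in> A) ?F = filter (%i. i \<in> A) (concat us)" using A0 by (induction us) auto
 have distF: "distinct (filter (%i. i \<in> A) ?F)" unfolding filt using d by simp
 have setF: "set ?F Int A = A"
 proof -
  have "set ?F Int A = set (filter (%i. i \<in> A) ?F)" by force
  also have "... = A" using d S by auto
  finally show ?thesis .
 qed
 have inner: "inner_steps A ?F < card A" using inner_steps_bound[OF distF] S unfolding setF by auto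
 have lim': "(?f \<longlongrightarrow> ?R) (at 0)"
  unfolding d_def by (rule tree_collide) (use d A0 S col inner in "simp_all del: set_concat")
 thus "EX l. (?f \<longlongrightarrow> l) (at 0)" by blast
 show "l = 0" if l: "(?f \<longlongrightarrow> l) (at 0)"
  and no: "!!us1 p b q us2. us = us1 @ (p @ b @ q) # us2 ==> set b ~= A"
 proof -
  have "d ~= 0"
  proof
   assume "d = 0"
   hence "card (set ?F Int A) <= Suc (inner_steps A ?F)" unfolding setF by (simp add: d_def)
   moreover have "set ?F Int A ~= {}" using S unfolding setF by auto
   ultimately obtain P b Q where F: "?F = P @ b @ Q" "set b = A" using inner_steps_block[OF distF] unfolding setF by blast
   obtain us1 p q us2 where "us = us1 @ (p @ b @ q) # us2" using block_in_word[OF F(1)] F S by fastforce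
   thus False using no F by blast
  qed
  hence "?R = 0" by simp
  thus "l = 0" using tendsto_unique[OF _ l lim'] by simp
 qed
 show "(?f \<longlongrightarrow> chain s b * tree z (us1 @ (p @ a # q) # us2)) (at 0)"
  if us12: "us = us1 @ (p @ b @ q) # us2" and b: "set b = A"
 proof -
  have dis: "distinct (concat us1 @ (p @ b @ q) @ concat us2)" using d us12 by simp
  have disj: "set (concat us1) Int A = {}" "set (concat us2) Int A = {}" "set p Int A = {}" "set q Int A = {}" "distinct b"
   using dis b by auto
  have steps_notin: "inner_steps A (concat (map ((#) 0) us')) = 0" if "set (concat us') Int A = {}" for us'
   using that A0 by (intro inner_steps_notin) auto
  have pbq: "inner_steps A (p @ b @ q) = card A - 1"
  proof -
   have pre: "inner_steps A (p @ v) = inner_steps A v" if "set p Int A = {}" for p v using that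
   proof (induction p)
    case (Cons c p)
    thus ?case by (cases "p @ v") auto
   qed simp
   have "inner_steps A (b @ q) = inner_steps A b"
   proof (cases q)
    case (Cons c q')
    thus ?thesis using disj inner_steps_append_notin[of c] inner_steps_notin by auto
   qed simp
   thus ?thesis using pre[OF disj(3)] inner_steps_subset[of b] b distinct_card[OF disj(5)] by simp
  qed
  have "?F = concat (map ((#) 0) us1) @ (0 # p @ b @ q) @ concat (map ((#) 0) us2)" by (simp add: us12)
  hence "inner_steps A ?F = inner_steps A (concat (map ((#) 0) us1) @ 0 # (p @ b @ q)) + 0"
   using inner_steps_separated[OF A0, of "concat (map ((#) 0) us1) @ 0 # (p @ b @ q)"] steps_notin[OF disj(2)] by simp
  also have "... = card A - 1" using inner_steps_append_notin[OF A0] steps_notin[OF disj(1)] pbq by simp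
  finally have d0: "d = 0" by (simp add: d_def)
  have blk: "collided_chain A z s ((0 # p) @ b @ q) = chain s b * chain z ((0 # p) @ a # q)"
  proof (rule collided_chain_block)
   show "z i = z a" if "i \<in> set b" for i using collidable_eq[OF col] that b S by auto
  qed (use b S A0 disj in auto)
  have oth: "map (%u. collided_chain A z s (0 # u)) us' = map (%u. chain z (0 # u)) us'"
   if "set (concat us') Int A = {}" for us' using that A0 by (intro map_cong collided_chain_notin) auto
  have "?R = chain s b * tree z (us1 @ (p @ a # q) # us2)" using blk by (simp add: d0 us12 oth[OF disj(1)] oth[OF disj(2)] tree_def)
  thus ?thesis using lim' by simp
 qed
qed

lemma concat_subst1: "concat (map (subst1 a b) us) = subst1 a b (concat us)"
 by (induction us) auto

lemma subst1_inj:
 assumes "a \<in> A" "set b = A" "distinct w" "distinct w'" "set w \<subseteq> insert a (S - A)" "set w' \<subseteq> insert a (S - A)"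
  and eq: "subst1 a b w = subst1 a b w'"
 shows "w = w'"
proof -
 have iff: "a \<in> set v \<longleftrightarrow> set (subst1 a b v) Int A ~= {}" if "set v \<subseteq> insert a (S - A)" for v
  using that assms by (auto simp: subst1_def)
 show ?thesis
 proof (cases "a \<in> set w")
  case False
  hence "a \<notin> set w'" using iff[OF assms(5)] iff[OF assms(6)] eq by simp
  thus ?thesis using False eq by simp
 next
  case True
  hence "a \<in> set w'" using iff[OF assms(5)] iff[OF assms(6)] eq by simp
  obtain x y where 1: "w = x @ a # y" using split_list[OF True] by blast
  obtain x' y' where 2: "w' = x' @ a # y'" using split_list[OF \<open>a \<in> set w'\<close>] by blast
  have n: "a \<notin> set x" "a \<notin> set y" "a \<notin> set x'" "a \<notin> set y'" using assms 1 2 by auto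
  have "x = x' & b = b & y = y'"
  proof (rule eq_append_blocks[where A=A])
   show "x @ b @ y = x' @ b @ y'" using eq n unfolding 1 2 by simp
  qed (use assms(1,2,5,6) 1 2 n in auto)
  thus ?thesis using 1 2 by simp
 qed
qed

lemma subst_all_inj:
 assumes "A \<subseteq> S" "a \<in> A" "concat us \<in> perms (insert a (S - A))" "concat us' \<in> perms (insert a (S - A))"
  "b \<in> perms A" "b' \<in> perms A" and eq: "map (subst1 a b) us = map (subst1 a b') us'"
 shows "us = us' & b = b'"
proof -
 have "subst1 a b (concat us) = subst1 a b' (concat us')" using arg_cong[OF eq, of concat] by (simp add: concat_subst1)
 hence "(concat us, b) = (concat us', b')"
  using inj_onD[OF bij_betw_imp_inj_on[OF blocks_bij[OF assms(1,2)]], of "(concat us, b)" "(concat us', b')"] assms by simp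
 hence bb: "b = b'" by simp
 have "inj_on (subst1 a b) (set us Un set us')"
 proof (rule inj_onI)
  fix w w' assume w: "w \<in> set us Un set us'" "w' \<in> set us Un set us'" and e: "subst1 a b w = subst1 a b w'"
  have "distinct v & set v \<subseteq> insert a (S - A)" if "v \<in> set us Un set us'" for v
  proof -
   have "v \<in> set us | v \<in> set us'" using that by simp
   thus ?thesis
   proof
    assume "v \<in> set us"
    hence "distinct v" "set v \<subseteq> set (concat us)" using assms(3) by (auto simp: perms_iff distinct_concat_iff)
    thus ?thesis using assms unfolding perms_iff by simp
   next
    assume "v \<in> set us'"
    hence "distinct v" "set v \<subseteq> set (concat us')" using assms(4) by (auto simp: perms_iff distinct_concat_iff)
    thus ?thesis using assms unfolding perms_iff by simp
   qed
  qed
  thus "w = w'" using subst1_inj[of a A b w w' S] assms w e by (simp add: perms_iff)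
 qed
 hence "us = us'" using eq bb by (metis map_inj_on)
 thus ?thesis using bb by simp
qed

text \<open>Contracting to the smallest letter of the block preserves first letters: if the block
  opens a factor, the head of the factor is its least letter and hence already \<open>Min A\<close>.
  So contracted forests are forests again.\<close>

lemma forest_contract:
 assumes us: "us1 @ (p @ b @ q) # us2 \<in> forests S" and A: "set b = A" "A ~= {}"
 shows "us1 @ (p @ Min A # q) # us2 \<in> forests (insert (Min A) (S - A))" "b \<in> perms A"
  "map (subst1 (Min A) b) (us1 @ (p @ Min A # q) # us2) = us1 @ (p @ b @ q) # us2"
proof -
 let ?a = "Min A"
 have fA: "finite A" using A by auto
 have aA: "?a \<in> A" "!!i. i \<in> A ==> ?a <= i" using fA A by auto
 have "concat (us1 @ (p @ b @ q) # us2) \<in> perms S" using us by (simp only: forests_def mem_Collect_eq)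
 hence dis: "distinct (concat us1 @ (p @ b @ q) @ concat us2)" "set (concat us1 @ (p @ b @ q) @ concat us2) = S"
  unfolding perms_iff by simp_all
 show "b \<in> perms A" using dis A by (simp add: perms_iff)
 have n: "?a \<notin> set (concat us1)" "?a \<notin> set p" "?a \<notin> set q" "?a \<notin> set (concat us2)" using dis aA(1) A(1) by auto
 have "map (subst1 ?a b) us1 = us1" "map (subst1 ?a b) us2 = us2" using n by (auto intro!: map_idI)
 thus "map (subst1 ?a b) (us1 @ (p @ ?a # q) # us2) = us1 @ (p @ b @ q) # us2" using n by simp
 have bne: "b ~= []" using A by auto
 have lyn: "\<forall>i\<in>set (p @ b @ q). hd (p @ b @ q) <= i" using us by (simp add: forests_def)
 have hd: "hd (p @ ?a # q) = hd (p @ b @ q)"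
 proof (cases p)
  case Nil
  have "hd b \<in> A" using A hd_in_set by blast
  moreover have "hd b <= ?a" using lyn Nil bne A by auto
  ultimately show ?thesis using Nil bne aA(2)[of "hd b"] by simp
 qed simp
 have "concat (us1 @ (p @ ?a # q) # us2) \<in> perms (insert ?a (S - A))"
 proof -
  have "distinct (concat us1 @ (p @ ?a # q) @ concat us2)" using dis(1) n by auto
  moreover have "set (concat us1 @ (p @ ?a # q) @ concat us2) = insert ?a (S - A)"
  proof -
   have "S - A = set (concat us1) Un set p Un set q Un set (concat us2)" using dis A(1) by auto
   thus ?thesis by auto
  qed
  ultimately show ?thesis by (simp add: perms_iff)
 qed
 moreover have "\<forall>i\<in>set (p @ ?a # q). hd (p @ ?a # q) <= i" unfolding hd using lyn A by auto
 moreover have "map hd (us1 @ (p @ ?a # q) # us2) = map hd (us1 @ (p @ b @ q) # us2)" using hd by simp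
 ultimately show "us1 @ (p @ ?a # q) # us2 \<in> forests (insert ?a (S - A))"
  using us unfolding forests_def mem_Collect_eq by (simp only:) auto
qed

text \<open>The conditional is there because substituting an arbitrary word for \<open>Min A\<close>
  may destroy the Lyndon condition; the resulting list then does not occur in the sum.\<close>

lemma forest_residue:
 fixes c :: "nat list list => complex"
 assumes S: "finite S" "0 \<notin> S" "A \<subseteq> S" "A ~= {}" and col: "collidable A z s (insert 0 S)"
 shows "((%t. t ^ (card A - 1) * (\<Sum>us\<in>forests S. c us * tree (collide A z s t) us)) \<longlongrightarrow>
  (\<Sum>us\<in>forests (insert (Min A) (S - A)). (\<Sum>b\<in>perms A.
    (if map (subst1 (Min A) b) us \<in> forests S then c (map (subst1 (Min A) b) us) else 0) * chain s b) * tree z us)) (at 0)"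
proof -
 let ?a = "Min A"
 let ?P = "forests (insert ?a (S - A)) \<times> perms A"
 have fA: "finite A" using S finite_subset by blast
 have aA: "?a \<in> A" using fA S by simp
 have finP: "finite ?P" using S by (intro finite_cartesian_product finite_forests) auto
 \<comment> \<open>The limit for one forest, written as a sum over all its contractions; by
   \<open>subst_all_inj\<close> it has at most one term.\<close>
 define R where "R us = (\<Sum>(us', b)\<in>?P. if map (subst1 ?a b) us' = us then chain s b * tree z us' else 0)" for us
 have lim: "((%t. t ^ (card A - 1) * tree (collide A z s t) us) \<longlongrightarrow> R us) (at 0)" if us: "us \<in> forests S" for us
 proof (cases "EX us1 p b q us2. us = us1 @ (p @ b @ q) # us2 & set b = A")
  case True
  then obtain us1 p b q us2 where e: "us = us1 @ (p @ b @ q) # us2" "set b = A" by blast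
  let ?us = "us1 @ (p @ ?a # q) # us2"
  have fc: "?us \<in> forests (insert ?a (S - A))" "b \<in> perms A" "map (subst1 ?a b) ?us = us" using forest_contract us e S by simp_all
  have "R us = (\<Sum>x\<in>?P. if x = (?us, b) then chain s b * tree z ?us else 0)" unfolding R_def
  proof (intro sum.cong refl)
   fix x assume x: "x \<in> ?P"
   obtain us' b' where xx: "x = (us', b')" by force
   have "x = (?us, b)" if "map (subst1 ?a b') us' = us" using subst_all_inj[OF S(3) aA, of us' ?us] x xx fc that by (auto simp: forests_def)
   thus "(case x of (us', b) => if map (subst1 ?a b) us' = us then chain s b * tree z us' else 0) =
    (if x = (?us, b) then chain s b * tree z ?us else 0)" using fc xx by (cases "map (subst1 ?a b') us' = us") auto
  qed
  also have "... = chain s b * tree z ?us" using finP fc by simp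
  finally show ?thesis using tree_residue(3)[OF forests_perms[OF us] S(1,2,3) aA col e] by simp
 next
  case False
  have "R us = 0" unfolding R_def
  proof (rule sum.neutral, clarify)
   fix us' b' assume us': "us' \<in> forests (insert ?a (S - A))" "b' \<in> perms A"
   have "map (subst1 ?a b') us' ~= us"
   proof
    assume m: "map (subst1 ?a b') us' = us"
    have "?a \<in> set (concat us')" using us' by (simp add: forests_def perms_iff)
    then obtain w where w: "w \<in> set us'" "?a \<in> set w" by auto
    obtain us1 us2 where 1: "us' = us1 @ w # us2" using split_list[OF w(1)] by blast
    obtain x y where 2: "w = x @ ?a # y" using split_list[OF w(2)] by blast
    have "us = map (subst1 ?a b') us1 @ (subst1 ?a b' x @ b' @ subst1 ?a b' y) # map (subst1 ?a b') us2" using m 1 2 by simp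
    thus False using False us' unfolding perms_iff by blast
   qed
   thus "(if map (subst1 ?a b') us' = us then chain s b' * tree z us' else 0) = 0" by simp
  qed
  moreover obtain l where l: "((%t. t ^ (card A - 1) * tree (collide A z s t) us) \<longlongrightarrow> l) (at 0)"
   using tree_residue[OF forests_perms[OF us] S(1,2,3) aA col] by blast
  moreover have "l = 0" using tree_residue(1)[OF forests_perms[OF us] S(1,2,3) aA col l] False by blast
  ultimately show ?thesis by simp
 qed
 have "((%t. \<Sum>us\<in>forests S. c us * (t ^ (card A - 1) * tree (collide A z s t) us)) \<longlongrightarrow>
   (\<Sum>us\<in>forests S. c us * R us)) (at 0)" by (intro tendsto_sum tendsto_mult tendsto_const lim)
 also have "(%t. \<Sum>us\<in>forests S. c us * (t ^ (card A - 1) * tree (collide A z s t) us)) =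
   (%t. t ^ (card A - 1) * (\<Sum>us\<in>forests S. c us * tree (collide A z s t) us))"
  by (simp add: sum_distrib_left mult.left_commute)
 also have "(\<Sum>us\<in>forests S. c us * R us) =
   (\<Sum>x\<in>?P. \<Sum>us\<in>forests S. if map (subst1 ?a (snd x)) (fst x) = us then c us * (chain s (snd x) * tree z (fst x)) else 0)"
  unfolding R_def sum_distrib_left by (subst sum.swap) (auto intro!: sum.cong)
 also have "... = (\<Sum>x\<in>?P. (if map (subst1 ?a (snd x)) (fst x) \<in> forests S then c (map (subst1 ?a (snd x)) (fst x)) else 0) *
   chain s (snd x) * tree z (fst x))" using finite_forests[OF S(1)] by (intro sum.cong refl) simp
 also have "... = (\<Sum>us\<in>forests (insert ?a (S - A)). (\<Sum>b\<in>perms A.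
    (if map (subst1 ?a b) us \<in> forests S then c (map (subst1 ?a b) us) else 0) * chain s b) * tree z us)"
  by (simp add: sum.cartesian_product case_prod_unfold sum_distrib_right)
 finally show ?thesis .
qed

lemma forests_empty [simp]: "forests {} = {[]}" by (auto simp: forests_def)

lemma forests_Cons:
 assumes "finite S" "S ~= {}" "us \<in> forests S"
 obtains y us' where "us = (Min S # y) # us'" "distinct (Min S # y)" "set y \<subseteq> S" "us' \<in> forests (S - set (Min S # y))"
proof -
 have cat: "distinct (concat us)" "set (concat us) = S" using assms by (simp_all add: forests_def perms_iff)
 have "us ~= []" using cat assms by auto
 then obtain u us' where us: "us = u # us'" by (cases us) auto
 have une: "u ~= []" using assms us by (auto simp: forests_def)
 have "Min S \<in> set (concat us)" using cat assms by simp
 then obtain v where v: "v \<in> set us" "Min S \<in> set v" by auto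
 have "hd v <= Min S" using assms(3) v by (auto simp: forests_def)
 moreover have "hd u <= hd v" using assms v us by (auto simp: forests_def)
 moreover have "Min S <= hd u" using cat us une by  auto
 ultimately have "hd u = Min S" by simp
 then obtain y where y: "u = Min S # y" using une by (cases u) auto
 have "concat us' \<in> perms (S - set u)" using cat us by (auto simp: perms_iff)
 hence "us' \<in> forests (S - set (Min S # y))" using assms us y by (auto simp: forests_def)
 moreover have "distinct (Min S # y)" "set y \<subseteq> S" using cat us y by auto
 ultimately show ?thesis using that us y by blast
qed

lemma forests_ConsI:
 assumes "finite S" "S ~= {}" "distinct (Min S # y)" "set y \<subseteq> S" "us' \<in> forests (S - set (Min S # y))"
 shows "(Min S # y) # us' \<in> forests S"
proof -
 have cat: "distinct (concat us')" "set (concat us') = S - set (Min S # y)" using assms by (simp_all add: forests_def perms_iff)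
 have mS: "Min S \<in> S" "!!i. i \<in> S ==> Min S <= i" using assms by auto
 have "set (concat ((Min S # y) # us')) = S" using cat assms(4) mS by auto
 moreover
  have "Min S < hd u" if u: "u \<in> set us'" for u
 proof -
  have "u ~= []" using assms u by (auto simp: forests_def)
  hence "hd u \<in> set (concat us')" using u hd_in_set unfolding set_concat by blast
  hence "hd u \<in> S" "hd u ~= Min S" using cat by auto
  thus ?thesis using mS(2)[of "hd u"] by simp
 qed
 moreover have "\<forall>i\<in>set (Min S # y). Min S <= i" using assms by auto
 ultimately show ?thesis using assms by (auto simp: forests_def perms_iff)
qed

text \<open>Everything before \<open>m\<close> comes from the second word, because \<open>m\<close>
  opens the first.\<close>

lemma shuffles_Cons_split:
 assumes w: "p @ m # q \<in> shuffles (m # y) v" and d: "distinct (p @ m # q)" "set (m # y) Int set v = {}"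
 shows "y = filter (%x. x \<in> set y) q" "v = p @ filter (%x. x \<notin> set y) q"
proof -
 let ?f = "filter (%x. x \<in> set (m # y))"
 have f: "?f p @ m # ?f q = [] @ m # y" "filter (%x. x \<notin> set (m # y)) (p @ m # q) = v"
  using filter_shuffles_disjoint1[OF d(2) w] by simp_all
 have m: "m \<notin> set (?f p)" "m \<notin> set (?f q)" "m \<notin> set q" using d by auto
 from f(1)[unfolded append_Cons_eq_iff[OF m(1,2)]] have p: "?f p = []" "?f q = y" by blast+
 have "filter (%x. x \<notin> set (m # y)) p = p" using p by (auto simp: filter_empty_conv)
 moreover have "filter (%x. x \<notin> set (m # y)) q = filter (%x. x \<notin> set y) q" "?f q = filter (%x. x \<in> set y) q"
  using m by (auto intro!: filter_cong)
 ultimately show "y = filter (%x. x \<in> set y) q" "v = p @ filter (%x. x \<notin> set y) q" using p f by auto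
qed

lemma append_in_shuffles: "p @ w \<in> shuffles w p"
 by (induction p) (auto intro: Cons_in_shuffles_rightI)

text \<open>Triangularity: all letters of \<open>y\<close> must come after \<open>m\<close>, so a
  word with at most \<open>length y\<close> letters after \<open>m\<close> occurs only when these
  letters are exactly \<open>y\<close>.\<close>

lemma coef_shuffle_all_Cons:
 assumes u: "distinct (m # y)" "distinct (p @ m # q)" and us: "distinct (concat us)" "set (m # y) Int set (concat us) = {}"
  and len: "length q <= length y"
 shows "coef (shuffle_all ((m # y) # us)) (p @ m # q) = (if q = y then coef (shuffle_all us) p else 0)"
proof -
 have "p @ m # q \<in> shuffles (m # y) v \<longleftrightarrow> v = p & q = y" if v: "v \<in> supp (shuffle_all us)" for v
 proof
  assume w: "p @ m # q \<in> shuffles (m # y) v"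
  have "set v = set (concat us)" using v supp_shuffle_all[OF us(1)] by (auto simp: perms_iff simp del: set_concat)
  hence "set (m # y) Int set v = {}" using us by simp
  note s = shuffles_Cons_split[OF w u(2) this]
  have "\<forall>x\<in>set q. x \<in> set y"
   using arg_cong[OF s(1), of length] len length_filter_less[of _ q "%x. x \<in> set y"] by fastforce
  hence "filter (%x. x \<in> set y) q = q" "filter (%x. x \<notin> set y) q = []" by auto
  thus "v = p & q = y" using s by simp
 qed (simp add: append_in_shuffles)
 hence "(\<Sum>v\<in>supp (shuffle_all us). coef (shuffle_all us) v * (if p @ m # q \<in> shuffles (m # y) v then 1 else 0)) =
   (\<Sum>v\<in>supp (shuffle_all us). if v = p then (if q = y then coef (shuffle_all us) v else 0) else 0)" by (intro sum.cong) auto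
 thus ?thesis by (simp add: shuffle_all_def word_shuffle_def bilin_ext_def lin_ext_def coef_sum lookup_single when_def in_keys_iff)
qed

text \<open>Test against the words \<open>p @ ?m # q\<close> with \<open>?m\<close> the least
  letter. An inner induction on \<open>length q\<close> has disposed of forests whose first factor
  is shorter, and by triangularity only those with first factor \<open>?m # q\<close> remain; the
  others factors are separated by the outer induction. The coefficients are general because complex
  and rational ones both occur.\<close>

lemma forests_independent:
 fixes c :: "nat list list => 'f :: field_char_0"
 assumes "finite S" and "!!w. w \<in> perms S ==> (\<Sum>us\<in>forests S. c us * of_rat (coef (shuffle_all us) w)) = 0"
  and "us \<in> forests S"
 shows "c us = 0"
 using assms
proof (induction "card S" arbitrary: S c us rule: less_induct)
 case outer: less
 show ?case
 proof (cases "S = {}")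
  case True
  thus ?thesis using outer.prems by (simp add: shuffle_all_def)
 next
  case False
  let ?m = "Min S"
  note S = outer.prems(1)
  have mS: "?m \<in> S" using S False by simp
  have "c ((?m # q) # vs) = 0" if "(?m # q) # vs \<in> forests S" for q vs using that
  proof (induction "length q" arbitrary: q vs rule: less_induct)
   case (less q vs)
   let ?R = "S - set (?m # q)"
   from forests_Cons[OF S False less.prems] have q: "distinct (?m # q)" "set q \<subseteq> S" "vs \<in> forests ?R" by auto
   show ?case
   proof (rule outer.hyps[where S = ?R and c = "%ws. c ((?m # q) # ws)"])
    show "card ?R < card S" using S mS by (intro psubset_card_mono) auto
    fix p assume p: "p \<in> perms ?R"
    hence w: "p @ ?m # q \<in> perms S" using q mS by (auto simp: perms_iff)
    let ?g = "%us. c us * of_rat (coef (shuffle_all us) (p @ ?m # q))"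
    have g: "?g ((?m # y) # ws) = (if y = q then c ((?m # q) # ws) * of_rat (coef (shuffle_all ws) p) else 0)"
     if us: "(?m # y) # ws \<in> forests S" for y ws
    proof (cases "length y < length q")
     case True
      show ?thesis using less.hyps[OF True us] by auto
    next
     case False
     have "concat ((?m # y) # ws) \<in> perms S" using us by (rule forests_perms)
     thus ?thesis using coef_shuffle_all_Cons w False by (auto simp: perms_iff)
    qed
    have "0 = sum ?g (forests S)" using outer.prems(2)[OF w] by simp
    also have "... = sum ?g ((#) (?m # q) ` forests ?R)"
    proof (intro sum.mono_neutral_right ballI finite_forests S)
     show "(#) (?m # q) ` forests ?R \<subseteq> forests S" using forests_ConsI[OF S False q(1,2)] by blast
     fix us assume us: "us \<in> forests S - (#) (?m # q) ` forests ?R"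
     then obtain y ws where "us = (?m # y) # ws" "ws \<in> forests (S - set (?m # y))" using forests_Cons[OF S False] by blast
     thus "?g us = 0" using g us by auto
    qed
    also have "... = (\<Sum>ws\<in>forests ?R. ?g ((?m # q) # ws))" by (rule sum.reindex_cong) auto
    also have "... = (\<Sum>ws\<in>forests ?R. c ((?m # q) # ws) * of_rat (coef (shuffle_all ws) p))"
     using g forests_ConsI[OF S False q(1,2)] by  auto
    finally show "(\<Sum>ws\<in>forests ?R. c ((?m # q) # ws) * of_rat (coef (shuffle_all ws) p)) = 0" ..
   qed (use S q in auto)
  qed
  thus ?thesis using forests_Cons[OF S False] outer.prems by metis
 qed
qed

text \<open>Expanded into rooted words, a vanishing combination of trees has vanishing word
  coefficients, to which \<open>forests_independent\<close> applies.\<close>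

lemma trees_independent:
 fixes c :: "nat list list => complex"
 assumes S: "finite S" "0 \<notin> S" and zero: "!!x. inj_on x (insert 0 S) ==> (\<Sum>us\<in>forests S. c us * tree x us) = 0"
  and us: "us \<in> forests S"
 shows "c us = 0"
proof (rule forests_independent[OF S(1) _ us])
 fix w assume w: "w \<in> perms S"
 show "(\<Sum>us\<in>forests S. c us * of_rat (coef (shuffle_all us) w)) = 0"
 proof (rule rooted_chain_independent[OF S _ w])
  fix x :: "nat => complex" assume x: "inj_on x (insert 0 S)"
  have "tree x us = (\<Sum>w\<in>perms S. of_rat (coef (shuffle_all us) w) * chain x (0 # w))" if "us \<in> forests S" for us
  proof -
   have d: "distinct (concat us)" "set (concat us) = S" using forests_perms[OF that] by (simp_all add: perms_iff)
   hence "tree x us = rooted x (shuffle_all us)" using rooted_shuffle_all x S by (simp only: not_False_eq_True)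
   thus ?thesis using lin_eval_superset[OF _ supp_shuffle_all] d by simp
  qed
  thus "(\<Sum>w\<in>perms S. (\<Sum>us\<in>forests S. c us * of_rat (coef (shuffle_all us) w)) * chain x (0 # w)) = 0"
   using zero[OF x] by (simp add: sum_distrib_left sum_distrib_right sum.swap[of _ "perms S"] mult.assoc)
 qed
qed

text \<open>The same triangularity solved for the extreme word: in the shuffle of
  \<open>?m # q\<close> with \<open>p\<close>, every other term has fewer letters before the least
  letter \<open>?m\<close>.\<close>

lemma bvec_in_forest_span:
 assumes "finite S" "w \<in> perms S"
 shows "bvec w \<in> qvec.span (shuffle_all ` forests S)"
 using assms
proof (induction "card S" arbitrary: S w rule: less_induct)
 case outer: less
 show ?case
 proof (cases "S = {}")
  case True
  thus ?thesis using outer.prems by (intro qvec.span_base) (simp add: shuffle_all_def)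
 next
  case False
  let ?m = "Min S" and ?V = "qvec.span (shuffle_all ` forests S)"
  have "bvec (p @ ?m # q) \<in> ?V" if "p @ ?m # q \<in> perms S" for p q using that
  proof (induction "length p" arbitrary: p q rule: less_induct)
   case (less p q)
   hence d: "S - set (?m # q) = set p" "distinct (?m # q)" "set q \<subseteq> S" "set p \<subset> S" "p \<in> perms (set p)" "set (?m # q) Int set p = {}"
    by (auto simp: perms_iff)
   have "word_shuffle (bvec (?m # q)) g \<in> ?V" if "g \<in> qvec.span (shuffle_all ` forests (set p))" for g using that
   proof (induction rule: qvec.span_induct_alt)
    case (step c x y)
    then obtain us where "x = shuffle_all us" "us \<in> forests (set p)" by blast
    hence "word_shuffle (bvec (?m # q)) x \<in> shuffle_all ` forests S" using forests_ConsI[OF outer.prems(1) False d(2,3)] unfolding d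
     by (intro image_eqI[of _ _ "(?m # q) # us"]) (simp_all add: shuffle_all_def)
    with step show ?case
     by (simp add: word_shuffle_def bilin_ext_add_right bilin_ext_scale_right qvec.span_add qvec.span_scale qvec.span_base)
   qed (simp add: word_shuffle_def qvec.span_zero)
   moreover have "bvec p \<in> qvec.span (shuffle_all ` forests (set p))"
    using outer.hyps[OF psubset_card_mono[OF outer.prems(1) d(4)] _ d(5)] by simp
   ultimately have "(\<Sum>v\<in>shuffles (?m # q) p. bvec v) \<in> ?V" by (fastforce simp: word_shuffle_def)
   moreover have "bvec v \<in> ?V" if v: "v \<in> shuffles (?m # q) p - {p @ ?m # q}" for v
   proof -
    have vS: "v \<in> perms S" using shuffles_perms[of "?m # q" "set (?m # q)" p "set p" v] v less.prems by (auto simp: perms_iff)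
    hence "?m \<in> set v" using outer.prems False by (simp add: perms_iff)
    then obtain p' q' where e: "v = p' @ ?m # q'" by (meson split_list)
    have "p' @ ?m # q' \<in> shuffles (?m # q) p" "distinct (p' @ ?m # q')" using v vS e by (auto simp: perms_iff)
    note s = shuffles_Cons_split[OF this d(6)]
    have "filter (%x. x \<notin> set q) q' ~= []"
    proof
     assume "filter (%x. x \<notin> set q) q' = []"
     hence "p = p'" "filter (%x. x \<in> set q) q' = q'" using s by (auto simp: filter_empty_conv)
     thus False using s v e by simp
    qed
    hence "length p' < length p" using arg_cong[OF s(2), of length] by simp
    thus ?thesis using less.hyps vS e by blast
   qed
   ultimately have "(\<Sum>v\<in>shuffles (?m # q) p. bvec v) - (\<Sum>v\<in>shuffles (?m # q) p - {p @ ?m # q}. bvec v) \<in> ?V"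
    by (rule qvec.span_diff[OF _ qvec.span_sum])
   thus ?case by (simp add: sum.remove[of _ "p @ ?m # q"] append_in_shuffles)
  qed
  moreover have "?m \<in> set w" using outer.prems False by (simp add: perms_iff)
  ultimately show ?thesis using outer.prems by (metis split_list)
 qed
qed

lemma forest_coordinates:
 assumes "finite S" "supp f \<subseteq> perms S"
 shows "EX c. supp c \<subseteq> forests S & f = lin_ext shuffle_all c"
proof -
 have "lin_ext bvec f \<in> qvec.span (shuffle_all ` forests S)" using assms bvec_in_forest_span by (intro lin_ext_in_span) blast
 thus ?thesis unfolding lin_ext_id by (rule span_image_lin_ext)
qed

lemma chain_shuffle_all_eq_0:
 assumes us: "distinct (concat us)" "[] \<notin> set us" "length us \<ge> 2" and x: "inj_on x (set (concat us))"
 shows "lin_eval (chain x) (shuffle_all us) = 0"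
proof -
 obtain u v us' where us': "us = u # v # us'" using us by (metis Suc_le_length_iff numeral_2_eq_2)
 have "lin_eval (chain x) (shuffle_all us) = lin_eval (%w. \<Sum>w'\<in>shuffles u w. chain x w') (shuffle_all (v # us'))"
  by (simp add: us' shuffle_all_def word_shuffle_def bilin_ext_def lin_eval_lin_ext lin_eval_sum)
 also have "... = lin_eval (%_. 0) (shuffle_all (v # us'))"
 proof (rule lin_eval_cong)
  fix w assume "w \<in> supp (shuffle_all (v # us'))"
  hence "w \<in> perms (set (concat (v # us')))" using supp_shuffle_all[of "v # us'"] us us' by auto
  hence w: "distinct w" "set w = set (concat (v # us'))" by (simp_all add: perms_iff)
  show "(\<Sum>w'\<in>shuffles u w. chain x w') = 0"
  proof (rule chain_shuffles_eq_0)
   show "distinct (u @ w)" using w us us' by auto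
   have "set (u @ w) = set (concat us)" using w us' by simp
   thus "inj_on x (set (u @ w))" using x by simp
   show "u ~= []" "w ~= []" using us us' w by auto
  qed
 qed
 also have "... = 0" by (simp add: lin_eval_def)
 finally show ?thesis .
qed

section \<open>The two patterns: Lyndon factors, and 1 followed by m\<close>

definition lyndon_pattern :: "nat => nat list list => bool" where
 "lyndon_pattern m us \<longleftrightarrow> us \<in> forests {1..m} & 2 <= length us"

definition heads :: "nat => nat list list => nat set" where
 "heads m us = hd ` set us"

lemma expand_eq_Nil: "composition k v m ==> valid_parts v b {1..k} ==> set u \<subseteq> {1..k} ==> expand v b u = [] \<longleftrightarrow> u = []"
proof (cases u)
 case (Cons i u')
 assume a: "composition k v m" "valid_parts v b {1..k}" "set u \<subseteq> {1..k}"
 hence "length (b i) = v i" "v i \<ge> 1" using valid_part Cons by (auto simp: composition_def)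
 thus ?thesis using Cons by (auto simp: expand_Cons)
qed simp

lemma hd_expand:
 assumes "composition k v m" "valid_parts v b {1..k}" "set u \<subseteq> {1..k}" "u ~= []"
 shows "hd (expand v b u) \<in> seg v (hd u)" "v (hd u) = 1 ==> hd (expand v b u) = off v (hd u) + 1"
proof -
 obtain i u' where u: "u = i # u'" using assms by (cases u) auto
 have i: "i \<in> {1..k}" using assms u by simp
 have "length (b i) = v i" "v i \<ge> 1" using valid_part assms i by (auto simp: composition_def)
 hence ne: "map ((+) (off v i)) (b i) ~= []" by auto
 hence h: "hd (expand v b u) = hd (map ((+) (off v i)) (b i))" by (simp add: u expand_Cons)
 hence 1: "hd (expand v b u) \<in> seg v i" using hd_in_set[OF ne] valid_part[OF assms(2) i] by simp
 thus "hd (expand v b u) \<in> seg v (hd u)" by (simp add: u)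
 show "hd (expand v b u) = off v (hd u) + 1" if "v (hd u) = 1" using 1 that by (simp add: u seg_def)
qed

text \<open>With two nonempty factors, none can use all letters. Contraction and expansion preserve
  the order of first letters because the segment of a head consists of one letter, so the head of an
  expanded factor is the start of its segment.\<close>

interpretation lyndon: pattern_family lyndon_pattern heads
proof
 fix m us assume X: "lyndon_pattern m us"
 thus cat: "concat us \<in> perms {1..m}" and ne: "[] \<notin> set us" by (auto simp: lyndon_pattern_def forests_def)
 obtain u v us' where us: "us = u # v # us'" using X by (metis Suc_le_length_iff lyndon_pattern_def numeral_2_eq_2)
 have "u ~= []" "v ~= []" using ne us by auto
 have "2 <= length (concat us)" using us \<open>u ~= []\<close> \<open>v ~= []\<close> by (cases u; cases v) auto
 thus "2 <= m" using cat distinct_card[of "concat us"] by (simp add: perms_iff)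
next
 fix m us u assume X: "lyndon_pattern m us" and u: "u \<in> set us" "{1..m} \<subseteq> set u"
 have cat: "distinct (concat us)" "set (concat us) = {1..m}" and ne: "[] \<notin> set us" "length us \<ge> 2"
  using X by (auto simp: lyndon_pattern_def forests_def perms_iff)
 obtain us1 us2 where us: "us = us1 @ u # us2" using split_list[OF u(1)] by blast
 have "set (concat us1) \<subseteq> set u" "set (concat us2) \<subseteq> set u" using cat u us by auto
 moreover have "set (concat us1) Int set u = {}" "set (concat us2) Int set u = {}" using cat us by auto
 ultimately have "set (concat us1) = {}" "set (concat us2) = {}" by (metis Int_absorb2)+
 hence "us1 = []" "us2 = []" using ne(1) us by (cases us1; cases us2; auto)+
 thus "1 \<in> heads m us & m \<in> heads m us" using ne us by simp
next
 fix k v m b us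
 assume comp: "composition k v m" and val: "valid_parts v b {1..k}" and cat: "concat us \<in> perms {1..k}"
  and ne: "[] \<notin> set us" and X: "lyndon_pattern m (map (expand v b) us)"
  and unm: "!!i. i \<in> {1..k} ==> v i > 1 ==> seg v i Int heads m (map (expand v b) us) = {}"
 have su: "set u \<subseteq> {1..k}" "u ~= []" "hd u \<in> {1..k}" if "u \<in> set us" for u
 proof -
  show s: "set u \<subseteq> {1..k}" "u ~= []" using cat that ne by (auto simp: perms_iff)
  thus "hd u \<in> {1..k}" by force
 qed
 have v1: "v (hd u) = 1" if u: "u \<in> set us" for u
 proof -
  have "hd (expand v b u) \<in> seg v (hd u)" by (rule hd_expand[OF comp val su(1,2)[OF u]])
  hence "~ v (hd u) > 1" using unm[OF su(3)] u by (auto simp: heads_def)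
  moreover have "v (hd u) \<ge> 1" using comp su[OF u] by (auto simp: composition_def)
  ultimately show ?thesis by simp
 qed
 have hd_eq: "hd (expand v b u) = off v (hd u) + 1" if u: "u \<in> set us" for u by (rule hd_expand(2)[OF comp val su(1,2)[OF u] v1[OF u]])
 have "hd u <= i" if u: "u \<in> set us" and i: "i \<in> set u" for u i
 proof (rule ccontr)
  assume "~ hd u <= i"
  hence lt: "i < hd u" by simp
  have ik: "i \<in> {1..k}" using su[OF u] i by auto
  have valu: "valid_parts v b (set u)" using val su[OF u] by (auto simp: valid_parts_def)
  have "off v i + 1 \<in> set (expand v b u)" using set_expand[OF valu] part_nonempty[OF comp ik] i by auto
  hence "hd (expand v b u) <= off v i + 1" using X u by (auto simp: lyndon_pattern_def forests_def)
  moreover have "off v i + 1 < off v (hd u) + 1"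
   using part_less[of i] ik lt part_nonempty[OF comp ik] part_nonempty[OF comp su(3)[OF u]] by auto
  ultimately show False using hd_eq[OF u] by simp
 qed
 moreover have "sorted_wrt (<) (map hd us)"
 proof -
  have "sorted_wrt (<) (map hd (map (expand v b) us))" using X by (simp add: lyndon_pattern_def forests_def)
  hence "sorted_wrt (%u u'. hd (expand v b u) < hd (expand v b u')) us" by (simp add: sorted_wrt_map)
  hence "sorted_wrt (%u u'. hd u < hd u') us"
  proof (rule sorted_wrt_mono_rel[rotated])
   fix u u' assume u: "u \<in> set us" "u' \<in> set us" "hd (expand v b u) < hd (expand v b u')"
   hence "off v (hd u) < off v (hd u')" using hd_eq by simp
   thus "hd u < hd u'" using off_mono[of "hd u'" "hd u" v] by cases auto
  qed
  thus ?thesis by (simp add: sorted_wrt_map)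
 qed
 ultimately have "lyndon_pattern k us" using X cat by (auto simp: lyndon_pattern_def forests_def)
 thus "lyndon_pattern k us & (\<forall>i\<in>heads k us. v i = 1)" using v1 by (auto simp: heads_def)
next
 fix k v m b us
 assume comp: "composition k v m" and val: "valid_parts v b {1..k}" and X: "lyndon_pattern k us"
  and h1: "\<forall>i\<in>heads k us. v i = 1"
 have cat: "concat us \<in> perms {1..k}" and ne: "[] \<notin> set us" using X by (auto simp: lyndon_pattern_def forests_def)
 have su: "set u \<subseteq> {1..k}" "u ~= []" "hd u \<in> {1..k}" if "u \<in> set us" for u
 proof -
  show s: "set u \<subseteq> {1..k}" "u ~= []" using cat that ne by (auto simp: perms_iff)
  thus "hd u \<in> {1..k}" by force
 qed
 have hd_eq: "hd (expand v b u) = off v (hd u) + 1" if u: "u \<in> set us" for u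
  by (rule hd_expand[OF comp val su(1,2)]) (use h1 u in "auto simp: heads_def")
 have "hd (expand v b u) <= i" if u: "u \<in> set us" and i: "i \<in> set (expand v b u)" for u i
 proof -
  have valu: "valid_parts v b (set u)" using val su[OF u] by (auto simp: valid_parts_def)
  obtain j where j: "j \<in> set u" "i \<in> seg v j" using i set_expand[OF valu] by auto
  have "hd u <= j" using X u j by (auto simp: lyndon_pattern_def forests_def)
  hence "off v (hd u) <= off v j" by (rule off_mono)
  thus ?thesis using hd_eq[OF u] j by (auto simp: seg_def)
 qed
 moreover have "sorted_wrt (<) (map hd (map (expand v b) us))"
 proof -
  have "sorted_wrt (%u u'. hd u < hd u') us" using X by (simp add: lyndon_pattern_def forests_def sorted_wrt_map)
  hence "sorted_wrt (%u u'. hd (expand v b u) < hd (expand v b u')) us"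
  proof (rule sorted_wrt_mono_rel[rotated])
   fix u u' assume u: "u \<in> set us" "u' \<in> set us" "hd u < hd u'"
   hence "off v (hd u) + v (hd u) <= off v (hd u')" using su by (intro off_less) auto
   moreover have "v (hd u) = 1" using h1 u by (auto simp: heads_def)
   ultimately show "hd (expand v b u) < hd (expand v b u')" using hd_eq u by simp
  qed
  thus ?thesis by (simp add: sorted_wrt_map)
 qed
 moreover have "concat (map (expand v b) us) \<in> perms {1..m}" unfolding concat_expand by (rule expand_perms[OF comp cat val])
 moreover have "expand v b u ~= []" if "u \<in> set us" for u using expand_eq_Nil[OF comp val] su[OF that] by simp
 ultimately show "lyndon_pattern m (map (expand v b) us)" using X by (auto simp: lyndon_pattern_def forests_def)
qed

text \<open>Insertion words have one factor, so the list is a singleton.\<close>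

definition adjacent_pattern :: "nat => nat list list => bool" where
 "adjacent_pattern m us \<longleftrightarrow> 2 <= m & (EX w. us = [w] & w \<in> perms {1..m} & sublist [1, m] w)"

definition end_marks :: "nat => nat list list => nat set" where
 "end_marks m us = {1, m}"

lemma composition_ends:
 assumes "composition k v m" "v 1 = 1" "v k = 1" "k \<ge> 1"
 shows "off v 1 = 0" "off v k + 1 = m"
 using assms off_Suc composition_off[of k v] by simp_all

text \<open>With marks at both ends, the first and last segments are {1} and {m}. The neighbours 1
  and \<open>m\<close> of the expanded word thus come from neighbours 1 and \<open>k\<close>, and
  conversely.\<close>

interpretation adjacent: pattern_family adjacent_pattern end_marks
proof
 fix m us assume X: "adjacent_pattern m us"
 thus "concat us \<in> perms {1..m}" "2 <= m" "[] \<notin> set us" by (auto simp: adjacent_pattern_def)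
 show "1 \<in> end_marks m us & m \<in> end_marks m us" by (simp add: end_marks_def)
next
 fix k v m b us
 assume comp: "composition k v m" and val: "valid_parts v b {1..k}" and cat: "concat us \<in> perms {1..k}"
  and ne: "[] \<notin> set us" and X: "adjacent_pattern m (map (expand v b) us)"
  and unm: "!!i. i \<in> {1..k} ==> v i > 1 ==> seg v i Int end_marks m (map (expand v b) us) = {}"
 have m: "2 <= m" using X by (simp add: adjacent_pattern_def)
 obtain u where us: "us = [u]" "sublist [1, m] (expand v b u)" using X by (auto simp: adjacent_pattern_def)
 have u: "u \<in> perms {1..k}" using cat us by simp
 have k1: "k \<ge> 1" using ccontr comp m by (force simp: composition_def)
 have vpos: "v i \<ge> 1" if "i \<in> {1..k}" for i using comp that by (simp add: composition_def)
 have "1 \<in> seg v 1" using vpos k1 by (simp add: seg_def)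
 hence "~ v 1 > 1" using unm k1 by (auto simp: end_marks_def)
 hence v1: "v 1 = 1" using vpos[of 1] k1 by simp
 have "m \<in> seg v k" using vpos k1 off_Suc composition_off[OF comp] by (auto simp: seg_def)
 hence "~ v k > 1" using unm k1 by (auto simp: end_marks_def)
 hence vk: "v k = 1" using vpos[of k] k1 by simp
 note ends = composition_ends[OF comp v1 vk k1]
 have k2: "k \<ge> 2"
 proof (rule ccontr)
  assume "~ k \<ge> 2"
  hence "k = 1" using k1 by simp
  thus False using ends m by simp
 qed
 have "b 1 \<in> perms {1..v 1}" using val k1 by (simp add: valid_parts_def)
 hence b1: "b 1 = [1]" using v1 by simp
 have "1 \<in> set u" using u k1 by (simp add: perms_iff)
 then obtain x y where xy: "u = x @ 1 # y" by (meson split_list)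
 have y: "distinct u" "set y \<subseteq> {1..k}" "1 \<notin> set y" "1 \<notin> set x" "set x \<subseteq> {1..k}" using u xy by (auto simp: perms_iff)
 obtain P Q where PQ: "expand v b u = P @ 1 # m # Q" using us by (auto simp: sublist_pair_iff)
 have ex: "expand v b u = expand v b x @ 1 # expand v b y" using b1 by (simp add: xy expand_append expand_Cons)
 have dis: "distinct (expand v b u)" using expand_perms[OF comp u val] by (simp add: perms_iff)
 have "expand v b x = P & expand v b y = m # Q"
 proof -
  have "1 \<notin> set P" "1 \<notin> set (expand v b x)" using dis[unfolded PQ] dis[unfolded ex] by auto
  thus ?thesis using ex PQ by (metis append_Cons_eq_iff dis distinct.simps distinct_append)
 qed
 hence ey: "expand v b y = m # Q" by simp
 hence "y ~= []" by auto
 then obtain j y' where j: "y = j # y'" by (cases y) auto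
 have "m \<in> seg v j" using hd_expand[OF comp val y(2)] ey j by simp
 hence "j = k" using part_unique \<open>m \<in> seg v k\<close> j y by auto
 hence "sublist [1, k] u" using xy j by (auto simp: sublist_pair_iff)
 hence "adjacent_pattern k us" using u us k2 by (auto simp: adjacent_pattern_def)
 thus "adjacent_pattern k us & (\<forall>i\<in>end_marks k us. v i = 1)" using v1 vk by (simp add: end_marks_def)
next
 fix k v m b us
 assume comp: "composition k v m" and val: "valid_parts v b {1..k}" and X: "adjacent_pattern k us"
  and h1: "\<forall>i\<in>end_marks k us. v i = 1"
 obtain u where u: "us = [u]" "u \<in> perms {1..k}" "sublist [1, k] u" and k: "2 <= k" using X by (auto simp: adjacent_pattern_def)
 have v1: "v 1 = 1" "v k = 1" using h1 by (auto simp: end_marks_def)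
 have k1: "k \<ge> 1" using k by simp
 note ends = composition_ends[OF comp v1 k1]
 have "b 1 \<in> perms {1..v 1}" "b k \<in> perms {1..v k}" using val k1 by (simp_all add: valid_parts_def)
 hence b1: "b 1 = [1]" "b k = [1]" using v1 by simp_all
 obtain x y where "u = x @ 1 # k # y" using u by (auto simp: sublist_pair_iff)
 hence "expand v b u = expand v b x @ 1 # m # expand v b y" using b1 ends by (simp add: expand_append expand_Cons)
 hence "sublist [1, m] (expand v b u)" by (auto simp: sublist_pair_iff)
 moreover have "2 <= m" using ends off_less[of 1 k v] v1 k by simp
 ultimately show "adjacent_pattern m (map (expand v b) us)" using expand_perms[OF comp u(2) val] u by (simp add: adjacent_pattern_def)
qed

section \<open>Vanishing slices in words and in forests\<close>

lemma sum_perms_rooted: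
 fixes g :: "'a list => complex"
 assumes h: "r \<notin> T" "!!u. u \<in> perms (insert r T) ==> g u ~= 0 ==> hd u = r"
 shows "(\<Sum>u\<in>perms (insert r T). g u) = (\<Sum>u\<in>perms T. g (r # u))"
proof -

 have "sum g (perms (insert r T)) = sum g ((#) r ` perms T)"
 proof (intro sum.mono_neutral_right)
  show "(#) r ` perms T \<subseteq> perms (insert r T)" using h by (auto simp: perms_iff)
  show "\<forall>i\<in>perms (insert r T) - (#) r ` perms T. g i = 0"
  proof
   fix u assume u: "u \<in> perms (insert r T) - (#) r ` perms T"
   show "g u = 0"
   proof (rule ccontr)
    assume "g u ~= 0"
    hence "hd u = r" using h u by blast
    moreover have "u ~= []" using u by (auto simp: perms_iff)
    ultimately obtain u' where "u = r # u'" by (cases u) auto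
    thus False using u h perms_remove[of u "insert r T" "[]"] by auto
   qed
  qed
 qed auto
 thus ?thesis by (simp add: sum.reindex)
qed

text \<open>Words with a common first letter are rooted words; their root is one of the letters
  instead of 0.\<close>

lemma hd_chain_independent:
 fixes g :: "'a list => complex"
 assumes I: "finite I" "r \<in> I" and supp: "!!u. u \<in> perms I ==> g u ~= 0 ==> hd u = r"
  and null: "!!x. inj_on x I ==> (\<Sum>u\<in>perms I. g u * chain x u) = 0" and u: "u \<in> perms I"
 shows "g u = 0"
proof (rule ccontr)
 assume nz: "g u ~= 0"
 have Ir: "insert r (I - {r}) = I" using I by auto
 have "u ~= []" using u I by (auto simp: perms_iff)
 then obtain u' where u': "u = r # u'" using supp[OF u nz] by (cases u) auto
 have "g (r # u') = 0"
 proof (rule rooted_chain_independent[where S="I - {r}" and r=r and w=u' and c="%w. g (r # w)"])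
  fix x :: "'a => complex" assume "inj_on x (insert r (I - {r}))"
  hence "(\<Sum>u\<in>perms I. g u * chain x u) = 0" using null by simp
  thus "(\<Sum>u\<in>perms (I - {r}). g (r # u) * chain x (r # u)) = 0"
   using sum_perms_rooted[of r "I - {r}" "%u. g u * chain x u"] supp Ir by auto
 qed (use I u u' perms_remove[of u I "[]" r u'] in auto)
 thus False using nz u' by simp
qed

lemma null_on_rooted:
 assumes I: "finite I" "r \<in> I" and null: "null_on I g"
  and supp: "!!u. u \<in> perms I ==> g u ~= 0 ==> hd u = r" and u: "u \<in> perms I"
 shows "g u = 0"
 using hd_chain_independent[OF I, of "%u. of_rat (g u)"] supp null u by (simp add: null_on_def)

lemma collidable_extend:
 assumes "inj_on z (insert a (T - A))" "a \<in> A" "inj_on s A"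
 shows "collidable A (%i. if i \<in> A then z a else z i) s T" using assms by (auto simp: collidable_def inj_on_def)

text \<open>A function given in both bases has one residue along the interval. For fixed bubble
  positions \<open>s\<close> it is a combination of rooted words on the contracted alphabet and also
  one of trees; both families are independent, so the vanishing of either set of coefficients means
  that the residue is zero.\<close>

lemma slices_iff_array_slices:
 assumes c: "supp c \<subseteq> forests {1..m}" and pq: "1 <= p" "p < q" "q <= m"
 shows "(\<forall>w\<in>perms (insert p ({1..m} - {p..q})). null_on {p..q} (%u. coef (lin_ext shuffle_all c) (subst1 p u w))) \<longleftrightarrow>
  (ALL us. concat us \<in> perms (insert p ({1..m} - {p..q})) --> null_on {p..q} (%u. coef c (map (subst1 p u) us)))"
proof -
 let ?S = "{1..m}" let ?A = "{p..q}" let ?S' = "insert p (?S - ?A)"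
 define f where "f = lin_ext shuffle_all c"
 let ?L = "%(s :: nat => complex) z. \<Sum>w\<in>perms ?S'. (\<Sum>u\<in>perms ?A. of_rat (coef f (subst1 p u w)) * chain s u) * chain z (0 # w)"
 let ?R = "%(s :: nat => complex) z. \<Sum>us\<in>forests ?S'. (\<Sum>b\<in>perms ?A. of_rat (coef c (map (subst1 p b) us)) * chain s b) * tree z us"
 have S: "finite ?S" "0 \<notin> ?S" "?A \<subseteq> ?S" "?A ~= {}" "p \<in> ?A" using pq by auto
 have minA: "Min ?A = p" using pq by (intro Min_eqI) auto
 have S': "finite ?S'" "0 \<notin> ?S'" using pq by auto
 have cat: "distinct (concat us)" "set (concat us) = ?S" if "us \<in> forests ?S" for us using that by (simp_all add: forests_def perms_iff)
 have sf: "supp f \<subseteq> perms ?S" unfolding f_def by (rule supp_lin_ext_shuffle_all[OF c])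
 have rf: "(\<Sum>w\<in>perms ?S. of_rat (coef f w) * chain x (0 # w)) = (\<Sum>us\<in>forests ?S. of_rat (coef c us) * tree x us)"
  if x: "inj_on x (insert 0 ?S)" for x
 proof -
  have "(\<Sum>w\<in>perms ?S. of_rat (coef f w) * chain x (0 # w)) = rooted x f" using lin_eval_superset[OF _ sf] by simp
  also have "... = lin_eval (%us. rooted x (shuffle_all us)) c" by (simp add: f_def lin_eval_lin_ext)
  also have "... = lin_eval (tree x) c"
  proof (rule lin_eval_cong)
   fix us assume "us \<in> supp c"
   hence us: "us \<in> forests ?S" using c by blast
   show "rooted x (shuffle_all us) = tree x us" by (rule rooted_shuffle_all) (use cat[OF us] x S in "simp_all only: not_False_eq_True")
  qed
  also have "... = (\<Sum>us\<in>forests ?S. of_rat (coef c us) * tree x us)" using lin_eval_superset[OF finite_forests c] by simp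
  finally show ?thesis .
 qed
 have ifc: "(if map (subst1 p b) us \<in> forests ?S then (of_rat (coef c (map (subst1 p b) us)) :: complex) else 0) =
   of_rat (coef c (map (subst1 p b) us))" for b us using c by (auto simp: in_keys_iff)
 \<comment> \<open>Both sides are the limit of the same rescaled form along one collision
   path.\<close>
 have key: "?L s z = ?R s z"
  if z: "inj_on z (insert 0 ?S')" and s: "inj_on s ?A" for z s
 proof -
  define z' where "z' i = (if i \<in> ?A then z p else z i)" for i
  let ?T = "%e. e ^ (card ?A - 1) * (\<Sum>us\<in>forests ?S. of_rat (coef c us) * tree (collide ?A z' s e) us)"
  have z'z: "z' i = z i" if "i \<in> insert 0 ?S'" for i using that by (auto simp: z'_def)
  have "inj_on z (insert p (insert 0 ?S - ?A))" using z by (rule inj_on_subset) auto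
  hence col: "collidable ?A z' s (insert 0 ?S)" unfolding z'_def using S(5) s by (rule collidable_extend)
  have col': "collidable ?A z' s (set [0] Un ?S Un set [])" using col by simp
  obtain H where H: "H field_differentiable (at 0)"
   "H 0 = (\<Sum>w\<in>perms ?S'. \<Sum>u\<in>perms ?A. of_rat (coef f (subst1 p u w)) * chain s u * chain z' ([0] @ w @ []))"
   "!!e. e ~= 0 ==> H e = e ^ (card ?A - 1) * (\<Sum>w\<in>perms ?S. of_rat (coef f w) * chain (collide ?A z' s e) ([0] @ w @ []))"
   using residue_sum[OF S(1,3,5) col', of "%w. of_rat (coef f w)"] by auto
  have "(H \<longlongrightarrow> H 0) (at 0)" using field_differentiable_imp_continuous_at[OF H(1)] by (simp add: continuous_at)
  moreover have "eventually (%e. H e = ?T e) (at 0)"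
  proof -
   have "eventually (%e. inj_on (collide ?A z' s e) (insert 0 ?S)) (at 0)" using collide_inj[OF _ col] by simp
   moreover have "eventually (%e::complex. e ~= 0) (at 0)" by (simp add: eventually_at_filter)
   ultimately show ?thesis
   proof eventually_elim
    case (elim e)
    show ?case using H(3)[OF elim(2)] rf[OF elim(1)] by simp
   qed
  qed
  ultimately have "(?T \<longlongrightarrow> H 0) (at 0)" by (rule Lim_transform_eventually)
  from tendsto_unique[OF _ this forest_residue[OF S(1-4) col]]
  have "H 0 = ?R s z'" unfolding minA ifc by simp
  also have "... = ?R s z"
  proof (intro sum.cong refl arg_cong2[of _ _ _ _ "(*)"])
   fix us assume us: "us \<in> forests ?S'"
   show "tree z' us = tree z us" unfolding tree_def
   proof (intro arg_cong[of _ _ prod_list] map_cong refl chain_cong z'z)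
    fix u i assume "u \<in> set us" "i \<in> set (0 # u)"
    moreover have "set (concat us) = ?S'" using us by (simp add: forests_def perms_iff)
    ultimately show "i \<in> insert 0 ?S'" by auto
   qed
  qed
  finally
  moreover have "H 0 = ?L s z" unfolding H(2) sum_distrib_right
  proof (intro sum.cong refl)
   fix w u assume w: "w \<in> perms ?S'"
   have "chain z' (0 # w) = chain z (0 # w)" by (rule chain_cong, rule z'z) (use w in "auto simp: perms_iff")
   thus "of_rat (coef f (subst1 p u w)) * chain s u * chain z' ([0] @ w @ []) =
    of_rat (coef f (subst1 p u w)) * chain s u * chain z (0 # w)" by simp
  qed
  ultimately show ?thesis by simp
 qed
 show ?thesis unfolding f_def[symmetric]
 proof
  assume L: "\<forall>w\<in>perms ?S'. null_on ?A (%u. coef f (subst1 p u w))"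
  show "ALL us. concat us \<in> perms ?S' --> null_on ?A (%u. coef c (map (subst1 p u) us))"
  proof (intro allI impI)
   fix us assume us: "concat us \<in> perms ?S'"
   show "null_on ?A (%u. coef c (map (subst1 p u) us))"
   proof (cases "us \<in> forests ?S'")
    case True
    show ?thesis unfolding null_on_def
    proof (intro allI impI)
     fix s :: "nat => complex" assume s: "inj_on s ?A"
     show "(\<Sum>b\<in>perms ?A. of_rat (coef c (map (subst1 p b) us)) * chain s b) = 0"
     proof (rule trees_independent[OF S' _ True])
      fix z :: "nat => complex" assume z: "inj_on z (insert 0 ?S')"
      have "?L s z = 0" using L s by (auto simp: null_on_def)
      thus "?R s z = 0" using key[OF z s] by simp
     qed
    qed
   next
    case False
    \<comment> \<open>A contracted list that is not a forest has no forest among its expansions, by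
      \<open>forest_contract\<close>, so its slice is zero for trivial reasons.\<close>
    have "coef c (map (subst1 p b) us) = 0" if b: "b \<in> perms ?A" for b
    proof (rule ccontr)
     assume "coef c (map (subst1 p b) us) ~= 0"
     hence F: "map (subst1 p b) us \<in> forests ?S" using c by (auto simp: in_keys_iff)
     have "p \<in> set (concat us)" using us by (simp add: perms_iff)
     then obtain w where w: "w \<in> set us" "p \<in> set w" by auto
     obtain us1 us2 where 1: "us = us1 @ w # us2" using split_list[OF w(1)] by blast
     obtain x y where 2: "w = x @ p # y" using split_list[OF w(2)] by blast
     have dis: "distinct (concat us)" using us by (simp add: perms_iff)
     have n: "p \<notin> set (concat us1)" "p \<notin> set x" "p \<notin> set y" "p \<notin> set (concat us2)" using dis 1 2 by auto
     have "map (subst1 p b) us1 = us1" "map (subst1 p b) us2 = us2" using n by (auto intro!: map_idI)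
     hence "map (subst1 p b) us = us1 @ (x @ b @ y) # us2" using n by (simp add: 1 2)
     hence "us1 @ (x @ p # y) # us2 \<in> forests ?S'" using forest_contract[of us1 x b y us2 ?S ?A] F b S minA by (simp add: perms_iff)
     thus False using False 1 2 by simp
    qed
    hence "null_on ?A (%u. coef c (map (subst1 p u) us)) \<longleftrightarrow> null_on ?A (%_. 0)" by (intro null_on_cong)
    thus ?thesis using null_on_0 by simp
   qed
  qed
 next
  assume R: "ALL us. concat us \<in> perms ?S' --> null_on ?A (%u. coef c (map (subst1 p u) us))"
  show "\<forall>w\<in>perms ?S'. null_on ?A (%u. coef f (subst1 p u w))"
  proof
   fix w assume w: "w \<in> perms ?S'"
   show "null_on ?A (%u. coef f (subst1 p u w))" unfolding null_on_def
   proof (intro allI impI)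
    fix s :: "nat => complex" assume s: "inj_on s ?A"
    show "(\<Sum>u\<in>perms ?A. of_rat (coef f (subst1 p u w)) * chain s u) = 0"
    proof (rule rooted_chain_independent[OF S' _ w])
     fix z :: "nat => complex" assume z: "inj_on z (insert 0 ?S')"
     have "?R s z = 0" using R s forests_perms by (auto simp: null_on_def)
     thus "?L s z = 0" using key[OF z s] by simp
    qed
   qed
  qed
 qed
qed

section \<open>The Lyndon insertion shuffles as a basis\<close>

abbreviation lyndon_shuffles :: "nat => word_comb set" where
 "lyndon_shuffles m \<equiv> Collect (lyndon_insertion_shuffle m)"

lemma simple_word_iff_convergent:
 assumes "length u < k"
 shows "simple_word k u \<longleftrightarrow> convergent_word {1..k} u" using sublist_length_le assms by (force simp: simple_word_def convergent_word_def)

lemma lyndon_word_iff: "lyndon_word u \<longleftrightarrow> u ~= [] & distinct u & (\<forall>i\<in>set u. hd u <= i)"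
proof -
 have "hd u = Min (set u) \<longleftrightarrow> (\<forall>i\<in>set u. hd u <= i)" if "u ~= []"
  using hd_in_set[OF that] by (auto intro: Min_eqI[symmetric])
 thus ?thesis unfolding lyndon_word_def by blast
qed

text \<open>The rooted form of a shuffle product is a product of complex numbers, which does not
  depend on the order of the factors.\<close>

lemma shuffle_all_mset:
 assumes m: "mset us = mset us'" and d: "distinct (concat us)" "0 \<notin> set (concat us)"
 shows "shuffle_all us = shuffle_all us'"
proof -
 let ?S = "set (concat us)"
 have "mset (concat us) = mset (concat us')" using arg_cong[OF m, of "%M. sum_mset (image_mset mset M)"]
  by (simp add: mset_concat sum_mset_sum_list flip: mset_map)
 from mset_eq_imp_distinct_iff[OF this] mset_eq_setD[OF this] d
 have d': "distinct (concat us')" "set (concat us') = ?S" by auto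
 have "shuffle_all us - shuffle_all us' = 0"
 proof (rule rooted_eq_0D[OF finite_set d(2)])
  show "supp (shuffle_all us - shuffle_all us') \<subseteq> perms ?S"
   using keys_diff[of "shuffle_all us"] supp_shuffle_all[OF d(1)] supp_shuffle_all[OF d'(1)] unfolding d' by blast
  fix x :: "nat => complex" assume x: "inj_on x (insert 0 ?S)"
  have "tree x us = tree x us'" using arg_cong[OF m, of "%M. prod_mset (image_mset (%u. chain x (0 # u)) M)"]
   by (simp add: tree_def prod_mset_prod_list flip: mset_map)
  thus "rooted x (shuffle_all us - shuffle_all us') = 0"
   using rooted_shuffle_all rooted_shuffle_all[OF d'(1)] d x unfolding d' by (simp add: lin_eval_diff)
 qed
 thus ?thesis by simp
qed

text \<open>A convergent Lyndon shuffle may list its factors in any order, whereas the forests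
 list them by increasing first letter.\<close>

lemma insertion_shuffle_sort:
 assumes comp: "composition k v m" and c: "!!i. i \<in> {1..k} ==> supp (c i) \<subseteq> perms {1..v i}"
  and us: "concat us \<in> perms {1..k}" "concat us' \<in> perms {1..k}" "mset us' = mset us"
 shows "foldr word_shuffle (map (insert_word v c) us) (bvec []) = foldr word_shuffle (map (insert_word v c) us') (bvec [])"
proof -
 have cat: "distinct (concat us)" "distinct (concat us')" "set (concat us) = {1..k}" "set (concat us') = {1..k}"
  using us by (simp_all only: perms_iff)
 have "shuffle_all (map (expand v b) us) = shuffle_all (map (expand v b) us')" if "b \<in> PiE {1..k} (%i. supp (c i))" for b
 proof -
  have "valid_parts v b {1..k}" using that c unfolding valid_parts_def by blast
  hence "concat (map (expand v b) us) \<in> perms {1..m}" unfolding concat_expand by (rule expand_perms[OF comp us(1)])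
  thus ?thesis using us by (intro shuffle_all_mset) (simp_all only: perms_iff mset_map, simp)
 qed
 thus ?thesis unfolding shuffle_insert_words[OF cat(1)] shuffle_insert_words[OF cat(2)] tensor_array_def cat
  by (simp add: lin_ext_sum lin_ext_qscale)
qed

text \<open>Sorting the factors turns a convergent Lyndon shuffle into a skeleton: each factor is
  shorter than \<open>k\<close>, so convergence is simplicity. The base clause is the skeleton [[1],
  [2]], the only one with two letters.\<close>

lemma lyndon_shuffles_insertions:
 assumes m: "2 <= m" and L: "!!j f. 2 <= j ==> j < m ==> f \<in> lyndon_shuffles j ==> f \<in> null_slices j"
 shows "lyndon_shuffles m = lin_ext shuffle_all ` lyndon.insertions lyndon_shuffles m"
proof
 have pair: "lin_ext shuffle_all (tensor_array v c [[1], [2]]) = word_shuffle (bvec [1]) (bvec [2])"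
  if v: "v 1 = 1" "v 2 = 1" and c: "c 1 = bvec [1]" "c 2 = bvec [1]" for v c
 proof -
  have "(\<Sum>h=Suc 0..<2. v h) = Suc 0" using v by (simp add: numeral_2_eq_2)
  hence "insert_word v c [1] = bvec [1]" "insert_word v c [2] = bvec [2]"
   using c by (simp_all add: insert_word_def word_concat_def numeral_2_eq_2)
  thus ?thesis using shuffle_insert_words[of "[[1], [2]]" v c] by (simp add: word_shuffle_def)
 qed
 show "lyndon_shuffles m \<subseteq> lin_ext shuffle_all ` lyndon.insertions lyndon_shuffles m"
 proof
  fix f assume "f \<in> lyndon_shuffles m"
  hence "lyndon_insertion_shuffle m f" by simp
  thus "f \<in> lin_ext shuffle_all ` lyndon.insertions lyndon_shuffles m"
  proof cases
   case two
   let ?us = "[[1], [2::nat]]"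
   have "lyndon.skeleton m 2 (%_. 1) ?us"
    using two by (auto simp: lyndon.skeleton_def composition_def lyndon_pattern_def forests_def perms_iff simple_word_def)
   moreover have "lyndon.filling lyndon_shuffles 2 (%_. 1) (%_. bvec [1])" by (simp add: lyndon.filling_def)
   ultimately have "tensor_array (%_. 1) (%_. bvec [1]) ?us \<in> lyndon.insertions lyndon_shuffles m"
    unfolding lyndon.insertions_def by blast
   thus ?thesis using pair[of "%_. 1" "%_. bvec [1]"] two by force
  next
   case (insertion k us v c)
   note I = insertion
   let ?us = "sort_key hd us"
   have comp: "composition k v m" using I(5,6) by (simp add: composition_def)
   have fac: "length us \<ge> 2" "concat us \<in> perms {1..k}" "!!u. u \<in> set us ==> lyndon_word u"
    "!!u. u \<in> set us ==> convergent_word {1..k} u" using I(4) by (auto simp: convergent_lyndon_factors_def perms_iff)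
   have ne: "[] \<notin> set us" using fac(3) by (auto simp: lyndon_word_def)
   have "removeAll [] us = us" using ne by simp
   hence dus: "distinct us" using fac(2) by (auto simp: perms_iff distinct_concat_iff)
   have sdis: "set u Int set u' = {}" if "u \<in> set us" "u' \<in> set us" "u ~= u'" for u u'
    using fac(2) that by (auto simp: perms_iff distinct_concat_iff)
   have ls: "length ?us = length us" "set ?us = set us" "distinct ?us" using dus by simp_all
   have hdu: "hd u ~= hd u'" if "u \<in> set us" "u' \<in> set us" "u ~= u'" for u u'
    using sdis[OF that] that ne by (metis disjoint_iff hd_in_set)
   have cat: "concat ?us \<in> perms {1..k}"
   proof -
    have "distinct (concat ?us)"
    proof (rule distinct_concat[OF ls(3)])
     show "distinct u" if "u \<in> set ?us" for u using fac(3) that by (auto simp: lyndon_word_def)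
     show "set u Int set u' = {}" if "u \<in> set ?us" "u' \<in> set ?us" "u ~= u'" for u u' using sdis that by simp
    qed
    moreover have "set (concat ?us) = set (concat us)" by simp
    ultimately show ?thesis using fac(2) by (simp add: perms_iff)
   qed
   have sorted: "sorted_wrt (<) (map hd ?us)"
   proof -
    have "distinct (map hd ?us)" using hdu ls(3) by (auto simp: distinct_map inj_on_def)
    thus ?thesis by (simp add: strict_sorted_iff)
   qed
   have lp: "lyndon_pattern k ?us" using cat sorted fac(1,3) ls unfolding lyndon_pattern_def forests_def by (auto simp: lyndon_word_iff)
   have "simple_word k u" if u: "u \<in> set ?us" for u
   proof -
    have "~ {1..k} \<subseteq> set u"
    proof
     assume sub: "{1..k} \<subseteq> set u"
     hence "heads k ?us = hd ` set us" "length us \<ge> 2" using fac(1) by (simp_all add: heads_def)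
     obtain u' where u': "u' \<in> set us" "u' ~= u"
      using fac(1) dus u by (metis (no_types, lifting) One_nat_def Suc_1 Suc_le_eq card_eq_0_iff card_le_Suc0_iff_eq distinct_card finite_set linorder_not_less set_sort)
     hence "set u' \<subseteq> {1..k}" using fac(2) by (auto simp: perms_iff)
     hence "set u' \<subseteq> set u" using sub by simp
     thus False using sdis[OF u'(1)] u u' ne by (metis Int_absorb2 set_empty2 set_sort)
    qed
    moreover have "distinct u" "set u \<subseteq> {1..k}" using lyndon.X_word[OF lp u] by simp_all
    ultimately have "card (set u) < card {1..k}" by (intro psubset_card_mono) auto
    hence "length u < k" using \<open>distinct u\<close> distinct_card[of u] by simp
    thus ?thesis using simple_word_iff_convergent fac(4) u by simp
   qed
   hence sk: "lyndon.skeleton m k v ?us" using comp lp I(7) by (simp add: lyndon.skeleton_def heads_def)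
   have fill: "lyndon.filling lyndon_shuffles k v c" using I(8) by (simp add: lyndon.filling_def)
   have cs: "supp (c i) \<subseteq> perms {1..v i}" if "i \<in> {1..k}" for i
    using lyndon.skeleton_supp(1)[OF sk fill L that] by (simp add: null_slices_def)
   have "f = foldr word_shuffle (map (insert_word v c) ?us) (bvec [])"
    unfolding I(1) by (rule insertion_shuffle_sort[OF comp cs fac(2) cat]) simp_all
   also have "... = lin_ext shuffle_all (tensor_array v c ?us)" using cat by (intro shuffle_insert_words) (simp add: perms_iff)
   finally have "f = lin_ext shuffle_all (tensor_array v c ?us)" .
   thus ?thesis using sk fill unfolding lyndon.insertions_def by blast
  qed
 qed
 show "lin_ext shuffle_all ` lyndon.insertions lyndon_shuffles m \<subseteq> lyndon_shuffles m"
 proof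
  fix f assume "f \<in> lin_ext shuffle_all ` lyndon.insertions lyndon_shuffles m"
  then obtain k v c us where f: "f = lin_ext shuffle_all (tensor_array v c us)"
   and sk: "lyndon.skeleton m k v us" and fill: "lyndon.filling lyndon_shuffles k v c"
   unfolding lyndon.insertions_def by blast
  have comp: "composition k v m" and X: "lyndon_pattern k us" and h1: "!!u. u \<in> set us ==> v (hd u) = 1"
   and simple: "!!u. u \<in> set us ==> simple_word k u"
   using sk by (auto simp: lyndon.skeleton_def heads_def)
  have F: "us \<in> forests {1..k}" "length us \<ge> 2" using X by (simp_all add: lyndon_pattern_def)
  have cat: "distinct (concat us)" "set (concat us) = {1..k}" using F by (simp_all add: forests_def perms_iff)
  have k2: "2 <= k" by (rule lyndon.X_ge2[OF X])
  have km: "k <= m"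
  proof -
   have "(\<Sum>i=1..k. 1) <= (\<Sum>i=1..k. v i)" using comp by (intro sum_mono) (auto simp: composition_def)
   thus ?thesis using comp by (simp add: composition_def)
  qed
  have lt: "length u < k" if u: "u \<in> set us" for u
  proof -
   obtain us1 us2 where us12: "us = us1 @ u # us2" using split_list[OF u] by blast
   have "length (concat us) = k" using cat distinct_card[of "concat us"] by simp
   hence "length (concat us1) + length u + length (concat us2) = k" using us12 by simp
   moreover have "concat us1 ~= [] | concat us2 ~= []"
   proof -
    have "us1 ~= [] | us2 ~= []" using F(2) us12 by auto
    moreover have "[] \<notin> set us" using lyndon.X_nonempty[OF X] .
    ultimately show ?thesis using us12 by (cases us1; cases us2) auto
   qed
   ultimately show ?thesis by auto
  qed
  have "lyndon_insertion_shuffle m f"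
  proof (cases "k = 2")
   case False
   have "lyndon_insertion_shuffle m (foldr word_shuffle (map (insert_word v c) us) (bvec []))"
   proof (rule lyndon_insertion_shuffle.insertion)
    show "3 <= k" using k2 False by simp
    have "lyndon_word u" if "u \<in> set us" for u using F(1) that lyndon.X_word(1)[OF X that] by (auto simp: lyndon_word_iff forests_def)
    thus "convergent_lyndon_factors k us" using cat F(2) simple lt simple_word_iff_convergent by (auto simp: convergent_lyndon_factors_def)
    show "\<forall>i\<in>{1..k}. 1 <= v i" "(\<Sum>i=1..k. v i) = m" using comp by (auto simp: composition_def)
    show "\<forall>i\<in>{1..k}. (v i = 1 --> c i = bvec [1]) & (1 < v i --> lyndon_insertion_shuffle (v i) (c i))"
     using fill by (simp add: lyndon.filling_def)
   qed (use km h1 in auto)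
   thus ?thesis using f shuffle_insert_words[OF cat(1)] by simp
  next
   \<comment> \<open>Both letters are heads, so nothing can be inserted, \<open>m = 2\<close>, and
     the element comes from the clause \<open>two\<close>; the clause \<open>insertion\<close>
     starts at three letters.\<close>
   case True
   obtain u1 u2 us' where us: "us = u1 # u2 # us'" using F(2) by (auto simp: numeral_2_eq_2 Suc_le_length_iff)
   have "length (concat us) = 2" using cat distinct_card[of "concat us"] True by simp
   moreover have "u1 ~= []" "u2 ~= []" "[] \<notin> set us'" using lyndon.X_nonempty[OF X] us by auto
   ultimately have "length u1 = 1 & length u2 = 1 & us' = []" using us by (cases u1; cases u2; cases us') auto
   then obtain a b where ab: "us = [[a], [b]]" using us by (auto simp: length_Suc_conv)
   hence "a < b" "a \<in> {1..2}" "b \<in> {1..2}" using F(1) cat(2) True by (auto simp: forests_def)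
   hence us2: "us = [[1], [2]]" unfolding ab by auto
   have v: "v 1 = 1" "v 2 = 1" using h1[of "[1]"] h1[of "[2]"] us2 by simp_all
   have "(\<Sum>i=1..2. v i) = m" using comp True by (simp add: composition_def)
   hence m2: "m = 2" using v by (simp add: numeral_2_eq_2)
   have "c 1 = bvec [1]" "c 2 = bvec [1]" using fill True v by (auto simp: lyndon.filling_def)
   thus ?thesis using pair[OF v] f us2 m2 lyndon_insertion_shuffle.two by simp
  qed
  thus "f \<in> lyndon_shuffles m" by simp
 qed
qed

lemma linear_lin_ext: "Vector_Spaces.linear qscale qscale (lin_ext f)"
 by unfold_locales (simp_all add: lin_ext_add lin_ext_qscale)

lemma lyndon_pattern_shuffle_null:
 assumes c: "!!us. us \<in> supp c ==> lyndon_pattern m us"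
 shows "null_on {1..m} (coef (lin_ext shuffle_all c))"
 unfolding null_on_def
proof (intro allI impI)
 fix x :: "nat => complex" assume x: "inj_on x {1..m}"
 have cF: "supp c \<subseteq> forests {1..m}" using c by (auto simp: lyndon_pattern_def)
 have "(\<Sum>u\<in>perms {1..m}. of_rat (coef (lin_ext shuffle_all c) u) * chain x u) = lin_eval (chain x) (lin_ext shuffle_all c)"
  using lin_eval_superset[OF _ supp_lin_ext_shuffle_all[OF cF]] by simp
 also have "... = lin_eval (%us. lin_eval (chain x) (shuffle_all us)) c" by (rule lin_eval_lin_ext)
 also have "... = lin_eval (%_. 0) c"
 proof (rule lin_eval_cong)
  fix us assume us: "us \<in> supp c"
  have "distinct (concat us)" "set (concat us) = {1..m}" using lyndon.X_perms[OF c[OF us]] by (simp_all add: perms_iff)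
  thus "lin_eval (chain x) (shuffle_all us) = 0"
   using x c[OF us] lyndon.X_nonempty by (intro chain_shuffle_all_eq_0) (auto simp: lyndon_pattern_def)
 qed
 finally show "(\<Sum>u\<in>perms {1..m}. of_rat (coef (lin_ext shuffle_all c) u) * chain x u) = 0" by (simp add: lin_eval_def)
qed

text \<open>Products of at least two factors have zero form, so the part of \<open>f\<close> given
  by single Lyndon words has zero form as well. These words all begin with 1 and are independent,
  hence this part vanishes and every remaining forest has two factors.\<close>

lemma null_slices_coordinates:
 assumes m: "2 <= m" and f: "f \<in> null_slices m"
 shows "EX c. (\<forall>us\<in>supp c. lyndon_pattern m us) & f = lin_ext shuffle_all c & array_null_slices m c"
proof -
 let ?S = "{1..m}"
 have sf: "supp f \<subseteq> perms ?S" using f by (simp add: null_slices_def)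
 obtain c where c: "supp c \<subseteq> forests ?S" "f = lin_ext shuffle_all c" using forest_coordinates[of ?S f] sf by auto
 have null: "null_on ?S (coef f)"
 proof -
  have "[1] \<in> perms (insert 1 (?S - {1..m}))" using m by (simp add: perms_iff)
  moreover have "1 < m" using m by simp
  ultimately have "null_on {1..m} (%u. coef f (subst1 1 u [1]))" using f unfolding null_slices_def by blast
  thus ?thesis by (simp add: subst1_def)
 qed
 have single: "us = [hd us] & hd us \<in> perms ?S & hd (hd us) = 1" if us: "us \<in> supp c" "~ length us \<ge> 2" for us
 proof -
  have F: "us \<in> forests ?S" using us(1) c(1) by blast
  have "us ~= []" using F m by (auto simp: forests_def perms_iff)
  then obtain u where u: "us = [u]" using us(2) by (cases us; cases "tl us") auto
  have up: "u \<in> perms ?S" using F u by (simp add: forests_def)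
  have "u ~= []" using F u by (simp add: forests_def)
  hence "hd u \<in> ?S" using up hd_in_set by (auto simp: perms_iff)
  moreover have "hd u <= 1" using F u up m by (auto simp: forests_def perms_iff)
  ultimately show ?thesis using u up by simp
 qed
 \<comment> \<open>The coordinates of \<open>f\<close> at forests with one factor.\<close>
 define g where "g u = coef c [u]" for u
 have "null_on ?S g" unfolding null_on_def
 proof (intro allI impI)
  fix x :: "nat => complex" assume x: "inj_on x ?S"
  let ?E = "lin_eval (chain x)" and ?T = "(%u. [u]) ` perms ?S"
  have "?E f = 0" using null x lin_eval_superset[OF _ sf, of "chain x"] by (simp add: null_on_def)
  hence "0 = lin_eval (%us. ?E (shuffle_all us)) c" by (simp add: c(2) lin_eval_lin_ext)
  also have "... = (\<Sum>us\<in>supp c Un ?T. of_rat (coef c us) * ?E (shuffle_all us))" by (rule lin_eval_superset) auto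
  also have "... = (\<Sum>us\<in>?T. of_rat (coef c us) * ?E (shuffle_all us))"
  proof (rule sum.mono_neutral_right)
   show "\<forall>us\<in>supp c Un ?T - ?T. of_rat (coef c us) * ?E (shuffle_all us) = 0"
   proof
    fix us assume us: "us \<in> supp c Un ?T - ?T"
    have "length us \<ge> 2"
    proof (rule ccontr)
     assume "~ length us \<ge> 2"
     hence "us = [hd us]" "hd us \<in> perms ?S" using single[of us] us by auto
     hence "us \<in> ?T" by (rule image_eqI)
     thus False using us by blast
    qed
    moreover have "us \<in> forests ?S" using us c(1) by blast
    moreover from forests_perms[OF this] have "distinct (concat us)" "set (concat us) = ?S" by (simp_all add: perms_iff)
    ultimately have "?E (shuffle_all us) = 0" using x by (intro chain_shuffle_all_eq_0) (auto simp: forests_def simp del: set_concat)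
    thus "of_rat (coef c us) * ?E (shuffle_all us) = 0" by simp
   qed
  qed auto
  also have "... = (\<Sum>u\<in>perms ?S. of_rat (g u) * chain x u)"
   by (subst sum.reindex) (auto simp: inj_on_def g_def shuffle_all_def word_shuffle_def)
  finally show "(\<Sum>u\<in>perms ?S. of_rat (g u) * chain x u) = 0" by simp
 qed
 moreover have "hd u = 1" if "g u ~= 0" for u using single[of "[u]"] that by (auto simp: g_def in_keys_iff)
 ultimately have g0: "g u = 0" if "u \<in> perms ?S" for u using null_on_rooted[of ?S 1 g u] m that by auto
 have "lyndon_pattern m us" if us: "us \<in> supp c" for us
 proof (cases "length us \<ge> 2")
  case True
  thus ?thesis using us c(1) by (auto simp: lyndon_pattern_def)
 next
  case False
  hence "coef c us = 0" using single[OF us] g0[of "hd us"] by (metis g_def)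
  thus ?thesis using us by (simp add: in_keys_iff)
 qed
 moreover have "array_null_slices m c" unfolding array_null_slices_def
 proof (intro allI impI, elim conjE)
  fix p q us assume pq: "1 <= p" "p < q" "q <= m" and us: "concat us \<in> perms (insert p (?S - {p..q}))"
  have "\<forall>w\<in>perms (insert p (?S - {p..q})). null_on {p..q} (%u. coef f (subst1 p u w))"
   using f pq by (simp add: null_slices_def)
  thus "null_on {p..q} (%u. coef c (map (subst1 p u) us))" using slices_iff_array_slices[OF c(1) pq] c(2) us by simp
 qed
 ultimately show ?thesis using c(2) by blast
qed

text \<open>An interval block containing a head opens its factor. Every word of the slice then
  yields a Lyndon factor and so begins with the least letter \<open>p\<close>; a null combination of
  words with common first letter is zero, contrary to the choice of \<open>us\<close>.\<close>

lemma lyndon_unmarked: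
 assumes c: "!!us. us \<in> supp c ==> lyndon_pattern m us" "array_null_slices m c"
  and us: "us \<in> supp c" "u \<in> set us" "sublist B u" "2 <= length B" "length B < m" "interval_of {1..m} (set B)"
 shows "set B Int heads m us = {}"
proof (rule ccontr)
 assume ne: "set B Int heads m us ~= {}"
 have X: "lyndon_pattern m us" by (rule c(1)[OF us(1)])
 have F: "us \<in> forests {1..m}" using X by (simp add: lyndon_pattern_def)
 have cat: "distinct (concat us)" "set (concat us) = {1..m}" using F by (simp_all add: forests_def perms_iff)
 obtain x y where u: "u = x @ B @ y" using us by (auto simp: sublist_def)
 have Bne: "B ~= []" using us by auto
 obtain us1 us2 where us12: "us = us1 @ u # us2" using split_list[OF us(2)] by blast
 have du: "distinct u" "set u \<subseteq> {1..m}" using lyndon.X_word[OF X us(2)] by simp_all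
 obtain h where h: "h \<in> set B" "h \<in> hd ` set us" using ne by (auto simp: heads_def)
 then obtain u' where u': "u' \<in> set us" "h = hd u'" by auto
 have "u' ~= []" using lyndon.X_word(3)[OF X u'(1)] .
 hence "h \<in> set u'" using u' by simp
 have "u' = u"
 proof (rule ccontr)
  assume "u' ~= u"
  hence "set u' Int set u = {}" using cat u' us by (auto simp: distinct_concat_iff)
  thus False using \<open>h \<in> set u'\<close> h u by auto
 qed
 hence hh: "h = hd u" using u' by simp
 have x: "x = []"
 proof (rule ccontr)
  assume "x ~= []"
  hence "hd u \<in> set x" using u by simp
  thus False using du u h hh by auto
 qed
 obtain p q where pq: "1 <= p" "p <= q" "q <= m" "set B = {p..q}" using interval_cases[OF us(6)] Bne by auto
 have "distinct B" using du u by simp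
 hence "length B = Suc q - p" using distinct_card[of B] pq by simp
 hence pq': "p < q" "~ (p = 1 & q = m)" using us by auto

 have mB: "Min {p..q} = p" using pq by (intro Min_eqI) auto
 let ?us = "us1 @ (x @ p # y) # us2"
 have fc: "?us \<in> forests (insert p ({1..m} - {p..q}))" "B \<in> perms {p..q}" "map (subst1 p B) ?us = us"
  using forest_contract[of us1 x B y us2 "{1..m}"] F us12 u pq mB by auto
 have null: "null_on {p..q} (%b. coef c (map (subst1 p b) ?us))"
  using c pq pq' forests_perms[OF fc(1)] unfolding array_null_slices_def by blast
 have "coef c (map (subst1 p B) ?us) = 0"
 proof (rule null_on_rooted[OF _ _ null _ fc(2)])
  fix b assume b: "b \<in> perms {p..q}" "coef c (map (subst1 p b) ?us) ~= 0"
  hence F': "map (subst1 p b) ?us \<in> forests {1..m}" using c by (simp add: in_keys_iff lyndon_pattern_def)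
  have bne: "b ~= []" using b pq by (auto simp: perms_iff)
  have "distinct (p # y)" using fc by (auto simp: forests_def perms_iff)
  hence "subst1 p b (x @ p # y) = b @ y" using x by simp
  hence "b @ y \<in> set (map (subst1 p b) ?us)" by simp
  moreover have "\<forall>u\<in>set (map (subst1 p b) ?us). \<forall>i\<in>set u. hd u <= i" using F' unfolding forests_def by blast
  ultimately have "\<forall>i\<in>set (b @ y). hd (b @ y) <= i" by blast
  hence "hd b <= p" using bne b pq by (auto simp: perms_iff)
  moreover have "hd b \<in> {p..q}" using bne b by (auto simp: perms_iff)
  ultimately show "hd b = p" by simp
 qed (use pq in auto)
 thus False using fc us by (simp add: in_keys_iff)
qed

text \<open>Strong induction on \<open>m\<close>: inserted parts are shorter than \<open>m\<close>,
  so the insertion theorems apply to lists of words, and shuffling carries the result over because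
  it is injective on combinations of forests.\<close>

theorem lyndon_shuffles_basis:
 assumes "2 <= m"
 shows "qvec.span (lyndon_shuffles m) = null_slices m" "qvec.independent (lyndon_shuffles m)"
proof -
 have "qvec.span (lyndon_shuffles m) = null_slices m & qvec.independent (lyndon_shuffles m)" using assms
 proof (induction m rule: less_induct)
  case (less m)
  have L: "qvec.span (lyndon_shuffles j) = null_slices j" "qvec.independent (lyndon_shuffles j)"
   if "2 <= j" "j < m" for j using less.IH[OF that(2,1)] by simp_all
  have Ls: "f \<in> null_slices j" if "2 <= j" "j < m" "f \<in> lyndon_shuffles j" for j f
   using L[OF that(1,2)] qvec.span_base[OF that(3)] by simp
  let ?I = "lyndon.insertions lyndon_shuffles m"
  have eq: "lyndon_shuffles m = lin_ext shuffle_all ` ?I" by (rule lyndon_shuffles_insertions[OF less.prems Ls])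
  interpret lin: Vector_Spaces.linear qscale qscale "lin_ext shuffle_all" by (rule linear_lin_ext)
  have pat: "lyndon_pattern m us" if "g \<in> ?I" "us \<in> supp g" for g us by (rule lyndon.insertions_X[OF Ls that])
  have "lyndon_shuffles m \<subseteq> null_slices m"
  proof
   fix f assume "f \<in> lyndon_shuffles m"
   then obtain g where g: "g \<in> ?I" "f = lin_ext shuffle_all g" unfolding eq by blast
   have gF: "supp g \<subseteq> forests {1..m}" using pat[OF g(1)] by (auto simp: lyndon_pattern_def)
   have an: "array_null_slices m g" by (rule lyndon.insertions_null_slices[OF Ls g(1)])
   have "supp f \<subseteq> perms {1..m}" unfolding g by (rule supp_lin_ext_shuffle_all[OF gF])
   moreover have "null_on {p..q} (%u. coef f (subst1 p u w))"
    if pq: "1 <= p" "p < q" "q <= m" and w: "w \<in> perms (insert p ({1..m} - {p..q}))" for p q w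
   proof (cases "p = 1 & q = m")
    case True
    hence "insert p ({1..m} - {p..q}) = {1}" by auto
    hence "w \<in> perms {1}" using w by (simp only:)
    hence "w = [1]" by simp
    moreover have "null_on {1..m} (coef f)" unfolding g by (rule lyndon_pattern_shuffle_null) (rule pat[OF g(1)])
    ultimately show ?thesis using True by simp
   next
    case False
    have "ALL us. concat us \<in> perms (insert p ({1..m} - {p..q})) --> null_on {p..q} (%u. coef g (map (subst1 p u) us))"
     using an pq False unfolding array_null_slices_def by blast
    thus ?thesis using slices_iff_array_slices[OF gF pq] w g by blast
   qed
   ultimately show "f \<in> null_slices m" by (simp add: null_slices_def)
  qed
  hence sub: "qvec.span (lyndon_shuffles m) \<subseteq> null_slices m" by (rule qvec.span_minimal[OF _ subspace_null_slices])
  have sup: "null_slices m \<subseteq> qvec.span (lyndon_shuffles m)"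
  proof
   fix f assume "f \<in> null_slices m"
   then obtain c where c: "!!us. us \<in> supp c ==> lyndon_pattern m us" "f = lin_ext shuffle_all c" "array_null_slices m c"
    using null_slices_coordinates[OF less.prems] by blast
   have "c \<in> qvec.span ?I" by (rule lyndon.insertions_span[OF L c(1,3) lyndon_unmarked[OF c(1,3)]])
   hence "lin_ext shuffle_all c \<in> lin_ext shuffle_all ` qvec.span ?I" by blast
   thus "f \<in> qvec.span (lyndon_shuffles m)" unfolding eq c lin.span_image .
  qed
  have "qvec.independent (lyndon_shuffles m)" unfolding eq
  proof (rule lin.independent_inj_on_image)
   show "qvec.independent ?I" by (rule lyndon.insertions_independent[OF L])
   show "inj_on (lin_ext shuffle_all) (qvec.span ?I)" unfolding lin.inj_on_iff_eq_0[OF qvec.subspace_span]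
   proof (intro ballI impI)
    fix c assume c: "c \<in> qvec.span ?I" "lin_ext shuffle_all c = 0"
    have cF: "supp c \<subseteq> forests {1..m}" by (rule supp_span[OF c(1)]) (use pat in "auto simp: lyndon_pattern_def")
    have "coef c us = 0" if us: "us \<in> forests {1..m}" for us
    proof -
     have "coef (lin_ext shuffle_all c) w = (\<Sum>us\<in>forests {1..m}. coef c us * coef (shuffle_all us) w)" for w
      by (simp add: lin_ext_superset[OF finite_forests cF] coef_sum)
     hence "(\<Sum>us\<in>forests {1..m}. coef c us * of_rat (coef (shuffle_all us) w)) = 0" for w using c by simp
     thus ?thesis using forests_independent[OF _ _ us, of "coef c"] by simp
    qed
    thus "c = 0" using cF by (metis in_keys_iff keys_eq_empty subset_eq ex_in_conv)
   qed
  qed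
  thus ?case using sub sup by blast
 qed
 thus "qvec.span (lyndon_shuffles m) = null_slices m" "qvec.independent (lyndon_shuffles m)" by auto
qed

section \<open>The Lyndon insertion words as a basis\<close>

text \<open>The full interval carries no condition: its complement is the point infinity alone, so
  it does not define a boundary divisor.\<close>

definition adjacent_null_slices :: "nat => word_comb set" where
 "adjacent_null_slices m = {f. (\<forall>w\<in>supp f. w \<in> perms {1..m} & sublist [1, m] w) &
   (ALL p q w. 1 <= p & p < q & q <= m & ~ (p = 1 & q = m) & w \<in> perms (insert p ({1..m} - {p..q})) -->
    null_on {p..q} (%u. coef f (subst1 p u w)))}"

lemma null_on_rev:
 assumes "null_on I g"
 shows "null_on I (%u. g (rev u))"
 unfolding null_on_def
proof (intro allI impI)
 fix x :: "nat => complex" assume x: "inj_on x I"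
 have "rev ` perms I = perms I" by simp
 hence "(\<Sum>u\<in>perms I. of_rat (g (rev u)) * chain x u) = (\<Sum>u\<in>perms I. of_rat (g (rev (rev u))) * chain x (rev u))"
  by (metis (no_types, lifting) inj_on_rev sum.reindex_cong)
 also have "... = (\<Sum>u\<in>perms I. (-1) ^ (card I - 1) * (of_rat (g u) * chain x u))"
  by (intro sum.cong) (auto simp: chain_rev perms_iff distinct_card)
 also have "... = 0" using assms x by (simp add: null_on_def flip: sum_distrib_left)
 finally show "(\<Sum>u\<in>perms I. of_rat (g (rev u)) * chain x u) = 0" .
qed

text \<open>Reversing all words multiplies the form by a common sign.\<close>

lemma null_on_rooted_last:
 assumes I: "finite I" "r \<in> I" and null: "null_on I g"
  and supp: "!!u. u \<in> perms I ==> g u ~= 0 ==> last u = r" and u: "u \<in> perms I"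
 shows "g u = 0"
proof -
 have "(%u. g (rev u)) (rev u) = 0"
 proof (rule null_on_rooted[OF I null_on_rev[OF null]])
  show "hd v = r" if "v \<in> perms I" "g (rev v) ~= 0" for v using supp[of "rev v"] that by (simp add: perms_iff last_rev)
 qed (use u in "simp add: perms_iff")
 thus ?thesis by simp
qed

definition singletons :: "word_comb => (nat list list \<Rightarrow>\<^sub>0 rat)" where
 "singletons f = lin_ext (%w. bvec [w]) f"

abbreviation first_words :: "(nat list list \<Rightarrow>\<^sub>0 rat) => word_comb" where
 "first_words \<equiv> lin_ext (%us. bvec (hd us))"

lemma coef_singletons: "coef (singletons f) us = (if length us = 1 then coef f (hd us) else 0)"
proof -
 have "coef (singletons f) us = (\<Sum>w\<in>supp f. if [w] = us then coef f w else 0)"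
  by (simp add: singletons_def lin_ext_def coef_sum lookup_single when_def if_distrib cong: if_cong)
 also have "... = (\<Sum>w\<in>supp f. if w = hd us then (if length us = 1 then coef f (hd us) else 0) else 0)"
  by (intro sum.cong) (auto simp: length_Suc_conv)
 also have "... = (if length us = 1 then coef f (hd us) else 0)" by (simp add: in_keys_iff)
 finally show ?thesis .
qed

lemma first_words_singletons [simp]: "first_words (singletons f) = f"
 by (simp add: singletons_def lin_ext_comp lin_ext_id)

lemma singletons_first_words:
 assumes "!!us. us \<in> supp c ==> length us = 1"
 shows "singletons (first_words c) = c"
proof -
 have "singletons (first_words c) = lin_ext (%us. bvec [hd us]) c" by (simp add: singletons_def lin_ext_comp)
 also have "... = lin_ext bvec c"
 proof (rule lin_ext_cong)
  fix us assume "us \<in> supp c"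
  hence "length us = 1" by (rule assms)
  then obtain y where "us = [y]" by (cases us) auto
  thus "bvec [hd us] = bvec us" by simp
 qed
 finally show ?thesis by (simp add: lin_ext_id)
qed

lemma special_convergent_iff: "special_convergent_word k w \<longleftrightarrow> w \<in> perms {1..k} & simple_word k w" by (auto simp: special_convergent_word_def simple_word_def perms_iff)

lemma insert_word_ones:
 assumes "distinct w" "0 \<notin> set w" "!!i. i \<in> set w ==> off v i + 1 = i & c i = bvec [1]"
 shows "insert_word v c w = bvec w"
 using assms
proof (induction w)
 case (Cons i w)
 have "insert_word v c (i # w) = word_concat (lin_ext (%u. bvec (map (%j. off v i + j) u)) (c i)) (insert_word v c w)"
  by (simp add: insert_word_def off_def)
 also have "... = word_concat (bvec [i]) (bvec w)" using Cons by simp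
 finally show ?case by (simp add: word_concat_def)
qed (simp add: insert_word_def)

text \<open>Special convergent words are the skeletons with \<open>k = m\<close>, where the sizes
  sum to \<open>m\<close> and therefore all equal 1; proper insertions are those with
  \<open>k < m\<close>.\<close>

lemma lyndon_words_insertions:
 assumes m: "2 <= m"
 shows "lyndon_insertion_words m = first_words ` adjacent.insertions lyndon_shuffles m"
proof
 show "lyndon_insertion_words m \<subseteq> first_words ` adjacent.insertions lyndon_shuffles m"
 proof
  fix f assume "f \<in> lyndon_insertion_words m"
  then consider w where "f = bvec w" "special_convergent_word m w" "sublist [1, m] w"
   | k v c w where "f = insert_word v c w" "k < m" "special_convergent_word k w" "sublist [1, k] w"
    "\<forall>i\<in>{1..k}. v i \<ge> 1" "v 1 = 1" "v k = 1" "(\<Sum>i=1..k. v i) = m"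
    "\<forall>i\<in>{1..k}. (v i = 1 --> c i = bvec [1]) & (v i > 1 --> lyndon_insertion_shuffle (v i) (c i))"
   unfolding lyndon_insertion_words_def by blast
  thus "f \<in> first_words ` adjacent.insertions lyndon_shuffles m"
  proof cases
   case 1
   have w: "w \<in> perms {1..m}" "simple_word m w" using 1 special_convergent_iff by simp_all
   have "adjacent.skeleton m m (%_. 1) [w]" using w 1 m by (simp add: adjacent.skeleton_def composition_def adjacent_pattern_def)
   moreover have "adjacent.filling lyndon_shuffles m (%_. 1) (%_. bvec [1])" by (simp add: adjacent.filling_def)
   ultimately have "tensor_array (%_. 1) (%_. bvec [1]) [w] \<in> adjacent.insertions lyndon_shuffles m"
    unfolding adjacent.insertions_def by blast
   moreover have "insert_word (%_. 1) (%_. bvec [1]) w = bvec w"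
    by (rule insert_word_ones) (use w in "auto simp: perms_iff off_def")
   moreover have "insert_word (%_. 1) (%_. bvec [1]) w = first_words (tensor_array (%_. 1) (%_. bvec [1]) [w])"
    by (rule insert_word_tensor_array) (use w in "simp add: perms_iff")
   ultimately show ?thesis using 1(1) by (metis image_eqI)
  next
   case 2
   have w: "w \<in> perms {1..k}" "simple_word k w" using 2 special_convergent_iff by simp_all
   have k2: "2 <= k"
   proof -
    have "2 <= length w" using sublist_length_le[OF 2(4)] by simp
    thus ?thesis using w(1) distinct_card[of w] by (simp add: perms_iff)
   qed
   have "adjacent.skeleton m k v [w]" using w 2 k2 by (auto simp: adjacent.skeleton_def composition_def adjacent_pattern_def end_marks_def)
   moreover have "adjacent.filling lyndon_shuffles k v c" using 2 by (simp add: adjacent.filling_def)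
   ultimately have "tensor_array v c [w] \<in> adjacent.insertions lyndon_shuffles m" unfolding adjacent.insertions_def by blast
   moreover have "f = first_words (tensor_array v c [w])" unfolding 2(1) by (rule insert_word_tensor_array) (use w in "simp add: perms_iff")
   ultimately show ?thesis by blast
  qed
 qed
 show "first_words ` adjacent.insertions lyndon_shuffles m \<subseteq> lyndon_insertion_words m"
 proof
  fix f assume "f \<in> first_words ` adjacent.insertions lyndon_shuffles m"
  then obtain k v c us where f: "f = first_words (tensor_array v c us)"
   and sk: "adjacent.skeleton m k v us" and fill: "adjacent.filling lyndon_shuffles k v c"
   unfolding adjacent.insertions_def by blast
  obtain w where w: "us = [w]" "w \<in> perms {1..k}" "sublist [1, k] w" "simple_word k w" "2 <= k"
   using sk by (auto simp: adjacent.skeleton_def adjacent_pattern_def)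
  have comp: "composition k v m" "v 1 = 1" "v k = 1" using sk by (auto simp: adjacent.skeleton_def end_marks_def)
  have fw: "f = insert_word v c w" unfolding f w(1) using insert_word_tensor_array[of w v c] w(2) by (simp add: perms_iff)
  have vpos: "\<forall>i\<in>{1..k}. v i \<ge> 1" "(\<Sum>i=1..k. v i) = m" using comp(1) by (simp_all add: composition_def)
  have "(\<Sum>i=1..k. 1) <= (\<Sum>i=1..k. v i)" using vpos(1) by (intro sum_mono) auto
  hence "k <= m" using vpos(2) by simp
  show "f \<in> lyndon_insertion_words m"
  proof (cases "k = m")
   case False
   hence "k < m" using \<open>k <= m\<close> by simp
   moreover have "special_convergent_word k w" using w special_convergent_iff by simp
   moreover have "\<forall>i\<in>{1..k}. (v i = 1 --> c i = bvec [1]) & (v i > 1 --> lyndon_insertion_shuffle (v i) (c i))"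
    using fill by (simp add: adjacent.filling_def)
   ultimately show ?thesis unfolding lyndon_insertion_words_def fw using w(3) vpos comp(2,3) by blast
  next
   case True
   have v1: "v i = 1" if i: "i \<in> {1..k}" for i
   proof (rule ccontr)
    assume "v i ~= 1"
    hence "v i > 1" using vpos(1) i by (metis le_neq_implies_less)
    hence "(\<Sum>i=1..k. 1) < (\<Sum>i=1..k. v i)" using vpos(1) i by (intro sum_strict_mono_ex1) auto
    thus False using vpos(2) True by simp
   qed
   have "off v i + 1 = i & c i = bvec [1]" if i: "i \<in> set w" for i
   proof -
    have ik: "i \<in> {1..k}" using i w(2) by (simp add: perms_iff)
    have "off v i = (\<Sum>h=1..<i. 1)" unfolding off_def using v1 ik by (intro sum.cong) auto
    thus ?thesis using ik fill v1[OF ik] by (auto simp: adjacent.filling_def)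
   qed
   hence "f = bvec w" unfolding fw using w(2) by (intro insert_word_ones) (auto simp: perms_iff)
   moreover have "special_convergent_word m w" using w special_convergent_iff True by simp
   ultimately show ?thesis unfolding lyndon_insertion_words_def using w(3) True by blast
  qed
 qed
qed

text \<open>A proper interval contains at most one of 1 and \<open>m\<close>. A block with 1 must
  end in 1, because \<open>m\<close> follows outside, and a block with \<open>m\<close> must begin
  with \<open>m\<close>. Null combinations of words with a common end letter vanish.\<close>

lemma adjacent_unmarked:
 assumes f: "f \<in> adjacent_null_slices m" and w: "w \<in> supp f"
  and B: "sublist B w" "2 <= length B" "length B < m" "interval_of {1..m} (set B)"
 shows "set B Int {1, m} = {}"
proof (rule ccontr)
 assume ne: "set B Int {1, m} ~= {}"
 have wp: "w \<in> perms {1..m}" "sublist [1, m] w" using f w by (simp_all add: adjacent_null_slices_def)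
 obtain x y where xy: "w = x @ B @ y" using B(1) by (auto simp: sublist_def)
 have Bne: "B ~= []" using B(2) by auto
 obtain p q where pq: "1 <= p" "p <= q" "q <= m" "set B = {p..q}" using interval_cases[OF B(4)] Bne by auto
 have dw: "distinct w" "set w = {1..m}" using wp by (simp_all add: perms_iff)
 have "length B = Suc q - p" using distinct_card[of B] dw(1) xy pq(4) by simp
 hence pq': "p < q" "~ (p = 1 & q = m)" using B pq by auto
 let ?w = "x @ p # y"
 have dis: "set x Int {p..q} = {}" "set y Int {p..q} = {}" using dw(1) xy pq(4) by auto
 have n: "p \<notin> set x" "p \<notin> set y" using dis pq by auto
 have sub: "subst1 p b ?w = x @ b @ y" for b using n by simp
 have sxy: "set x Un set y = {1..m} - {p..q}" using dw xy pq(4) by auto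
 have "distinct ?w" using dw(1) xy n by auto
 moreover have "set ?w = insert p ({1..m} - {p..q})" unfolding sxy[symmetric] by auto
 ultimately have wq: "?w \<in> perms (insert p ({1..m} - {p..q}))" by (simp add: perms_iff)
 have null: "null_on {p..q} (%b. coef f (subst1 p b ?w))" using f pq pq' wq unfolding adjacent_null_slices_def by blast
 have adj: "EX X Y. x @ b @ y = X @ 1 # m # Y" if "coef f (subst1 p b ?w) ~= 0" for b
 proof -
  have "x @ b @ y \<in> supp f" using that sub by (simp add: in_keys_iff)
  hence "sublist [1, m] (x @ b @ y)" using f by (simp add: adjacent_null_slices_def)
  thus ?thesis by (simp add: sublist_pair_iff)
 qed
 have Bp: "B \<in> perms {p..q}" using dw(1) xy pq(4) by (simp add: perms_iff)
 have nth_adj: "EX i. Suc i < length v & v ! i = 1 & v ! Suc i = m" if "v = X @ 1 # m # Y" for v X Y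
  using that by (intro exI[of _ "length X"]) (auto simp: nth_append)
 have m2: "1 < m" using pq pq' by simp
 have "coef f (subst1 p B ?w) = 0"
 proof (cases "1 \<in> set B")
  case True
  hence p1: "p = 1" "q < m" using pq pq' by auto
  show ?thesis
  proof (rule null_on_rooted_last[OF _ _ null _ Bp, of 1])
   fix b assume b: "b \<in> perms {p..q}" "coef f (subst1 p b ?w) ~= 0"
   obtain X Y where XY: "x @ b @ y = X @ 1 # m # Y" using adj[OF b(2)] by blast
   have sb: "set b = {p..q}" "distinct b" using b(1) by (simp_all add: perms_iff)
   have db: "distinct (x @ b @ y)" using dw(1) dis sb unfolding xy by auto
   have "1 \<in> set b" using sb p1 pq by simp
   then obtain b1 b2 where b12: "b = b1 @ 1 # b2" by (meson split_list)
   have "x @ b1 = X & b2 @ y = m # Y"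
   proof -
    have e: "(x @ b1) @ 1 # (b2 @ y) = X @ 1 # (m # Y)" using XY b12 by simp
    have "1 \<notin> set (x @ b1)" "1 \<notin> set (b2 @ y)" using db b12 by auto
    moreover have "1 \<notin> set X" "1 \<notin> set (m # Y)" using db unfolding XY by auto
    ultimately show ?thesis using e by (metis append_Cons_eq_iff)
   qed
   moreover have "set b2 \<subseteq> set b" unfolding b12 by auto
   hence "m \<notin> set b2" unfolding sb(1) using p1(2) by auto
   ultimately have "b2 = []" by (cases b2) auto
   thus "last b = 1" using b12 by simp
  qed (use pq p1 in auto)
 next
  case False
  hence mB: "m \<in> set B" using ne by auto
  hence qm: "q = m" "1 < p" using pq pq' by auto
  show ?thesis
  proof (rule null_on_rooted[OF _ _ null _ Bp, of m])
   fix b assume b: "b \<in> perms {p..q}" "coef f (subst1 p b ?w) ~= 0"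
   obtain X Y where XY: "x @ b @ y = X @ 1 # m # Y" using adj[OF b(2)] by blast
   have sb: "set b = {p..q}" "distinct b" using b(1) by (simp_all add: perms_iff)
   have db: "distinct (x @ b @ y)" using dw(1) dis sb unfolding xy by auto
   have "m \<in> set b" using sb qm pq by simp
   then obtain b1 b2 where b12: "b = b1 @ m # b2" by (meson split_list)
   have "x @ b1 = X @ [1] & b2 @ y = Y"
   proof -
    have e: "(x @ b1) @ m # (b2 @ y) = (X @ [1]) @ m # Y" using XY b12 by simp
    have "m \<notin> set (x @ b1)" "m \<notin> set (b2 @ y)" using db b12 by auto
    moreover have "m \<notin> set (X @ [1])" "m \<notin> set Y" using db unfolding XY by auto
    ultimately show ?thesis using e by (metis append_Cons_eq_iff)
   qed
   moreover have "1 \<notin> set b1" using sb b12 qm by auto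
   ultimately have "b1 = []" by (cases b1 rule: rev_cases) auto
   thus "hd b = m" using b12 by simp
  qed (use pq qm in auto)
 qed
 thus False using w xy sub by (simp add: in_keys_iff)
qed

text \<open>On lists of length one, \<open>first_words\<close> and \<open>singletons\<close> are
  inverse to each other, so the insertion theorems transfer directly; the inserted parts are
  controlled by \<open>lyndon_shuffles_basis\<close>.\<close>

theorem lyndon_words_basis:
 assumes m: "2 <= m"
 shows "qvec.span (lyndon_insertion_words m) = adjacent_null_slices m" "qvec.independent (lyndon_insertion_words m)"
proof -
 let ?I = "adjacent.insertions lyndon_shuffles m"
 note L = lyndon_shuffles_basis
 have Ls: "f \<in> null_slices j" if "2 <= j" "f \<in> lyndon_shuffles j" for j f
  using L(1)[OF that(1)] qvec.span_base[OF that(2)] by simp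
 interpret lin: Vector_Spaces.linear qscale qscale first_words by (rule linear_lin_ext)
 have pat: "adjacent_pattern m us" if "g \<in> ?I" "us \<in> supp g" for g us by (rule adjacent.insertions_X[OF Ls that])
 have span_pat: "adjacent_pattern m us" if "g \<in> qvec.span ?I" "us \<in> supp g" for g us
 proof -
  have "supp g \<subseteq> {us. adjacent_pattern m us}" by (rule supp_span[OF that(1)]) (use pat in auto)
  thus ?thesis using that(2) by blast
 qed
 have len1: "length us = 1" if "adjacent_pattern m us" for us using that by (auto simp: adjacent_pattern_def)
 have img: "qvec.span (lyndon_insertion_words m) = first_words ` qvec.span ?I" unfolding lyndon_words_insertions[OF m] lin.span_image ..
 have "first_words ` qvec.span ?I = adjacent_null_slices m"
 proof
  show "first_words ` qvec.span ?I \<subseteq> adjacent_null_slices m"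
  proof
   fix f assume "f \<in> first_words ` qvec.span ?I"
   then obtain g where g: "g \<in> qvec.span ?I" "f = first_words g" by blast
   have sg: "singletons f = g" unfolding g(2) by (rule singletons_first_words) (use span_pat[OF g(1)] len1 in blast)
   have cf: "coef f w = coef g [w]" for w using coef_singletons[of f "[w]"] sg by simp
   have an: "array_null_slices m g" by (rule array_null_slices_span[OF g(1) adjacent.insertions_null_slices[OF Ls]])
   have "w \<in> perms {1..m} & sublist [1, m] w" if "w \<in> supp f" for w
    using span_pat[OF g(1), of "[w]"] that by (auto simp: cf in_keys_iff adjacent_pattern_def)
   moreover have "null_on {p..q} (%u. coef f (subst1 p u w))"
    if "1 <= p" "p < q" "q <= m" "~ (p = 1 & q = m)" "w \<in> perms (insert p ({1..m} - {p..q}))" for p q w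
   proof -
    have "concat [w] \<in> perms (insert p ({1..m} - {p..q}))" using that by simp
    hence "null_on {p..q} (%u. coef g (map (subst1 p u) [w]))" using an that(1-4) unfolding array_null_slices_def by blast
    thus ?thesis by (simp add: cf)
   qed
   ultimately show "f \<in> adjacent_null_slices m" unfolding adjacent_null_slices_def by blast
  qed
  show "adjacent_null_slices m \<subseteq> first_words ` qvec.span ?I"
  proof
   fix f assume f: "f \<in> adjacent_null_slices m"
   have s: "length us = 1 & hd us \<in> supp f" if "us \<in> supp (singletons f)" for us
    using that by (auto simp: in_keys_iff coef_singletons split: if_splits)
   have X: "adjacent_pattern m us" if us: "us \<in> supp (singletons f)" for us
   proof -
    obtain w where "us = [w]" "w \<in> supp f" using s[OF us] by (cases us) auto
    thus ?thesis using f m by (auto simp: adjacent_null_slices_def adjacent_pattern_def)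
   qed
   have an: "array_null_slices m (singletons f)" unfolding array_null_slices_def
   proof (intro allI impI, elim conjE)
    fix p q us assume h: "1 <= p" "p < q" "q <= m" "~ (p = 1 & q = m)" "concat us \<in> perms (insert p ({1..m} - {p..q}))"
    show "null_on {p..q} (%u. coef (singletons f) (map (subst1 p u) us))"
    proof (cases "length us = 1")
     case True
     then obtain w where w: "us = [w]" by (auto simp: length_Suc_conv)
     have "null_on {p..q} (%u. coef f (subst1 p u w))" using f h w by (simp add: adjacent_null_slices_def)
     thus ?thesis by (simp add: w coef_singletons)
    next
     case False
     thus ?thesis by (simp add: coef_singletons null_on_0)
    qed
   qed
   have "singletons f \<in> qvec.span ?I"
   proof (rule adjacent.insertions_span[OF L X an])
    fix us u B assume us: "us \<in> supp (singletons f)" "u \<in> set us" and B: "sublist B u" "2 <= length B" "length B < m" "interval_of {1..m} (set B)"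
    obtain w where "us = [w]" "w \<in> supp f" using s[OF us(1)] by (cases us) auto
    thus "set B Int end_marks m us = {}" using adjacent_unmarked[OF f _ _ B(2-4)] us(2) B(1) by (simp add: end_marks_def)
   qed
   thus "f \<in> first_words ` qvec.span ?I" by (metis first_words_singletons image_eqI)
  qed
 qed
 thus "qvec.span (lyndon_insertion_words m) = adjacent_null_slices m" using img by simp
 show "qvec.independent (lyndon_insertion_words m)" unfolding lyndon_words_insertions[OF m]
 proof (rule lin.independent_inj_on_image)
  show "qvec.independent ?I" by (rule adjacent.insertions_independent[OF L])
  show "inj_on first_words (qvec.span ?I)" by (rule inj_on_inverseI[of _ singletons]) (use singletons_first_words span_pat len1 in blast)
 qed
qed

section \<open>Cyclic orders as classes of rotations\<close>

lemma mem_cyc_iff: "ys \<in> cyc xs \<longleftrightarrow> (EX u w. xs = u @ w & ys = w @ u)"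
proof
 assume "ys \<in> cyc xs"
 then obtain k where "ys = rotate k xs" by (auto simp: cyc_def)
 hence "xs = take (k mod length xs) xs @ drop (k mod length xs) xs &
   ys = drop (k mod length xs) xs @ take (k mod length xs) xs" by (simp add: rotate_drop_take)
 thus "EX u w. xs = u @ w & ys = w @ u" by blast
next
 assume "EX u w. xs = u @ w & ys = w @ u"
 then obtain u w where "xs = u @ w" "ys = w @ u" by blast
 hence "ys = rotate (length u) xs" by (simp add: rotate_append)
 thus "ys \<in> cyc xs" by (auto simp: cyc_def)
qed

lemma cyc_append_subset: "cyc (w @ u) \<subseteq> cyc (u @ w)"
proof
 fix ys assume "ys \<in> cyc (w @ u)"
 then obtain k where "ys = rotate k (w @ u)" by (auto simp: cyc_def)
 hence "ys = rotate (k + length u) (u @ w)" by (simp add: rotate_append flip: rotate_rotate)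
 thus "ys \<in> cyc (u @ w)" unfolding cyc_def by blast
qed

lemma cyc_append: "cyc (u @ w) = cyc (w @ u)"
 using cyc_append_subset by blast

lemma cyc_eqI: "ys \<in> cyc xs ==> cyc ys = cyc xs"
 by (metis cyc_append mem_cyc_iff)

lemma self_in_cyc [simp]: "xs \<in> cyc xs"
 by (metis append_Nil append_Nil2 mem_cyc_iff)

lemma cyc_Cons: "cyc (a # u) = cyc (u @ [a])"
 using cyc_append[of "[a]" u] by simp

lemma cyc_snoc_inj:
 assumes "distinct (u @ [e])" "cyc (u @ [e]) = cyc (u' @ [e])"
 shows "u = u'"
proof -
 have "u' @ [e] \<in> cyc (u @ [e])" using assms by simp
 then obtain p q where pq: "u @ [e] = p @ q" "u' @ [e] = q @ p" unfolding mem_cyc_iff by blast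
 show ?thesis
 proof (cases q rule: rev_cases)
  case Nil
  hence "u @ [e] = u' @ [e]" using pq by simp
  thus ?thesis by simp
 next
  case (snoc q' c)

   have "u = p @ q'" using pq snoc by simp
  moreover have "p = []"
  proof (rule ccontr)
   assume "p ~= []"
   hence "last p = e" using pq by (metis last_appendR last_snoc)
   hence "e \<in> set u" using \<open>p ~= []\<close> calculation by (metis Un_iff last_in_set set_append)
   thus False using assms by simp
  qed
  ultimately show ?thesis using pq snoc by simp
 qed
qed

lemma cyclic_orders_snoc:
 assumes "e \<in> T"
 shows "bij_betw (%u. cyc (u @ [e])) (perms (T - {e})) (cyclic_orders T)"
proof (rule bij_betw_imageI)
 show "inj_on (%u. cyc (u @ [e])) (perms (T - {e}))" by (rule , rule cyc_snoc_inj) (auto simp: perms_iff)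
 show "(%u. cyc (u @ [e])) ` perms (T - {e}) = cyclic_orders T"
 proof
  show "(%u. cyc (u @ [e])) ` perms (T - {e}) \<subseteq> cyclic_orders T" using assms by (auto simp: perms_iff cyclic_orders_def)
  show "cyclic_orders T \<subseteq> (%u. cyc (u @ [e])) ` perms (T - {e})"
  proof
   fix g assume "g \<in> cyclic_orders T"
   then obtain xs where xs: "g = cyc xs" "distinct xs" "set xs = T" unfolding cyclic_orders_def by blast
   obtain p q where pq: "xs = p @ e # q" using xs assms by (meson split_list)
   have "g = cyc ((q @ p) @ [e])" unfolding xs pq using cyc_append[of q] by simp
   moreover have "q @ p \<in> perms (T - {e})" using xs pq by (auto simp: perms_iff)
   ultimately show "g \<in> (%u. cyc (u @ [e])) ` perms (T - {e})" by blast
  qed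
 qed
qed

lemma cyc_in_cyclic_orders: "distinct xs ==> set xs = T ==> cyc xs \<in> cyclic_orders T"
 unfolding cyclic_orders_def by blast

lemma opposite_cyc: "opposite (cyc xs) = cyc (rev xs)"
proof -
 have *: "rev ` cyc ys \<subseteq> cyc (rev ys)" for ys :: "'a list" unfolding image_subset_iff Ball_def mem_cyc_iff by (metis rev_append)

 hence "cyc (rev xs) \<subseteq> rev ` cyc xs" by force
 thus ?thesis using * unfolding opposite_def by blast
qed

lemma permute_cyc_cyc: "permute_cyc s (cyc xs) = cyc (map s xs)"
 unfolding permute_cyc_def
proof
 show "map s ` cyc xs \<subseteq> cyc (map s xs)" unfolding image_subset_iff Ball_def mem_cyc_iff by (metis map_append)
 show "cyc (map s xs) \<subseteq> map s ` cyc xs"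
 proof
  fix ys assume "ys \<in> cyc (map s xs)"
  then obtain u w where "map s xs = u @ w" "ys = w @ u" unfolding mem_cyc_iff by blast
  then obtain u' w' where "xs = u' @ w'" "ys = map s (w' @ u')" by (metis append_eq_map_conv)
  thus "ys \<in> map s ` cyc xs" unfolding image_iff Bex_def mem_cyc_iff by blast
 qed
qed

lemma filter_eq_appendD: "filter P xs = p @ q ==> EX u w. xs = u @ w & filter P u = p & filter P w = q"
proof (induction xs arbitrary: p)
 case Nil
 thus ?case by simp
next
 case (Cons a xs)
 show ?case
 proof (cases "P a & p ~= []")
  case True
  then obtain p' where p: "p = a # p'" "filter P xs = p' @ q" using Cons.prems by (cases p) auto
  then obtain u w where "xs = u @ w" "filter P u = p'" "filter P w = q" using Cons.IH by blast
  thus ?thesis using True p by (intro exI[of _ "a # u"] exI) simp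
 next
  case False
  show ?thesis
  proof (cases "p = []")
   case True
   thus ?thesis using Cons.prems by (intro exI[of _ "[]"] exI[of _ "a # xs"]) simp
  next
   case f2: False
   hence na: "~ P a" using False by simp
   hence "filter P xs = p @ q" using Cons.prems by simp
   then obtain u w where "xs = u @ w" "filter P u = p" "filter P w = q" using Cons.IH by blast
   thus ?thesis using na by (intro exI[of _ "a # u"] exI) simp
  qed
 qed
qed

lemma restrict_cyc_cyc: "restrict_cyc T (cyc xs) = cyc (filter (%x. x \<in> T) xs)"
 unfolding restrict_cyc_def
proof
 show "filter (%x. x \<in> T) ` cyc xs \<subseteq> cyc (filter (%x. x \<in> T) xs)"
  unfolding image_subset_iff Ball_def mem_cyc_iff by (metis filter_append)
 show "cyc (filter (%x. x \<in> T) xs) \<subseteq> filter (%x. x \<in> T) ` cyc xs"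
 proof
  fix ys assume "ys \<in> cyc (filter (%x. x \<in> T) xs)"
  then obtain u w where uw: "filter (%x. x \<in> T) xs = u @ w" "ys = w @ u" unfolding mem_cyc_iff by blast
  then obtain u' w' where uw': "xs = u' @ w'" "filter (%x. x \<in> T) u' = u" "filter (%x. x \<in> T) w' = w"
   using filter_eq_appendD by blast
  hence "ys = filter (%x. x \<in> T) (w' @ u')" "w' @ u' \<in> cyc xs" using uw by (simp, unfold mem_cyc_iff, blast)
  thus "ys \<in> filter (%x. x \<in> T) ` cyc xs" by blast
 qed
qed

lemma underlying_cyc [simp]: "underlying (cyc xs) = set xs" by (auto simp: cyc_def underlying_def)

lemma underlying_cyclic_order: "g \<in> cyclic_orders T ==> underlying g = T"
 by (auto simp: cyclic_orders_def)

lemma finite_cyclic_order: "g \<in> cyclic_orders T ==> finite T"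
 by (auto simp: cyclic_orders_def)

lemma opposite_cyclic_order: "g \<in> cyclic_orders T ==> opposite g \<in> cyclic_orders T"
 by (force simp: cyclic_orders_def opposite_cyc)

lemma permute_cyclic_order: "g \<in> cyclic_orders T ==> inj_on s T ==> permute_cyc s g \<in> cyclic_orders (s ` T)"
 by (force simp: cyclic_orders_def permute_cyc_cyc distinct_map)

lemma permute_cyc_opposite: "permute_cyc s (opposite g) = opposite (permute_cyc s g)"
 by (simp add: permute_cyc_def opposite_def image_image rev_map)

lemma supp_polygon_space:
 assumes "v \<in> polygon_space T"
 shows "supp v \<subseteq> cyclic_orders T"
 using assms unfolding polygon_space_def
proof (rule supp_span)
 fix s assume "s \<in> polygon ` cyclic_orders T"
 then obtain c where g: "c \<in> cyclic_orders T" "s = polygon c" by blast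
 have "coef s \<eta> = 0" if "\<eta> \<notin> cyclic_orders T" for \<eta> using that g opposite_cyclic_order
  by (auto simp: polygon_def lookup_add lookup_single when_def)
 thus "supp s \<subseteq> cyclic_orders T" by auto
qed

section \<open>Cyclic cell-forms with all points finite\<close>

text \<open>The cell-form with all marked points at finite positions, before fixing three of them.\<close>

definition cyclic_chain :: "('a => complex) => 'a cyclic_order => complex" where
 "cyclic_chain x g = (let ys = (SOME ys. ys \<in> g) in chain x (ys @ [hd ys]))"

lemma cyclic_chain_cyc:
 assumes "xs ~= []"
 shows "cyclic_chain x (cyc xs) = chain x (xs @ [hd xs])"
proof -
 have "chain x (ys @ [hd ys]) = chain x (xs @ [hd xs])" if ys: "ys \<in> cyc xs" for ys
 proof -
  obtain u w where uw: "xs = u @ w" "ys = w @ u" using ys unfolding mem_cyc_iff by blast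
  show ?thesis
  proof (cases "u = [] | w = []")
   case True
   thus ?thesis using uw by auto
  next
   case False
   then obtain a u' b w' where "u = a # u'" "w = b # w'" by (meson neq_Nil_conv)
   thus ?thesis using uw chain_append[of x "a # u'" b "w' @ [a]"] chain_append[of x "b # w'" a "u' @ [b]"] by simp
  qed
 qed
 moreover have "(SOME ys. ys \<in> cyc xs) \<in> cyc xs" by (rule someI[of _ xs]) simp
 ultimately show ?thesis unfolding cyclic_chain_def Let_def by blast
qed

lemma cyclic_chain_snoc: "cyclic_chain x (cyc (u @ [e])) = chain x (e # u @ [e])"
 using cyclic_chain_cyc[of "e # u" x] by (simp add: cyc_Cons)

lemma cyclic_chain_permute: "g \<in> cyclic_orders T ==> T ~= {} ==> cyclic_chain x (permute_cyc s g) = cyclic_chain (%i. x (s i)) g"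
proof -
 assume "g \<in> cyclic_orders T" "T ~= {}"
 then obtain xs where xs: "g = cyc xs" "xs ~= []" by (auto simp: cyclic_orders_def)
 have "map s xs @ [hd (map s xs)] = map s (xs @ [hd xs])" using xs by (simp add: hd_map)
 thus ?thesis using xs by (simp only: permute_cyc_cyc cyclic_chain_cyc chain_map map_is_Nil_conv not_False_eq_True)
qed

text \<open>A closed word has \<open>card T\<close> steps, each of which changes sign. This is
  exactly the sign of the polygon quotient, so cyclic forms are well defined on it.\<close>

lemma cyclic_chain_opposite:
 assumes "g \<in> cyclic_orders T" "T ~= {}"
 shows "cyclic_chain x (opposite g) = of_rat (rev_sign g) * cyclic_chain x g"
proof -
 obtain e where e: "e \<in> T" using assms by blast
 obtain u where u: "g = cyc (u @ [e])" "u \<in> perms (T - {e})" using cyclic_orders_snoc[OF e] assms unfolding bij_betw_def by blast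
 have "card T = Suc (length u)" using u e finite_cyclic_order[OF assms(1)] by (simp add: perms_iff) (metis card.remove distinct_card)
 moreover have "cyclic_chain x (opposite g) = chain x (rev (e # u @ [e]))"
  unfolding u opposite_cyc using cyclic_chain_snoc by (simp add: cyc_Cons)
 moreover have "cyclic_chain x g = chain x (e # u @ [e])" unfolding u by (rule cyclic_chain_snoc)
 ultimately show ?thesis unfolding chain_rev
  using underlying_cyclic_order[OF assms(1)] by (simp add: rev_sign_def of_rat_minus of_rat_power)
qed

abbreviation cyclic_form :: "('a => complex) => ('a cyclic_order \<Rightarrow>\<^sub>0 rat) => complex" where
 "cyclic_form x \<equiv> lin_eval (cyclic_chain x)"

lemma cyclic_form_polygon:
 assumes "g \<in> cyclic_orders T" "T ~= {}"
 shows "cyclic_form x (polygon g) = cyclic_chain x g"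
proof -
 have "of_rat (rev_sign g) * (of_rat (rev_sign g) :: complex) = 1" by (metis of_rat_1 of_rat_mult rev_sign_square)
 thus ?thesis by (simp add: polygon_def lin_eval_scale lin_eval_add cyclic_chain_opposite[OF assms] of_rat_divide)
qed

lemma lin_eval_cyclic_orders:
 assumes "finite T" "e \<in> T" "supp v \<subseteq> cyclic_orders T"
 shows "lin_eval \<phi> v = (\<Sum>u\<in>perms (T - {e}). of_rat (coef v (cyc (u @ [e]))) * \<phi> (cyc (u @ [e])))"
proof -
 note bij = cyclic_orders_snoc[OF assms(2)]
 have "finite (cyclic_orders T)" using bij_betw_finite[OF bij] by simp
 hence "lin_eval \<phi> v = (\<Sum>g\<in>cyclic_orders T. of_rat (coef v g) * \<phi> g)"
  using assms(3) by (rule lin_eval_superset)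
 also have "... = (\<Sum>u\<in>perms (T - {e}). of_rat (coef v (cyc (u @ [e]))) * \<phi> (cyc (u @ [e])))"
  by (rule sum.reindex_bij_betw[OF bij, symmetric])
 finally show ?thesis .
qed

lemma cyclic_form_snoc:
 assumes "finite T" "e \<in> T" "supp v \<subseteq> cyclic_orders T"
 shows "cyclic_form x v = (\<Sum>u\<in>perms (T - {e}). of_rat (coef v (cyc (u @ [e]))) * chain x (e # u @ [e]))"
 using lin_eval_cyclic_orders[OF assms] by (simp add: cyclic_chain_snoc)

lemma cyclic_form_cong:
 assumes "finite T" "T ~= {}" "supp v \<subseteq> cyclic_orders T" "!!i. i \<in> T ==> x i = y i"
 shows "cyclic_form x v = cyclic_form y v"
proof -
 obtain e where e: "e \<in> T" using assms by blast
 show ?thesis unfolding cyclic_form_snoc[OF assms(1) e assms(3)]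
 proof (intro sum.cong refl arg_cong2[where f="(*)"] chain_cong)
  fix u a assume "u \<in> perms (T - {e})" "a \<in> set (e # u @ [e])"
  hence "a \<in> T" using e by (auto simp: perms_iff)
  thus "x a = y a" by (rule assms)
 qed
qed

text \<open>The substitution \<open>x i \<mapsto> 1 / (x i - x a)\<close> moves the point \<open>a\<close> to infinity.\<close>

lemma chain_inversion:
 assumes "distinct (a # w)" "inj_on x (set (a # w))" "w ~= []"
 shows "chain (%i. 1 / (x i - x a)) w = (-1) ^ length w * (\<Prod>i\<in>set w. (x i - x a)\<^sup>2) * chain x (a # w @ [a])"
 using assms
proof (induction w)
 case Nil
 thus ?case by simp
next
 case (Cons b w)
 have ba: "x b - x a ~= 0" using Cons.prems by auto
 show ?case
 proof (cases w)
  case Nil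
  have "(x b - x a) / (x a - x b) = -1" using ba by (simp add: divide_eq_eq)
  thus ?thesis using Nil ba by (simp add: power2_eq_square)
 next
  case (Cons c w')
  have ca: "x c - x a ~= 0" "x c - x b ~= 0" using Cons.prems Cons by auto
  have IH: "chain (%i. 1 / (x i - x a)) w = (-1) ^ length w * (\<Prod>i\<in>set w. (x i - x a)\<^sup>2) * chain x (a # w @ [a])"
   using Cons.prems by (intro Cons.IH) (auto simp: Cons)
  let ?y = "%i. 1 / (x i - x a)" and ?s = "(-1) ^ length w :: complex"
   and ?P = "\<Prod>i\<in>set w. (x i - x a)\<^sup>2" and ?E = "chain x (w @ [a])"
  have alg: "s * P * (E / d2) / (- d3 / (d2 * d1)) = - s * (d1\<^sup>2 * P) * (E / (d3 * d1))"
   if "d1 ~= 0" "d2 ~= 0" "d3 ~= 0" for s P E d1 d2 d3 :: complex using that by (simp add: power2_eq_square)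
  have frac: "1 / (x c - x a) - 1 / (x b - x a) = - (x c - x b) / ((x c - x a) * (x b - x a))" using ca ba by (simp add: field_simps)
  have E: "chain x (a # w @ [a]) = ?E / (x c - x a)" by (simp add: Cons)
  have "chain ?y (b # w) = chain ?y w / (1 / (x c - x a) - 1 / (x b - x a))" by (simp add: Cons)
  also have "... = ?s * ?P * (?E / (x c - x a)) / (- (x c - x b) / ((x c - x a) * (x b - x a)))" by (simp only: IH E frac)
  also have "... = - ?s * ((x b - x a)\<^sup>2 * ?P) * (?E / ((x c - x b) * (x b - x a)))" by (rule alg) (use ca ba in auto)
  also have "(x b - x a)\<^sup>2 * ?P = (\<Prod>i\<in>set (b # w). (x i - x a)\<^sup>2)" using Cons.prems by simp
  also have "?E / ((x c - x b) * (x b - x a)) = chain x (a # (b # w) @ [a])" by (simp add: Cons)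
  finally show ?thesis by simp
 qed
qed

lemma sum_chain_inversion:
 assumes "a \<notin> B" "inj_on x (insert a B)" "B ~= {}"
 shows "(\<Sum>w\<in>perms B. g w * chain (%i. 1 / (x i - x a)) w) =
  (-1) ^ card B * (\<Prod>i\<in>B. (x i - x a)\<^sup>2) * (\<Sum>w\<in>perms B. g w * chain x (a # w @ [a]))" unfolding sum_distrib_left
proof (rule sum.cong[OF refl])
 fix w assume "w \<in> perms B"
 hence w: "distinct w" "set w = B" by (simp_all add: perms_iff)
 have "chain (%i. 1 / (x i - x a)) w = (-1) ^ length w * (\<Prod>i\<in>set w. (x i - x a)\<^sup>2) * chain x (a # w @ [a])"
  by (rule chain_inversion) (use w assms in auto)
 thus "g w * chain (%i. 1 / (x i - x a)) w =
  (-1) ^ card B * (\<Prod>i\<in>B. (x i - x a)\<^sup>2) * (g w * chain x (a # w @ [a]))" using w distinct_card[OF w(1)] by simp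
qed

text \<open>Inversion at \<open>a\<close> multiplies all closed words through \<open>a\<close> by
  the same nonzero factor, and every configuration of the remaining points is obtained by inversion
  after a translation. Closed words through \<open>a\<close> are thus words with \<open>a\<close> at
  infinity.\<close>

lemma chain_sum_0_iff:
 fixes g :: "'a list => complex"
 assumes "finite B" "a \<notin> B" "B ~= {}"
 shows "(ALL y. inj_on y B --> (\<Sum>w\<in>perms B. g w * chain y w) = 0) \<longleftrightarrow>
  (ALL x. inj_on x (insert a B) --> (\<Sum>w\<in>perms B. g w * chain x (a # w @ [a])) = 0)"
proof (intro iffI allI impI)
 fix x :: "'a => complex" assume h: "ALL y. inj_on y B --> (\<Sum>w\<in>perms B. g w * chain y w) = 0" and x: "inj_on x (insert a B)"
 have ne: "x i - x a ~= 0" if "i \<in> B" for i using x that assms(2) by (auto simp: inj_on_def)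
 have "inj_on (%i. 1 / (x i - x a)) B" using x by (auto simp: inj_on_def)
 hence "(\<Sum>w\<in>perms B. g w * chain (%i. 1 / (x i - x a)) w) = 0" using h by blast
 moreover have "(\<Prod>i\<in>B. (x i - x a)\<^sup>2) ~= 0" using ne assms(1) by simp
 ultimately show "(\<Sum>w\<in>perms B. g w * chain x (a # w @ [a])) = 0" unfolding sum_chain_inversion[OF assms(2) x assms(3)] by simp
next
 fix y :: "'a => complex" assume h: "ALL x. inj_on x (insert a B) --> (\<Sum>w\<in>perms B. g w * chain x (a # w @ [a])) = 0" and y: "inj_on y B"
 have "finite ((%i. - y i) ` B)" using assms(1) by simp
 \<comment> \<open>The translation by \<open>c\<close> keeps the positions \<open>y i\<close> away
   from 0, so that they can be inverted, with \<open>a\<close> placed at 0.\<close>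
 then obtain c where c: "c \<notin> (%i. - y i) ` B" using ex_new_if_finite[OF infinite_UNIV_char_0[where 'a = complex]] by meson
 have ne: "y i + c ~= 0" if "i \<in> B" for i
 proof
  assume "y i + c = 0"
  hence "c = - y i" by (simp add: add_eq_0_iff)
  thus False using c that by blast
 qed
 define x where "x i = (if i = a then 0 else 1 / (y i + c))" for i
 have x: "inj_on x (insert a B)"
 proof (rule inj_onI)
  fix i j assume "i \<in> insert a B" "j \<in> insert a B" "x i = x j"
  thus "i = j" using inj_onD[OF y, of i j] ne[of i] ne[of j] by (auto simp: x_def split: if_splits)
 qed
 have *: "chain (%i. 1 / (x i - x a)) w = chain y w" if w: "w \<in> perms B" for w
 proof -
  have "chain (%i. 1 / (x i - x a)) w = chain (%i. 1 * y i + c) w"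
   by (rule chain_cong) (use w assms(2) in "auto simp: x_def perms_iff")
  thus ?thesis by (subst (asm) chain_affine) simp_all
 qed
 have "(\<Sum>w\<in>perms B. g w * chain (%i. 1 / (x i - x a)) w) = 0"
  unfolding sum_chain_inversion[OF assms(2) x assms(3)] using h x by simp
 thus "(\<Sum>w\<in>perms B. g w * chain y w) = 0" using * by simp
qed

section \<open>Regularity along a divisor\<close>

text \<open>Absence of a pole along the divisor on which the points of \<open>A\<close> collide, for arbitrary
 cyclic orders and with all points at finite positions: this makes the condition invariant under
 relabelling and, by \<open>regular_iff_split\<close>, symmetric in the two blocks of the partition.\<close>

definition regular :: "'a set => 'a set => ('a cyclic_order \<Rightarrow>\<^sub>0 rat) => bool" where
 "regular T A v \<longleftrightarrow> (ALL z s. collidable A z s T -->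
   ((%e. e ^ (card A - 1) * cyclic_form (collide A z s e) v) \<longlongrightarrow> 0) (at 0))"

abbreviation residue_coef :: "('a cyclic_order \<Rightarrow>\<^sub>0 rat) => 'a set => 'a => 'a => ('a => complex) => 'a list => complex" where
 "residue_coef v A a e s w \<equiv> \<Sum>u\<in>perms A. of_rat (coef v (cyc (subst1 a u w @ [e]))) * chain s u"

text \<open>\<open>residue_sum\<close> with the base point \<open>e\<close> at both ends; the base
  point has to lie outside the colliding set.\<close>

lemma cyclic_form_residue:
 assumes "finite T" "A \<subseteq> T" "a \<in> A" "e \<in> T" "e \<notin> A" "supp v \<subseteq> cyclic_orders T" "collidable A z s T"
 shows "((%t. t ^ (card A - 1) * cyclic_form (collide A z s t) v) \<longlongrightarrow>
  (\<Sum>w\<in>perms (insert a (T - {e} - A)). residue_coef v A a e s w * chain z (e # w @ [e]))) (at 0)"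
proof -
 have "set [e] Un (T - {e}) Un set [e] = T" using assms by auto
 hence col: "collidable A z s (set [e] Un (T - {e}) Un set [e])" using assms by metis
 have sub: "A \<subseteq> T - {e}" using assms by blast
 have fin: "finite (T - {e})" using assms by simp
 obtain H where H: "H field_differentiable (at 0)"
  "H 0 = (\<Sum>w\<in>perms (insert a (T - {e} - A)). \<Sum>u\<in>perms A.
    of_rat (coef v (cyc (subst1 a u w @ [e]))) * chain s u * chain z ([e] @ w @ [e]))"
  "!!t. t ~= 0 ==> H t = t ^ (card A - 1) *
    (\<Sum>w\<in>perms (T - {e}). of_rat (coef v (cyc (w @ [e]))) * chain (collide A z s t) ([e] @ w @ [e]))"
  using residue_sum[where c = "%w. of_rat (coef v (cyc (w @ [e])))" and pre = "[e]" and post = "[e]", OF fin sub assms(3) col]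
  by auto
 have "(H \<longlongrightarrow> H 0) (at 0)" using field_differentiable_imp_continuous_at[OF H(1)] by (simp add: continuous_within)
 hence "((%t. t ^ (card A - 1) * cyclic_form (collide A z s t) v) \<longlongrightarrow> H 0) (at 0)"
 proof (rule Lim_transform_eventually)
  show "\<forall>\<^sub>F t in at 0. H t = t ^ (card A - 1) * cyclic_form (collide A z s t) v"
   unfolding eventually_at_filter by (simp add: H cyclic_form_snoc[OF assms(1,4,6)])
 qed
 thus ?thesis unfolding H by (simp add: sum_distrib_right)
qed

lemma regular_iff_cyclic:
 assumes "finite T" "A \<subseteq> T" "a \<in> A" "e \<in> T" "e \<notin> A" "supp v \<subseteq> cyclic_orders T"
 shows "regular T A v \<longleftrightarrow> (ALL s. inj_on s A --> (ALL x. inj_on x (insert a (T - A)) -->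
  (\<Sum>w\<in>perms (insert a (T - {e} - A)). residue_coef v A a e s w * chain x (e # w @ [e])) = 0))"
proof (intro iffI allI impI)
 fix s x :: "'a => complex"
 assume reg: "regular T A v" and s: "inj_on s A" and x: "inj_on x (insert a (T - A))"
 let ?z = "%i. if i \<in> A then x a else x i"
 have "collidable A ?z s T" by (rule collidable_extend) (use s x assms in auto)
 from cyclic_form_residue[OF assms this]
 have "(\<Sum>w\<in>perms (insert a (T - {e} - A)). residue_coef v A a e s w * chain ?z (e # w @ [e])) = 0"
  using reg \<open>collidable A ?z s T\<close> unfolding regular_def by (meson LIM_unique)
 moreover have "chain ?z (e # w @ [e]) = chain x (e # w @ [e])" if "w \<in> perms (insert a (T - {e} - A))" for w
  by (rule chain_cong) (use that assms in "auto simp: perms_iff")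
 ultimately show "(\<Sum>w\<in>perms (insert a (T - {e} - A)). residue_coef v A a e s w * chain x (e # w @ [e])) = 0" by simp
next
 assume h: "ALL s. inj_on s A --> (ALL x. inj_on x (insert a (T - A)) -->
  (\<Sum>w\<in>perms (insert a (T - {e} - A)). residue_coef v A a e s w * chain x (e # w @ [e])) = 0)"
 show "regular T A v" unfolding regular_def
 proof (intro allI impI)
  fix z s assume col: "collidable A z s T"
  have "inj_on z (insert a (T - A))"
  proof (rule inj_onI)
   fix i j assume ij: "i \<in> insert a (T - A)" "j \<in> insert a (T - A)" "z i = z j"
   show "i = j" by (use ij collidable_neq[OF col] assms in auto)
  qed
  hence "(\<Sum>w\<in>perms (insert a (T - {e} - A)). residue_coef v A a e s w * chain z (e # w @ [e])) = 0"
   using h collidable_inj[OF col] by blast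
  thus "((%t. t ^ (card A - 1) * cyclic_form (collide A z s t) v) \<longlongrightarrow> 0) (at 0)"
   using cyclic_form_residue[OF assms col] by simp
 qed
qed

text \<open>The base point \<open>e\<close> of the residue is sent to infinity, which leaves a plain
  sum of words.\<close>

lemma regular_iff_residues:
 assumes "finite T" "A \<subseteq> T" "a \<in> A" "e \<in> T" "e \<notin> A" "supp v \<subseteq> cyclic_orders T"
 shows "regular T A v \<longleftrightarrow> (ALL s. inj_on s A --> (ALL z. inj_on z (insert a (T - {e} - A)) -->
  (\<Sum>w\<in>perms (insert a (T - {e} - A)). residue_coef v A a e s w * chain z w) = 0))"
proof -
 have "insert e (insert a (T - {e} - A)) = insert a (T - A)" using assms by auto
 thus ?thesis unfolding regular_iff_cyclic[OF assms] by (subst chain_sum_0_iff[of _ e]) (use assms in auto)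
qed

text \<open>The closed word through \<open>e\<close> is read from \<open>a\<close> instead: the two
  letters exchange the role of base point.\<close>

definition reroot :: "'a => 'a => 'a list => 'a list" where
 "reroot a e w = tl (dropWhile (%i. i ~= a) w) @ e # takeWhile (%i. i ~= a) w"

lemma reroot_append: "a \<notin> set p ==> reroot a e (p @ a # q) = q @ e # p"
proof -
 assume "a \<notin> set p"
 hence "dropWhile (%i. i ~= a) (p @ a # q) = a # q" "takeWhile (%i. i ~= a) (p @ a # q) = p"
  by (auto simp: dropWhile_append takeWhile_append)
 thus ?thesis by (simp add: reroot_def)
qed

lemma sum_reroot:
 assumes "a \<notin> R" "e \<notin> R"
 shows "(\<Sum>w\<in>perms (insert a R). f (reroot a e w)) = (\<Sum>w\<in>perms (insert e R). f w)"
proof (rule sum.reindex_bij_witness[where j = "reroot a e" and i = "reroot e a"])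
 have *: "reroot e a (reroot a e w) = w & reroot a e w \<in> perms (insert e R)"
  if w: "w \<in> perms (insert a R)" and ae: "a \<notin> R" "e \<notin> R" for a e w
 proof -
  obtain p q where pq: "w = p @ a # q" "a \<notin> set p" "a \<notin> set q" "p @ q \<in> perms R" using perms_split[OF w ae(1)] .
  have "e \<notin> set q" using pq ae by (auto simp: perms_iff)
  thus ?thesis using pq ae by (auto simp: reroot_append perms_iff)
 qed
 show "reroot e a (reroot a e w) = w" if "w \<in> perms (insert a R)" for w using *[OF that assms] by blast
 show "reroot a e w \<in> perms (insert e R)" if "w \<in> perms (insert a R)" for w using *[OF that assms] by blast
 show "reroot a e (reroot e a w) = w" if "w \<in> perms (insert e R)" for w using *[OF that assms(2,1)] by blast
 show "reroot e a w \<in> perms (insert a R)" if "w \<in> perms (insert e R)" for w using *[OF that assms(2,1)] by blast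
qed simp

text \<open>Rerooting the residue at the collapsed block \<open>a\<close> and sending
  \<open>a\<close> to infinity removes both auxiliary points: what remains pairs words on
  \<open>A\<close> with words on the complement.\<close>

lemma regular_iff_split:
 assumes "finite T" "A \<subseteq> T" "A ~= {}" "T - A ~= {}" "supp v \<subseteq> cyclic_orders T"
 shows "regular T A v \<longleftrightarrow> (ALL s. inj_on s A --> (ALL x. inj_on x (T - A) -->
  (\<Sum>w\<in>perms (T - A). (\<Sum>u\<in>perms A. of_rat (coef v (cyc (u @ w))) * chain s u) * chain x w) = 0))"
proof -
 obtain a e where ae: "a \<in> A" "e \<in> T" "e \<notin> A" using assms by blast
 have eq: "(\<Sum>w\<in>perms (insert a (T - {e} - A)). residue_coef v A a e s w * chain x (e # w @ [e])) =
  (\<Sum>w\<in>perms (T - A). (\<Sum>u\<in>perms A. of_rat (coef v (cyc (u @ w))) * chain s u) * chain x (a # w @ [a]))" (is "_ = sum ?f _")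
  for s x
 proof -
  have "insert e (T - {e} - A) = T - A" using ae by auto
  moreover have "(\<Sum>w\<in>perms (insert a (T - {e} - A)). ?f (reroot a e w)) = (\<Sum>w\<in>perms (insert e (T - {e} - A)). ?f w)"
   by (rule sum_reroot) (use ae in auto)
  moreover have "residue_coef v A a e s w * chain x (e # w @ [e]) = ?f (reroot a e w)"
   if w: "w \<in> perms (insert a (T - {e} - A))" for w
  proof -
   obtain p q where pq: "w = p @ a # q" "a \<notin> set p" "a \<notin> set q" "p @ q \<in> perms (T - {e} - A)"
    using perms_split[OF w] ae by auto
   have "cyc (subst1 a u w @ [e]) = cyc (u @ reroot a e w)" for u
    unfolding pq reroot_append[OF pq(2)] using pq cyc_append[of "u @ q @ [e]"] by simp
   moreover have "chain x (e # w @ [e]) = chain x (a # reroot a e w @ [a])" unfolding pq reroot_append[OF pq(2)]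
    using chain_append[of x "e # p" a "q @ [e]"] chain_append[of x "a # q" e "p @ [a]"] by simp
   ultimately show ?thesis by simp
  qed
  ultimately show ?thesis by simp
 qed
 have "regular T A v \<longleftrightarrow> (ALL s. inj_on s A --> (ALL x. inj_on x (insert a (T - A)) -->
  (\<Sum>w\<in>perms (T - A). (\<Sum>u\<in>perms A. of_rat (coef v (cyc (u @ w))) * chain s u) * chain x (a # w @ [a])) = 0))"
  unfolding regular_iff_cyclic[OF assms(1,2) ae assms(5)] eq ..
 thus ?thesis by (subst chain_sum_0_iff) (use assms ae in auto)
qed

text \<open>In \<open>regular_iff_split\<close> the two blocks enter symmetrically, since
  \<open>cyc (u @ w) = cyc (w @ u)\<close>; exchanging the order of summation is enough.\<close>

lemma regular_complement:
 assumes "finite T" "A \<subseteq> T" "A ~= {}" "T - A ~= {}" "supp v \<subseteq> cyclic_orders T"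
 shows "regular T (T - A) v \<longleftrightarrow> regular T A v"
proof -
 have A: "T - (T - A) = A" using assms by blast
 have eq: "(\<Sum>w\<in>perms A. (\<Sum>u\<in>perms (T - A). of_rat (coef v (cyc (u @ w))) * chain s u) * chain x w) =
  (\<Sum>w\<in>perms (T - A). (\<Sum>u\<in>perms A. of_rat (coef v (cyc (u @ w))) * chain x u) * chain s w)" for s x
  unfolding sum_distrib_right by (subst sum.swap) (simp add: cyc_append mult.left_commute mult.commute)
 have "regular T (T - A) v \<longleftrightarrow> (ALL s. inj_on s (T - A) --> (ALL x. inj_on x A -->
  (\<Sum>w\<in>perms A. (\<Sum>u\<in>perms (T - A). of_rat (coef v (cyc (u @ w))) * chain s u) * chain x w) = 0))"
  using regular_iff_split[OF assms(1) Diff_subset assms(4) _] assms unfolding A by blast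
 thus ?thesis unfolding eq regular_iff_split[OF assms] by blast
qed

text \<open>Collision data for the relabelled points are pulled back along \<open>h\<close>, and
  conversely pushed forward along its inverse on \<open>T\<close>; the forms agree at corresponding
  positions.\<close>

lemma regular_transfer:
 assumes "finite T" "T ~= {}" "supp v \<subseteq> cyclic_orders T" "A \<subseteq> T" "inj_on h T"
  and v': "!!x. cyclic_form x v' = cyclic_form (%i. x (h i)) v"
 shows "regular (h ` T) (h ` A) v' \<longleftrightarrow> regular T A v"
proof -
 have mem: "h i \<in> h ` A \<longleftrightarrow> i \<in> A" if "i \<in> T" for i
  using inj_on_image_mem_iff[OF assms(5) that assms(4)] .
 have card: "card (h ` A) = card A" using inj_on_subset[OF assms(5,4)] by (rule card_image)
 have form: "cyclic_form (collide (h ` A) z s e) v' = cyclic_form (collide A (%i. z (h i)) (%i. s (h i)) e) v" for z s e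
  unfolding v' by (rule cyclic_form_cong[OF assms(1-3)]) (simp add: collide_def mem)
 have inj: "inj_on s (h ` A) \<longleftrightarrow> inj_on (%i. s (h i)) A" for s :: "'b => complex"
  using comp_inj_on_iff[OF inj_on_subset[OF assms(5,4)]] by (simp add: comp_def)
 have neq: "h i ~= h j \<longleftrightarrow> i ~= j" if "i \<in> T" "j \<in> T" for i j using inj_on_eq_iff[OF assms(5) that] by simp
 have col: "collidable (h ` A) z s (h ` T) \<longleftrightarrow> collidable A (%i. z (h i)) (%i. s (h i)) T" for z s
  unfolding collidable_def inj by (simp add: mem neq)
 show ?thesis
 proof
  assume reg: "regular (h ` T) (h ` A) v'"
  show "regular T A v" unfolding regular_def
  proof (intro allI impI)
   fix z s assume c: "collidable A z s T"
   let ?i = "inv_into T h"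
   let ?z = "%j. z (?i j)" and ?s = "%j. s (?i j)"
   have inv: "?i (h i) = i" if "i \<in> T" for i using assms that by simp
   have "inj_on (%i. ?s (h i)) A \<longleftrightarrow> inj_on s A" by (rule inj_on_cong) (use assms in auto)
   hence "collidable A (%i. ?z (h i)) (%i. ?s (h i)) T" using c inv unfolding collidable_def by simp
   hence "collidable (h ` A) ?z ?s (h ` T)" unfolding col .
   hence "((%e. e ^ (card (h ` A) - 1) * cyclic_form (collide (h ` A) ?z ?s e) v') \<longlongrightarrow> 0) (at 0)"
    using reg unfolding regular_def by blast
   hence "((%e. e ^ (card A - 1) * cyclic_form (collide A (%i. ?z (h i)) (%i. ?s (h i)) e) v) \<longlongrightarrow> 0) (at 0)"
    unfolding form card .
   moreover have "cyclic_form (collide A (%i. ?z (h i)) (%i. ?s (h i)) e) v = cyclic_form (collide A z s e) v" for e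
    by (rule cyclic_form_cong[OF assms(1-3)]) (simp add: collide_def inv)
   ultimately show "((%e. e ^ (card A - 1) * cyclic_form (collide A z s e) v) \<longlongrightarrow> 0) (at 0)" by simp
  qed
 next
  assume reg: "regular T A v"
  show "regular (h ` T) (h ` A) v'" unfolding regular_def form col card using reg unfolding regular_def by blast
 qed
qed

lemma regular_subspace: "qvec.subspace {v. regular T A v}"
proof (rule qvec.subspaceI)
 show "0 \<in> {v. regular T A v}" by (simp add: regular_def)
next
 fix v w assume h: "v \<in> {v. regular T A v}" "w \<in> {v. regular T A v}"
 show "v + w \<in> {v. regular T A v}" unfolding mem_Collect_eq regular_def
 proof (intro allI impI)
  fix z s assume c: "collidable A z s T"
  have "((%e. e ^ (card A - 1) * cyclic_form (collide A z s e) v + e ^ (card A - 1) * cyclic_form (collide A z s e) w) \<longlongrightarrow> 0 + 0) (at 0)"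
   by (rule tendsto_add) (use h c in "simp_all add: regular_def")
  thus "((%e. e ^ (card A - 1) * cyclic_form (collide A z s e) (v + w)) \<longlongrightarrow> 0) (at 0)"
   by (simp add: lin_eval_add distrib_left)
 qed
next
 fix c v assume h: "v \<in> {v. regular T A v}"
 show "qscale c v \<in> {v. regular T A v}" unfolding mem_Collect_eq regular_def
 proof (intro allI impI)
  fix z s assume col: "collidable A z s T"
  have "((%e. of_rat c * (e ^ (card A - 1) * cyclic_form (collide A z s e) v)) \<longlongrightarrow> of_rat c * 0) (at 0)"
   by (rule tendsto_mult[OF tendsto_const]) (use h col in "simp add: regular_def")
  thus "((%e. e ^ (card A - 1) * cyclic_form (collide A z s e) (qscale c v)) \<longlongrightarrow> 0) (at 0)"
   by (simp add: lin_eval_scale mult.left_commute)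
 qed
qed

lemma regular_if_form_0:
 assumes "finite T" "!!x. inj_on x T ==> cyclic_form x v = 0"
 shows "regular T A v"
 unfolding regular_def
proof (intro allI impI)
 fix z s assume "collidable A z s T"
 hence "\<forall>\<^sub>F e in at 0. inj_on (collide A z s e) T" by (rule collide_inj[OF assms(1)])
 hence "\<forall>\<^sub>F e in at 0. e ^ (card A - 1) * cyclic_form (collide A z s e) v = 0"
  by eventually_elim (simp add: assms)
 thus "((%e. e ^ (card A - 1) * cyclic_form (collide A z s e) v) \<longlongrightarrow> 0) (at 0)"
  by (rule tendsto_eventually)
qed

section \<open>Arcs of a cyclic order\<close>

lemma consecutive_cyc_iff: "consecutive (cyc xs) A \<longleftrightarrow> (EX b c. A = set b & b @ c \<in> cyc xs)"
 unfolding consecutive_def by (metis append_eq_conv_conj append_take_drop_id)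

lemma consecutive_block: "consecutive (cyc (p @ b @ q)) (set b)"
 unfolding consecutive_cyc_iff mem_cyc_iff by (metis append.assoc)

lemma consecutive_complement:
 assumes "consecutive (cyc xs) A" "distinct xs"
 shows "consecutive (cyc xs) (set xs - A)"
proof -
 obtain b c where bc: "A = set b" "b @ c \<in> cyc xs" using assms unfolding consecutive_cyc_iff by blast
 then obtain k where k: "b @ c = rotate k xs" by (auto simp: cyc_def)
 hence "set xs = set b Un set c" "set b Int set c = {}" by (metis set_append set_rotate) (metis k assms distinct_append distinct_rotate)
 hence "set xs - A = set c" using bc by blast
 moreover have "c @ b \<in> cyc xs" using bc by (metis cyc_append cyc_eqI self_in_cyc)
 ultimately show ?thesis unfolding consecutive_cyc_iff by blast
qed

lemma consecutive_opposite: "g \<in> cyclic_orders T ==> consecutive (opposite g) A ==> consecutive g A"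
proof -
 assume "g \<in> cyclic_orders T" "consecutive (opposite g) A"
 then obtain xs where xs: "g = cyc xs" "consecutive (cyc (rev xs)) A" by (auto simp: cyclic_orders_def opposite_cyc)
 then obtain b c where bc: "A = set b" "b @ c \<in> cyc (rev xs)" unfolding consecutive_cyc_iff by blast
 hence "cyc (rev (b @ c)) = cyc xs" by (metis cyc_eqI opposite_cyc rev_rev_ident)
 hence "cyc (rev b @ rev c) = cyc xs" by (metis cyc_append rev_append)
 hence "rev b @ rev c \<in> cyc xs" by force
 thus ?thesis using bc unfolding xs consecutive_cyc_iff by (metis set_rev)
qed

lemma consecutive_permute:
 assumes "g \<in> cyclic_orders T" "consecutive (permute_cyc s g) A"
 shows "EX A'. A' \<subseteq> T & A = s ` A' & consecutive g A'"
proof -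
 obtain xs where xs: "g = cyc xs" "set xs = T" using assms by (auto simp: cyclic_orders_def)
 obtain ys k where ys: "ys \<in> cyc xs" "A = set (take k (map s ys))"
  using assms unfolding xs consecutive_def permute_cyc_def by blast
 have "A = s ` set (take k ys)" using ys by (simp add: take_map)
 moreover have "set (take k ys) \<subseteq> T" using ys xs by (auto simp: cyc_def dest: in_set_takeD)
 ultimately show ?thesis using ys unfolding xs consecutive_def by blast
qed

lemma consecutive_restrict:
 assumes "consecutive g A"
 shows "consecutive (restrict_cyc T g) (A Int T)"
proof -
 obtain ys k where ys: "ys \<in> g" "A = set (take k ys)" using assms unfolding consecutive_def by blast
 let ?f = "filter (%x. x \<in> T)"
 have "?f ys = ?f (take k ys) @ ?f (drop k ys)" by (metis append_take_drop_id filter_append)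
 hence "take (length (?f (take k ys))) (?f ys) = ?f (take k ys)" by simp
 hence "A Int T = set (take (length (?f (take k ys))) (?f ys))" using ys by auto
 thus ?thesis using ys unfolding consecutive_def restrict_cyc_def by blast
qed

lemma consecutive_linear:
 assumes "distinct (xs @ [e])" "consecutive (cyc (xs @ [e])) A" "e \<notin> A"
 shows "EX p b q. xs = p @ b @ q & A = set b"
proof -
 obtain b c where bc: "A = set b" "b @ c \<in> cyc (xs @ [e])" using assms unfolding consecutive_cyc_iff by blast
 hence "set (b @ c) = set (xs @ [e])" unfolding cyc_def mem_Collect_eq by (metis set_rotate)
 hence "e \<in> set (b @ c)" by simp
 hence "e \<in> set c" using assms bc by simp
 then obtain c1 c2 where c: "c = c1 @ e # c2" by (meson split_list)
 have "cyc (xs @ [e]) = cyc (b @ c)" using cyc_eqI[OF bc(2)] by simp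
 also have "... = cyc ((c2 @ b @ c1) @ [e])" using cyc_append[of c2] by (simp add: c)
 finally have "xs = c2 @ b @ c1" using cyc_snoc_inj[OF assms(1)] by blast
 thus ?thesis using bc by blast
qed

text \<open>Convergence on the cell of an arbitrary cyclic order. The product map moves the standard
  cell to other cells and back, so the standard order is too narrow here.\<close>

definition arc_regular :: "label set => label cyclic_order => (label cyclic_order \<Rightarrow>\<^sub>0 rat) => bool" where
 "arc_regular T g v \<longleftrightarrow>
  (\<forall>A\<subseteq>T. consecutive g A & 2 <= card A & 2 <= card (T - A) --> regular T A v)"

lemma arc_regular_opposite:
 "g \<in> cyclic_orders T ==> arc_regular T g v ==> arc_regular T (opposite g) v"
 unfolding arc_regular_def using consecutive_opposite by blast

section \<open>Marked points as numbers\<close>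

text \<open>The letter \<open>0\<close> stands for the additional letter \<open>d\<close>.\<close>

definition point :: "nat => nat => label" where
 "point n i = (if i = 0 then Pinf else letter_label n i)"

lemma point_inj: "inj_on (point n) {0..n - 1}"
 by (rule inj_onI) (auto simp: point_def letter_label_def split: if_splits)

lemma point_image:
 assumes "3 <= n"
 shows "point n ` {0..n - 1} = Z n"
proof
 show "point n ` {0..n - 1} \<subseteq> Z n" by (fastforce simp: point_def letter_label_def labels_def)
 show "Z n \<subseteq> point n ` {0..n - 1}"
 proof
  fix x assume x: "x \<in> Z n"
  have "x = point n (case x of P0 => 1 | P1 => n - 1 | Pinf => 0 | Pt j => Suc j)"
   using x assms by (cases x) (auto simp: point_def letter_label_def labels_def)
  moreover have "(case x of P0 => 1 | P1 => n - 1 | Pinf => 0 | Pt j => Suc j) \<in> {0..n - 1}"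
   using x assms by (auto simp: labels_def)
  ultimately show "x \<in> point n ` {0..n - 1}" by blast
 qed
qed

lemma point_finite_image: "3 <= n ==> point n ` {1..n - 1} = Z n - {Pinf}"
proof -
 assume n: "3 <= n"
 have "{0..n - 1} = insert 0 {1..n - 1}" by auto
 hence "Z n = insert (point n 0) (point n ` {1..n - 1})" using point_image[OF n] by (metis image_insert)
 hence "Z n = insert Pinf (point n ` {1..n - 1})" by (simp add: point_def)
 moreover have "Pinf \<notin> point n ` {1..n - 1}" by (auto simp: point_def letter_label_def)
 ultimately show ?thesis by auto
qed

lemma map_point: "0 \<notin> set u ==> map (letter_label n) u = map (point n) u"
 by (auto simp: point_def)

lemma delta_eq:
 assumes "3 <= n"
 shows "delta n = cyc (map (point n) [1..<n] @ [Pinf])"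
proof -
 have "[1..<n] = 1 # map Suc [1..<n - 2] @ [n - 1]"
 proof -
  have "[1..<n] = 1 # [2..<n]" using assms by (simp add: upt_conv_Cons numeral_2_eq_2)
  also have "[2..<n] = [2..<n - 1] @ [n - 1]" using assms upt_Suc_append[of 2 "n - 1"] by simp
  also have "[2..<n - 1] = map Suc [1..<n - 2]" using assms by (simp add: map_Suc_upt numeral_2_eq_2 Suc_diff_Suc)
  finally show ?thesis by simp
 qed
 moreover have "map (point n) (map Suc [1..<n - 2]) = map Pt [1..<n - 2]" by (auto simp: point_def letter_label_def)
 moreover have "{1..n - 3} = {1..<n - 2}" by auto
 moreover have "point n 1 = P0" "point n (n - 1) = P1" using assms by (auto simp: point_def letter_label_def)
 ultimately show ?thesis by (simp add: std_order_def del: map_map)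
qed

lemma delta_distinct: "3 <= n ==> distinct (map (point n) [1..<n] @ [Pinf])"
proof -
 assume n: "3 <= n"
 have "set [1..<n] \<subseteq> {0..n - 1}" by auto
 hence "inj_on (point n) (set [1..<n])" using point_inj inj_on_subset by blast
 moreover have "Pinf \<notin> point n ` set [1..<n]" by (auto simp: point_def letter_label_def)
 ultimately show ?thesis by (simp add: distinct_map)
qed

lemma delta_set: "3 <= n ==> set (map (point n) [1..<n] @ [Pinf]) = Z n"
proof -
 assume n: "3 <= n"
 have "set [1..<n] = {1..n - 1}" by auto
 thus ?thesis using point_finite_image[OF n] by (auto simp: labels_def)
qed

lemma finite_labels [simp]: "finite S ==> finite (labels S)"
 by (simp add: labels_def)

lemma labels_mem [simp]: "P0 \<in> labels S" "P1 \<in> labels S" "Pinf \<in> labels S"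
 by (simp_all add: labels_def)

lemma upt_block: "[1..<n] = p @ b @ q ==> set b = {Suc (length p)..length p + length b}"
proof -
 assume h: "[1..<n] = p @ b @ q"
 have len: "n - 1 = length p + length b + length q" using arg_cong[OF h, of length] by simp
 have "b = take (length b) (drop (length p) [1..<n])" unfolding h by simp
 also have "... = [1 + length p..<1 + length p + length b]"
 proof (cases "b = []")
  case False
  hence "1 + length p + length b <= n" using len by (cases b) auto
  thus ?thesis by (simp add: take_upt)
 qed simp
 finally have "set b = set [1 + length p..<1 + length p + length b]" by (rule arg_cong)
 also have "... = {Suc (length p)..length p + length b}" by (simp add: atLeastLessThanSuc_atLeastAtMost del: upt_Suc)
 finally show ?thesis .
qed

text \<open>Read from infinity, a block of the standard order without infinity is an interval of
  {1..n - 1}; the full interval would leave only infinity on the other side.\<close>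

lemma std_divisorsE:
 assumes "3 <= n" "A \<in> std_divisors n"
 obtains p q where "1 <= p" "p < q" "q <= n - 1" "~ (p = 1 & q = n - 1)" "A = point n ` {p..q}"
proof -
 have A: "Pinf \<notin> A" "2 <= card A" "2 <= card (Z n - A)" "consecutive (delta n) A" using assms by (auto simp: std_divisors_def)
 obtain p' b' q' where "map (point n) [1..<n] = p' @ b' @ q'" "A = set b'"
  using consecutive_linear[OF delta_distinct[OF assms(1)] A(4)[unfolded delta_eq[OF assms(1)]] A(1)] by blast
 then obtain p b q where pbq: "[1..<n] = p @ b @ q" "A = point n ` set b" by (metis list.set_map map_eq_append_conv)
 have b: "set b = {Suc (length p)..length p + length b}" by (rule upt_block[OF pbq(1)])
 have len: "length p + length b + length q = n - 1" using arg_cong[OF pbq(1), of length] by simp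
 have "card A <= length b" unfolding pbq by (metis card_image_le card_length finite_set le_trans)
 hence b2: "2 <= length b" using A by linarith
 show thesis
 proof
  show "A = point n ` {Suc (length p)..length p + length b}" using pbq b by simp
  show "~ (Suc (length p) = 1 & length p + length b = n - 1)"
  proof
   assume "Suc (length p) = 1 & length p + length b = n - 1"
   hence "set b = {1..n - 1}" unfolding b by metis
   hence "A = Z n - {Pinf}" using pbq point_finite_image[OF assms(1)] by simp
   hence "Z n - A \<subseteq> {Pinf}" by blast
   hence "card (Z n - A) <= 1" using card_mono[of "{Pinf}"] by force
   thus False using A by simp
  qed
 qed (use b2 len in auto)
qed

lemma std_divisorsI:
 assumes "3 <= n" "1 <= p" "p < q" "q <= n - 1" "~ (p = 1 & q = n - 1)"
 shows "point n ` {p..q} \<in> std_divisors n"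
proof -
 have "{p..q} \<subseteq> {1..n - 1}" using assms by auto
 hence A: "point n ` {p..q} \<subseteq> Z n - {Pinf}" using point_finite_image[OF assms(1)] by blast
 have inj: "inj_on (point n) X" if "X \<subseteq> {0..n - 1}" for X using point_inj that by (rule inj_on_subset)
 have "card (point n ` {p..q}) = card {p..q}" by (rule card_image, rule inj) (use assms in auto)
 hence c1: "2 <= card (point n ` {p..q})" using assms by simp
 have "Z n - point n ` {p..q} = point n ` ({0..n - 1} - {p..q})" unfolding point_image[OF assms(1), symmetric]
  by (rule inj_on_image_set_diff[OF point_inj, symmetric]) (use assms in auto)
 moreover have "card (point n ` ({0..n - 1} - {p..q})) = card ({0..n - 1} - {p..q})" by (rule card_image, rule inj) auto
 moreover have "card ({0..n - 1} - {p..q}) = card {0..n - 1} - card {p..q}" by (rule card_Diff_subset) (use assms in auto)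
 ultimately have c2: "2 <= card (Z n - point n ` {p..q})" using assms by auto
 have "[1..<n] = [1..<p] @ [p..<Suc q] @ [Suc q..<n]"
 proof -
  have "[1..<n] = [1..<p] @ [p..<n]" using upt_add_eq_append[of 1 p "n - p"] assms by simp
  moreover have "[p..<n] = [p..<Suc q] @ [Suc q..<n]" using upt_add_eq_append[of p "Suc q" "n - Suc q"] assms by simp
  ultimately show ?thesis by simp
 qed
 hence "delta n = cyc (map (point n) [1..<p] @ map (point n) [p..<Suc q] @ (map (point n) [Suc q..<n] @ [Pinf]))"
  unfolding delta_eq[OF assms(1)] by simp
 hence con: "consecutive (delta n) (set (map (point n) [p..<Suc q]))" by (simp only: consecutive_block)
 have "set (map (point n) [p..<Suc q]) = point n ` {p..q}" by auto
 with con have con: "consecutive (delta n) (point n ` {p..q})" by simp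
  have "consecutive (delta n) (Z n - point n ` {p..q})"
  using consecutive_complement[OF con[unfolded delta_eq[OF assms(1)]] delta_distinct[OF assms(1)]]
  unfolding delta_set[OF assms(1)] delta_eq[OF assms(1)] by simp
 thus ?thesis using A c1 c2 con unfolding std_divisors_def by blast
qed

section \<open>Convergence on the standard cell\<close>

lemma chain_eq_prod: "chain x w = (\<Prod>i<length w - 1. 1 / (x (w ! Suc i) - x (w ! i)))"
proof (induction x w rule: chain.induct)
 case (3 x a b w)
 have "(\<Prod>i<length (a # b # w) - 1. 1 / (x ((a # b # w) ! Suc i) - x ((a # b # w) ! i))) =
  1 / (x b - x a) * (\<Prod>i<length (b # w) - 1. 1 / (x ((b # w) ! Suc i) - x ((b # w) ! i)))"
  by (simp add: prod.lessThan_Suc_shift del: prod.lessThan_Suc)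
 thus ?case using 3 by simp
qed simp_all

lemma cell_coeff_snoc:
 assumes "distinct (u @ [Pinf])"
 shows "cell_coeff (cyc (u @ [Pinf])) x = chain x u"
proof -
 have "(THE ys. ys @ [Pinf] \<in> cyc (u @ [Pinf])) = u"
 proof (rule the_equality)
  fix ys assume "ys @ [Pinf] \<in> cyc (u @ [Pinf])"
  from cyc_eqI[OF this] show "ys = u" using cyc_snoc_inj[OF assms, of ys] by simp
 qed simp
 thus ?thesis by (simp add: cell_coeff_def chain_eq_prod)
qed

lemma form_coeff_eq:
 assumes "supp v \<subseteq> cyclic_orders (Z n)"
 shows "form_coeff v x = (\<Sum>u\<in>perms (Z n - {Pinf}). of_rat (coef v (cyc (u @ [Pinf]))) * chain x u)"
proof -
 have "form_coeff v x = lin_eval (%\<eta>. cell_coeff \<eta> x) v" by (simp add: form_coeff_def lin_eval_def)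
 also have "... = (\<Sum>u\<in>perms (Z n - {Pinf}). of_rat (coef v (cyc (u @ [Pinf]))) * cell_coeff (cyc (u @ [Pinf])) x)"
  by (rule lin_eval_cyclic_orders[OF _ _ assms]) simp_all
 finally show ?thesis by (simp add: cell_coeff_snoc perms_iff)
qed

text \<open>Affine changes of \<open>z\<close> and \<open>s\<close> bring them to the normalisation of \<open>no_pole_along\<close>.\<close>

lemma no_pole_along_iff:
 assumes n: "3 <= n" and A: "A \<in> std_divisors n" and v: "supp v \<subseteq> cyclic_orders (Z n)"
 shows "no_pole_along n A (form_coeff v) \<longleftrightarrow> regular (Z n) A v"
proof -
 obtain p q where pq: "1 <= p" "p < q" "q <= n - 1" "~ (p = 1 & q = n - 1)" "A = point n ` {p..q}"
  using std_divisorsE[OF n A] .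
 have sub: "{p..q} \<subseteq> {0..n - 1}" using pq by auto
 have A2: "2 <= card A" "A \<subseteq> Z n" "Pinf \<notin> A" using A by (auto simp: std_divisors_def)
 have P01: "point n 1 = P0" "point n (n - 1) = P1" using n by (auto simp: point_def letter_label_def)
 have "~ (P0 \<in> A & P1 \<in> A)"
 proof
  assume h: "P0 \<in> A & P1 \<in> A"
  have "i \<in> {p..q}" if "point n i \<in> A" "i \<in> {0..n - 1}" for i
   using inj_on_image_mem_iff[OF point_inj that(2) sub] that unfolding pq by blast
  from this[of 1] this[of "n - 1"] h pq P01 n show False by auto
 qed
 hence A01: "P0 \<notin> A | P1 \<notin> A" by blast
 have Zmem: "P0 \<in> Z n" "P1 \<in> Z n" "Pinf \<in> Z n" by auto
 obtain a where a: "a \<in> A" using A2 by fastforce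
 let ?S = "Z n - {Pinf}"
 let ?B = "insert a (?S - A)"
 let ?R = "%s z. \<Sum>w\<in>perms ?B. residue_coef v A a Pinf s w * chain z w"
 have S: "finite ?S" "A \<subseteq> ?S" using A2 by auto
 have reg: "regular (Z n) A v \<longleftrightarrow> (ALL s. inj_on s A --> (ALL z. inj_on z ?B --> ?R s z = 0))"
  by (rule regular_iff_residues) (use a A2 v in auto)
 \<comment> \<open>The volume form supplies only the power \<open>card A - 2\<close>, so the
   function tested for a pole is \<open>H e / e\<close>; it has a pole exactly if the residue
   \<open>H 0\<close> is nonzero.\<close>
 have res: "EX H. H field_differentiable (at 0) & H 0 = ?R s z &
   (ALL e. e ~= 0 --> H e = e * (e ^ (card A - 2) * form_coeff v (%i. if i \<in> A then z i + e * s i else z i)))"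
  if col: "collidable A z s ?S" for z s
 proof -
  have col': "collidable A z s (set [] Un ?S Un set [])" using col by simp
  obtain H where H: "H field_differentiable (at 0)"
   "H 0 = (\<Sum>w\<in>perms ?B. \<Sum>u\<in>perms A. of_rat (coef v (cyc (subst1 a u w @ [Pinf]))) * chain s u * chain z ([] @ w @ []))"
   "ALL e. e ~= 0 --> H e = e ^ (card A - 1) *
     (\<Sum>w\<in>perms ?S. of_rat (coef v (cyc (w @ [Pinf]))) * chain (collide A z s e) ([] @ w @ []))"
   using residue_sum[where c = "%w. of_rat (coef v (cyc (w @ [Pinf])))", OF S a col'] by auto
  have "card A - 1 = Suc (card A - 2)" using A2 by simp
  hence "ALL e. e ~= 0 --> H e = e * (e ^ (card A - 2) * form_coeff v (%i. if i \<in> A then z i + e * s i else z i))"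
   using H(3) by (simp add: form_coeff_eq[OF v] collide_def mult.assoc)
  moreover have "H 0 = ?R s z" using H by (simp add: sum_distrib_right)
  ultimately show ?thesis using H by blast
 qed
 show ?thesis
 proof
  assume r: "regular (Z n) A v"
  show "no_pole_along n A (form_coeff v)" unfolding no_pole_along_def
  proof (intro allI impI, elim conjE)
   fix z s :: "label => complex"
   let ?f = "%e. e ^ (card A - 2) * form_coeff v (%i. if i \<in> A then z i + e * s i else z i)"
   assume zs: "\<forall>a\<in>?S. \<forall>b\<in>?S. a ~= b --> (z a = z b \<longleftrightarrow> a \<in> A & b \<in> A)" "inj_on s A"
   have col: "collidable A z s ?S" unfolding collidable_def using zs by blast
   obtain H where H: "H field_differentiable (at 0)" "H 0 = ?R s z" "!!e. e ~= 0 ==> H e = e * ?f e"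
    using res[OF col] by blast
   have "inj_on z ?B"
   proof (rule inj_onI)
    fix i j assume ij: "i \<in> ?B" "j \<in> ?B" "z i = z j"
    show "i = j" by (use ij collidable_neq[OF col] S a in auto)
   qed
   hence "H 0 = 0" using r zs H(2) unfolding reg by simp
   \<comment> \<open>With \<open>H 0 = 0\<close> the tested function is a difference quotient of
     \<open>H\<close> and tends to its derivative.\<close>
   obtain D where "(H has_field_derivative D) (at 0)" using H unfolding field_differentiable_def by blast
   hence "((%e. (H e - H 0) / (e - 0)) \<longlongrightarrow> D) (at 0)" unfolding has_field_derivative_iff .
   hence "(?f \<longlongrightarrow> D) (at 0)"
    by (rule Lim_transform_eventually) (simp add: eventually_at_filter H(3) \<open>H 0 = 0\<close>)
   thus "~ is_pole ?f 0" unfolding is_pole_def using not_tendsto_and_filterlim_at_infinity[OF at_neq_bot] by blast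
  qed
 next
  assume np: "no_pole_along n A (form_coeff v)"
  show "regular (Z n) A v" unfolding reg
  proof (intro allI impI)
   fix s z :: "label => complex" assume s: "inj_on s A" and z: "inj_on z ?B"
   define rep where "rep i = (if i \<in> A then a else i)" for i
   define c where "c = z (rep P1) - z (rep P0)"
   have "rep P0 ~= rep P1" using A01 a by (auto simp: rep_def)
   moreover have "rep P0 \<in> ?B" "rep P1 \<in> ?B" by (auto simp: rep_def)
   ultimately have c0: "c ~= 0" using inj_onD[OF z, of "rep P0"] by (auto simp: c_def)
   \<comment> \<open>The point placed at 0 in the bubble; it has to be the fixed point 0 or 1 if one
     of them lies in \<open>A\<close>, and both never do.\<close>
   define p' where "p' = (if P0 \<in> A then P0 else if P1 \<in> A then P1 else a)"
   have p': "p' \<in> A" using a by (simp add: p'_def)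
   have "~ A \<subseteq> {p'}" using A2 card_mono[of "{p'}" A] by auto
   then obtain q' where q': "q' \<in> A" "q' ~= p'" by blast
   define d where "d = s q' - s p'"
   have d0: "d ~= 0" using inj_onD[OF s _ q'(1) p'] q' by (auto simp: d_def)
   define z1 where "z1 = (%i. (1 / c) * z i + (- z (rep P0) / c))"
   define z2 where "z2 = (%i. if i \<in> A then z1 a else z1 i)"
   define s2 where "s2 = (%i. (1 / d) * s i + (- s p' / d))"
   have s2: "inj_on s2 A" using s d0 by (auto simp: inj_on_def s2_def)
   have z1: "inj_on z1 ?B" using z c0 unfolding inj_on_def z1_def by simp
   have col: "collidable A z2 s2 ?S" unfolding z2_def by (rule collidable_extend) (use z1 a s2 in auto)
   obtain H where H: "H field_differentiable (at 0)" "H 0 = ?R s2 z2"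
    "!!e. e ~= 0 ==> H e = e * (e ^ (card A - 2) * form_coeff v (%i. if i \<in> A then z2 i + e * s2 i else z2 i))"
    using res[OF col] by blast
   have z2rep: "z2 i = z1 (rep i)" for i by (simp add: z2_def rep_def)
   have "z2 P0 = 0" "z2 P1 = 1" using c0 by (simp_all add: z2rep z1_def c_def flip: diff_divide_distrib)
   moreover have "s2 p' = 0" "s2 q' = 1" using d0 by (simp_all add: s2_def d_def flip: diff_divide_distrib)
   hence "{0, 1} \<subseteq> s2 ` A" using p' q' by force
   moreover have "\<forall>b\<in>A Int {P0, P1}. s2 b = 0" using \<open>s2 p' = 0\<close> A01 by (auto simp: p'_def)
   moreover have "\<forall>a\<in>?S. \<forall>b\<in>?S. a ~= b --> (z2 a = z2 b \<longleftrightarrow> a \<in> A & b \<in> A)" using col unfolding collidable_def by blast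
   ultimately have "~ is_pole (%e. e ^ (card A - 2) * form_coeff v (%i. if i \<in> A then z2 i + e * s2 i else z2 i)) 0" (is "~ is_pole ?f 0")
    using np s2 unfolding no_pole_along_def by blast
   moreover have "is_pole ?f 0" if "H 0 ~= 0"
   proof -
    have "(H \<longlongrightarrow> H 0) (at 0)" using field_differentiable_imp_continuous_at[OF H(1)] by (simp add: continuous_within)
    moreover have "filterlim (%e::complex. e) (at 0) (at 0)" by (rule filterlim_ident)
    ultimately have "filterlim (%e. H e / e) at_infinity (at 0)" by (rule filterlim_divide_at_infinity[OF _ _ that])
    moreover have "filterlim (%e. H e / e) at_infinity (at 0) \<longleftrightarrow> filterlim ?f at_infinity (at 0)"
     by (rule filterlim_cong[OF refl refl]) (simp add: eventually_at_filter H)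
    ultimately show ?thesis unfolding is_pole_def by simp
   qed
   ultimately have "?R s2 z2 = 0" using H by auto
   moreover have "?R s2 z2 = (1 / (1 / d) ^ (card A - 1)) * (1 / (1 / c) ^ (card ?B - 1)) * ?R s z" unfolding sum_distrib_left
   proof (rule sum.cong[OF refl])
    fix w assume w: "w \<in> perms ?B"
    have "chain z2 w = chain z1 w" by (rule chain_cong) (use w in "auto simp: z2_def perms_iff")
    also have "... = chain z w / (1 / c) ^ (length w - 1)" unfolding z1_def by (rule chain_affine) (use c0 in simp)
    also have "length w = card ?B" using w by (metis distinct_card perms_iff)
    finally have cz: "chain z2 w = chain z w / (1 / c) ^ (card ?B - 1)" .
    have cs: "chain s2 u = chain s u / (1 / d) ^ (card A - 1)" if u: "u \<in> perms A" for u
    proof -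
     have "chain s2 u = chain s u / (1 / d) ^ (length u - 1)" unfolding s2_def by (rule chain_affine) (use d0 in simp)
     also have "length u = card A" using u by (metis distinct_card perms_iff)
     finally show ?thesis .
    qed
    have "residue_coef v A a Pinf s2 w = residue_coef v A a Pinf s w / (1 / d) ^ (card A - 1)"
     unfolding sum_divide_distrib by (simp add: cs)
    thus "residue_coef v A a Pinf s2 w * chain z2 w =
     (1 / (1 / d) ^ (card A - 1)) * (1 / (1 / c) ^ (card ?B - 1)) * (residue_coef v A a Pinf s w * chain z w)" unfolding cz by simp
   qed
   ultimately show "?R s z = 0" using c0 d0 by simp
  qed
 qed
qed

text \<open>\<open>std_divisors\<close> names each partition by the block without infinity; an arc
  containing infinity is handled through its complement.\<close>

lemma convergent_on_cell_iff:
 assumes n: "3 <= n" and v: "supp v \<subseteq> cyclic_orders (Z n)"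
 shows "convergent_on_cell n v \<longleftrightarrow> arc_regular (Z n) (delta n) v"
proof
 assume c: "convergent_on_cell n v"
 show "arc_regular (Z n) (delta n) v" unfolding arc_regular_def
 proof (intro allI impI, elim conjE)
  fix A assume A: "A \<subseteq> Z n" "consecutive (delta n) A" "2 <= card A" "2 <= card (Z n - A)"
  have AA: "Z n - (Z n - A) = A" using A by blast
  have con: "consecutive (delta n) (Z n - A)" using consecutive_complement[OF A(2)[unfolded delta_eq[OF n]] delta_distinct[OF n]]
   unfolding delta_set[OF n] delta_eq[OF n] .
  show "regular (Z n) A v"
  proof (cases "Pinf \<in> A")
   case False
   hence "A \<in> std_divisors n" using A con by (simp add: std_divisors_def)
   thus ?thesis using c no_pole_along_iff[OF n _ v] unfolding convergent_on_cell_def by blast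
  next
   case True
   hence d: "Z n - A \<in> std_divisors n" using A con AA by (simp add: std_divisors_def)
   hence "regular (Z n) (Z n - A) v" using c no_pole_along_iff[OF n _ v] unfolding convergent_on_cell_def by blast
   moreover have "A ~= {}" "Z n - A ~= {}" using A by (metis card.empty not_numeral_le_zero)+
   ultimately show ?thesis using regular_complement[OF finite_labels A(1) _ _ v] by blast
  qed
 qed
next
 assume r: "arc_regular (Z n) (delta n) v"
 have "regular (Z n) A v" if "A \<in> std_divisors n" for A using r that unfolding arc_regular_def std_divisors_def by blast
 thus "convergent_on_cell n v" using no_pole_along_iff[OF n _ v] unfolding convergent_on_cell_def by blast
qed

lemma convergent_polygons_iff:
 assumes "3 <= n"
 shows "v \<in> convergent_polygons n \<longleftrightarrow> v \<in> polygon_space (Z n) & arc_regular (Z n) (delta n) v"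
 unfolding convergent_polygons_def using convergent_on_cell_iff[OF assms supp_polygon_space] by blast

section \<open>Relabelling of points\<close>

lemma push_polygon:
 assumes "g \<in> cyclic_orders T" "inj_on s T"
 shows "push s (polygon g) = polygon (permute_cyc s g)"
proof -
 have "rev_sign (permute_cyc s g) = rev_sign g"
  using underlying_cyclic_order[OF assms(1)] underlying_cyclic_order[OF permute_cyclic_order[OF assms]]
  by (simp add: rev_sign_def card_image[OF assms(2)])
 thus ?thesis by (simp add: push_def polygon_def lin_ext_qscale lin_ext_add permute_cyc_opposite)
qed

lemma push_polygon_space:
 assumes "v \<in> polygon_space T" "inj_on s T"
 shows "push s v \<in> polygon_space (s ` T)"
 using assms(1) unfolding polygon_space_def
proof (induction rule: qvec.span_induct_alt)
 case base
  show ?case by (simp add: push_def qvec.span_zero)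
next
 case (step c x y)
 then obtain k where g: "k \<in> cyclic_orders T" "x = polygon k" by blast
 have "push s x \<in> polygon ` cyclic_orders (s ` T)"
  unfolding g push_polygon[OF g(1) assms(2)] using permute_cyclic_order[OF g(1) assms(2)] by blast
 hence "qscale c (push s x) + push s y \<in> qvec.span (polygon ` cyclic_orders (s ` T))"
  using step by (intro qvec.span_add qvec.span_scale) (auto intro: qvec.span_base)
 thus ?case by (simp add: push_def lin_ext_add lin_ext_qscale)
qed

lemma cyclic_form_push:
 assumes "supp v \<subseteq> cyclic_orders T" "T ~= {}"
 shows "cyclic_form x (push s v) = cyclic_form (%i. x (s i)) v"
 unfolding push_def lin_eval_lin_ext
proof (rule lin_eval_cong)
 fix g assume "g \<in> supp v"
 hence "g \<in> cyclic_orders T" using assms by blast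
 from cyclic_chain_permute[OF this assms(2)]
 show "cyclic_form x (bvec (permute_cyc s g)) = cyclic_chain (%i. x (s i)) g" by simp
qed

text \<open>Arcs of the image order are images of arcs of the same size, so
  \<open>regular_transfer\<close> can be applied to each of them.\<close>

lemma arc_regular_push:
 assumes v: "v \<in> polygon_space T" and g: "c \<in> cyclic_orders T" and T: "T ~= {}" "inj_on s T" and reg: "arc_regular T c v"
 shows "arc_regular (s ` T) (permute_cyc s c) (push s v)"
 unfolding arc_regular_def
proof (intro allI impI, elim conjE)
 fix A assume A: "A \<subseteq> s ` T" "consecutive (permute_cyc s c) A" "2 <= card A" "2 <= card (s ` T - A)"
 obtain A' where A': "A' \<subseteq> T" "A = s ` A'" "consecutive c A'" using consecutive_permute[OF g A(2)] by blast
 have "card A' = card A" unfolding A' by (rule card_image[symmetric]) (rule inj_on_subset[OF T(2) A'(1)])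
 moreover have "s ` T - A = s ` (T - A')" using inj_on_image_set_diff[OF T(2)] A' by simp
 hence "card (T - A') = card (s ` T - A)" using card_image[OF inj_on_subset[OF T(2) Diff_subset]] by metis
 ultimately have "regular T A' v" using reg A A' unfolding arc_regular_def by simp
 thus "regular (s ` T) A (push s v)"
  unfolding A' using regular_transfer[OF finite_cyclic_order[OF g] T(1) supp_polygon_space[OF v] A'(1) T(2)]
   cyclic_form_push[OF supp_polygon_space[OF v] T(1)] by blast
qed

section \<open>Shuffles of cyclic orders as products of forms\<close>

lemma cyc_Cons_inj: "distinct (a # u) ==> cyc (a # u) = cyc (a # u') ==> u = u'"
 unfolding cyc_Cons by (rule cyc_snoc_inj) auto

lemma cyclic_order_Cons:
 assumes "g \<in> cyclic_orders T" "a \<in> T"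
 obtains u where "g = cyc (a # u)" "distinct (a # u)" "set (a # u) = T"
proof -
 obtain u where u: "u \<in> perms (T - {a})" "g = cyc (u @ [a])"
  using cyclic_orders_snoc[OF assms(2)] assms unfolding bij_betw_def by blast
 show thesis by rule (use u assms in "auto simp: cyc_Cons perms_iff")
qed

abbreviation oriented :: "label list => label list => label list => label list" where
 "oriented A B C \<equiv> P0 # A @ P1 # B @ Pinf # C"

lemma split_oriented:
 assumes "distinct (P0 # u)" "P1 \<in> set u" "Pinf \<in> set u"
 shows "(EX A B C. P0 # u = oriented A B C) | (EX A B C. P0 # u = P0 # A @ Pinf # B @ P1 # C)"
proof -
 obtain p q where pq: "u = p @ P1 # q" using assms by (meson split_list)
 hence "Pinf \<in> set p | Pinf \<in> set q" using assms by auto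
 thus ?thesis
 proof
  assume "Pinf \<in> set p"
  then obtain p1 p2 where "p = p1 @ Pinf # p2" by (meson split_list)
  hence "P0 # u = P0 # p1 @ Pinf # p2 @ P1 # q" unfolding pq by simp
  thus ?thesis by blast
 next
  assume "Pinf \<in> set q"
  then obtain q1 q2 where "q = q1 @ Pinf # q2" by (meson split_list)
  hence "P0 # u = oriented p q1 q2" unfolding pq by simp
  thus ?thesis by blast
 qed
qed

text \<open>Starting at 0, either 1 or infinity comes first. In the second case the opposite order,
  rotated back to start at 0, has 1 first.\<close>

lemma orientE:
 assumes a: "\<alpha> \<in> cyclic_orders T" and T: "{P0, P1, Pinf} \<subseteq> T"
 obtains A B C where "orient \<alpha> = cyc (oriented A B C)" "distinct (oriented A B C)" "set (oriented A B C) = T"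
proof -
 obtain u where u: "\<alpha> = cyc (P0 # u)" "distinct (P0 # u)" "set (P0 # u) = T" using cyclic_order_Cons[OF a] T by blast
 have mem: "P1 \<in> set u" "Pinf \<in> set u" using u T by auto
 let ?f = "filter (%x. x \<in> {P0, P1, Pinf})"
 have empty: "?f A = []" if "set A Int {P0, P1, Pinf} = {}" for A using that by (auto simp: filter_empty_conv)
 from split_oriented[OF u(2) mem] show thesis
 proof (elim disjE exE)
  fix A B C assume e: "P0 # u = oriented A B C"
  have dist: "set A Int {P0, P1, Pinf} = {}" "set B Int {P0, P1, Pinf} = {}" "set C Int {P0, P1, Pinf} = {}"
   using u unfolding e by auto
  have "?f (P0 # u) = [P0] @ ?f A @ [P1] @ ?f B @ [Pinf] @ ?f C" unfolding e by simp
  hence "?f (P0 # u) = [P0, P1, Pinf]" by (simp only: empty[OF dist(1)] empty[OF dist(2)] empty[OF dist(3)] append.simps)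
  hence "orient \<alpha> = \<alpha>" by (simp add: orient_def orientation_ok_def u restrict_cyc_cyc)
  thus thesis using that u e by metis
 next
  fix A B C assume e: "P0 # u = P0 # A @ Pinf # B @ P1 # C"
  have dist: "set A Int {P0, P1, Pinf} = {}" "set B Int {P0, P1, Pinf} = {}" "set C Int {P0, P1, Pinf} = {}"
   using u unfolding e by auto
  have "?f (P0 # u) = [P0] @ ?f A @ [Pinf] @ ?f B @ [P1] @ ?f C" unfolding e by simp
  hence f: "?f (P0 # u) = [P0, Pinf, P1]" by (simp only: empty[OF dist(1)] empty[OF dist(2)] empty[OF dist(3)] append.simps)
  have "cyc [P0, Pinf, P1] ~= cyc [P0, P1, Pinf]" using cyc_Cons_inj[of P0 "[P1, Pinf]"] by auto
  hence "~ orientation_ok \<alpha>" unfolding orientation_ok_def u restrict_cyc_cyc f .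
  hence "orient \<alpha> = cyc (rev (P0 # u))" by (simp add: orient_def u opposite_cyc)
  also have "rev (P0 # u) = (rev C @ P1 # rev B @ Pinf # rev A) @ [P0]" by (simp add: e)
  also have "cyc ... = cyc (oriented (rev C) (rev B) (rev A))" by (simp only: cyc_Cons)
  finally
  moreover have "distinct (oriented (rev C) (rev B) (rev A))" using u unfolding e by auto
  moreover have "set (oriented (rev C) (rev B) (rev A)) = T" using u unfolding e by auto
  ultimately show thesis by rule
 qed
qed

lemma orient_cases: "orient \<alpha> \<in> {\<alpha>, opposite \<alpha>}"
 by (simp add: orient_def)

lemma cyclic_chain_orient:
 assumes "\<alpha> \<in> cyclic_orders T" "T ~= {}"
 shows "of_rat (orient_sign \<alpha>) * cyclic_chain x (orient \<alpha>) = cyclic_chain x \<alpha>"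
proof -
 have "of_rat (rev_sign \<alpha>) * (of_rat (rev_sign \<alpha>) :: complex) = 1" by (metis of_rat_1 of_rat_mult rev_sign_square)
 thus ?thesis by (simp add: orient_def orient_sign_def cyclic_chain_opposite[OF assms])
qed

lemma shuffles_iff_filter:
 assumes "set A \<subseteq> X" "set B \<subseteq> Y" "X Int Y = {}"
 shows "w \<in> shuffles A B \<longleftrightarrow> set w \<subseteq> X Un Y & filter (%i. i \<in> X) w = A & filter (%i. i \<in> Y) w = B"
proof
 assume w: "w \<in> shuffles A B"
 have AB: "set A Int set B = {}" using assms by blast
 have sw: "set w = set A Un set B" using set_shuffles[OF w] .
 have "filter (%i. i \<in> X) w = filter (%i. i \<in> set A) w" by (rule filter_cong) (use sw assms in auto)
 moreover have "filter (%i. i \<in> Y) w = filter (%i. i \<notin> set A) w" by (rule filter_cong) (use sw assms in auto)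
 ultimately show "set w \<subseteq> X Un Y & filter (%i. i \<in> X) w = A & filter (%i. i \<in> Y) w = B"
  using filter_shuffles_disjoint1[OF AB w] sw assms by auto
next
 assume w: "set w \<subseteq> X Un Y & filter (%i. i \<in> X) w = A & filter (%i. i \<in> Y) w = B"
 have "filter (%i. i \<notin> X) w = filter (%i. i \<in> Y) w" by (rule filter_cong) (use w assms in auto)
 thus "w \<in> shuffles A B" using partition_in_shuffles[of w "%i. i \<in> X"] w by simp
qed

lemma cyclic_chain_oriented:
 "cyclic_chain x (cyc (oriented A B C)) = chain x (P0 # A @ [P1]) * (chain x (P1 # B @ [Pinf]) * chain x (Pinf # C @ [P0]))"
 using cyclic_chain_cyc[of "oriented A B C"] chain_append[of x "P0 # A" P1 "B @ Pinf # C @ [P0]"]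
  chain_append[of x "P1 # B" Pinf "C @ [P0]"] by simp

text \<open>The words merging \<open>u\<close> and \<open>v\<close>, whose common letters occur in the same order.\<close>

definition amalgams :: "'a list => 'a list => 'a list set" where
 "amalgams u v = {w. distinct w & set w = set u Un set v & filter (%i. i \<in> set u) w = u & filter (%i. i \<in> set v) w = v}"

lemma amalgams_disjoint:
 assumes "distinct u" "distinct v" "set u Int set v = {}"
 shows "amalgams u v = shuffles u v"
proof -
 have "distinct w & set w = set u Un set v" if "w \<in> shuffles u v" for w
  using distinct_disjoint_shuffles[OF assms that] set_shuffles[OF that] by blast
 thus ?thesis unfolding amalgams_def using shuffles_iff_filter[OF order_refl order_refl assms(3)] by blast
qed

text \<open>A merged word splits at the common letter \<open>c\<close>. What precedes
  \<open>c\<close> has no common letters and is an ordinary shuffle; the rest is merged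
  further.\<close>

lemma sum_amalgams:
 assumes d: "distinct (A1 @ c # R1)" "distinct (A2 @ c # R2)" "set A1 Int (set A2 Un set R2) = {}" "set A2 Int set R1 = {}"
 shows "(\<Sum>w\<in>amalgams (A1 @ c # R1) (A2 @ c # R2). f w) = (\<Sum>a\<in>shuffles A1 A2. \<Sum>r\<in>amalgams R1 R2. f (a @ c # r))"
proof -
 let ?u = "A1 @ c # R1" and ?v = "A2 @ c # R2"
 have sh: "a \<in> shuffles A1 A2 \<longleftrightarrow> set a \<subseteq> set A1 Un set A2 & filter (%i. i \<in> set A1) a = A1 & filter (%i. i \<in> set A2) a = A2" for a
  using shuffles_iff_filter[of A1] d by blast
 have fil: "filter (%i. i \<in> set ?u) a = filter (%i. i \<in> set A1) a & filter (%i. i \<in> set ?v) a = filter (%i. i \<in> set A2) a &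
   filter (%i. i \<in> set ?u) r = filter (%i. i \<in> set R1) r & filter (%i. i \<in> set ?v) r = filter (%i. i \<in> set R2) r"
  if "set a \<subseteq> set A1 Un set A2" "set r \<subseteq> set R1 Un set R2" for a r
  using that d by (intro conjI filter_cong refl; auto)
 have "bij_betw (%(a, r). a @ c # r) (shuffles A1 A2 \<times> amalgams R1 R2) (amalgams ?u ?v)"
 proof (rule bij_betw_imageI)
  have s: "set a \<subseteq> set A1 Un set A2 & distinct a & c \<notin> set a" if "a \<in> shuffles A1 A2" for a
   using set_shuffles[OF that] distinct_disjoint_shuffles[OF _ _ _ that] d by auto
  have r: "set r = set R1 Un set R2 & distinct r & c \<notin> set r" if "r \<in> amalgams R1 R2" for r
   using that d unfolding amalgams_def by auto
  show "inj_on (%(a, r). a @ c # r) (shuffles A1 A2 \<times> amalgams R1 R2)"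
  proof (rule inj_onI, clarify)
   fix a r a' r' assume h: "a \<in> shuffles A1 A2" "r \<in> amalgams R1 R2" "a @ c # r = a' @ c # r'"
   show "a = a' & r = r'" using append_Cons_eq_iff[of c] h s r[OF h(2)] by blast
  qed
  show "(%(a, r). a @ c # r) ` (shuffles A1 A2 \<times> amalgams R1 R2) = amalgams ?u ?v"
  proof (intro equalityI subsetI)
   fix w assume "w \<in> (%(a, r). a @ c # r) ` (shuffles A1 A2 \<times> amalgams R1 R2)"
   then obtain a r' where h: "w = a @ c # r'" "a \<in> shuffles A1 A2" "r' \<in> amalgams R1 R2" by auto
   have "set w = set ?u Un set ?v" using set_shuffles[OF h(2)] r[OF h(3)] unfolding h by auto
   moreover have "distinct w" using s[OF h(2)] r[OF h(3)] d unfolding h by auto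
   ultimately show "w \<in> amalgams ?u ?v" using fil[of a r'] h unfolding sh unfolding amalgams_def by simp
  next
   fix w assume w: "w \<in> amalgams ?u ?v"
   hence "c \<in> set w" unfolding amalgams_def by auto
   then obtain a r' where h: "w = a @ c # r'" by (meson split_list)

   have f: "filter (%i. i \<in> set ?u) a = A1 & filter (%i. i \<in> set ?u) r' = R1"
    "filter (%i. i \<in> set ?v) a = A2 & filter (%i. i \<in> set ?v) r' = R2" using w append_Cons_eq_iff[of c]

    unfolding h amalgams_def by auto
   have "set a \<subseteq> set ?u Un set ?v" "set r' \<subseteq> set ?u Un set ?v" using w unfolding h amalgams_def by auto
   hence sub: "set a = set A1 Un set A2" "set r' = set R1 Un set R2"
    using arg_cong[OF f(1)[THEN conjunct1], of set] arg_cong[OF f(1)[THEN conjunct2], of set]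
     arg_cong[OF f(2)[THEN conjunct1], of set] arg_cong[OF f(2)[THEN conjunct2], of set] unfolding set_filter by blast+
   have "a \<in> shuffles A1 A2 & r' \<in> amalgams R1 R2" using fil[of a r'] sub f w unfolding sh h amalgams_def by simp
   thus "w \<in> (%(a, r). a @ c # r) ` (shuffles A1 A2 \<times> amalgams R1 R2)" unfolding h by force
  qed
 qed
 thus ?thesis by (simp add: sum.reindex_bij_betw[symmetric] sum.cartesian_product case_prod_unfold)
qed

text \<open>The points 0, 1 and infinity cut both orders into three segments which are shuffled
  independently. Each segment is a shuffle between two roots and contributes the distance of its end
  points, whence the factor in front.\<close>

lemma sum_cyc_shuffles:
 assumes T: "T1 Int T2 = {P0, P1, Pinf}" and a: "\<alpha>1 \<in> cyclic_orders T1" "\<alpha>2 \<in> cyclic_orders T2"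
  and x: "inj_on x (T1 Un T2)"
 shows "(\<Sum>g\<in>cyc_shuffles \<alpha>1 \<alpha>2. cyclic_chain x g) =
  (x P1 - x P0) * (x Pinf - x P1) * (x P0 - x Pinf) * cyclic_chain x (orient \<alpha>1) * cyclic_chain x (orient \<alpha>2)"
proof -
 obtain A1 B1 C1 where o1: "orient \<alpha>1 = cyc (oriented A1 B1 C1)" "distinct (oriented A1 B1 C1)" "set (oriented A1 B1 C1) = T1"
  using orientE[OF a(1)] T by blast
 obtain A2 B2 C2 where o2: "orient \<alpha>2 = cyc (oriented A2 B2 C2)" "distinct (oriented A2 B2 C2)" "set (oriented A2 B2 C2) = T2"
  using orientE[OF a(2)] T by blast
 define u v where uv: "u = A1 @ P1 # B1 @ Pinf # C1" "v = A2 @ P1 # B2 @ Pinf # C2"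
 have TT: "T1 = set (P0 # u)" "T2 = set (P0 # v)" "distinct (P0 # u)" "distinct (P0 # v)" using o1 o2 by (simp_all only: uv)
 have out: "i \<notin> set A2 Un set B2 Un set C2 Un {P0, P1, Pinf}" if i: "i \<in> set A1 Un set B1 Un set C1" for i
 proof -
  have "i \<in> T1" "i \<notin> {P0, P1, Pinf}" using i o1 by auto
  hence "i \<notin> T2" using T by blast
  thus ?thesis unfolding o2(3)[symmetric] by auto
 qed
 have disj: "set A1 Int (set A2 Un set (B2 @ Pinf # C2)) = {}" "set A2 Int set (B1 @ Pinf # C1) = {}"
  "set B1 Int (set B2 Un set C2) = {}" "set B2 Int set C1 = {}" "set C1 Int set C2 = {}" using out o2 by auto
 have eq: "restrict_cyc (set (P0 # u)) (cyc (P0 # w)) = cyc (P0 # u) \<longleftrightarrow> filter (%i. i \<in> set u) w = u"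
  if "distinct (P0 # w)" "distinct (P0 # u)" for u w :: "label list"
 proof -
  have "filter (%i. i \<in> set (P0 # u)) (P0 # w) = P0 # filter (%i. i \<in> set u) w"
   using that by (auto intro!: filter_cong)
  thus ?thesis unfolding restrict_cyc_cyc using cyc_Cons_inj[of P0 "filter (%i. i \<in> set u) w"] that by auto
 qed
 have am: "distinct (P0 # w) & set (P0 # w) = T1 Un T2" if "w \<in> amalgams u v" for w
  using that TT unfolding amalgams_def by auto
 have iff: "cyc (P0 # w) \<in> cyc_shuffles \<alpha>1 \<alpha>2 \<longleftrightarrow> w \<in> amalgams u v" if w: "distinct (P0 # w)" "set (P0 # w) = T1 Un T2" for w
 proof -
  have "set w = (T1 Un T2) - {P0}" using w by auto
  moreover have "set u Un set v = (T1 Un T2) - {P0}" using TT by auto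
  ultimately have "set w = set u Un set v" by simp
  thus ?thesis using w eq cyc_in_cyclic_orders[OF w] TT
   unfolding cyc_shuffles_def amalgams_def underlying_cyclic_order[OF a(1)] underlying_cyclic_order[OF a(2)] o1 o2 uv[symmetric] by simp
 qed
 have "bij_betw (%w. cyc (P0 # w)) (amalgams u v) (cyc_shuffles \<alpha>1 \<alpha>2)"
 proof (rule bij_betw_imageI)
  show "inj_on (%w. cyc (P0 # w)) (amalgams u v)"
  proof (rule inj_onI)
   fix w w' assume "w \<in> amalgams u v" "w' \<in> amalgams u v" "cyc (P0 # w) = cyc (P0 # w')"
   thus "w = w'" using cyc_Cons_inj[of P0] am by auto
  qed
  show "(%w. cyc (P0 # w)) ` amalgams u v = cyc_shuffles \<alpha>1 \<alpha>2"
  proof (intro equalityI subsetI)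
   fix g assume g: "g \<in> cyc_shuffles \<alpha>1 \<alpha>2"
   have "g \<in> cyclic_orders (T1 Un T2)" "P0 \<in> T1 Un T2"
    using g T unfolding cyc_shuffles_def underlying_cyclic_order[OF a(1)] underlying_cyclic_order[OF a(2)] by auto
   from cyclic_order_Cons[OF this] obtain w where w: "g = cyc (P0 # w)" "distinct (P0 # w)" "set (P0 # w) = T1 Un T2" .
   thus "g \<in> (%w. cyc (P0 # w)) ` amalgams u v" using iff g by blast
  qed (use am iff in blast)
 qed
 hence "(\<Sum>g\<in>cyc_shuffles \<alpha>1 \<alpha>2. cyclic_chain x g) = (\<Sum>w\<in>amalgams u v. cyclic_chain x (cyc (P0 # w)))"
  by (rule sum.reindex_bij_betw[symmetric])
 also have "... = (\<Sum>A\<in>shuffles A1 A2. \<Sum>B\<in>shuffles B1 B2. \<Sum>C\<in>shuffles C1 C2.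
   chain x (P0 # A @ [P1]) * (chain x (P1 # B @ [Pinf]) * chain x (Pinf # C @ [P0])))"
  using disj o1 o2 unfolding uv by (simp add: sum_amalgams amalgams_disjoint cyclic_chain_oriented)
 also have "... = (\<Sum>A\<in>shuffles A1 A2. chain x (P0 # A @ [P1])) *
  ((\<Sum>B\<in>shuffles B1 B2. chain x (P1 # B @ [Pinf])) * (\<Sum>C\<in>shuffles C1 C2. chain x (Pinf # C @ [P0])))"
  by (simp only: sum_distrib_left[symmetric] sum_distrib_right)
 also have "... = (x P1 - x P0) * chain x (P0 # A1 @ [P1]) * chain x (P0 # A2 @ [P1]) *
  ((x Pinf - x P1) * chain x (P1 # B1 @ [Pinf]) * chain x (P1 # B2 @ [Pinf]) * ((x P0 - x Pinf) * chain x (Pinf # C1 @ [P0]) * chain x (Pinf # C2 @ [P0])))"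
 proof -
  have "(\<Sum>w\<in>shuffles A B. chain x (r # w @ [e])) = (x e - x r) * chain x (r # A @ [e]) * chain x (r # B @ [e])"
   if "distinct (r # A @ [e])" "distinct (r # B @ [e])" "set A Int set B = {}" "set (r # A @ [e]) \<subseteq> T1" "set B \<subseteq> T2" for r A B e
  proof (rule chain_shuffles_two_roots)
   show "distinct (r # A @ B @ [e])" using that by auto
   show "inj_on x (set (r # A @ B @ [e]))" by (rule inj_on_subset[OF x]) (use that in auto)
  qed
  note two = this
  show ?thesis by (intro arg_cong2[where f = "(*)"] two) (use o1 o2 disj in auto)
 qed
 finally show ?thesis unfolding o1 o2 cyclic_chain_oriented by (simp only: mult_ac)
qed

text \<open>The orientation signs are absorbed by \<open>cyclic_chain_orient\<close>, and the factor
  depends on the positions only, so the identity for two cyclic orders extends bilinearly.\<close>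

lemma cyclic_form_polygon_shuffle:
 assumes T: "T1 Int T2 = {P0, P1, Pinf}" and v: "v1 \<in> polygon_space T1" "v2 \<in> polygon_space T2"
  and x: "inj_on x (T1 Un T2)"
 shows "cyclic_form x (polygon_shuffle v1 v2) =
  (x P1 - x P0) * (x Pinf - x P1) * (x P0 - x Pinf) * (cyclic_form x v1 * cyclic_form x v2)"
proof -
 let ?F = "(x P1 - x P0) * (x Pinf - x P1) * (x P0 - x Pinf)"
 have ne: "T1 ~= {}" "T2 ~= {}" "T1 Un T2 ~= {}" using T by auto
 have pair: "cyclic_form x (qscale (orient_sign \<alpha>1 * orient_sign \<alpha>2) (\<Sum>g\<in>cyc_shuffles \<alpha>1 \<alpha>2. polygon g)) =
   ?F * (cyclic_chain x \<alpha>1 * cyclic_chain x \<alpha>2)"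
  if a: "\<alpha>1 \<in> cyclic_orders T1" "\<alpha>2 \<in> cyclic_orders T2" for \<alpha>1 \<alpha>2
 proof -
  have "cyclic_form x (polygon g) = cyclic_chain x g" if "g \<in> cyc_shuffles \<alpha>1 \<alpha>2" for g
  proof (rule cyclic_form_polygon[OF _ ne(3)])
   show "g \<in> cyclic_orders (T1 Un T2)"
    using that unfolding cyc_shuffles_def by (simp add: underlying_cyclic_order[OF a(1)] underlying_cyclic_order[OF a(2)])
  qed
  hence "cyclic_form x (qscale (orient_sign \<alpha>1 * orient_sign \<alpha>2) (\<Sum>g\<in>cyc_shuffles \<alpha>1 \<alpha>2. polygon g)) =
   of_rat (orient_sign \<alpha>1) * of_rat (orient_sign \<alpha>2) * (\<Sum>g\<in>cyc_shuffles \<alpha>1 \<alpha>2. cyclic_chain x g)"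
   by (simp add: lin_eval_scale lin_eval_sum of_rat_mult)
  also have "... = ?F * ((of_rat (orient_sign \<alpha>1) * cyclic_chain x (orient \<alpha>1)) * (of_rat (orient_sign \<alpha>2) * cyclic_chain x (orient \<alpha>2)))"
   unfolding sum_cyc_shuffles[OF T a x] by (simp only: mult_ac)
  finally show ?thesis unfolding cyclic_chain_orient[OF a(1) ne(1)] cyclic_chain_orient[OF a(2) ne(2)] .
 qed
 have "cyclic_form x (polygon_shuffle v1 v2) = lin_eval (%\<alpha>1. lin_eval (%\<alpha>2. ?F * (cyclic_chain x \<alpha>1 * cyclic_chain x \<alpha>2)) v2) v1"
  unfolding polygon_shuffle_def bilin_ext_def lin_eval_lin_ext
  by (intro lin_eval_cong pair subsetD[OF supp_polygon_space[OF v(1)]] subsetD[OF supp_polygon_space[OF v(2)]])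
 also have "... = ?F * (cyclic_form x v1 * cyclic_form x v2)"
 proof -
  have c: "lin_eval (%u. c * \<phi> u) f = c * lin_eval \<phi> f" for c \<phi> and f :: "label cyclic_order \<Rightarrow>\<^sub>0 rat"
   by (simp add: lin_eval_def sum_distrib_left mult_ac)
  have "lin_eval (%\<alpha>2. ?F * (cyclic_chain x \<alpha>1 * cyclic_chain x \<alpha>2)) v2 = ?F * cyclic_form x v2 * cyclic_chain x \<alpha>1" for \<alpha>1
   using c[of "?F * cyclic_chain x \<alpha>1" "cyclic_chain x" v2] by (simp only: mult_ac)
  thus ?thesis by (simp only: c) (simp only: mult_ac)
 qed
 finally show ?thesis .
qed

lemma polygon_shuffle_space:
 assumes v: "v1 \<in> polygon_space T1" "v2 \<in> polygon_space T2"
 shows "polygon_shuffle v1 v2 \<in> polygon_space (T1 Un T2)"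
 unfolding polygon_shuffle_def bilin_ext_def polygon_space_def
proof (intro lin_ext_in_span qvec.span_scale qvec.span_sum)
 fix \<alpha>1 \<alpha>2 g assume h: "\<alpha>1 \<in> supp v1" "\<alpha>2 \<in> supp v2" "g \<in> cyc_shuffles \<alpha>1 \<alpha>2"
 have "underlying \<alpha>1 = T1" "underlying \<alpha>2 = T2"
  using subsetD[OF supp_polygon_space[OF v(1)] h(1)] subsetD[OF supp_polygon_space[OF v(2)] h(2)] by (simp_all add: underlying_cyclic_order)
 hence "g \<in> cyclic_orders (T1 Un T2)" using h unfolding cyc_shuffles_def by simp
 thus "polygon g \<in> qvec.span (polygon ` cyclic_orders (T1 Un T2))" by (intro qvec.span_base imageI)
qed

text \<open>Restricted to the points of \<open>T\<close>, colliding the points of \<open>A\<close> is colliding those of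
 \<open>A Int T\<close>.\<close>

lemma cyclic_form_limit:
 assumes v: "v \<in> polygon_space T" and T: "finite T" "T ~= {}" "~ T \<subseteq> A" and col: "collidable A z s T"
  and reg: "2 <= card (A Int T) ==> regular T (A Int T) v"
 shows "EX L. ((%t. t ^ (card (A Int T) - 1) * cyclic_form (collide A z s t) v) \<longlongrightarrow> L) (at 0) & (2 <= card (A Int T) --> L = 0)"
proof -
 note supp = supp_polygon_space[OF v]
 have eq: "cyclic_form (collide A z s t) v = cyclic_form (collide (A Int T) z s t) v" for t
  by (rule cyclic_form_cong[OF T(1,2) supp]) (simp add: collide_def)
 have col': "collidable (A Int T) z s T" using col inj_on_subset[of s A "A Int T"] unfolding collidable_def by blast
 show ?thesis
 proof (cases "A Int T = {}")
  case True
  thus ?thesis unfolding eq by (auto simp: collide_def)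
 next
  case False
  then obtain a where a: "a \<in> A Int T" by blast
  obtain e where e: "e \<in> T" "e \<notin> A Int T" using T(3) by blast
  note lim = cyclic_form_residue[OF T(1) Int_lower2 a e supp col']
  show ?thesis
  proof (cases "2 <= card (A Int T)")
   case True
   thus ?thesis using reg col' unfolding eq regular_def by blast
  next
   case False
   thus ?thesis using lim unfolding eq by blast
  qed
 qed
qed

text \<open>The form is a product, so the pole order is at most the sum for the two factors, each
  seeing only its share of \<open>A\<close>. The shares overlap in at most one of 0, 1, infinity,
  which leaves enough powers of \<open>e\<close>.\<close>

lemma regular_polygon_shuffle:
 assumes T: "T1 Int T2 = {P0, P1, Pinf}" "finite T1" "finite T2"
  and v: "v1 \<in> polygon_space T1" "v2 \<in> polygon_space T2"
  and A: "A \<subseteq> T1 Un T2" "2 <= card A" "card (A Int {P0, P1, Pinf}) <= 1"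
  and reg: "2 <= card (A Int T1) ==> regular T1 (A Int T1) v1" "2 <= card (A Int T2) ==> regular T2 (A Int T2) v2"
 shows "regular (T1 Un T2) A (polygon_shuffle v1 v2)"
 unfolding regular_def
proof (intro allI impI)
 fix z s assume col: "collidable A z s (T1 Un T2)"
 let ?K = "{P0, P1, Pinf}"
 let ?x = "collide A z s"
 let ?f1 = "%e. e ^ (card (A Int T1) - 1) * cyclic_form (?x e) v1"
 let ?f2 = "%e. e ^ (card (A Int T2) - 1) * cyclic_form (?x e) v2"
 let ?F = "%x :: label => complex. (x P1 - x P0) * (x Pinf - x P1) * (x P0 - x Pinf)"
 have "~ ?K \<subseteq> A" using A by auto
 hence nsub: "~ T1 \<subseteq> A" "~ T2 \<subseteq> A" "T1 ~= {}" "T2 ~= {}" using T by blast+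
 obtain L1 where L1: "(?f1 \<longlongrightarrow> L1) (at 0)" "2 <= card (A Int T1) --> L1 = 0"
  using cyclic_form_limit[OF v(1) T(2) nsub(3,1) collidable_subset[OF col] reg(1)] by blast
 obtain L2 where L2: "(?f2 \<longlongrightarrow> L2) (at 0)" "2 <= card (A Int T2) --> L2 = 0"
  using cyclic_form_limit[OF v(2) T(3) nsub(4,2) collidable_subset[OF col] reg(2)] by blast
 have x: "((%e. ?x e i) \<longlongrightarrow> z i) (at 0)" for i
 proof -
  have "((%e. z i + e * s i) \<longlongrightarrow> z i + 0 * s i) (at 0)" by (intro tendsto_intros)
  thus ?thesis by (cases "i \<in> A") (simp_all add: collide_def)
 qed
 have F: "((%e. ?F (?x e)) \<longlongrightarrow> ?F z) (at 0)" by (intro tendsto_mult tendsto_diff x)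
 have un: "(A Int T1) Un (A Int T2) = A" and int: "(A Int T1) Int (A Int T2) = A Int ?K" using A T by blast+
 have fin: "finite (A Int T1)" "finite (A Int T2)" using T by auto
 have cards: "card (A Int T1) + card (A Int T2) = card A + card (A Int ?K)" using card_Un_Int[OF fin] unfolding un int .
 have le: "card (A Int ?K) <= card (A Int T1)" "card (A Int ?K) <= card (A Int T2)"
  using T by (intro card_mono ; blast)+
 define k where "k = card A - 1 - ((card (A Int T1) - 1) + (card (A Int T2) - 1))"
 have k: "card A - 1 = (card (A Int T1) - 1) + (card (A Int T2) - 1) + k" "k = 0 --> 2 <= card (A Int T1) | 2 <= card (A Int T2)"
  using cards le A unfolding k_def by linarith+
 have "((%e. e ^ k * ?F (?x e) * (?f1 e * ?f2 e)) \<longlongrightarrow> 0 ^ k * ?F z * (L1 * L2)) (at 0)"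
  by (intro tendsto_mult F L1 L2 tendsto_power tendsto_ident_at)
 moreover have "0 ^ k * ?F z * (L1 * L2) = 0" using k L1 L2 by  auto
 ultimately have lim: "((%e. e ^ k * ?F (?x e) * (?f1 e * ?f2 e)) \<longlongrightarrow> 0) (at 0)" by simp
 have pow: "e ^ (card A - 1) = e ^ (card (A Int T1) - 1) * e ^ (card (A Int T2) - 1) * e ^ k" for e :: complex
  by (simp only: k power_add)
 have "\<forall>\<^sub>F e in at 0. e ^ (card A - 1) * cyclic_form (?x e) (polygon_shuffle v1 v2) =
  e ^ k * ?F (?x e) * (?f1 e * ?f2 e)" using collide_inj[OF finite_UnI[OF T(2,3)] col]
  by eventually_elim (simp only: cyclic_form_polygon_shuffle[OF T(1) v] pow mult_ac)
 from tendsto_cong[OF this] lim show "((%e. e ^ (card A - 1) * cyclic_form (?x e) (polygon_shuffle v1 v2)) \<longlongrightarrow> 0) (at 0)" by simp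
qed

text \<open>Of an arc and its complement, one contains at most one of 0, 1, infinity; by
  \<open>regular_complement\<close> it may be taken to be the arc. Its trace on \<open>T1\<close> or
  \<open>T2\<close> is an arc there, and two of the three points lie outside it.\<close>

lemma arc_regular_polygon_shuffle:
 assumes T: "T1 Int T2 = {P0, P1, Pinf}" "finite T1" "finite T2"
  and v: "v1 \<in> polygon_space T1" "v2 \<in> polygon_space T2"
  and c: "c1 \<in> cyclic_orders T1" "c2 \<in> cyclic_orders T2" "c \<in> cyc_shuffles c1 c2"
  and reg: "arc_regular T1 c1 v1" "arc_regular T2 c2 v2"
 shows "arc_regular (T1 Un T2) c (polygon_shuffle v1 v2)"
proof -
 let ?T = "T1 Un T2" and ?K = "{P0, P1, Pinf}" and ?v = "polygon_shuffle v1 v2"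
 have u: "underlying c1 = T1" "underlying c2 = T2" using c by (simp_all add: underlying_cyclic_order)
 have g: "c \<in> cyclic_orders ?T" "restrict_cyc T1 c = orient c1" "restrict_cyc T2 c = orient c2"
  using c unfolding cyc_shuffles_def u by auto
 have small: "regular ?T A ?v" if A: "A \<subseteq> ?T" "consecutive c A" "2 <= card A" "card (A Int ?K) <= 1" for A
 proof (rule regular_polygon_shuffle[OF T v A(1,3,4)])
  have *: "regular U (A Int U) w" if U: "2 <= card (A Int U)" "?K \<subseteq> U" "finite U" "\<eta> \<in> cyclic_orders U"
   "restrict_cyc U c = orient \<eta>" "arc_regular U \<eta> w" for U \<eta> w
  proof -
   have "card (?K - A) = card ?K - card (A Int ?K)" by (rule card_Diff_subset_Int[of ?K , unfolded Int_commute[of ?K]]) simp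
   moreover have "card (?K - A) <= card (U - A Int U)" using U by (intro card_mono) auto
   moreover have "consecutive \<eta> (A Int U)"
    using consecutive_restrict[OF A(2), of U] consecutive_opposite[OF U(4)] orient_cases[of \<eta>] unfolding U by auto
   ultimately show ?thesis using U(1,6) A(4) unfolding arc_regular_def by auto
  qed
  show "regular T1 (A Int T1) v1" if "2 <= card (A Int T1)" using *[OF that _ T(2) c(1) g(2) reg(1)] T by blast
  show "regular T2 (A Int T2) v2" if "2 <= card (A Int T2)" using *[OF that _ T(3) c(2) g(3) reg(2)] T by blast
 qed
 show ?thesis unfolding arc_regular_def
 proof (intro allI impI, elim conjE)
  fix A assume A: "A \<subseteq> ?T" "consecutive c A" "2 <= card A" "2 <= card (?T - A)"
  obtain xs where xs: "c = cyc xs" "distinct xs" "set xs = ?T" using g by (auto simp: cyclic_orders_def)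
  have "card (A Int ?K) + card ((?T - A) Int ?K) = card ((A Int ?K) Un ((?T - A) Int ?K))" by (rule card_Un_disjoint[symmetric]) auto
  also have "(A Int ?K) Un ((?T - A) Int ?K) = ?K" using T by blast
  finally have "card (A Int ?K) <= 1 | card ((?T - A) Int ?K) <= 1" by auto
  moreover have "consecutive c (?T - A)" using consecutive_complement[of xs] A xs by simp
  moreover have "A ~= {}" "?T - A ~= {}" using A by force+
  hence "regular ?T (?T - A) ?v \<longleftrightarrow> regular ?T A ?v"
   by (intro regular_complement A finite_UnI T supp_polygon_space polygon_shuffle_space v)
  ultimately show "regular ?T A ?v" using small[OF A(1-3)] small[OF Diff_subset _ A(4)] by blast
 qed
qed

section \<open>The defining relations stay within convergent pairs\<close>

lemma std_order_cyclic_order: "finite S ==> std_order S \<in> cyclic_orders (labels S)"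
 unfolding std_order_def by (rule cyc_in_cyclic_orders) (auto simp: labels_def distinct_map inj_on_def)

text \<open>Reading both orders from the fixed point \<open>a\<close> gives two lists, and the
  permutation has to match them entry by entry.\<close>

lemma permutation_with_cyclic_order:
 assumes "g \<in> cyclic_orders T" "\<eta> \<in> cyclic_orders T" "a \<in> T"
 shows "\<exists>!\<tau>. \<tau> permutes T & permute_cyc \<tau> g = \<eta> & \<tau> a = a"
proof -
 obtain u where u: "g = cyc (a # u)" "distinct (a # u)" "set (a # u) = T" using cyclic_order_Cons[OF assms(1,3)] .
 obtain w where w: "\<eta> = cyc (a # w)" "distinct (a # w)" "set (a # w) = T" using cyclic_order_Cons[OF assms(2,3)] .
 have len: "length (a # u) = length (a # w)" using u w by (metis distinct_card)
 have iff: "\<tau> permutes T & permute_cyc \<tau> g = \<eta> & \<tau> a = a \<longleftrightarrow> \<tau> permutes T & map \<tau> (a # u) = a # w" for \<tau>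
 proof -
  have "map \<tau> u = w" if "\<tau> permutes T" "cyc (a # map \<tau> u) = cyc (a # w)" "\<tau> a = a"
   using cyc_Cons_inj[of a] that u permutes_inj_on[OF that(1)] distinct_map[of \<tau> "a # u"] by simp
  thus ?thesis unfolding u w permute_cyc_cyc by (intro iffI ; elim conjE) simp_all
 qed
 define f where "f x = (if x \<in> T then the (map_of (zip (a # u) (a # w)) x) else x)" for x
 have f: "map f (a # u) = a # w"
 proof (rule nth_equalityI)
  fix i assume "i < length (map f (a # u))"
  hence i: "i < length (a # u)" "i < length (a # w)" using len by simp_all
  hence "(a # u) ! i \<in> T" using u nth_mem by blast
  thus "map f (a # u) ! i = (a # w) ! i" unfolding nth_map[OF i(1)] f_def using map_of_zip_nth[OF len u(2) i(2)] by simp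
 qed (use len in simp)
 have "f ` T = T" using arg_cong[OF f, of set] u w by (simp only: set_map)
 hence "f permutes T" by (intro bij_imp_permutes) (auto simp: bij_betw_def f_def finite_cyclic_order[OF assms(1)] eq_card_imp_inj_on)
 thus ?thesis unfolding iff
 proof (intro ex1I[of _ f] conjI f)
  fix \<tau> assume t: "\<tau> permutes T & map \<tau> (a # u) = a # w"
  hence "map \<tau> (a # u) = map f (a # u)" unfolding f by simp
  hence "\<tau> x = f x" if "x \<in> T" for x using that u unfolding map_eq_conv by blast
  thus "\<tau> = f" using t unfolding permutes_def f_def by fastforce
 qed
qed

lemma std_perm:
 assumes "finite S" "g \<in> cyclic_orders (labels S)"
 shows "std_perm S g permutes labels S" "permute_cyc (std_perm S g) (std_order S) = g"
 using theI'[OF permutation_with_cyclic_order[OF std_order_cyclic_order[OF assms(1)] assms(2)]] unfolding std_perm_def by auto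

lemma std_label:
 assumes "finite S"
 shows "inj_on (std_label S) (Z (card S + 3))" "std_label S ` Z (card S + 3) = labels S"
  "permute_cyc (std_label S) (delta (card S + 3)) = std_order S"
proof -
 let ?l = "sorted_list_of_set S"
 have "[1..<Suc (card S)] = map Suc [0..<length ?l]" by (simp add: map_Suc_upt)
 hence "map (%j. Pt (?l ! (j - 1))) [1..<Suc (card S)] = map Pt (map ((!) ?l) [0..<length ?l])" by simp
 hence "map (%j. Pt (?l ! (j - 1))) [1..<Suc (card S)] = map Pt ?l" unfolding map_nth .
 thus p: "permute_cyc (std_label S) (delta (card S + 3)) = std_order S"
  by (simp add: std_order_def permute_cyc_cyc std_label_def comp_def flip: atLeastLessThanSuc_atLeastAtMost)
 have "underlying (permute_cyc (std_label S) (delta (card S + 3))) = std_label S ` Z (card S + 3)"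
  unfolding std_order_def permute_cyc_cyc by (auto simp: labels_def)
 thus im: "std_label S ` Z (card S + 3) = labels S" unfolding p by (simp add: underlying_cyclic_order[OF std_order_cyclic_order[OF assms]])
 have c: "card (labels S) = card S + 3" if "finite S" for S :: "nat set"
  unfolding labels_def using that by (subst card_Un_disjoint) (auto simp: card_image inj_on_def)
 show "inj_on (std_label S) (Z (card S + 3))"
  by (intro eq_card_imp_inj_on) (simp_all only: im c assms finite_labels finite_atLeastAtMost, simp)
qed

lemma cell_space_subspace: "3 <= n ==> qvec.subspace (convergent_polygons n)"
proof -
 assume n: "3 <= n"
 have "convergent_polygons n = polygon_space (Z n) Int (\<Inter>A\<in>{A. A \<subseteq> Z n & consecutive (delta n) A & 2 <= card A & 2 <= card (Z n - A)}. {v. regular (Z n) A v})"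
  using convergent_polygons_iff[OF n] unfolding arc_regular_def by auto
 thus ?thesis unfolding polygon_space_def by (auto intro!: qvec.subspace_inter qvec.subspace_Int regular_subspace)
qed

lemma std_pair_lin: "std_pair n (v + w) = std_pair n v + std_pair n w" "std_pair n (qscale c v) = qscale c (std_pair n v)"
 "std_pair n (sum g B) = (\<Sum>i\<in>B. std_pair n (g i))" "std_pair n (v - w) = std_pair n v - std_pair n w" "std_pair n 0 = 0"
proof -
 have l: "std_pair n v = lin_ext (%y. lin_ext (%x. bvec (x, y)) (polygon (delta n))) v" for v
  unfolding std_pair_def tensor_def bilin_ext_def lin_ext_def by (simp add: qvec.scale_sum_right) (subst sum.swap, simp add: mult.commute)
 show "std_pair n (v + w) = std_pair n v + std_pair n w" "std_pair n (qscale c v) = qscale c (std_pair n v)"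
 "std_pair n (sum g B) = (\<Sum>i\<in>B. std_pair n (g i))" "std_pair n (v - w) = std_pair n v - std_pair n w" "std_pair n 0 = 0"
  unfolding l by (simp_all add: lin_ext_add lin_ext_qscale lin_ext_sum lin_ext_diff)
qed

lemma convergent_push:
 assumes "3 <= n" "v \<in> polygon_space (Z n)" "arc_regular (Z n) g v" "g \<in> cyclic_orders (Z n)"
  "s permutes Z n" "permute_cyc s g = delta n"
 shows "push s v \<in> convergent_polygons n"
proof -
 have "Z n ~= {}" by (auto simp: labels_def)
 thus ?thesis
  using push_polygon_space[OF assms(2) permutes_inj_on[OF assms(5)]] arc_regular_push[OF assms(2,4) _ permutes_inj_on[OF assms(5)] assms(3)]
  unfolding convergent_polygons_iff[OF assms(1)] permutes_image[OF assms(5)] assms by simp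
qed

text \<open>If the permutation reverses the standard order, the first tensor factor changes only by
  the sign of \<open>polygon_opposite\<close>, which is moved to the second factor.\<close>

lemma dihedral_data_cell_space:
 assumes "(n, a, a') \<in> dihedral_data"
 shows "5 <= n" "a \<in> cell_space n" "a' \<in> cell_space n"
proof -
 obtain v s where a: "a = std_pair n v" "a' = tensor (polygon (permute_cyc s (delta n))) (push s v)"
  and n: "5 <= n" and v: "v \<in> convergent_polygons n" and s: "s permutes Z n" and d: "permute_cyc s (delta n) = delta n | permute_cyc s (delta n) = opposite (delta n)"
  using assms unfolding dihedral_data_def std_pair_def by auto
 have n3: "3 <= n" using n by simp
 have D: "delta n \<in> cyclic_orders (Z n)" by (rule std_order_cyclic_order) simp
 have V: "v \<in> polygon_space (Z n)" "arc_regular (Z n) (delta n) v" using v convergent_polygons_iff[OF n3] by auto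
 have push: "push s v \<in> convergent_polygons n"
 proof (cases "permute_cyc s (delta n) = delta n")
  case True
  thus ?thesis by (rule convergent_push[OF n3 V D s])
 next
  case False
  hence "permute_cyc s (opposite (delta n)) = delta n" using d by (simp add: permute_cyc_opposite)
  thus ?thesis by (rule convergent_push[OF n3 V(1) arc_regular_opposite[OF D V(2)] opposite_cyclic_order[OF D] s])
 qed
 have t: "tensor (qscale c p) q = qscale c (tensor p q)" for c p and q :: "label cyclic_order \<Rightarrow>\<^sub>0 rat"
  unfolding tensor_def by (rule bilin_ext_scale_left)
 have "EX c. a' = std_pair n (qscale c (push s v))" using d polygon_opposite unfolding a std_pair_lin unfolding std_pair_def
  by (metis opposite_opposite qvec.scale_one t)
 thus "a' \<in> cell_space n" unfolding cell_space_def using qvec.subspace_scale[OF cell_space_subspace[OF n3] push] by blast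
 show "5 <= n" "a \<in> cell_space n" unfolding cell_space_def a using n v by auto
qed

text \<open>Relabelling makes each form converge on the cell of its own order \<open>c1\<close> or
  \<open>c2\<close>. Their shuffle then converges on the cell of every \<open>c\<close> in
  \<open>cyc_shuffles c1 c2\<close>, and the inverse of its standard permutation carries that cell
  back to the standard one.\<close>

lemma product_data_cell_space:
 assumes "((m1, a1), (m2, a2), (n, a)) \<in> product_data"
 shows "5 <= m1" "a1 \<in> cell_space m1" "5 <= m2" "a2 \<in> cell_space m2" "5 <= n" "a \<in> cell_space n"
proof -
 obtain S1 S2 c1 c2 \<eta>1 \<eta>2 where
  e: "m1 = card S1 + 3" "a1 = std_pair m1 \<eta>1" "m2 = card S2 + 3" "a2 = std_pair m2 \<eta>2"
   "a = product_pair S1 S2 c1 c2 (push (std_label S1) \<eta>1) (push (std_label S2) \<eta>2)"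
  and h: "n \<ge> 5" "S1 Un S2 = {1..n - 3}" "S1 Int S2 = {}" "card S1 \<ge> 2" "card S2 \<ge> 2"
   "c1 \<in> cyclic_orders (labels S1)" "c2 \<in> cyclic_orders (labels S2)"
   "\<eta>1 \<in> convergent_polygons m1" "\<eta>2 \<in> convergent_polygons m2" using assms unfolding product_data_def by blast
 show "5 <= m1" "a1 \<in> cell_space m1" "5 <= m2" "a2 \<in> cell_space m2" "5 <= n" using e h by (auto simp: cell_space_def)
 have fin: "finite S1" "finite S2" using h by auto
 have n: "card (S1 Un S2) + 3 = n" "3 <= n" using h by simp_all
 have T: "labels S1 Int labels S2 = {P0, P1, Pinf}" "labels S1 Un labels S2 = Z n" using h by (auto simp: labels_def)
 define \<omega> where "\<omega> S c \<eta> = push (std_perm S c) (push (std_label S) \<eta>)" for S c \<eta>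
 have \<omega>: "\<omega> S c \<eta> \<in> polygon_space (labels S) & arc_regular (labels S) c (\<omega> S c \<eta>)"
  if S: "finite S" "c \<in> cyclic_orders (labels S)" "\<eta> \<in> convergent_polygons (card S + 3)" for S c \<eta>
 proof -
  have ne: "labels U ~= {}" for U by (auto simp: labels_def)
  have D: "delta (card S + 3) \<in> cyclic_orders (Z (card S + 3))" by (rule std_order_cyclic_order) simp
  have V: "\<eta> \<in> polygon_space (Z (card S + 3))" "arc_regular (Z (card S + 3)) (delta (card S + 3)) \<eta>"
   using S convergent_polygons_iff by auto
  note l = std_label[OF S(1)] and p = std_perm[OF S(1,2)]
  note l1 = push_polygon_space[OF V(1) l(1), unfolded l(2)] arc_regular_push[OF V(1) D ne l(1) V(2), unfolded l(2,3)]
  show ?thesis unfolding \<omega>_def using push_polygon_space[OF l1(1) permutes_inj_on[OF p(1)]]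
    arc_regular_push[OF l1(1) std_order_cyclic_order[OF S(1)] ne permutes_inj_on[OF p(1)] l1(2)] unfolding permutes_image[OF p(1)] p by simp
 qed
 have o: "\<omega> S1 c1 \<eta>1 \<in> polygon_space (labels S1)" "arc_regular (labels S1) c1 (\<omega> S1 c1 \<eta>1)"
  "\<omega> S2 c2 \<eta>2 \<in> polygon_space (labels S2)" "arc_regular (labels S2) c2 (\<omega> S2 c2 \<eta>2)"
  using \<omega>[OF fin(1) h(6)] \<omega>[OF fin(2) h(7)] h(8,9) e by auto
 let ?w = "polygon_shuffle (\<omega> S1 c1 \<eta>1) (\<omega> S2 c2 \<eta>2)"
 have conv: "push (inv_into UNIV (std_perm (S1 Un S2) c)) ?w \<in> convergent_polygons n" if c: "c \<in> cyc_shuffles c1 c2" for c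
 proof -
  have g: "c \<in> cyclic_orders (labels (S1 Un S2))"
   using c T unfolding cyc_shuffles_def underlying_cyclic_order[OF h(6)] underlying_cyclic_order[OF h(7)] h by simp
  let ?t = "std_perm (S1 Un S2) c"
  have t: "?t permutes Z n" "permute_cyc ?t (delta n) = c" using std_perm[OF _ g] by (simp_all add: h)
  have "permute_cyc (inv_into UNIV ?t) (permute_cyc ?t (delta n)) = delta n"
   by (simp only: permute_cyc_def image_image list.map_comp permutes_inv_o[OF t(1)] list.map_id image_ident)
  hence "permute_cyc (inv_into UNIV ?t) c = delta n" unfolding t .
  thus ?thesis using convergent_push[OF n(2), of ?w] polygon_shuffle_space[OF o(1,3)] g permutes_inv[OF t(1)]
    arc_regular_polygon_shuffle[OF T(1) _ _ o(1,3) h(6,7) c o(2,4)] fin unfolding T h by simp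
 qed
 note sub = cell_space_subspace[OF n(2)]
 have "a = std_pair n (qscale (orient_sign c1 * orient_sign c2) (\<Sum>c\<in>cyc_shuffles c1 c2. push (inv_into UNIV (std_perm (S1 Un S2) c)) ?w))"
  unfolding e product_pair_def Let_def n std_pair_lin \<omega>_def ..
 thus "a \<in> cell_space n" unfolding cell_space_def by (auto intro!: qvec.subspace_scale[OF sub] qvec.subspace_sum[OF sub] conv)
qed

section \<open>Convergent polygons in terms of words with 1 followed by m\<close>

lemma coef_lin_ext: "coef (lin_ext h f) x = (\<Sum>u\<in>supp f. coef f u * coef (h u) x)"
 by (simp add: lin_ext_def coef_sum)

lemma coef_lin_ext_inj:
 assumes "inj_on h U" "supp f \<subseteq> U" "u \<in> U"
 shows "coef (lin_ext (%u. bvec (h u)) f) (h u) = coef f u"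
proof -
 have "coef (lin_ext (%u. bvec (h u)) f) (h u) = (\<Sum>w\<in>supp f. if w = u then coef f u else 0)"
  unfolding coef_lin_ext using assms by (intro sum.cong) (auto simp: lookup_single inj_on_def)
 thus ?thesis by (simp add: in_keys_iff)
qed

text \<open>Read from \<open>a\<close> on, the cyclic order of \<open>e # w\<close> starts with \<open>a, b\<close>; with \<open>a\<close> at infinity all
 words are rooted at \<open>b\<close>.\<close>

lemma adjacent_chain_independent:
 fixes c :: "'a list => complex"
 assumes S: "finite S" "a \<in> S" "b \<in> S" "a ~= b" "e \<notin> S"
  and adj: "!!w. w \<in> perms S ==> c w ~= 0 ==> sublist [a, b] w"
  and zero: "!!x. inj_on x (insert e S) ==> (\<Sum>w\<in>perms S. c w * chain x (e # w @ [e])) = 0"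
  and w: "w \<in> perms S"
 shows "c w = 0"
proof -
 let ?R = "S - {a}" and ?B = "insert e (S - {a})"
 have aS: "insert a ?R = S" "insert a ?B = insert e S" "a \<notin> ?R" "e \<notin> ?R" "?B - {b} = insert e (S - {a, b})" using S by auto
 have rr: "reroot a e w \<in> perms ?B & reroot e a (reroot a e w) = w & chain x (a # reroot a e w @ [a]) = chain x (e # w @ [e]) &
   (sublist [a, b] w --> hd (reroot a e w) = b)" if w: "w \<in> perms S" for w and x :: "'a => complex"
 proof -
  obtain p q where pq: "w = p @ a # q" "a \<notin> set p" "a \<notin> set q" "p @ q \<in> perms ?R"
   using perms_split[of w a ?R] w aS by auto
  have "e \<notin> set q" using pq aS by (auto simp: perms_iff)
  moreover have "hd (q @ e # p) = b" if h: "sublist [a, b] w" using h pq by (auto simp: sublist_pair_iff append_Cons_eq_iff)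
  ultimately show ?thesis
   unfolding pq reroot_append[OF pq(2)] using pq(4) aS(4) chain_append[of x "e # p" a "q @ [e]"] chain_append[of x "a # q" e "p @ [a]"]
   by (auto simp: reroot_append perms_iff)
 qed
 have "(\<Sum>v\<in>perms ?B. c (reroot e a v) * chain x (a # v @ [a])) = (\<Sum>w\<in>perms S. c w * chain x (e # w @ [e]))" for x
  unfolding sum_reroot[OF aS(3,4), symmetric] aS using rr by  auto
 hence "ALL x. inj_on x (insert a ?B) --> (\<Sum>v\<in>perms ?B. c (reroot e a v) * chain x (a # v @ [a])) = 0"
  using zero aS by simp
 hence null: "ALL y. inj_on y ?B --> (\<Sum>v\<in>perms ?B. c (reroot e a v) * chain y v) = 0"
  by (subst chain_sum_0_iff) (use S in auto)
 have "c (reroot e a (reroot a e w)) = 0"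
 proof (rule hd_chain_independent[OF _ _ _ null[rule_format]])
  fix v assume v: "v \<in> perms ?B" "c (reroot e a v) ~= 0"
  then obtain p q where pq: "v = p @ e # q" "e \<notin> set p" "e \<notin> set q" "p @ q \<in> perms ?R" using perms_split[OF _ aS(4)] by blast
  have "a \<notin> set q" "set p Un set q = S - {a}" "q @ a # p \<in> perms (insert a ?R)" using pq by (auto simp: perms_iff)
  hence "reroot e a v \<in> perms S" "reroot a e (reroot e a v) = v" using aS by (simp_all add: pq reroot_append)
  thus "hd v = b" using rr adj v by metis
 qed (use S rr[OF w] in auto)
 thus ?thesis using rr[OF w] by simp
qed

definition word_polygon :: "nat => word_comb => (label cyclic_order \<Rightarrow>\<^sub>0 rat)" where
 "word_polygon n = lin_ext (%u. polygon (cyc (map (letter_label n) u @ [Pinf])))"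

definition adjacent_words :: "nat => nat list set" where
 "adjacent_words m = {w \<in> perms {1..m}. sublist [1, m] w}"

lemma label_word:
 assumes "3 <= n" "u \<in> perms {1..n - 1}"
 shows "cyc (u @ [0]) \<in> cyclic_orders {0..n - 1}"
  "cyc (map (letter_label n) u @ [Pinf]) = permute_cyc (point n) (cyc (u @ [0]))"
  "cyc (map (letter_label n) u @ [Pinf]) \<in> cyclic_orders (Z n)"
proof -
 have "insert 0 {1..n - 1} = {0..n - 1}" by auto
 hence u: "distinct (u @ [0])" "set (u @ [0]) = {0..n - 1}" "0 \<notin> set u" using assms by (simp_all add: perms_iff)
 show c: "cyc (u @ [0]) \<in> cyclic_orders {0..n - 1}" by (rule cyc_in_cyclic_orders) (rule u)+
 show e: "cyc (map (letter_label n) u @ [Pinf]) = permute_cyc (point n) (cyc (u @ [0]))"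
  by (simp add: permute_cyc_cyc map_point[OF u(3)] point_def)
 show "cyc (map (letter_label n) u @ [Pinf]) \<in> cyclic_orders (Z n)"
  unfolding e point_image[OF assms(1), symmetric] by (rule permute_cyclic_order[OF c point_inj])
qed

lemma word_polygon_space:
 assumes "3 <= n" "supp f \<subseteq> perms {1..n - 1}"
 shows "word_polygon n f \<in> polygon_space (Z n)"
 unfolding word_polygon_def polygon_space_def by (intro lin_ext_in_span qvec.span_base imageI label_word(3) assms(1) subsetD[OF assms(2)])

lemma cyclic_form_word_polygon:
 assumes "3 <= n" "supp f \<subseteq> perms {1..n - 1}"
 shows "cyclic_form x (word_polygon n f) = cyclic_form (%i. x (point n i)) (lin_ext (%u. bvec (cyc (u @ [0]))) f)"
 unfolding word_polygon_def lin_eval_lin_ext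
proof (rule lin_eval_cong)
 fix u assume "u \<in> supp f"
 hence u: "u \<in> perms {1..n - 1}" using assms by blast
 have "Z n ~= {}" by (auto simp: labels_def)
 from cyclic_form_polygon[OF label_word(3)[OF assms(1) u] this]
 show "cyclic_form x (polygon (cyc (map (letter_label n) u @ [Pinf]))) = cyclic_form (%i. x (point n i)) (bvec (cyc (u @ [0])))"
  using cyclic_chain_permute[OF label_word(1)[OF assms(1) u]] label_word[OF assms(1) u] by simp
qed

lemma coef_cyc_word:
 assumes "supp f \<subseteq> perms {1..m}" "u \<in> perms {1..m}"
 shows "coef (lin_ext (%u. bvec (cyc (u @ [0 :: nat]))) f) (cyc (u @ [0])) = coef f u"
proof (rule coef_lin_ext_inj[OF _ assms])
 show "inj_on (%u. cyc (u @ [0 :: nat])) (perms {1..m})" by (rule , rule cyc_snoc_inj) (auto simp: perms_iff)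
qed

text \<open>An interval containing 1 keeps its name 1 after contraction, and one containing
  \<open>m\<close> is renamed \<open>p\<close>. As it never contains both, the pair 1,
  \<open>m\<close> is not swallowed and its images remain neighbours.\<close>

lemma contract_adjacent:
 fixes p q m :: nat
 assumes w: "w \<in> perms (insert p ({1..m} - {p..q}))" and u: "u \<in> perms {p..q}" and adj: "sublist [1, m] (subst1 p u w)"
  and pq: "1 <= p" "p < q" "q <= m" "~ (p = 1 & q = m)"
 shows "sublist [1, if q = m then p else m] w"
proof -
 have "p \<notin> {1..m} - {p..q}" using pq by auto
 from perms_split[OF w this] obtain x y where xy: "w = x @ p # y" "p \<notin> set x" "p \<notin> set y" "x @ y \<in> perms ({1..m} - {p..q})" .
 have d: "set x Int {p..q} = {}" "set y Int {p..q} = {}" using xy by (auto simp: perms_iff)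
 have su: "set u = {p..q}" "2 <= length u" using u pq distinct_card[of u] by (auto simp: perms_iff)
 obtain X Y where XY: "x @ u @ y = X @ 1 # m # Y" using adj xy by (auto simp: sublist_pair_iff)
 have nb: "~ (1 \<in> set u & m \<in> set u)" using pq by (auto simp: su)
 from XY consider (l) us where "x = X @ us" "us @ u @ y = 1 # m # Y" | (r) us where "X = x @ us" "u @ y = us @ 1 # m # Y"
  unfolding append_eq_append_conv2 by blast
 thus ?thesis
 proof cases
  case l
  then consider "us = []" | "us = [1]" "u @ y = m # Y" | us' where "us = 1 # m # us'" by (cases us; cases "tl us") auto
  thus ?thesis
  proof cases
   case 1
   thus ?thesis using l su(2) nb by (cases u; cases "tl u") auto
  next
   case 2
   hence "m \<in> set u" using su by (cases u) auto
   hence "q = m" using pq by (auto simp: su)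
   thus ?thesis using l 2 unfolding xy by (auto simp: sublist_pair_iff)
  next
   case 3
   hence "m \<in> set x" using l by simp
   hence "q ~= m" using d pq by auto
   thus ?thesis using l 3 unfolding xy by (auto simp: sublist_pair_iff)
  qed
 next
  case r
  from r(2) consider vs where "y = vs @ 1 # m # Y" | vs where "u = us @ vs" "vs @ y = 1 # m # Y" unfolding append_eq_append_conv2 by blast
  thus ?thesis
  proof cases
   case 1
   hence "m \<in> set y" by simp
   hence "q ~= m" using d(2) pq by auto
   hence "w = (x @ p # vs) @ 1 # (if q = m then p else m) # Y" unfolding xy 1 by simp
   thus ?thesis unfolding sublist_pair_iff by blast
  next
   case 2
   then consider "y = 1 # m # Y" | "vs = [1]" "y = m # Y" | vs' where "vs = 1 # m # vs'" by (cases vs; cases "tl vs") auto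
   thus ?thesis
   proof cases
    case 1
    hence "m \<in> set y" by simp
    hence "q ~= m" using d pq by auto
    hence "w = (x @ [p]) @ 1 # (if q = m then p else m) # Y" unfolding xy 1 by simp
    thus ?thesis unfolding sublist_pair_iff by blast
   next
    case b: 2
    hence "1 \<in> set u" "m \<in> set y" using 2 by simp_all
    hence "p = 1" "q ~= m" using pq by (auto simp: su)
    thus ?thesis using b unfolding xy by (auto simp: sublist_pair_iff)
   qed (use 2 nb in auto)
  qed
 qed
qed

text \<open>Contracted words still contain a fixed pair of neighbours and are therefore independent
  by \<open>adjacent_chain_independent\<close>. The residue thus vanishes only if its coefficient at
  each contracted word does, which is the slice condition.\<close>

lemma regular_word_polygon:
 assumes n: "3 <= n" and f: "supp f \<subseteq> adjacent_words (n - 1)" and pq: "1 <= p" "p < q" "q <= n - 1" "~ (p = 1 & q = n - 1)"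
 shows "regular (Z n) (point n ` {p..q}) (word_polygon n f) \<longleftrightarrow>
  (\<forall>w\<in>perms (insert p ({1..n - 1} - {p..q})). null_on {p..q} (%u. coef f (subst1 p u w)))"
proof -
 let ?m = "n - 1" and ?g = "lin_ext (%u. bvec (cyc (u @ [0 :: nat]))) f"
 let ?R = "insert p ({1..?m} - {p..q})"
 let ?r = "%(s :: nat => complex) w. \<Sum>u\<in>perms {p..q}. of_rat (coef f (subst1 p u w)) * chain s u"
 let ?S = "%(s :: nat => complex) z. \<Sum>w\<in>perms ?R. ?r s w * chain z (0 # w @ [0])"
 have fp: "supp f \<subseteq> perms {1..?m}" using f unfolding adjacent_words_def by blast
 have g: "supp ?g \<subseteq> cyclic_orders {0..?m}"
  using supp_lin_ext[of "%u. bvec (cyc (u @ [0 :: nat]))" f] label_word(1)[OF n] fp by (fastforce split: if_splits)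
 have "regular (Z n) (point n ` {p..q}) (word_polygon n f) \<longleftrightarrow> regular {0..?m} {p..q} ?g"
  unfolding point_image[OF n, symmetric] by (rule regular_transfer[OF _ _ g _ point_inj cyclic_form_word_polygon[OF n fp]]) (use pq in auto)
 also have "... \<longleftrightarrow> (ALL s. inj_on s {p..q} --> (ALL z. inj_on z (insert 0 ?R) --> ?S s z = 0))"
 proof -
  have R: "insert p ({0..?m} - {0} - {p..q}) = ?R" "insert p ({0..?m} - {p..q}) = insert 0 ?R" using pq by auto
  have sub: "{p..q} \<subseteq> {1..?m}" "p \<in> {p..q}" using pq by auto
  have "coef ?g (cyc (subst1 p u w @ [0])) = coef f (subst1 p u w)" if "w \<in> perms ?R" "u \<in> perms {p..q}" for u w
   by (rule coef_cyc_word[OF fp subst1_perms[OF that sub(2,1)]])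
  hence "(\<Sum>w\<in>perms ?R. residue_coef ?g {p..q} p 0 s w * chain z (0 # w @ [0])) = ?S s z" for s z
   by (intro sum.cong refl arg_cong2[where f = "(*)"]) simp_all
  thus ?thesis using regular_iff_cyclic[of "{0..?m}" "{p..q}" p 0 ?g] pq g unfolding R by simp
 qed
 also have "... \<longleftrightarrow> (\<forall>w\<in>perms ?R. null_on {p..q} (%u. coef f (subst1 p u w)))"
 proof
  assume h: "ALL s. inj_on s {p..q} --> (ALL z. inj_on z (insert 0 ?R) --> ?S s z = 0)"
  show "\<forall>w\<in>perms ?R. null_on {p..q} (%u. coef f (subst1 p u w))" unfolding null_on_def
  proof (intro ballI allI impI)
   fix w and s :: "nat => complex" assume w: "w \<in> perms ?R" and s: "inj_on s {p..q}"
   show "?r s w = 0"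
   proof (rule adjacent_chain_independent[of ?R 1 "if q = ?m then p else ?m" 0, OF _ _ _ _ _ _ _ w])
    fix w assume w: "w \<in> perms ?R" "?r s w ~= 0"
    then obtain u where u: "u \<in> perms {p..q}" "of_rat (coef f (subst1 p u w)) * chain s u ~= 0" by (meson sum.neutral)
    hence "subst1 p u w \<in> supp f" by (auto simp: in_keys_iff)
    hence "sublist [1, ?m] (subst1 p u w)" using f unfolding adjacent_words_def by blast
    thus "sublist [1, if q = ?m then p else ?m] w" by (rule contract_adjacent[OF w(1) u(1) _ pq])
   qed (use h s pq in auto)
  qed
 qed (simp add: null_on_def)
 finally show ?thesis .
qed

lemma word_polygon_convergent_iff:
 assumes n: "3 <= n" and f: "supp f \<subseteq> adjacent_words (n - 1)"
 shows "word_polygon n f \<in> convergent_polygons n \<longleftrightarrow> f \<in> adjacent_null_slices (n - 1)"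
proof -
 have fp: "supp f \<subseteq> perms {1..n - 1}" using f unfolding adjacent_words_def by blast
 note v = word_polygon_space[OF n fp]
 have "word_polygon n f \<in> convergent_polygons n \<longleftrightarrow> (\<forall>A\<in>std_divisors n. regular (Z n) A (word_polygon n f))"
  unfolding convergent_polygons_def convergent_on_cell_def using v no_pole_along_iff[OF n _ supp_polygon_space] by simp
 also have "... \<longleftrightarrow> (ALL p q. 1 <= p & p < q & q <= n - 1 & ~ (p = 1 & q = n - 1) --> regular (Z n) (point n ` {p..q}) (word_polygon n f))"
  using std_divisorsE[OF n] std_divisorsI[OF n] by metis
 also have "... \<longleftrightarrow> f \<in> adjacent_null_slices (n - 1)"
  using f regular_word_polygon[OF n f] unfolding adjacent_null_slices_def adjacent_words_def by blast
 finally show ?thesis .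
qed

text \<open>The same independence before any contraction. It makes the words with 1 followed by
  \<open>m\<close> independent modulo everything with zero form, in particular modulo shuffles with
  one element.\<close>

lemma word_polygon_form_0:
 assumes n: "3 <= n" and f: "supp f \<subseteq> adjacent_words (n - 1)"
  and 0: "!!x. inj_on x (Z n) ==> cyclic_form x (word_polygon n f) = 0"
 shows "f = 0"
proof (rule poly_mapping_eqI)
 fix w
 let ?m = "n - 1" and ?g = "lin_ext (%u. bvec (cyc (u @ [0 :: nat]))) f"
 have fp: "supp f \<subseteq> perms {1..?m}" using f unfolding adjacent_words_def by blast
 have g: "supp ?g \<subseteq> cyclic_orders {0..?m}"
  using supp_lin_ext[of "%u. bvec (cyc (u @ [0 :: nat]))"] label_word(1)[OF n] fp by fastforce
 have ins: "{0..?m} - {0} = {1..?m}" "insert 0 {1..?m} = {0..?m}" by auto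
 have "(\<Sum>u\<in>perms {1..?m}. of_rat (coef f u) * chain y (0 # u @ [0])) = 0" if y: "inj_on y (insert 0 {1..?m})" for y
 proof -
  define i where "i = inv_into {0..?m} (point n)"
  have i: "i (point n j) = j" if "j \<in> {0..?m}" for j unfolding i_def by (rule inv_into_f_f[OF point_inj that])
  have "inj_on ((%l. y (i l)) \<circ> point n) {0..?m}" using y unfolding ins by (subst inj_on_cong) (simp_all add: i)
  hence "inj_on (%l. y (i l)) (Z n)" unfolding point_image[OF n, symmetric] by (rule inj_on_imageI)
  from 0[OF this] have "cyclic_form (%j. y (i (point n j))) ?g = 0" unfolding cyclic_form_word_polygon[OF n fp] .
  moreover have "cyclic_form (%j. y (i (point n j))) ?g = cyclic_form y ?g" by (rule cyclic_form_cong[OF _ _ g]) (auto simp: i)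
  moreover have "cyclic_form y ?g = (\<Sum>u\<in>perms {1..?m}. of_rat (coef f u) * chain y (0 # u @ [0]))"
   using cyclic_form_snoc[OF _ _ g, of 0] unfolding ins by (simp add: coef_cyc_word[OF fp, simplified])
  ultimately show ?thesis by simp
 qed
 moreover have "sublist [1, ?m] u" if "of_rat (coef f u) ~= (0 :: complex)" for u
  using that f unfolding adjacent_words_def by (auto simp: in_keys_iff)
 ultimately have "of_rat (coef f w) = (0 :: complex)" if "w \<in> perms {1..?m}"
  by (intro adjacent_chain_independent[of "{1..?m}" 1 ?m 0 "%w. of_rat (coef f w)", OF _ _ _ _ _ _ _ that]) (use n in auto)
 thus "coef f w = coef 0 w" using fp by (auto simp: in_keys_iff)
qed

section \<open>Reduction modulo shuffles with respect to one element\<close>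

definition shuffle_polygons :: "nat => (label cyclic_order \<Rightarrow>\<^sub>0 rat) set" where
 "shuffle_polygons n = {\<Sum>w\<in>shuffles A B. polygon (cyc (w @ [e])) | A B e.
   e \<in> Z n & A ~= [] & B ~= [] & distinct (A @ B) & set (A @ B) = Z n - {e}}"

lemma shuffle_pairs_eq: "shuffle_pairs n = std_pair n ` shuffle_polygons n"
 unfolding shuffle_pairs_def shuffle_polygons_def by blast

lemma cyc_shuffle_order:
 assumes "e \<in> T" "distinct (A @ B)" "set (A @ B) = T - {e}" "w \<in> shuffles A B"
 shows "cyc (w @ [e]) \<in> cyclic_orders T"
 using assms set_shuffles[OF assms(4)] distinct_disjoint_shuffles[OF _ _ _ assms(4)] by (intro cyc_in_cyclic_orders) auto

text \<open>Sending \<open>e\<close> to infinity turns the closed words into plain words, where the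
  shuffle sum vanishes by \<open>chain_shuffles_eq_0\<close>.\<close>

lemma shuffle_polygons_form:
 assumes v: "v \<in> shuffle_polygons n" and x: "inj_on x (Z n)"
 shows "cyclic_form x v = 0"
proof -
 obtain A B e where e: "v = (\<Sum>w\<in>shuffles A B. polygon (cyc (w @ [e])))" "e \<in> Z n"
  and AB: "A ~= []" "B ~= []" "distinct (A @ B)" "set (A @ B) = Z n - {e}"
  using v unfolding shuffle_polygons_def by blast
 have ne: "Z n ~= {}" using e by blast
 have sub: "shuffles A B \<subseteq> perms (Z n - {e})" using shuffles_perms[of A] AB(3) unfolding AB(4)[symmetric] by (auto simp: perms_iff)
 have S: "(\<Sum>w\<in>shuffles A B. h w) = (\<Sum>w\<in>perms (Z n - {e}). (if w \<in> shuffles A B then 1 else 0) * h w)" for h :: "label list => complex"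
  by (rule sum.mono_neutral_cong_left) (use sub in auto)
 have "cyclic_form x v = (\<Sum>w\<in>shuffles A B. chain x (e # w @ [e]))" unfolding e lin_eval_sum
  by (simp add: cyclic_form_polygon[OF cyc_shuffle_order[OF e(2) AB(3,4)] ne] cyclic_chain_snoc)
 also have "... = 0" unfolding S
 proof (rule chain_sum_0_iff[THEN iffD1, rule_format])
  fix y :: "label => complex" assume "inj_on y (Z n - {e})"
  hence "(\<Sum>w\<in>shuffles A B. chain y w) = 0" by (intro chain_shuffles_eq_0) (use AB in auto)
  thus "(\<Sum>w\<in>perms (Z n - {e}). (if w \<in> shuffles A B then 1 else 0) * chain y w) = 0" unfolding S .
 next
  show "inj_on x (insert e (Z n - {e}))" unfolding insert_Diff[OF e(2)] by (rule x)
  show "Z n - {e} ~= {}" unfolding AB(4)[symmetric] using AB(1) by simp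
 qed simp_all
 finally show ?thesis .
qed

text \<open>A form that is identically zero has no pole along any divisor.\<close>

lemma shuffle_polygons_convergent:
 assumes n: "3 <= n"
 shows "qvec.span (shuffle_polygons n) \<subseteq> convergent_polygons n"
proof (rule qvec.span_minimal[OF _ cell_space_subspace[OF n]], rule subsetI)
 fix v assume v: "v \<in> shuffle_polygons n"
 obtain A B e where e: "v = (\<Sum>w\<in>shuffles A B. polygon (cyc (w @ [e])))" "e \<in> Z n" "distinct (A @ B)" "set (A @ B) = Z n - {e}"
  using v unfolding shuffle_polygons_def by blast
 have "v \<in> polygon_space (Z n)" unfolding e polygon_space_def by (intro qvec.span_sum qvec.span_base imageI cyc_shuffle_order[OF e(2-)])
 moreover have "regular (Z n) A v" for A by (rule regular_if_form_0) (auto simp: shuffle_polygons_form[OF v])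
 ultimately show "v \<in> convergent_polygons n" unfolding convergent_polygons_iff[OF n] arc_regular_def by blast
qed

text \<open>Apart from the concatenation, every shuffle places some letter of \<open>X\<close> after
  \<open>c\<close>.\<close>

lemma shuffles_first:
 assumes "c \<notin> set X" "w \<in> shuffles X (c # Y)"
 shows "w = X @ c # Y | (EX p q. w = p @ c # q & length p < length X)"
 using assms
proof (induction X arbitrary: w)
 case (Cons x X)
 from Cons.prems(2) consider w' where "w = x # w'" "w' \<in> shuffles X (c # Y)" | w' where "w = c # w'" by auto
 thus ?case
 proof cases
  case 1
  thus ?thesis using Cons.IH Cons.prems by auto (metis append_Cons length_Cons Suc_less_eq)
 qed force
qed simp

text \<open>Shuffling with \<open>e = 0\<close> moves the letter \<open>1\<close> to the right of \<open>0\<close>.\<close>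

lemma polygon_reduction:
 assumes n: "3 <= n" and v: "v \<in> polygon_space (Z n)"
 shows "EX f. supp f \<subseteq> adjacent_words (n - 1) & v - word_polygon n f \<in> qvec.span (shuffle_polygons n)"
proof -
 let ?h = "%u. polygon (cyc (map (letter_label n) u @ [Pinf]))"
 let ?B = "?h ` adjacent_words (n - 1)"
 let ?S = "qvec.span (?B Un shuffle_polygons n)"
 \<comment> \<open>\<open>X\<close> consists of the points between 0 and 1. The shuffle of
   \<open>X\<close> with \<open>P1 # Y\<close> relates the word to words with fewer points there;
   when none is left, the order is rotated so that infinity comes last.\<close>
 have mem: "polygon (cyc ((X @ P1 # Y) @ [P0])) \<in> ?S" if "distinct (X @ P1 # Y)" "set (X @ P1 # Y) = Z n - {P0}" for X Y using that
 proof (induction X arbitrary: Y rule: length_induct)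
  case (1 X)
  show ?case
  proof (cases "X = []")
   case True
   have "Pinf \<in> set (P1 # Y)" using 1 True by auto
   then obtain Y1 Y2 where Y: "Y = Y1 @ Pinf # Y2" by (auto simp: in_set_conv_decomp)
   have "set (Y2 @ P0 # P1 # Y1) = Z n - {Pinf}"
   proof -
    have "Pinf \<notin> set (Y2 @ P0 # P1 # Y1)" using 1 unfolding Y by auto
    moreover have "insert Pinf (set (Y2 @ P0 # P1 # Y1)) = insert P0 (set (X @ P1 # Y))" unfolding True Y by auto
    moreover have "insert P0 (Z n - {P0}) = Z n" by auto
    ultimately show ?thesis unfolding 1 by blast
   qed
   hence s: "set (Y2 @ P0 # P1 # Y1) = point n ` {1..n - 1}" unfolding point_finite_image[OF n] .
   define u where "u = map (inv_into {1..n - 1} (point n)) (Y2 @ P0 # P1 # Y1)"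
   have inj: "inj_on (point n) {1..n - 1}" by (rule inj_on_subset[OF point_inj]) auto
   have mu: "map (point n) u = Y2 @ P0 # P1 # Y1"
    unfolding u_def map_map by (rule map_idI, unfold comp_def, rule f_inv_into_f, simp only: s)
   have su: "set u = {1..n - 1}" unfolding u_def set_map s by (rule inv_into_image_cancel[OF inj order_refl])
   have "distinct (Y2 @ P0 # P1 # Y1)" using 1 unfolding Y by auto
   hence du: "distinct u" using distinct_map[of "point n" u] mu by simp
   have i: "inv_into {1..n - 1} (point n) P0 = 1" "inv_into {1..n - 1} (point n) P1 = n - 1"
    by (rule inv_into_f_eq[OF inj]; use n in "simp add: point_def letter_label_def")+
   have "EX p q. u = p @ 1 # (n - 1) # q" unfolding u_def map_append list.map i by blast
   hence "u \<in> adjacent_words (n - 1)" unfolding adjacent_words_def sublist_pair_iff using su du by blast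
   moreover have "cyc ((X @ P1 # Y) @ [P0]) = cyc ((Y2 @ P0 # P1 # Y1) @ [Pinf])" unfolding True Y using cyc_append[of "Y2 @ [P0]"] by simp
   ultimately have "polygon (cyc ((X @ P1 # Y) @ [P0])) \<in> ?B" using map_point[of u n] su mu by (intro image_eqI) auto
   thus ?thesis by (intro qvec.span_base) blast
  next
   case False
   let ?W = "shuffles X (P1 # Y)"
   have "P1 \<notin> set X" using 1 by auto
   note first = shuffles_first[OF this]
   have "xs @ ys \<in> shuffles xs ys" for xs ys :: "label list" by (induction xs) (auto intro: Cons_in_shuffles_leftI)
   hence X: "X @ P1 # Y \<in> ?W" .
   have rest: "polygon (cyc (w @ [P0])) \<in> ?S" if w: "w \<in> ?W - {X @ P1 # Y}" for w
   proof -
    obtain p q where pq: "w = p @ P1 # q" "length p < length X" using first w by blast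
    have "distinct w" "set w = Z n - {P0}" using w 1(2,3) set_shuffles[of w X "P1 # Y"] distinct_disjoint_shuffles[of X "P1 # Y" w] by auto
    thus ?thesis using 1 pq by blast
   qed
   have "(\<Sum>w\<in>?W. polygon (cyc (w @ [P0]))) \<in> shuffle_polygons n" unfolding shuffle_polygons_def
    by (rule , intro exI[of _ X] exI[of _ "P1 # Y"] exI conjI) (use False 1(2,3) in simp_all)
   hence "(\<Sum>w\<in>?W. polygon (cyc (w @ [P0]))) \<in> ?S" by (intro qvec.span_base) blast
   moreover have "(\<Sum>w\<in>?W - {X @ P1 # Y}. polygon (cyc (w @ [P0]))) \<in> ?S" by (rule qvec.span_sum) (rule rest)
   ultimately have "(\<Sum>w\<in>?W. polygon (cyc (w @ [P0]))) - (\<Sum>w\<in>?W - {X @ P1 # Y}. polygon (cyc (w @ [P0]))) \<in> ?S"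
    by (rule qvec.span_diff)
   thus ?thesis by (simp add: sum.remove[OF finite_shuffles X])
  qed
 qed
 have "polygon_space (Z n) \<subseteq> ?S" unfolding polygon_space_def
 proof (rule qvec.span_minimal[OF _ qvec.subspace_span], rule subsetI)
  fix s assume "s \<in> polygon ` cyclic_orders (Z n)"
  then obtain g where g: "s = polygon g" "g \<in> cyclic_orders (Z n)" by blast
  have "P0 \<in> Z n" by simp
  hence "g \<in> (%u. cyc (u @ [P0])) ` perms (Z n - {P0})"
   using bij_betw_imp_surj_on[OF cyclic_orders_snoc] g by metis
  then obtain w where w: "s = polygon (cyc (w @ [P0]))" "w \<in> perms (Z n - {P0})" unfolding g by auto
  have "P1 \<in> set w" using w by (simp add: perms_iff)
  then obtain X Y where "w = X @ P1 # Y" by (meson split_list)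
  thus "s \<in> ?S" using mem w by (simp add: perms_iff)
 qed
 then obtain x y where xy: "v = x + y" "x \<in> qvec.span ?B" "y \<in> qvec.span (shuffle_polygons n)"
  using v unfolding qvec.span_Un by blast
 thus ?thesis using span_image_lin_ext[OF xy(2)] unfolding word_polygon_def by auto
qed

text \<open>The standard order differs from its opposite, so its polygon has a nonzero coefficient
  at it, and the second tensor factor can be read off there.\<close>

lemma std_pair_eq_0:
 assumes "3 <= n" "std_pair n v = 0"
 shows "v = 0"
proof (rule poly_mapping_eqI)
 fix \<eta>
 have "delta n ~= opposite (delta n)"
 proof
  assume "delta n = opposite (delta n)"
  hence "cyc (P0 # map Pt [1..<Suc (n - 3)] @ [P1, Pinf]) = cyc (P0 # Pinf # P1 # rev (map Pt [1..<Suc (n - 3)]))"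
   unfolding std_order_def opposite_cyc by (simp add: cyc_Cons flip: atLeastLessThanSuc_atLeastAtMost)
  hence "map Pt [1..<Suc (n - 3)] @ [P1, Pinf] = Pinf # P1 # rev (map Pt [1..<Suc (n - 3)])"
   by (rule cyc_Cons_inj[rotated]) (auto simp: distinct_map inj_on_def)
  thus False by (cases "[1..<Suc (n - 3)]") auto
 qed
 hence d: "coef (polygon (delta n)) (delta n) ~= 0" by (simp add: polygon_def lookup_add lookup_single)
 have c: "coef (tensor p q) (a, b) = coef p a * coef q b" for p :: "label cyclic_order \<Rightarrow>\<^sub>0 rat" and q :: "label cyclic_order \<Rightarrow>\<^sub>0 rat" and a b
 proof -
  have "coef (lin_ext (%y. bvec (x, y)) q) (a, b) = (if x = a then coef q b else 0)" for x
   unfolding coef_lin_ext by (auto simp: lookup_single when_def in_keys_iff if_distrib cong: if_cong)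
  thus ?thesis unfolding tensor_def bilin_ext_def coef_lin_ext by (simp add: in_keys_iff if_distrib[of "(*) _"] cong: if_cong)
 qed
 show "coef v \<eta> = coef 0 \<eta>" using d c[of "polygon (delta n)" v "delta n"] assms unfolding std_pair_def by simp
qed

lemma span_shuffle_pairs: "qvec.span (shuffle_pairs n) = std_pair n ` qvec.span (shuffle_polygons n)"
proof -
 interpret Vector_Spaces.linear qscale qscale "std_pair n" by unfold_locales (simp_all add: std_pair_lin)
 show ?thesis unfolding shuffle_pairs_eq by (rule span_image)
qed

lemma lin_ext_word_pair: "lin_ext (word_pair n) c = std_pair n (word_polygon n (lin_ext (%w. w) c))"
 unfolding lin_ext_def[of "word_pair n"] lin_ext_def[of "%w. w"]
 by (simp add: word_pair_def word_polygon_def lin_ext_sum lin_ext_qscale std_pair_lin)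

text \<open>The difference of two solutions is a combination of insertion words whose polygon lies
  in the span of shuffles, so its form vanishes. By \<open>word_polygon_form_0\<close> the
  combination itself is zero, and the insertion words are independent.\<close>

lemma lyndon_coeffs_eqI:
 assumes n: "5 <= n" and c: "supp c \<subseteq> lyndon_insertion_words (n - 1)"
  and a: "a - lin_ext (word_pair n) c \<in> qvec.span (shuffle_pairs n)"
 shows "lyndon_coeffs n a = c"
 unfolding lyndon_coeffs_def
proof (rule the_equality)
 fix c' assume c': "supp c' \<subseteq> lyndon_insertion_words (n - 1) & a - lin_ext (word_pair n) c' \<in> qvec.span (shuffle_pairs n)"
 let ?d = "c' - c" and ?W = "lyndon_insertion_words (n - 1)"
 have n3: "3 <= n" "2 <= n - 1" using n by auto
 have d: "supp ?d \<subseteq> ?W" using c c' Poly_Mapping.keys_diff[of c'] by blast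
 have "lin_ext (word_pair n) ?d = (a - lin_ext (word_pair n) c) - (a - lin_ext (word_pair n) c')" by (simp add: lin_ext_diff)
 hence "lin_ext (word_pair n) ?d \<in> qvec.span (shuffle_pairs n)" using a c' qvec.span_diff by metis
 then obtain s where s: "s \<in> qvec.span (shuffle_polygons n)" "std_pair n (word_polygon n (lin_ext (%w. w) ?d) - s) = 0"
  unfolding lin_ext_word_pair span_shuffle_pairs by (auto simp: std_pair_lin)
 hence s': "word_polygon n (lin_ext (%w. w) ?d) \<in> qvec.span (shuffle_polygons n)" using std_pair_eq_0[OF n3(1)] by fastforce
 have "lin_ext (%w. w) ?d \<in> qvec.span ?W" by (rule lin_ext_in_span) (use d qvec.span_base in blast)
 hence "lin_ext (%w. w) ?d \<in> adjacent_null_slices (n - 1)" using lyndon_words_basis[OF n3(2)] by simp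
 hence "supp (lin_ext (%w. w) ?d) \<subseteq> adjacent_words (n - 1)" unfolding adjacent_null_slices_def adjacent_words_def by blast
 hence "lin_ext (%w. w) ?d = 0"
 proof (rule word_polygon_form_0[OF n3(1)])
  fix x :: "label => complex" assume x: "inj_on x (Z n)"
  show "cyclic_form x (word_polygon n (lin_ext (%w. w) ?d)) = 0" using s'
   by (induction rule: qvec.span_induct_alt) (simp_all add: lin_eval_add lin_eval_scale shuffle_polygons_form[OF _ x])
 qed
 hence "(\<Sum>w\<in>supp ?d. qscale (coef ?d w) w) = 0" by (simp add: lin_ext_def)
 hence "coef ?d w = 0" if "w \<in> supp ?d" for w using qvec.independentD[OF lyndon_words_basis(2)[OF n3(2)] finite_keys d _ that] by blast
 hence "?d = 0" by (metis keys_eq_empty in_keys_iff equals0I)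
 thus "c' = c" by simp
qed (use c a in simp)

text \<open>Reduction by shuffles leaves words with 1 followed by \<open>n - 1\<close>. Shuffles
  converge, so this remainder converges with \<open>v\<close>, and convergence puts it into the span
  of the insertion words.\<close>

lemma lyndon_coeffs:
 assumes n: "5 <= n" and a: "a \<in> cell_space n"
 shows "supp (lyndon_coeffs n a) \<subseteq> lyndon_insertion_words (n - 1)"
  "a - lin_ext (word_pair n) (lyndon_coeffs n a) \<in> qvec.span (shuffle_pairs n)"
proof -
 have n3: "3 <= n" "2 <= n - 1" using n by auto
 obtain v where v: "a = std_pair n v" "v \<in> convergent_polygons n" using a unfolding cell_space_def by blast
 hence "v \<in> polygon_space (Z n)" unfolding convergent_polygons_def by simp
 then obtain f where f: "supp f \<subseteq> adjacent_words (n - 1)" "v - word_polygon n f \<in> qvec.span (shuffle_polygons n)"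
  using polygon_reduction[OF n3(1)] by blast
 hence "v - (v - word_polygon n f) \<in> convergent_polygons n"
  using qvec.subspace_diff[OF cell_space_subspace[OF n3(1)] v(2)] shuffle_polygons_convergent[OF n3(1)] by blast
 hence "f \<in> qvec.span ((%w. w) ` lyndon_insertion_words (n - 1))"
  using word_polygon_convergent_iff[OF n3(1) f(1)] lyndon_words_basis[OF n3(2)] by simp
 from span_image_lin_ext[OF this] obtain c where c: "supp c \<subseteq> lyndon_insertion_words (n - 1)" "f = lin_ext (%w. w) c" by blast
 have "a - lin_ext (word_pair n) c = std_pair n (v - word_polygon n f)" unfolding v lin_ext_word_pair c std_pair_lin ..
 hence e: "a - lin_ext (word_pair n) c \<in> qvec.span (shuffle_pairs n)" unfolding span_shuffle_pairs using f by blast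
 thus "supp (lyndon_coeffs n a) \<subseteq> lyndon_insertion_words (n - 1)"
  "a - lin_ext (word_pair n) (lyndon_coeffs n a) \<in> qvec.span (shuffle_pairs n)" using lyndon_coeffs_eqI[OF n] c by simp_all
qed

lemma word_pair_cell_space:
 assumes "5 <= n" "w \<in> lyndon_insertion_words (n - 1)"
 shows "word_pair n w \<in> cell_space n"
proof -
 have n3: "3 <= n" "2 <= n - 1" using assms by auto
 have "w \<in> adjacent_null_slices (n - 1)" using lyndon_words_basis[OF n3(2)] qvec.span_base[OF assms(2)] by simp
 moreover from this have "supp w \<subseteq> adjacent_words (n - 1)" unfolding adjacent_null_slices_def adjacent_words_def by blast
 ultimately have "word_polygon n w \<in> convergent_polygons n" using word_polygon_convergent_iff[OF n3(1)] by blast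
 thus ?thesis unfolding cell_space_def word_pair_def word_polygon_def by blast
qed

lemma shuffle_pairs_cell_space: "5 <= n ==> qvec.span (shuffle_pairs n) \<subseteq> cell_space n"
 unfolding span_shuffle_pairs cell_space_def using shuffle_polygons_convergent[of n] by auto

lemma subspace_cell_space: "5 <= n ==> qvec.subspace (cell_space n)"
proof -
 assume "5 <= n"
 hence "qvec.subspace (convergent_polygons n)" by (intro cell_space_subspace) simp
 interpret Vector_Spaces.linear qscale qscale "std_pair n" by unfold_locales (simp_all add: std_pair_lin)
 show ?thesis unfolding cell_space_def by (rule subspace_image) fact
qed

section \<open>Substitution in polynomials and free commutative algebras\<close>

lemma cst_mult: "cst c * p = qscale c p"
proof -
 have e: "cst c * qscale a (bvec m) = qscale c (qscale a (bvec m))" for a and m :: "'a \<Rightarrow>\<^sub>0 nat"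
 proof -
  have "qscale a (bvec m) = Poly_Mapping.single m a" by (rule poly_mapping_eqI) (simp add: lookup_single when_def)
  thus ?thesis by (intro poly_mapping_eqI) (simp add: cst_def mult_single lookup_single when_def)
 qed
 note p = poly_mapping_expand[OF finite_keys order_refl, of p]
 show ?thesis by (subst (1 2) p) (simp only: sum_distrib_left qvec.scale_sum_right e)
qed

lemma cst_hom: "cst (a + b) = cst a + cst b" "cst (a * b) = cst a * cst b" "cst 1 = 1" "cst 0 = 0" "cst (- a) = - cst a"
 by (simp_all add: cst_def single_add mult_single single_uminus)

lemma scale_times: "qscale a p * qscale b q = qscale (a * b) (p * q)" for p q :: "'v qpoly"
 by (simp add: cst_mult[symmetric] cst_hom)

lemma poly_subst_lin_ext: "poly_subst f = lin_ext (%m. \<Prod>x\<in>Poly_Mapping.keys m. f x ^ Poly_Mapping.lookup m x)"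
 by (simp add: poly_subst_def lin_ext_def cst_mult fun_eq_iff)

lemma poly_subst_add: "poly_subst f (p + q) = poly_subst f p + poly_subst f q"
 by (simp add: poly_subst_lin_ext lin_ext_add)

lemma poly_subst_diff: "poly_subst f (p - q) = poly_subst f p - poly_subst f q"
 by (simp add: poly_subst_lin_ext lin_ext_diff)

lemma poly_subst_sum: "poly_subst f (sum g A) = (\<Sum>i\<in>A. poly_subst f (g i))"
 by (simp add: poly_subst_lin_ext lin_ext_sum)

lemma poly_subst_cst [simp]: "poly_subst f (cst c) = cst c"
 by (simp add: poly_subst_def cst_def)

lemma poly_subst_var [simp]: "poly_subst f (var x) = f x"
 by (simp add: poly_subst_lin_ext var_def)

lemma poly_subst_mult:
 fixes f :: "'a => 'b qpoly"
 shows "poly_subst f (p * q) = poly_subst f p * poly_subst f q"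
proof -
 let ?e = "%m :: 'a \<Rightarrow>\<^sub>0 nat. \<Prod>x\<in>Poly_Mapping.keys m. f x ^ Poly_Mapping.lookup m x"
 have e: "?e (m + n) = ?e m * ?e n" for m n
 proof -
  have k: "?e k = (\<Prod>x\<in>Poly_Mapping.keys m Un Poly_Mapping.keys n. f x ^ Poly_Mapping.lookup k x)"
   if "Poly_Mapping.keys k \<subseteq> Poly_Mapping.keys m Un Poly_Mapping.keys n" for k
   by (rule prod.mono_neutral_left) (use that in "auto simp: in_keys_iff")
  show ?thesis unfolding k[OF Poly_Mapping.keys_add] k[OF Un_upper1] k[OF Un_upper2] by (simp only: lookup_add power_add prod.distrib)
 qed
 have "p * q = (\<Sum>m\<in>supp p. \<Sum>n\<in>supp q. qscale (coef p m * coef q n) (bvec (m + n)))"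
  by (subst poly_mapping_expand[of "supp p"], simp, simp, subst poly_mapping_expand)
   (simp_all add: sum_product scale_times mult_single)
 hence "poly_subst f (p * q) = (\<Sum>m\<in>supp p. \<Sum>n\<in>supp q. qscale (coef p m) (?e m) * qscale (coef q n) (?e n))"
  by (simp add: poly_subst_lin_ext lin_ext_sum lin_ext_qscale e scale_times)
 thus ?thesis by (simp add: poly_subst_lin_ext lin_ext_def sum_product)
qed

lemma free_alg_simps [simp]:
 "x \<otimes>\<^bsub>free_alg X\<^esub> y = x * y" "x \<oplus>\<^bsub>free_alg X\<^esub> y = x + y" "\<one>\<^bsub>free_alg X\<^esub> = 1" "\<zero>\<^bsub>free_alg X\<^esub> = 0"
 by (simp_all add: free_alg_def)

lemma free_alg_closed:
 "cst c \<in> carrier (free_alg X)"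
 "x \<in> X ==> var x \<in> carrier (free_alg X)"
 "p \<in> carrier (free_alg X) ==> q \<in> carrier (free_alg X) ==> p + q \<in> carrier (free_alg X)"
 "p \<in> carrier (free_alg X) ==> q \<in> carrier (free_alg X) ==> p * q \<in> carrier (free_alg X)"
 "p \<in> carrier (free_alg X) ==> - p \<in> carrier (free_alg X)"
proof -
 assume p: "p \<in> carrier (free_alg X)"
 show "- p \<in> carrier (free_alg X)" using p by (simp add: free_alg_def)
 assume q: "q \<in> carrier (free_alg X)"
 show "p + q \<in> carrier (free_alg X)" using p q Poly_Mapping.keys_add[of p] by (auto simp: free_alg_def)
 show "p * q \<in> carrier (free_alg X)" unfolding free_alg_def
 proof (simp, intro ballI)
  fix m assume "m \<in> supp (p * q)"
  then obtain a b where "m = a + b" "a \<in> supp p" "b \<in> supp q" using keys_mult by blast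
  thus "Poly_Mapping.keys m \<subseteq> X" using p q Poly_Mapping.keys_add[of a] unfolding free_alg_def by simp blast
 qed
qed (auto simp: free_alg_def cst_def var_def split: if_splits)

lemma free_alg_cring: "cring (free_alg X)"
proof (intro cringI abelian_groupI comm_monoidI)
 show "\<exists>y\<in>carrier (free_alg X). y \<oplus>\<^bsub>free_alg X\<^esub> x = \<zero>\<^bsub>free_alg X\<^esub>" if "x \<in> carrier (free_alg X)" for x
  using free_alg_closed(5)[OF that] by (intro bexI) simp_all
qed (use free_alg_closed(1)[of 0] free_alg_closed(1)[of 1] in "auto simp: free_alg_closed cst_hom algebra_simps")

lemma free_alg_minus [simp]: "p \<in> carrier (free_alg X) ==> \<ominus>\<^bsub>free_alg X\<^esub> p = - p"
proof -
 interpret cring "free_alg X" by (rule free_alg_cring)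
 assume "p \<in> carrier (free_alg X)"
 thus ?thesis using minus_equality by (simp add: free_alg_closed)
qed

text \<open>Substituting each variable for itself returns the polynomial, and the explicit sum of
  products in \<open>poly_subst\<close> shows that it is built from constants and variables.\<close>

lemma free_alg_induct [consumes 1, case_names cst var add mult]:
 assumes "p \<in> carrier (free_alg X)" and cst: "!!c. P (cst c)" and var: "!!x. x \<in> X ==> P (var x)"
  and add: "!!p q. p \<in> carrier (free_alg X) ==> q \<in> carrier (free_alg X) ==> P p ==> P q ==> P (p + q)"
  and mult: "!!p q. p \<in> carrier (free_alg X) ==> q \<in> carrier (free_alg X) ==> P p ==> P q ==> P (p * q)"
 shows "P p"
proof -
 let ?C = "{p \<in> carrier (free_alg X). P p}"
 have C: "cst c \<in> ?C" "p \<in> ?C ==> q \<in> ?C ==> p + q \<in> ?C" "p \<in> ?C ==> q \<in> ?C ==> p * q \<in> ?C" "x \<in> X ==> var x \<in> ?C" for c p q x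
  using assms by (auto simp: free_alg_closed)
 have sum: "(\<Sum>i\<in>A. g i) \<in> ?C" if "!!i. i \<in> A ==> g i \<in> ?C" for A :: "('a \<Rightarrow>\<^sub>0 nat) set" and g
  using that C(1)[of 0] by (induction A rule: infinite_finite_induct) (auto simp: cst_hom C simp del: mem_Collect_eq)
 have pow: "q ^ k \<in> ?C" if "q \<in> ?C" for q k using that C(1)[of 1] by (induction k) (auto simp: cst_hom C simp del: mem_Collect_eq)
 have prod: "(\<Prod>i\<in>A. g i) \<in> ?C" if "!!i. i \<in> A ==> g i \<in> ?C" for A :: "'a set" and g
  using that C(1)[of 1] by (induction A rule: infinite_finite_induct) (auto simp: cst_hom C simp del: mem_Collect_eq)
 have var_pow: "var x ^ k = bvec (Poly_Mapping.single x k)" for x :: 'a and k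
  by (induction k) (simp_all add: var_def mult_single single_add[symmetric])
 have "(\<Prod>x\<in>A. bvec (Poly_Mapping.single x (h x))) = (bvec (\<Sum>x\<in>A. Poly_Mapping.single x (h x)) :: 'a qpoly)" for A :: "'a set" and h :: "'a => nat"
  by (induction rule: infinite_finite_induct) (simp_all add: mult_single)
 moreover have "(\<Sum>x\<in>Poly_Mapping.keys m. Poly_Mapping.single x (Poly_Mapping.lookup m x)) = m" for m :: "'a \<Rightarrow>\<^sub>0 nat"
  by (rule poly_mapping_eqI) (simp add: lookup_sum lookup_single when_def in_keys_iff)
 ultimately have "poly_subst var p = p" by (simp add: poly_subst_lin_ext var_pow lin_ext_id)
 moreover have "poly_subst var p \<in> ?C" unfolding poly_subst_def by (intro sum C prod pow) (use assms in "auto simp: free_alg_def")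
 ultimately show ?thesis by simp
qed

lemma poly_subst_closed:
 assumes "p \<in> carrier (free_alg X)" "!!x. x \<in> X ==> f x \<in> carrier (free_alg Y)"
 shows "poly_subst f p \<in> carrier (free_alg Y)"
 using assms(1) by (induction rule: free_alg_induct) (simp_all add: poly_subst_add poly_subst_mult free_alg_closed assms(2))

lemma poly_subst_hom: "(!!x. x \<in> X ==> f x \<in> carrier (free_alg Y)) ==> poly_subst f \<in> ring_hom (free_alg X) (free_alg Y)"
 using poly_subst_cst[of f 1] by (intro ring_hom_memI) (simp_all add: poly_subst_closed poly_subst_add poly_subst_mult cst_hom)

text \<open>Substitution is a ring homomorphism, and the preimage of \<open>J\<close> is an ideal
  containing the generators.\<close>

lemma genideal_subst:
 assumes "G \<subseteq> carrier (free_alg X)" "ideal J (free_alg Y)" "!!x. x \<in> X ==> f x \<in> carrier (free_alg Y)"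
  "!!p. p \<in> G ==> poly_subst f p \<in> J" "p \<in> genideal (free_alg X) G"
 shows "poly_subst f p \<in> J"
proof -
 interpret X: cring "free_alg X" by (rule free_alg_cring)
 interpret Y: cring "free_alg Y" by (rule free_alg_cring)
 interpret ring_hom_ring "free_alg X" "free_alg Y" "poly_subst f"
  by (intro ring_hom_ringI2 X.ring_axioms Y.ring_axioms poly_subst_hom assms)
 have "genideal (free_alg X) G \<subseteq> {r \<in> carrier (free_alg X). poly_subst f r \<in> J}"
  by (intro X.genideal_minimal ideal_vimage) (use assms in auto)
 thus ?thesis using assms by blast
qed

text \<open>Two mutually inverse substitutions, modulo ideals, identify the quotients.\<close>

lemma free_alg_presentation:
 fixes f :: "'b => 'a qpoly" and g :: "'a => 'b qpoly"
 assumes G: "G \<subseteq> carrier (free_alg X)" and H: "H \<subseteq> carrier (free_alg Y)"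
 defines "I \<equiv> genideal (free_alg X) G" and "J \<equiv> genideal (free_alg Y) H"
 assumes f: "!!y. y \<in> Y ==> f y \<in> carrier (free_alg X)" and g: "!!x. x \<in> X ==> g x \<in> carrier (free_alg Y)"
  and gG: "!!p. p \<in> G ==> poly_subst g p \<in> J" and fH: "!!p. p \<in> H ==> poly_subst f p \<in> I"
  and gf: "!!y. y \<in> Y ==> poly_subst g (f y) = var y" and fg: "!!x. x \<in> X ==> poly_subst f (g x) - var x \<in> I"
  and L: "!!p. L p = I +>\<^bsub>free_alg X\<^esub> poly_subst f p"
 shows "L \<in> ring_hom (free_alg Y) (free_alg X Quot I)"
  and "L ` carrier (free_alg Y) = carrier (free_alg X Quot I)"
  and "a_kernel (free_alg Y) (free_alg X Quot I) L = J"
  and "generate_ring (free_alg X Quot I) (range (%c. L (cst c)) Un (%y. L (var y)) ` Y) = carrier (free_alg X Quot I)"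
proof -
 interpret X: cring "free_alg X" by (rule free_alg_cring)
 interpret Y: cring "free_alg Y" by (rule free_alg_cring)
 interpret I: ideal I "free_alg X" unfolding I_def by (rule X.genideal_ideal[OF G])
 interpret J: ideal J "free_alg Y" unfolding J_def by (rule Y.genideal_ideal[OF H])
 let ?Q = "free_alg X Quot I"
 interpret Q: ring ?Q by (rule I.quotient_is_ring)
 note subst = poly_subst_closed[of _ Y f X, OF _ f] poly_subst_closed[of _ X g Y, OF _ g]
 have cls: "I +>\<^bsub>free_alg X\<^esub> p = I +>\<^bsub>free_alg X\<^esub> q \<longleftrightarrow> p - q \<in> I"
  if "p \<in> carrier (free_alg X)" "q \<in> carrier (free_alg X)" for p q
  using X.quotient_eq_iff_same_a_r_cos[OF I.is_ideal] that by (simp add: a_minus_def)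
 have "(%p. I +>\<^bsub>free_alg X\<^esub> p) \<circ> poly_subst f \<in> ring_hom (free_alg Y) ?Q"
  by (rule ring_hom_trans[OF poly_subst_hom I.rcos_ring_hom]) (rule f)
 thus hom: "L \<in> ring_hom (free_alg Y) ?Q" by (simp add: comp_def L[symmetric])
 then interpret L: ring_hom_ring "free_alg Y" ?Q L by (intro ring_hom_ringI2 Y.ring_axioms Q.ring_axioms)
 have fgI: "poly_subst f (poly_subst g p) - p \<in> I" if "p \<in> carrier (free_alg X)" for p using that
 proof (induction rule: free_alg_induct)
  case (cst c)
  thus ?case using I.zero_closed by simp
 next
  case (add p q)
  thus ?case using I.a_closed[OF add(3,4)] by (simp add: poly_subst_add algebra_simps)
 next
  case (mult p q)
  let ?h = "%p. poly_subst f (poly_subst g p)"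
  \<comment> \<open>The sum of these two elements is \<open>?h p * ?h q - p * q\<close>.\<close>
  have "?h p * (?h q - q) \<in> I" "q * (?h p - p) \<in> I" using mult subst I.I_l_closed by simp_all
  from I.a_closed[OF this] show ?case by (simp add: poly_subst_mult algebra_simps)
 qed (simp add: fg)
 show img: "L ` carrier (free_alg Y) = carrier ?Q"
 proof
  show "L ` carrier (free_alg Y) \<subseteq> carrier ?Q" by auto
  show "carrier ?Q \<subseteq> L ` carrier (free_alg Y)"
  proof
   fix P assume "P \<in> carrier ?Q"
   then obtain p where p: "p \<in> carrier (free_alg X)" "P = I +>\<^bsub>free_alg X\<^esub> p" by (auto simp: FactRing_def A_RCOSETS_def')
   hence "P = L (poly_subst g p)" using fgI subst cls unfolding L by metis
   thus "P \<in> L ` carrier (free_alg Y)" using subst p by blast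
  qed
 qed
 \<comment> \<open>In this direction the composite is the identity on the nose, which makes the
   kernel of \<open>L\<close> equal to \<open>J\<close>.\<close>
 have gf': "poly_subst g (poly_subst f p) = p" if "p \<in> carrier (free_alg Y)" for p
  using that by (induction rule: free_alg_induct) (simp_all add: poly_subst_add poly_subst_mult gf)
 have L0: "L p = \<zero>\<^bsub>?Q\<^esub> \<longleftrightarrow> poly_subst f p \<in> I" if "p \<in> carrier (free_alg Y)" for p
  using cls[of "poly_subst f p" 0] subst(1)[OF that] X.zero_closed X.a_coset_add_zero[OF I.a_subset] by (simp add: L FactRing_def)
 show "a_kernel (free_alg Y) ?Q L = J" unfolding a_kernel_def'
 proof (intro equalityI subsetI)
  fix p assume "p \<in> {p \<in> carrier (free_alg Y). L p = \<zero>\<^bsub>?Q\<^esub>}"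
  hence p: "p \<in> carrier (free_alg Y)" "poly_subst f p \<in> I" using L0 by auto
  show "p \<in> J" using genideal_subst[OF G J.is_ideal g gG, of "poly_subst f p"] p gf' unfolding I_def by simp
 next
  fix p assume p: "p \<in> J"
  have "poly_subst f p \<in> I" using genideal_subst[OF H I.is_ideal f fH] p unfolding J_def by simp
  thus "p \<in> {p \<in> carrier (free_alg Y). L p = \<zero>\<^bsub>?Q\<^esub>}" using L0 J.Icarr[OF p] by simp
 qed
 let ?S = "range (%c. L (cst c)) Un (%y. L (var y)) ` Y"
 have "?S \<subseteq> carrier ?Q" by (intro Un_least image_subsetI L.hom_closed free_alg_closed)
 moreover have "L p \<in> generate_ring ?Q ?S" if "p \<in> carrier (free_alg Y)" for p using that
 proof (induction rule: free_alg_induct)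
  case (add p q)
  thus ?case using generate_ring.eng_add L.hom_add by fastforce
 next
  case (mult p q)
  thus ?case using generate_ring.eng_mult L.hom_mult by fastforce
 qed (blast intro: generate_ring.incl)+
 ultimately show "generate_ring ?Q ?S = carrier ?Q"
  using Q.generate_ring_incl unfolding img[symmetric] by (metis image_subsetI subset_antisym)
qed

section \<open>Rewriting pairs by Lyndon insertion words\<close>

lemma rewrite_pair_eq: "rewrite_pair (n, a) = (\<Sum>w\<in>supp (lyndon_coeffs n a). qscale (coef (lyndon_coeffs n a) w) (var (n, w)))"
 by (simp add: rewrite_pair_def Let_def cst_mult)

lemma rewrite_pair_superset:
 assumes "finite W" "supp (lyndon_coeffs n a) \<subseteq> W"
 shows "rewrite_pair (n, a) = (\<Sum>w\<in>W. qscale (coef (lyndon_coeffs n a) w) (var (n, w)))"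
 unfolding rewrite_pair_eq using assms by (intro sum.mono_neutral_left) (auto simp: in_keys_iff)

text \<open>Sums and multiples of the coefficients solve the same congruence, and
  \<open>lyndon_coeffs_eqI\<close> says that it has only one solution.\<close>

lemma lyndon_coeffs_linear:
 assumes n: "5 <= n" and a: "a \<in> cell_space n" "b \<in> cell_space n"
 shows "lyndon_coeffs n (a + b) = lyndon_coeffs n a + lyndon_coeffs n b"
  "lyndon_coeffs n (qscale c a) = qscale c (lyndon_coeffs n a)"
proof -
 note A = lyndon_coeffs[OF n a(1)] and B = lyndon_coeffs[OF n a(2)]
 show "lyndon_coeffs n (a + b) = lyndon_coeffs n a + lyndon_coeffs n b"
 proof (rule lyndon_coeffs_eqI[OF n])
  show "supp (lyndon_coeffs n a + lyndon_coeffs n b) \<subseteq> lyndon_insertion_words (n - 1)"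
   by (rule order_trans[OF Poly_Mapping.keys_add Un_least[OF A(1) B(1)]])
  show "a + b - lin_ext (word_pair n) (lyndon_coeffs n a + lyndon_coeffs n b) \<in> qvec.span (shuffle_pairs n)"
   using qvec.span_add[OF A(2) B(2)] by (simp add: lin_ext_add algebra_simps)
 qed
 show "lyndon_coeffs n (qscale c a) = qscale c (lyndon_coeffs n a)"
 proof (rule lyndon_coeffs_eqI[OF n])
  show "supp (qscale c (lyndon_coeffs n a)) \<subseteq> lyndon_insertion_words (n - 1)" by (rule order_trans[OF supp_qscale A(1)])
  show "qscale c a - lin_ext (word_pair n) (qscale c (lyndon_coeffs n a)) \<in> qvec.span (shuffle_pairs n)"
   using qvec.span_scale[OF A(2)] by (simp add: lin_ext_qscale qvec.scale_right_diff_distrib)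
 qed
qed

lemma rewrite_pair_linear:
 assumes n: "5 <= n" and a: "a \<in> cell_space n" "b \<in> cell_space n"
 shows "rewrite_pair (n, a + b) = rewrite_pair (n, a) + rewrite_pair (n, b)"
  "rewrite_pair (n, qscale c a) = cst c * rewrite_pair (n, a)"
proof -
 let ?W = "supp (lyndon_coeffs n a) Un supp (lyndon_coeffs n b)"
 have "rewrite_pair (n, a + b) = (\<Sum>w\<in>?W. qscale (coef (lyndon_coeffs n (a + b)) w) (var (n, w)))"
  by (rule rewrite_pair_superset) (auto simp: lyndon_coeffs_linear[OF n a] Poly_Mapping.keys_add)
 thus "rewrite_pair (n, a + b) = rewrite_pair (n, a) + rewrite_pair (n, b)"
  by (simp add: lyndon_coeffs_linear[OF n a] lookup_add qvec.scale_left_distrib sum.distrib rewrite_pair_superset[of ?W])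
 have "rewrite_pair (n, qscale c a) = (\<Sum>w\<in>?W. qscale (coef (lyndon_coeffs n (qscale c a)) w) (var (n, w)))"
  by (rule rewrite_pair_superset) (simp_all add: lyndon_coeffs_linear[OF n a] le_supI1[OF supp_qscale])
 thus "rewrite_pair (n, qscale c a) = cst c * rewrite_pair (n, a)"
  by (simp add: lyndon_coeffs_linear[OF n a] rewrite_pair_superset[of ?W] cst_mult qvec.scale_sum_right)
qed

lemma rewrite_pair_shuffle:
 assumes n: "5 <= n" and a: "a \<in> shuffle_pairs n"
 shows "rewrite_pair (n, a) = 0"
 using lyndon_coeffs_eqI[OF n, of 0 a] qvec.span_base[OF a] by (simp add: rewrite_pair_eq)

lemma rewrite_pair_word_pair:
 assumes "5 <= n" "w \<in> lyndon_insertion_words (n - 1)"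
 shows "rewrite_pair (n, word_pair n w) = var (n, w)"
proof -
 have "lyndon_coeffs n (word_pair n w) = bvec w" by (rule lyndon_coeffs_eqI) (use assms in "simp_all add: qvec.span_zero")
 thus ?thesis by (simp add: rewrite_pair_eq)
qed

lemma rewrite_pair_closed:
 assumes "5 <= n" "a \<in> cell_space n"
 shows "rewrite_pair (n, a) \<in> carrier (free_alg lyndon_gens)"
proof -
 have "(\<Sum>w\<in>W. cst (h w) * var (n, w)) \<in> carrier (free_alg lyndon_gens)" if "W \<subseteq> lyndon_insertion_words (n - 1)" for W :: "word_comb set" and h
  using that assms free_alg_closed[of 0]
  by (induction W rule: infinite_finite_induct) (auto simp: cst_hom lyndon_gens_def intro!: free_alg_closed)
 from this[OF lyndon_coeffs(1)[OF assms]] show ?thesis by (simp add: rewrite_pair_def Let_def)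
qed

theorem corollary4p6:
  shows "generate_ring FC
           (range (\<lambda>c. FC_class (cst c)) \<union>
            {FC_class (var (n, word_pair n w)) | n w.
               n \<ge> 5 \<and> w \<in> lyndon_insertion_words (n - 1)}) = carrier FC
    \<and> lyndon_map \<in> ring_hom (free_alg lyndon_gens) FC
    \<and> lyndon_map ` carrier (free_alg lyndon_gens) = carrier FC
    \<and> a_kernel (free_alg lyndon_gens) FC lyndon_map =
           genideal (free_alg lyndon_gens) (lyndon_dihedral_rels \<union> lyndon_product_rels)"
proof -
 let ?X = "free_alg cell_gens" and ?Y = "free_alg lyndon_gens"
 let ?G = "linear_rels Un product_rels Un dihedral_rels Un shuffle_rels" and ?H = "lyndon_dihedral_rels Un lyndon_product_rels"
 let ?f = "%(n, w). var (n, word_pair n w)"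
 interpret X: cring ?X by (rule free_alg_cring)
 interpret Y: cring ?Y by (rule free_alg_cring)
 have diff: "p - q \<in> carrier (free_alg V)" if "p \<in> carrier (free_alg V)" "q \<in> carrier (free_alg V)" for p q :: "'v qpoly" and V
  using free_alg_closed(3)[OF that(1) free_alg_closed(5)[OF that(2)]] by simp
 have gens: "var (n, a) \<in> carrier ?X" if "5 <= n" "a \<in> cell_space n" for n a
  using that by (intro free_alg_closed) (simp add: cell_gens_def)
 note prod = product_data_cell_space and dih = dihedral_data_cell_space
 note sub = subspace_cell_space
 have G: "?G \<subseteq> carrier ?X"
 proof -
  have "linear_rels \<subseteq> carrier ?X" unfolding linear_rels_def
   by (auto intro!: diff gens free_alg_closed(1,4) qvec.subspace_add[OF sub] qvec.subspace_scale[OF sub])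
  moreover have "product_rels \<subseteq> carrier ?X" unfolding product_rels_def by (auto intro!: diff gens free_alg_closed(4) dest: prod)
  moreover have "dihedral_rels \<subseteq> carrier ?X" unfolding dihedral_rels_def by (auto intro!: diff gens dest: dih)
  moreover have "shuffle_rels \<subseteq> carrier ?X" unfolding shuffle_rels_def
   using shuffle_pairs_cell_space qvec.span_base by (fastforce intro!: gens)
  ultimately show ?thesis by blast
 qed
 have H: "?H \<subseteq> carrier ?Y" unfolding lyndon_product_rels_def lyndon_dihedral_rels_def
  by (auto intro!: diff rewrite_pair_closed free_alg_closed dest: prod dih)
 interpret I: ideal FC_ideal ?X unfolding FC_ideal_def by (rule X.genideal_ideal[OF G])
 interpret J: ideal "genideal ?Y ?H" ?Y by (rule Y.genideal_ideal[OF H])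
 have GI: "p \<in> FC_ideal" if "p \<in> ?G" for p unfolding FC_ideal_def using X.genideal_self[OF G] that by blast
 have HJ: "p \<in> genideal ?Y ?H" if "p \<in> ?H" for p using Y.genideal_self[OF H] that by blast
 have Iadd: "p + q \<in> FC_ideal" if "p \<in> FC_ideal" "q \<in> FC_ideal" for p q using I.a_closed[OF that] by simp
 have Icst: "cst c * p \<in> FC_ideal" if "p \<in> FC_ideal" for p c using I.I_l_closed[OF that free_alg_closed(1)] by simp
 have Idiff: "p - q \<in> FC_ideal" if "p \<in> FC_ideal" "q \<in> FC_ideal" for p q
  using Iadd[OF that(1) Icst[OF that(2), of "-1"]] by (simp add: cst_hom)
 have add: "var (n, a + b) - (var (n, a) + var (n, b)) \<in> FC_ideal" if "5 <= n" "a \<in> cell_space n" "b \<in> cell_space n" for n a b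
  using that by (intro GI) (auto simp: linear_rels_def diff_diff_add)
 have scale: "var (n, qscale c a) - cst c * var (n, a) \<in> FC_ideal" if "5 <= n" "a \<in> cell_space n" for n a c
  using that by (intro GI) (unfold linear_rels_def, blast)
 have zero: "var (n, 0) \<in> FC_ideal" if "5 <= n" for n
  using scale[OF that qvec.subspace_0[OF sub[OF that]], of 0] by (simp add: cst_hom)
 \<comment> \<open>Only variables of single shuffles are relations; the linear relations extend this
   to their span, with membership in \<open>cell_space n\<close> carried along because the linear
   relations require it.\<close>
 have "s \<in> cell_space n & var (n, s) \<in> FC_ideal" if n: "5 <= n" and s: "s \<in> qvec.span (shuffle_pairs n)" for n s using s
 proof (induction rule: qvec.span_induct_alt)
  case base
   show ?case using zero[OF n] qvec.subspace_0[OF sub[OF n]] by simp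
 next
  case (step c x y)
  have x: "x \<in> cell_space n" using step shuffle_pairs_cell_space[OF n] qvec.span_base by blast
  note c = qvec.subspace_scale[OF sub[OF n] x, of c] and y = step(2)[THEN conjunct1]
  have "var (n, x) \<in> FC_ideal" using step n by (intro GI) (auto simp: shuffle_rels_def)
  from Iadd[OF scale[OF n x, of c] Icst[OF this, of c]] have "var (n, qscale c x) \<in> FC_ideal" by simp
  from Iadd[OF add[OF n c y] Iadd[OF this step(2)[THEN conjunct2]]] show ?case using qvec.subspace_add[OF sub[OF n] c y] by simp
 qed
 hence span: "var (n, s) \<in> FC_ideal" if "5 <= n" "s \<in> qvec.span (shuffle_pairs n)" for n s using that by blast
 have lin: "var (n, lin_ext (word_pair n) c) - poly_subst ?f (\<Sum>w\<in>supp c. cst (coef c w) * var (n, w)) \<in> FC_ideal"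
  if n: "5 <= n" and c: "supp c \<subseteq> lyndon_insertion_words (n - 1)" for n c
 proof -
  have "var (n, \<Sum>w\<in>W. qscale (coef c w) (word_pair n w)) - (\<Sum>w\<in>W. cst (coef c w) * var (n, word_pair n w)) \<in> FC_ideal"
   if "finite W" "W \<subseteq> lyndon_insertion_words (n - 1)" for W using that
  proof (induction W)
   case empty
    show ?case using zero[OF n] by simp
  next
   case (insert w W)
   let ?v = "%w. qscale (coef c w) (word_pair n w)"
   have m: "?v u \<in> cell_space n" "word_pair n u \<in> cell_space n" if "u \<in> insert w W" for u
    using that insert.prems word_pair_cell_space[OF n] qvec.subspace_scale[OF sub[OF n]] by auto
   have "(\<Sum>w\<in>W. ?v w) \<in> cell_space n" by (rule qvec.subspace_sum[OF sub[OF n]]) (use m in simp)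
   from Iadd[OF add[OF n m(1)[OF insertI1] this] Iadd[OF scale[OF n m(2)[OF insertI1], of "coef c w"] insert.IH]] insert
   show ?case by (simp add: algebra_simps)
  qed
  from this[OF finite_keys c] show ?thesis by (simp add: lin_ext_def poly_subst_sum poly_subst_mult)
 qed
 \<comment> \<open>A pair differs from its rewriting by an element in the span of shuffles, whose
   variable lies in the ideal; the linear relations then take the combination of insertion words
   apart.\<close>
 have fg: "poly_subst ?f (rewrite_pair (n, a)) - var (n, a) \<in> FC_ideal" if n: "5 <= n" and a: "a \<in> cell_space n" for n a
 proof -
  let ?c = "lyndon_coeffs n a"
  note c = lyndon_coeffs[OF n a]
  have m: "a - lin_ext (word_pair n) ?c \<in> cell_space n" using c shuffle_pairs_cell_space[OF n] by blast
  have "lin_ext (word_pair n) ?c \<in> cell_space n" using qvec.subspace_diff[OF sub[OF n] a m] by simp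
  from add[OF n this m] have "var (n, a) - (var (n, lin_ext (word_pair n) ?c) + var (n, a - lin_ext (word_pair n) ?c)) \<in> FC_ideal" by simp
  from Iadd[OF this span[OF n c(2)]] have "var (n, a) - var (n, lin_ext (word_pair n) ?c) \<in> FC_ideal" by simp
  from Iadd[OF this lin[OF n c(1)]]
  have "var (n, a) - poly_subst ?f (rewrite_pair (n, a)) \<in> FC_ideal" by (simp add: rewrite_pair_def Let_def)
  from Icst[OF this, of "-1"] show ?thesis by (simp add: cst_hom)
 qed
 note closed = poly_subst_closed[of _ lyndon_gens ?f cell_gens]
 have f: "?f y \<in> carrier ?X" if "y \<in> lyndon_gens" for y using that by (auto simp: lyndon_gens_def intro!: gens word_pair_cell_space)
 have fH: "poly_subst ?f p \<in> FC_ideal" if p: "p \<in> ?H" for p using p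
 proof
  assume "p \<in> lyndon_dihedral_rels"
  then obtain n a a' where d: "p = rewrite_pair (n, a) - rewrite_pair (n, a')" "(n, a, a') \<in> dihedral_data"
   unfolding lyndon_dihedral_rels_def by blast
  note c = dih[OF d(2)]
  have "var (n, a) - var (n, a') \<in> FC_ideal" using d by (intro GI) (auto simp: dihedral_rels_def)
  from Iadd[OF this Idiff[OF fg[OF c(1,2)] fg[OF c(1,3)]]]
  show ?thesis unfolding d poly_subst_diff by simp
 next
  assume "p \<in> lyndon_product_rels"
  then obtain n1 a1 n2 a2 n a where d: "p = rewrite_pair (n1, a1) * rewrite_pair (n2, a2) - rewrite_pair (n, a)" "((n1, a1), (n2, a2), (n, a)) \<in> product_data"
   unfolding lyndon_product_rels_def by auto
  note c = prod[OF d(2)]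
  let ?r = "%n a. poly_subst ?f (rewrite_pair (n, a))"
  have "var (n1, a1) * var (n2, a2) - var (n, a) \<in> FC_ideal" using d by (intro GI) (auto simp: product_rels_def)
  from Idiff[OF this fg[OF c(5,6)]]
  have 1: "var (n1, a1) * var (n2, a2) - ?r n a \<in> FC_ideal" by simp
  have 2: "?r n1 a1 * (?r n2 a2 - var (n2, a2)) \<in> FC_ideal"
   using I.I_l_closed[OF fg[OF c(3,4)] closed[OF rewrite_pair_closed[OF c(1,2)] f]] by simp
  have 3: "var (n2, a2) * (?r n1 a1 - var (n1, a1)) \<in> FC_ideal" using I.I_l_closed[OF fg[OF c(1,2)] gens[OF c(3,4)]] by simp
  \<comment> \<open>The two factors are replaced one after the other, which telescopes to the
    product of the rewritten pairs.\<close>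
  show ?thesis using Iadd[OF Iadd[OF 2 3] 1] unfolding d poly_subst_diff poly_subst_mult by (simp add: algebra_simps)
 qed
 have gG: "poly_subst rewrite_pair p \<in> genideal ?Y ?H" if p: "p \<in> ?G" for p
 proof -
  from p consider "p \<in> linear_rels Un shuffle_rels" | "p \<in> product_rels" | "p \<in> dihedral_rels" by blast
  thus ?thesis
  proof cases
   \<comment> \<open>Rewriting is linear and kills shuffles with one element, so these relations
     become zero already in the free algebra. This is why only the dihedral and product relations
     remain.\<close>
   case 1
   hence "poly_subst rewrite_pair p = 0"
    by (auto simp: linear_rels_def shuffle_rels_def poly_subst_diff poly_subst_mult rewrite_pair_linear rewrite_pair_shuffle)
   thus ?thesis using J.zero_closed by simp
  next
   case 2
   then obtain x y z where "p = var x * var y - var z" "(x, y, z) \<in> product_data" unfolding product_rels_def by blast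
   thus ?thesis by (intro HJ) (simp only: poly_subst_diff poly_subst_mult poly_subst_var lyndon_product_rels_def, blast)
  next
   case 3
   then obtain n a a' where "p = var (n, a) - var (n, a')" "(n, a, a') \<in> dihedral_data" unfolding dihedral_rels_def by blast
   thus ?thesis by (intro HJ) (simp only: poly_subst_diff poly_subst_var lyndon_dihedral_rels_def, blast)
  qed
 qed
 have L: "lyndon_map p = FC_ideal +>\<^bsub>?X\<^esub> poly_subst ?f p" for p by (simp add: lyndon_map_def FC_class_def)
 have "range (%c. FC_class (cst c)) Un {FC_class (var (n, word_pair n w)) | n w. n \<ge> 5 & w \<in> lyndon_insertion_words (n - 1)} =
  range (%c. lyndon_map (cst c)) Un (%y. lyndon_map (var y)) ` lyndon_gens"
 proof -
  have "{h (n, w) | n w. 5 <= n & w \<in> lyndon_insertion_words (n - 1)} = h ` lyndon_gens" for h :: "nat \<times> word_comb => (nat \<times> polygon_pair) qpoly set"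
   unfolding lyndon_gens_def by blast
  from this[of "%y. lyndon_map (var y)"] show ?thesis by (simp add: lyndon_map_def)
 qed
 thus ?thesis
  using free_alg_presentation[where L = lyndon_map and f = ?f and g = rewrite_pair, OF G H f _ gG fH[unfolded FC_ideal_def] _ _ L[unfolded FC_ideal_def]]
   rewrite_pair_closed rewrite_pair_word_pair fg unfolding FC_def FC_ideal_def by (simp add: cell_gens_def lyndon_gens_def split_paired_all)
qed

end
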